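(* Let $F/K$ be a finite extension of $p$-adic local fields, $A\subseteq B\subseteq\mathrm{Hom}_K(F,\overline K)$ two subsets, $E=E_AE_B$, $R$ an $O_E$-algebra, and $M$ a locally free $O_F\otimes_{O_K}R$-module of $R$-rank $n[F:K]$. Let $$0\to\mathcal{F}\to M\to\mathcal{L}\to0$$ be an exact sequence of $O_F\otimes_{O_K}R$-modules such that $\mathcal{L}$ is locally free as $R$-module of rank $n|A|+d$, where $d\geq 0$. The following two conditions are equivalent: (1) The filtration is $(A,B)$-strict, i.e. $J_BM\subseteq\mathcal{F}\subseteq J_AM$. (2) $e_B\mathcal{L}=0$ and $\bigwedge^{d+1}_R(e_A\mid\mathcal{L})=0$ (the $(d+1)$-st exterior power over $R$ of the endomorphism $e_A:\mathcal{L}\to\mathcal{L}$ vanishes).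
   Context: $\overline K$ is an algebraic closure of $K$. For $S\subseteq\mathrm{Hom}_K(F,\overline K)$ the reflex field $E_S\subset\overline K$ is the fixed field of $\{\sigma\in\mathrm{Gal}(\overline K/K):\sigma\circ S=S\}$. Fix $\zeta\in O_F$ with $O_F=O_K[\zeta]$. The polynomial $e_{\zeta,S}(T)=\prod_{\phi\in S}(T-\phi(\zeta))$ lies in $O_{E_S}[T]$. For $E\supseteq E_S$, $e_S:=e_{\zeta,S}(\zeta\otimes1)\in O_F\otimes_{O_K}O_E$, and $J_S\subseteq O_F\otimes_{O_K}O_E$ is the ideal generated by $e_S$; it does not depend on the choice of $\zeta$. $J_SM$ and $e_S$ acting on $O_F\otimes_{O_K}R$-modules are understood via $O_E\to R$. *)

theory Defs
  imports "HOL-Algebra.Algebra"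
begin

section \<open>$p$-adic local fields and their rings of integers\<close>

text \<open>The ring of $p$-adic integers, as the inverse limit of the rings of residues
  \<open>{0..<p^n}\<close> modulo \<open>p^n\<close>.\<close>

definition padic_integers :: "nat \<Rightarrow> (nat \<Rightarrow> int) ring" where
  "padic_integers p =
     \<lparr>carrier = {x. \<forall>n. x n \<in> {0..<int p ^ n} \<and> x (Suc n) mod int p ^ n = x n},
      monoid.mult = (\<lambda>x y n. (x n * y n) mod int p ^ n),
      one = (\<lambda>n. 1 mod int p ^ n),
      ring.zero = (\<lambda>n. 0),
      ring.add = (\<lambda>x y n. (x n + y n) mod int p ^ n)\<rparr>"

text \<open>\<open>k\<close> is a finite extension of the field of $p$-adic numbers, the latter being the subfield of
  \<open>k\<close> generated by the image of the $p$-adic integers under the embedding \<open>z\<close>.\<close>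

definition padic_local_field :: "nat \<Rightarrow> ((nat \<Rightarrow> int) \<Rightarrow> 'a) \<Rightarrow> ('a, 'b) ring_scheme \<Rightarrow> bool" where
  "padic_local_field p z k \<longleftrightarrow>
     field k \<and> z \<in> ring_hom (padic_integers p) k \<and> inj_on z (carrier (padic_integers p)) \<and>
     ring.finite_dimension k (generate_field k (z ` carrier (padic_integers p))) (carrier k)"

definition integral_over :: "('a, 'b) ring_scheme \<Rightarrow> 'a set \<Rightarrow> 'a \<Rightarrow> bool" where
  "integral_over A S x \<longleftrightarrow>
     (\<exists>P \<in> carrier (univ_poly A S). P \<noteq> [] \<and> lead_coeff P = \<one>\<^bsub>A\<^esub> \<and> ring.eval A P x = \<zero>\<^bsub>A\<^esub>)"

text \<open>The ring of integers of a subfield \<open>E\<close> of \<open>A\<close>: the integral closure in \<open>E\<close> of \<open>S\<close>,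
  where \<open>S\<close> is the image of the $p$-adic integers.\<close>

definition ring_of_integers :: "'a ring \<Rightarrow> 'a set \<Rightarrow> 'a set \<Rightarrow> 'a ring" where
  "ring_of_integers A S E = A\<lparr>carrier := {x \<in> E. integral_over A S x}\<rparr>"

section \<open>Embeddings and reflex fields\<close>

text \<open>Throughout, \<open>K\<close> is a subfield of its algebraic closure \<open>C\<close>, whereas the extension \<open>F\<close> of \<open>K\<close>
  is given by a field homomorphism \<open>i\<close> from \<open>K\<close> to \<open>F\<close>. Embeddings are required to be extensional,
  so that each one is represented by exactly one function of the logic.\<close>

definition field_embeddings ::
    "'c set \<Rightarrow> ('c \<Rightarrow> 'f) \<Rightarrow> 'f ring \<Rightarrow> 'c ring \<Rightarrow> ('f \<Rightarrow> 'c) set" where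
  "field_embeddings K i F C =
     {\<phi> \<in> ring_hom F C \<inter> extensional (carrier F). \<forall>x\<in>K. \<phi> (i x) = x}"

definition galois_group :: "'c ring \<Rightarrow> 'c set \<Rightarrow> ('c \<Rightarrow> 'c) set" where
  "galois_group C K = {\<sigma> \<in> ring_iso C C. \<forall>x\<in>K. \<sigma> x = x}"

definition reflex_field :: "'c ring \<Rightarrow> 'c set \<Rightarrow> 'f ring \<Rightarrow> ('f \<Rightarrow> 'c) set \<Rightarrow> 'c set" where
  "reflex_field C K F S =
     {x \<in> carrier C. \<forall>\<sigma>\<in>galois_group C K. compose (carrier F) \<sigma> ` S = S \<longrightarrow> \<sigma> x = x}"

section \<open>Tensor products of commutative algebras\<close>

text \<open>The ring of integral combinations of pairs \<open>(a, b)\<close>, i.e. the monoid ring of the product of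
  the multiplicative monoids of \<open>A\<close> and \<open>B\<close>. Its additive group is the free abelian group on the
  set of pairs. The set of additive generators of the tensor relations is stable under
  multiplication by pairs, so the ideal generated by it agrees with the subgroup generated by it.\<close>

definition pair_ring :: "('a, 'x) ring_scheme \<Rightarrow> ('b, 'y) ring_scheme \<Rightarrow> ('a \<times> 'b \<Rightarrow>\<^sub>0 int) ring" where
  "pair_ring A B =
     \<lparr>carrier = {u. Poly_Mapping.keys u \<subseteq> carrier A \<times> carrier B},
      monoid.mult = (\<lambda>u v. frag_extend (\<lambda>(a, b).
                frag_extend (\<lambda>(a', b'). frag_of (a \<otimes>\<^bsub>A\<^esub> a', b \<otimes>\<^bsub>B\<^esub> b')) v) u),
      one = frag_of (\<one>\<^bsub>A\<^esub>, \<one>\<^bsub>B\<^esub>),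
      ring.zero = 0,
      ring.add = (+)\<rparr>"

definition tensor_ideal ::
    "('k, 'w) ring_scheme \<Rightarrow> ('k \<Rightarrow> 'a) \<Rightarrow> ('a, 'x) ring_scheme \<Rightarrow> ('k \<Rightarrow> 'b) \<Rightarrow> ('b, 'y) ring_scheme
      \<Rightarrow> ('a \<times> 'b \<Rightarrow>\<^sub>0 int) set" where
  "tensor_ideal k f A g B = Idl\<^bsub>pair_ring A B\<^esub>
     ({frag_of (a \<oplus>\<^bsub>A\<^esub> a', b) - frag_of (a, b) - frag_of (a', b) | a a' b.
         a \<in> carrier A \<and> a' \<in> carrier A \<and> b \<in> carrier B} \<union>
      {frag_of (a, b \<oplus>\<^bsub>B\<^esub> b') - frag_of (a, b) - frag_of (a, b') | a b b'.
         a \<in> carrier A \<and> b \<in> carrier B \<and> b' \<in> carrier B} \<union>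
      {frag_of (f c \<otimes>\<^bsub>A\<^esub> a, b) - frag_of (a, g c \<otimes>\<^bsub>B\<^esub> b) | c a b.
         c \<in> carrier k \<and> a \<in> carrier A \<and> b \<in> carrier B})"

text \<open>The tensor product of \<open>A\<close> and \<open>B\<close> over \<open>k\<close>, where \<open>f\<close> and \<open>g\<close> are the structure maps
  from \<open>k\<close> to \<open>A\<close> and \<open>B\<close>.\<close>

definition tensor_ring ::
    "('k, 'w) ring_scheme \<Rightarrow> ('k \<Rightarrow> 'a) \<Rightarrow> ('a, 'x) ring_scheme \<Rightarrow> ('k \<Rightarrow> 'b) \<Rightarrow> ('b, 'y) ring_scheme
      \<Rightarrow> ('a \<times> 'b \<Rightarrow>\<^sub>0 int) set ring" where
  "tensor_ring k f A g B = pair_ring A B Quot tensor_ideal k f A g B"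

definition pure_tensor ::
    "('k, 'w) ring_scheme \<Rightarrow> ('k \<Rightarrow> 'a) \<Rightarrow> ('a, 'x) ring_scheme \<Rightarrow> ('k \<Rightarrow> 'b) \<Rightarrow> ('b, 'y) ring_scheme
      \<Rightarrow> 'a \<Rightarrow> 'b \<Rightarrow> ('a \<times> 'b \<Rightarrow>\<^sub>0 int) set" where
  "pure_tensor k f A g B a b = tensor_ideal k f A g B +>\<^bsub>pair_ring A B\<^esub> frag_of (a, b)"

text \<open>The map with values in \<open>tensor_ring k f A g B\<close> induced by the identity of \<open>A\<close> and a
  homomorphism \<open>h\<close> into \<open>B\<close>; it is applied to cosets.\<close>

definition tensor_base_change ::
    "('k, 'w) ring_scheme \<Rightarrow> ('k \<Rightarrow> 'a) \<Rightarrow> ('a, 'x) ring_scheme \<Rightarrow> ('k \<Rightarrow> 'b) \<Rightarrow> ('b, 'y) ring_scheme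
      \<Rightarrow> ('e \<Rightarrow> 'b) \<Rightarrow> ('a \<times> 'e \<Rightarrow>\<^sub>0 int) set \<Rightarrow> ('a \<times> 'b \<Rightarrow>\<^sub>0 int) set" where
  "tensor_base_change k f A g B h V =
     (\<Union>u\<in>V. tensor_ideal k f A g B +>\<^bsub>pair_ring A B\<^esub> frag_extend (\<lambda>(a, e). frag_of (a, h e)) u)"

section \<open>Modules\<close>

text \<open>The fields \<open>mult\<close> and \<open>one\<close> of a module record play no role.\<close>

definition restrict_scalars :: "('r \<Rightarrow> 't) \<Rightarrow> ('t, 'm) module \<Rightarrow> ('r, 'm) module" where
  "restrict_scalars j M =
     \<lparr>carrier = carrier M, monoid.mult = monoid.mult M, one = one M,
      ring.zero = ring.zero M, ring.add = ring.add M,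
      smult = (\<lambda>r m. j r \<odot>\<^bsub>M\<^esub> m)\<rparr>"

definition regular_module :: "('r, 'x) ring_scheme \<Rightarrow> ('r, 'r) module" where
  "regular_module R =
     \<lparr>carrier = carrier R, monoid.mult = monoid.mult R, one = one R,
      ring.zero = ring.zero R, ring.add = ring.add R,
      smult = monoid.mult R\<rparr>"

definition module_homs :: "('r, 'x) ring_scheme \<Rightarrow> ('r, 'm) module \<Rightarrow> ('r, 'n) module \<Rightarrow> ('m \<Rightarrow> 'n) set" where
  "module_homs R M N =
     {h \<in> hom (add_monoid M) (add_monoid N).
        \<forall>r\<in>carrier R. \<forall>m\<in>carrier M. h (r \<odot>\<^bsub>M\<^esub> m) = r \<odot>\<^bsub>N\<^esub> h m}"

definition short_exact ::
    "('r, 'x) ring_scheme \<Rightarrow> ('r, 'n) module \<Rightarrow> ('n \<Rightarrow> 'm) \<Rightarrow> ('r, 'm) module \<Rightarrow> ('m \<Rightarrow> 'l) \<Rightarrow> ('r, 'l) module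
      \<Rightarrow> bool" where
  "short_exact R N f M g L \<longleftrightarrow>
     module R N \<and> module R M \<and> module R L \<and> f \<in> module_homs R N M \<and> g \<in> module_homs R M L \<and>
     inj_on f (carrier N) \<and> f ` carrier N = {m \<in> carrier M. g m = \<zero>\<^bsub>L\<^esub>} \<and> g ` carrier M = carrier L"

definition module_span :: "('r, 'x) ring_scheme \<Rightarrow> ('r, 'm) module \<Rightarrow> 'm set \<Rightarrow> 'm set" where
  "module_span R M S = \<Inter>{N. submodule N R M \<and> S \<subseteq> N}"

definition quotient_module :: "('r, 'm) module \<Rightarrow> 'm set \<Rightarrow> ('r, 'm set) module" where
  "quotient_module M N =
     \<lparr>carrier = a_rcosets\<^bsub>M\<^esub> N, monoid.mult = undefined, one = undefined,
      ring.zero = N, ring.add = set_add M,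
      smult = (\<lambda>r V. \<Union>x\<in>V. N +>\<^bsub>M\<^esub> (r \<odot>\<^bsub>M\<^esub> x))\<rparr>"

text \<open>Over the zero ring, the zero module is free of every rank.\<close>

definition free_of_rank :: "('r, 'x) ring_scheme \<Rightarrow> ('r, 'm) module \<Rightarrow> nat \<Rightarrow> bool" where
  "free_of_rank R M k \<longleftrightarrow>
     (\<exists>b \<in> {..<k} \<rightarrow> carrier M.
        bij_betw (\<lambda>c. \<Oplus>\<^bsub>M\<^esub>i\<in>{..<k}. c i \<odot>\<^bsub>M\<^esub> b i) ({..<k} \<rightarrow>\<^sub>E carrier R) (carrier M))"

subsection \<open>Localization and local freeness\<close>

text \<open>The fraction \<open>m / s^i\<close> as the class of all pairs \<open>(m', j)\<close> with \<open>m / s^i = m' / s^j\<close>.\<close>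

definition fraction :: "('r, 'x) ring_scheme \<Rightarrow> ('r, 'm) module \<Rightarrow> 'r \<Rightarrow> 'm \<Rightarrow> nat \<Rightarrow> ('m \<times> nat) set" where
  "fraction R M s m i =
     {(m', j). m' \<in> carrier M \<and>
        (\<exists>l::nat. (s [^]\<^bsub>R\<^esub> (l + j)) \<odot>\<^bsub>M\<^esub> m = (s [^]\<^bsub>R\<^esub> (l + i)) \<odot>\<^bsub>M\<^esub> m')}"

text \<open>\<open>M[1/s]\<close>; its scalars are the elements of \<open>R[1/s]\<close>, represented as fractions of
  \<open>regular_module R\<close>.\<close>

definition localized_module ::
    "('r, 'x) ring_scheme \<Rightarrow> ('r, 'm) module \<Rightarrow> 'r \<Rightarrow> (('r \<times> nat) set, ('m \<times> nat) set) module" where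
  "localized_module R M s =
     \<lparr>carrier = {fraction R M s m i | m i. m \<in> carrier M},
      monoid.mult = undefined,
      one = undefined,
      ring.zero = fraction R M s \<zero>\<^bsub>M\<^esub> 0,
      ring.add = (\<lambda>V W. \<Union>(m, i)\<in>V. \<Union>(m', j)\<in>W.
               fraction R M s ((s [^]\<^bsub>R\<^esub> j) \<odot>\<^bsub>M\<^esub> m \<oplus>\<^bsub>M\<^esub> (s [^]\<^bsub>R\<^esub> i) \<odot>\<^bsub>M\<^esub> m') (i + j)),
      smult = (\<lambda>V W. \<Union>(r, i)\<in>V. \<Union>(m, j)\<in>W. fraction R M s (r \<odot>\<^bsub>M\<^esub> m) (i + j))\<rparr>"

definition localized_ring :: "('r, 'x) ring_scheme \<Rightarrow> 'r \<Rightarrow> ('r \<times> nat) set ring" where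
  "localized_ring R s =
     (let N = localized_module R (regular_module R) s in
      \<lparr>carrier = carrier N, monoid.mult = smult N, one = fraction R (regular_module R) s \<one>\<^bsub>R\<^esub> 0,
       ring.zero = ring.zero N, ring.add = ring.add N\<rparr>)"

text \<open>\<open>S\<close> yields a cover of the spectrum of \<open>R\<close> by the basic open subsets \<open>D(s)\<close>.\<close>

definition locally_free_of_rank :: "('r, 'x) ring_scheme \<Rightarrow> ('r, 'm) module \<Rightarrow> nat \<Rightarrow> bool" where
  "locally_free_of_rank R M k \<longleftrightarrow>
     (\<exists>S. finite S \<and> S \<subseteq> carrier R \<and> Idl\<^bsub>R\<^esub> S = carrier R \<and>
        (\<forall>s\<in>S. free_of_rank (localized_ring R s) (localized_module R M s) k))"

text \<open>For an \<open>R\<close>-algebra \<open>T\<close> with structure map \<open>j\<close>: locally on the spectrum of \<open>R\<close>, the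
  \<open>T\<close>-module \<open>M\<close> is free of finite rank over \<open>T\<close>. Freeness locally on the spectrum of \<open>T\<close> would
  be weaker, since it allows different ranks at points with the same image in the spectrum of
  \<open>R\<close>.\<close>

definition locally_free_over ::
    "('r, 'x) ring_scheme \<Rightarrow> ('t, 'y) ring_scheme \<Rightarrow> ('r \<Rightarrow> 't) \<Rightarrow> ('t, 'm) module \<Rightarrow> bool" where
  "locally_free_over R T j M \<longleftrightarrow>
     (\<exists>S. finite S \<and> S \<subseteq> carrier R \<and> Idl\<^bsub>R\<^esub> S = carrier R \<and>
        (\<forall>s\<in>S. \<exists>k. free_of_rank (localized_ring T (j s)) (localized_module T M (j s)) k))"

subsection \<open>Exterior powers\<close>

definition free_module :: "('r, 'x) ring_scheme \<Rightarrow> 'b set \<Rightarrow> ('r, 'b \<Rightarrow> 'r) module" where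
  "free_module R V =
     \<lparr>carrier = {u. range u \<subseteq> carrier R \<and> finite {x. u x \<noteq> \<zero>\<^bsub>R\<^esub>} \<and> {x. u x \<noteq> \<zero>\<^bsub>R\<^esub>} \<subseteq> V},
      monoid.mult = undefined,
      one = undefined,
      ring.zero = (\<lambda>x. \<zero>\<^bsub>R\<^esub>),
      ring.add = (\<lambda>u v x. u x \<oplus>\<^bsub>R\<^esub> v x),
      smult = (\<lambda>r u x. r \<otimes>\<^bsub>R\<^esub> u x)\<rparr>"

definition free_generator :: "('r, 'x) ring_scheme \<Rightarrow> 'b \<Rightarrow> 'b \<Rightarrow> 'r" where
  "free_generator R x = (\<lambda>y. if y = x then \<one>\<^bsub>R\<^esub> else \<zero>\<^bsub>R\<^esub>)"

definition tuples :: "('r, 'm) module \<Rightarrow> nat \<Rightarrow> 'm list set" where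
  "tuples M k = {xs. length xs = k \<and> set xs \<subseteq> carrier M}"

definition exterior_relations ::
    "('r, 'x) ring_scheme \<Rightarrow> ('r, 'm) module \<Rightarrow> nat \<Rightarrow> ('m list \<Rightarrow> 'r) set" where
  "exterior_relations R M k =
     (let T = free_module R (tuples M k); G = free_generator R in
      module_span R T
        ({G (xs[i := a \<oplus>\<^bsub>M\<^esub> b]) \<ominus>\<^bsub>T\<^esub> (G (xs[i := a]) \<oplus>\<^bsub>T\<^esub> G (xs[i := b])) | xs i a b.
            xs \<in> tuples M k \<and> i < k \<and> a \<in> carrier M \<and> b \<in> carrier M} \<union>
         {G (xs[i := r \<odot>\<^bsub>M\<^esub> a]) \<ominus>\<^bsub>T\<^esub> r \<odot>\<^bsub>T\<^esub> G (xs[i := a]) | xs i r a.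
            xs \<in> tuples M k \<and> i < k \<and> r \<in> carrier R \<and> a \<in> carrier M} \<union>
         {G xs | xs. xs \<in> tuples M k \<and> (\<exists>i j. i < j \<and> j < k \<and> xs ! i = xs ! j)}))"

definition exterior_power ::
    "('r, 'x) ring_scheme \<Rightarrow> ('r, 'm) module \<Rightarrow> nat \<Rightarrow> ('r, ('m list \<Rightarrow> 'r) set) module" where
  "exterior_power R M k = quotient_module (free_module R (tuples M k)) (exterior_relations R M k)"

text \<open>The \<open>R\<close>-linear map sending the generator \<open>x\<close> to the generator \<open>f x\<close>.\<close>

definition pushforward :: "('r, 'x) ring_scheme \<Rightarrow> ('a \<Rightarrow> 'b) \<Rightarrow> ('a \<Rightarrow> 'r) \<Rightarrow> 'b \<Rightarrow> 'r" where
  "pushforward R f u = (\<lambda>y. \<Oplus>\<^bsub>R\<^esub>x\<in>{x. u x \<noteq> \<zero>\<^bsub>R\<^esub> \<and> f x = y}. u x)"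

text \<open>The endomorphism of the \<open>k\<close>-th exterior power induced by an endomorphism \<open>h\<close> of \<open>M\<close>; it sends
  the class of a tuple \<open>xs\<close> to the class of \<open>map h xs\<close>.\<close>

definition exterior_map ::
    "('r, 'x) ring_scheme \<Rightarrow> ('r, 'm) module \<Rightarrow> nat \<Rightarrow> ('m \<Rightarrow> 'm) \<Rightarrow> ('m list \<Rightarrow> 'r) set \<Rightarrow> ('m list \<Rightarrow> 'r) set" where
  "exterior_map R M k h V =
     (\<Union>u\<in>V. exterior_relations R M k +>\<^bsub>free_module R (tuples M k)\<^esub> pushforward R (map h) u)"

section \<open>The elements $e_S$, the ideals $J_S$ and strictness\<close>

definition e_poly :: "'c ring \<Rightarrow> 'f \<Rightarrow> ('f \<Rightarrow> 'c) set \<Rightarrow> 'c list" where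
  "e_poly C \<zeta> S = (\<Otimes>\<^bsub>poly_ring C\<^esub>\<phi>\<in>S. [\<one>\<^bsub>C\<^esub>, \<ominus>\<^bsub>C\<^esub> \<phi> \<zeta>])"

text \<open>Evaluation at \<open>\<zeta> \<otimes> 1\<close> in the tensor product of \<open>OF\<close> and \<open>OE\<close> over \<open>OK\<close>; here \<open>OK\<close> is
  contained in \<open>OE\<close>, and the coefficients of \<open>e_poly\<close> lie in \<open>OE\<close> (but in general the
  \<open>\<phi> \<zeta>\<close> do not).\<close>

definition e_element ::
    "'c ring \<Rightarrow> 'c ring \<Rightarrow> ('c \<Rightarrow> 'f) \<Rightarrow> 'f ring \<Rightarrow> 'c ring \<Rightarrow> 'f \<Rightarrow> ('f \<Rightarrow> 'c) set
      \<Rightarrow> ('f \<times> 'c \<Rightarrow>\<^sub>0 int) set" where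
  "e_element C OK i OF OE \<zeta> S =
     ring.eval (tensor_ring OK i OF id OE)
       (map (pure_tensor OK i OF id OE \<one>\<^bsub>OF\<^esub>) (e_poly C \<zeta> S))
       (pure_tensor OK i OF id OE \<zeta> \<one>\<^bsub>OE\<^esub>)"

definition J_ideal ::
    "'c ring \<Rightarrow> 'c ring \<Rightarrow> ('c \<Rightarrow> 'f) \<Rightarrow> 'f ring \<Rightarrow> 'c ring \<Rightarrow> 'f \<Rightarrow> ('f \<Rightarrow> 'c) set
      \<Rightarrow> ('f \<times> 'c \<Rightarrow>\<^sub>0 int) set set" where
  "J_ideal C OK i OF OE \<zeta> S = Idl\<^bsub>tensor_ring OK i OF id OE\<^esub> {e_element C OK i OF OE \<zeta> S}"

text \<open>\<open>J M\<close>, where the ideal \<open>J\<close> acts on the \<open>T\<close>-module \<open>M\<close> through the ring homomorphism \<open>h\<close>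
  into \<open>T\<close>.\<close>

definition ideal_smult :: "('t, 'x) ring_scheme \<Rightarrow> ('a \<Rightarrow> 't) \<Rightarrow> 'a set \<Rightarrow> ('t, 'm) module \<Rightarrow> 'm set" where
  "ideal_smult T h J M = module_span T M {h a \<odot>\<^bsub>M\<^esub> m | a m. a \<in> J \<and> m \<in> carrier M}"

end

theory Submission
  imports Defs
begin

text \<open>Write \<open>T\<close> for the tensor product of \<open>OF\<close> and \<open>R\<close>, \<open>x\<close> for \<open>\<zeta> \<otimes> 1\<close>, and \<open>e\<^sub>A\<close> for the
  value at \<open>x\<close> of the polynomial \<open>e_poly\<close> of \<open>A\<close>. The conditions on \<open>B\<close> correspond to each other
  because \<open>g\<close> is surjective with kernel \<open>\<F>\<close>, the image of \<open>f\<close>. For \<open>A\<close>, one has to show that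
  \<open>\<F> \<subseteq> e\<^sub>A M\<close> if and only if the exterior power of degree \<open>d + 1\<close> of \<open>e\<^sub>A\<close> on \<open>L\<close> vanishes. Both
  are local on the spectrum of \<open>R\<close>, so \<open>M\<close> can be taken to be free over \<open>T\<close>, necessarily of rank
  \<open>n\<close>, and \<open>L\<close> free over \<open>R\<close>.

  Since \<open>e_poly\<close> is a monic divisor of the minimal polynomial of \<open>\<zeta>\<close>, the module \<open>M / e\<^sub>A M\<close> is
  free over \<open>R\<close> of rank \<open>m = n |A|\<close>, with basis given by elements of \<open>M\<close> and dual functionals on
  \<open>M\<close> that vanish on \<open>e\<^sub>A M\<close>. If \<open>\<F> \<subseteq> e\<^sub>A M\<close>, then these functionals descend to \<open>L\<close> and vanish on
  \<open>e\<^sub>A L\<close>, which leaves only \<open>d\<close> of the \<open>m + d\<close> dimensions of \<open>L\<close> for the image of \<open>e\<^sub>A\<close>. Conversely,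
  assume that the exterior power vanishes. An element of \<open>\<F>\<close> is a combination of the \<open>m\<close> basis
  elements modulo \<open>e\<^sub>A M\<close>; its image in \<open>L\<close> is zero, which gives a relation between \<open>m\<close> elements
  generating \<open>L\<close> modulo \<open>e\<^sub>A L\<close>. In a volume form of degree \<open>m + d\<close> at most \<open>d\<close> arguments from
  \<open>e\<^sub>A L\<close> are possible, so all the \<open>m\<close> elements have to occur, and the relation forces its
  coefficients to annihilate the volume form, hence to vanish.\<close>

section \<open>Alternating maps\<close>

text \<open>Localization changes the types of rings and modules, so the arguments on forms never
  pass to localizations of \<open>M\<close> or \<open>L\<close>. Functionals and forms live on the
  \<open>R\<close>-modules themselves, take values over S = R[1/\<sigma>], and are linear along R ->
  S. A basis over S is then visible only up to denominators: units stand where one expects ones, and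
  generation is demanded only after multiplication by an element that becomes a unit. Forms have two
  kinds of targets: the localized exterior power of \<open>L\<close>, where their vanishing is the
  goal, and S, where a product of coordinate functionals is a volume form. Only vanishing matters,
  so no signs or determinants are computed. The element \<sigma> is a product of three, one from
  each cover in the hypotheses: freeness of \<open>M\<close> over \<open>T\<close>, its rank over
  \<open>R\<close>, the rank of \<open>L\<close> over \<open>R\<close>. Functionals on T / e T come
  from sequences: the values of a functional on the powers of \<open>x\<close> form a sequence with
  the recurrence of the minimal polynomial, and it kills e T exactly if the sequence obeys the
  shorter recurrence given by e.\<close>

definition alternating_map ::
    "('r, 'x) ring_scheme \<Rightarrow> ('r, 'l) module \<Rightarrow> ('r \<Rightarrow> 's) \<Rightarrow> ('s, 'w) module \<Rightarrow> nat \<Rightarrow> ('l list \<Rightarrow> 'w) \<Rightarrow> bool"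
  where
  "alternating_map R L i W k \<psi> \<longleftrightarrow>
     (\<forall>xs. set xs \<subseteq> carrier L \<and> length xs = k \<longrightarrow> \<psi> xs \<in> carrier W) \<and>
     (\<forall>us vs a b. set us \<subseteq> carrier L \<and> set vs \<subseteq> carrier L \<and> a \<in> carrier L \<and> b \<in> carrier L \<and>
        Suc (length us + length vs) = k \<longrightarrow>
        \<psi> (us @ (a \<oplus>\<^bsub>L\<^esub> b) # vs) = \<psi> (us @ a # vs) \<oplus>\<^bsub>W\<^esub> \<psi> (us @ b # vs)) \<and>
     (\<forall>us vs r a. set us \<subseteq> carrier L \<and> set vs \<subseteq> carrier L \<and> r \<in> carrier R \<and> a \<in> carrier L \<and>
        Suc (length us + length vs) = k \<longrightarrow>
        \<psi> (us @ (r \<odot>\<^bsub>L\<^esub> a) # vs) = i r \<odot>\<^bsub>W\<^esub> \<psi> (us @ a # vs)) \<and>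
     (\<forall>us vs a. set us \<subseteq> carrier L \<and> set vs \<subseteq> carrier L \<and> a \<in> carrier L \<and>
        Suc (Suc (length us + length vs)) = k \<longrightarrow> \<psi> (us @ a # a # vs) = \<zero>\<^bsub>W\<^esub>)"

definition semilinear_map ::
    "('r, 'x) ring_scheme \<Rightarrow> ('r, 'l) module \<Rightarrow> ('r \<Rightarrow> 's) \<Rightarrow> ('s, 'w) module \<Rightarrow> ('l \<Rightarrow> 'w) \<Rightarrow> bool" where
  "semilinear_map R L i W \<pi> \<longleftrightarrow>
     (\<forall>x\<in>carrier L. \<pi> x \<in> carrier W) \<and>
     (\<forall>x\<in>carrier L. \<forall>y\<in>carrier L. \<pi> (x \<oplus>\<^bsub>L\<^esub> y) = \<pi> x \<oplus>\<^bsub>W\<^esub> \<pi> y) \<and>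
     (\<forall>r\<in>carrier R. \<forall>x\<in>carrier L. \<pi> (r \<odot>\<^bsub>L\<^esub> x) = i r \<odot>\<^bsub>W\<^esub> \<pi> x)"

lemma semilinear_mapI:
  assumes "\<And>x. x \<in> carrier L \<Longrightarrow> \<pi> x \<in> carrier W"
    and "\<And>x y. x \<in> carrier L \<Longrightarrow> y \<in> carrier L \<Longrightarrow> \<pi> (x \<oplus>\<^bsub>L\<^esub> y) = \<pi> x \<oplus>\<^bsub>W\<^esub> \<pi> y"
    and "\<And>r x. r \<in> carrier R \<Longrightarrow> x \<in> carrier L \<Longrightarrow> \<pi> (r \<odot>\<^bsub>L\<^esub> x) = i r \<odot>\<^bsub>W\<^esub> \<pi> x"
  shows "semilinear_map R L i W \<pi>"
  using assms by (auto simp: semilinear_map_def)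

lemma semilinear_mapD:
  assumes "semilinear_map R L i W \<pi>"
  shows "x \<in> carrier L \<Longrightarrow> \<pi> x \<in> carrier W"
    and "x \<in> carrier L \<Longrightarrow> y \<in> carrier L \<Longrightarrow> \<pi> (x \<oplus>\<^bsub>L\<^esub> y) = \<pi> x \<oplus>\<^bsub>W\<^esub> \<pi> y"
    and "r \<in> carrier R \<Longrightarrow> x \<in> carrier L \<Longrightarrow> \<pi> (r \<odot>\<^bsub>L\<^esub> x) = i r \<odot>\<^bsub>W\<^esub> \<pi> x"
  using assms by (auto simp: semilinear_map_def)

lemma alternating_mapI:
  assumes "\<And>xs. set xs \<subseteq> carrier L \<Longrightarrow> length xs = k \<Longrightarrow> \<psi> xs \<in> carrier W"
    and "\<And>us vs a b. set us \<subseteq> carrier L \<Longrightarrow> set vs \<subseteq> carrier L \<Longrightarrow> a \<in> carrier L \<Longrightarrow> b \<in> carrier L \<Longrightarrow>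
        Suc (length us + length vs) = k \<Longrightarrow>
        \<psi> (us @ (a \<oplus>\<^bsub>L\<^esub> b) # vs) = \<psi> (us @ a # vs) \<oplus>\<^bsub>W\<^esub> \<psi> (us @ b # vs)"
    and "\<And>us vs r a. set us \<subseteq> carrier L \<Longrightarrow> set vs \<subseteq> carrier L \<Longrightarrow> r \<in> carrier R \<Longrightarrow> a \<in> carrier L \<Longrightarrow>
        Suc (length us + length vs) = k \<Longrightarrow>
        \<psi> (us @ (r \<odot>\<^bsub>L\<^esub> a) # vs) = i r \<odot>\<^bsub>W\<^esub> \<psi> (us @ a # vs)"
    and "\<And>us vs a. set us \<subseteq> carrier L \<Longrightarrow> set vs \<subseteq> carrier L \<Longrightarrow> a \<in> carrier L \<Longrightarrow>
        Suc (Suc (length us + length vs)) = k \<Longrightarrow> \<psi> (us @ a # a # vs) = \<zero>\<^bsub>W\<^esub>"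
  shows "alternating_map R L i W k \<psi>"
  unfolding alternating_map_def using assms by blast

lemma alternating_mapD:
  assumes "alternating_map R L i W k \<psi>"
  shows "set xs \<subseteq> carrier L \<Longrightarrow> length xs = k \<Longrightarrow> \<psi> xs \<in> carrier W"
    and "set us \<subseteq> carrier L \<Longrightarrow> set vs \<subseteq> carrier L \<Longrightarrow> a \<in> carrier L \<Longrightarrow> b \<in> carrier L \<Longrightarrow>
        Suc (length us + length vs) = k \<Longrightarrow>
        \<psi> (us @ (a \<oplus>\<^bsub>L\<^esub> b) # vs) = \<psi> (us @ a # vs) \<oplus>\<^bsub>W\<^esub> \<psi> (us @ b # vs)"
    and "set us \<subseteq> carrier L \<Longrightarrow> set vs \<subseteq> carrier L \<Longrightarrow> r \<in> carrier R \<Longrightarrow> a \<in> carrier L \<Longrightarrow>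
        Suc (length us + length vs) = k \<Longrightarrow>
        \<psi> (us @ (r \<odot>\<^bsub>L\<^esub> a) # vs) = i r \<odot>\<^bsub>W\<^esub> \<psi> (us @ a # vs)"
    and "set us \<subseteq> carrier L \<Longrightarrow> set vs \<subseteq> carrier L \<Longrightarrow> a \<in> carrier L \<Longrightarrow>
        Suc (Suc (length us + length vs)) = k \<Longrightarrow> \<psi> (us @ a # a # vs) = \<zero>\<^bsub>W\<^esub>"
  using assms unfolding alternating_map_def by blast+

text \<open>Expansion along the first factor of the product of a functional and an alternating map.\<close>

fun wedge :: "('s, 'w) module \<Rightarrow> ('l \<Rightarrow> 's) \<Rightarrow> ('l list \<Rightarrow> 'w) \<Rightarrow> 'l list \<Rightarrow> 'w" where
  "wedge W \<pi> \<psi> [] = \<zero>\<^bsub>W\<^esub>"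
| "wedge W \<pi> \<psi> (x # xs) = (\<pi> x \<odot>\<^bsub>W\<^esub> \<psi> xs) \<ominus>\<^bsub>W\<^esub> wedge W \<pi> (\<lambda>ys. \<psi> (x # ys)) xs"

text \<open>Factors are multiplied on from the left, the functional with the largest index
  outermost; this is the reason for the reversed argument lists below.\<close>

primrec wedges :: "('s, 'w) module \<Rightarrow> (nat \<Rightarrow> 'l \<Rightarrow> 's) \<Rightarrow> nat \<Rightarrow> ('l list \<Rightarrow> 'w) \<Rightarrow> 'l list \<Rightarrow> 'w" where
  "wedges W \<pi> 0 \<psi> = \<psi>"
| "wedges W \<pi> (Suc n) \<psi> = wedge W (\<pi> n) (wedges W \<pi> n \<psi>)"

section \<open>Spans and units in modules\<close>

lemma module_span_submodule:
  fixes M :: "('r, 'm) module"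
  assumes "module R M" and "Y \<subseteq> carrier M"
  shows "submodule (module_span R M Y) R M" and "Y \<subseteq> module_span R M Y"
    and "module_span R M Y \<subseteq> carrier M"
proof -
  interpret module R M by fact
  show "Y \<subseteq> module_span R M Y" by (auto simp: module_span_def)
  have c: "carrier M \<in> {N. submodule N R M \<and> Y \<subseteq> N}" using assms carrier_is_submodule by simp
  show "module_span R M Y \<subseteq> carrier M"
    using c unfolding module_span_def by blast
  then show "submodule (module_span R M Y) R M"
  proof (rule submoduleI)
    show "\<zero>\<^bsub>M\<^esub> \<in> module_span R M Y" unfolding module_span_def
      using submodule.axioms(1) subgroup.one_closed by fastforce
  next
    fix a assume "a \<in> module_span R M Y" then show "\<ominus>\<^bsub>M\<^esub> a \<in> module_span R M Y"
      unfolding module_span_def using submoduleE(3) by blast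
  next
    fix a b assume "a \<in> module_span R M Y" "b \<in> module_span R M Y"
    then show "a \<oplus>\<^bsub>M\<^esub> b \<in> module_span R M Y"
      unfolding module_span_def using submoduleE(5) by blast
  next
    fix a b assume "a \<in> carrier R" "b \<in> module_span R M Y"
    then show "a \<odot>\<^bsub>M\<^esub> b \<in> module_span R M Y"
      unfolding module_span_def using submoduleE(4) by blast
  qed
qed

lemma module_span_minimal:
  assumes "submodule N R M" "Y \<subseteq> N"
  shows "module_span R M Y \<subseteq> N"
  using assms by (auto simp: module_span_def)

lemma module_span_mono:
  assumes "Z \<subseteq> Y"
  shows "module_span R M Z \<subseteq> module_span R M Y"
  using assms by (auto simp: module_span_def)

lemma (in module) submodule_zero: "submodule H R M \<Longrightarrow> \<zero>\<^bsub>M\<^esub> \<in> H"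
  using submodule.axioms(1) subgroup.one_closed by fastforce

lemma (in module) a_inv_zero: "\<ominus>\<^bsub>M\<^esub> \<zero>\<^bsub>M\<^esub> = \<zero>\<^bsub>M\<^esub>"
  by (rule M.minus_equality) simp_all

lemma (in module) smult_unit_eq_zero:
  assumes "u \<in> Units R" "w \<in> carrier M" "u \<odot>\<^bsub>M\<^esub> w = \<zero>\<^bsub>M\<^esub>"
  shows "w = \<zero>\<^bsub>M\<^esub>"
proof -
  have u: "u \<in> carrier R" "inv\<^bsub>R\<^esub> u \<in> carrier R" using assms(1) by auto
  have "w = (inv\<^bsub>R\<^esub> u \<otimes>\<^bsub>R\<^esub> u) \<odot>\<^bsub>M\<^esub> w" using assms R.Units_l_inv by simp
  also have "\<dots> = \<zero>\<^bsub>M\<^esub>" using assms u by (simp only: smult_assoc1 smult_r_null)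
  finally show ?thesis .
qed

text \<open>In the applications \<open>S\<close> is a localization of the base ring, and
  \<open>W\<close> is either \<open>S\<close> itself or a localized exterior power of
  \<open>L\<close>.\<close>

locale semilinear_setting = L: module R L + W: module S W
  for R :: "('r, 'x) ring_scheme" and L :: "('r, 'l) module"
    and S :: "('s, 'y) ring_scheme" and W :: "('s, 'w) module" +
  fixes i :: "'r \<Rightarrow> 's"
  assumes hom: "i \<in> ring_hom R S"
begin

abbreviation "alt k \<psi> \<equiv> alternating_map R L i W k \<psi>"

lemma alt_append:
  assumes "alt (length ws + k) \<psi>" "set ws \<subseteq> carrier L"
  shows "alt k (\<lambda>ys. \<psi> (ws @ ys))"
proof (rule alternating_mapI)
  fix us vs r a b
  assume us: "set us \<subseteq> carrier L" "set vs \<subseteq> carrier L"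
    and l: "Suc (length us + length vs) = k" and a: "a \<in> carrier L"
  show "b \<in> carrier L \<Longrightarrow> \<psi> (ws @ us @ (a \<oplus>\<^bsub>L\<^esub> b) # vs) = \<psi> (ws @ us @ a # vs) \<oplus>\<^bsub>W\<^esub> \<psi> (ws @ us @ b # vs)"
    using alternating_mapD(2)[OF assms(1), of "ws @ us" vs a b] us l a assms(2) by simp
  show "r \<in> carrier R \<Longrightarrow> \<psi> (ws @ us @ (r \<odot>\<^bsub>L\<^esub> a) # vs) = i r \<odot>\<^bsub>W\<^esub> \<psi> (ws @ us @ a # vs)"
    using alternating_mapD(3)[OF assms(1), of "ws @ us" vs r a] us l a assms(2) by simp
next
  fix us vs a
  assume us: "set us \<subseteq> carrier L" "set vs \<subseteq> carrier L"
    and l: "Suc (Suc (length us + length vs)) = k" and a: "a \<in> carrier L"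
  show "\<psi> (ws @ us @ a # a # vs) = \<zero>\<^bsub>W\<^esub>"
    using alternating_mapD(4)[OF assms(1), of "ws @ us" vs a] us l a assms(2) by simp
qed (use assms alternating_mapD(1)[OF assms(1)] in auto)

lemma alt_Cons:
  assumes "alt (Suc k) \<psi>" "x \<in> carrier L"
  shows "alt k (\<lambda>ys. \<psi> (x # ys))"
  using alt_append[of "[x]" k \<psi>] assms by simp

lemma alt_zero_entry:
  assumes "alt k \<psi>" "set us \<subseteq> carrier L" "set vs \<subseteq> carrier L" "Suc (length us + length vs) = k"
  shows "\<psi> (us @ \<zero>\<^bsub>L\<^esub> # vs) = \<zero>\<^bsub>W\<^esub>"
proof -
  have "\<psi> (us @ \<zero>\<^bsub>L\<^esub> # vs) \<oplus>\<^bsub>W\<^esub> \<psi> (us @ \<zero>\<^bsub>L\<^esub> # vs) = \<psi> (us @ \<zero>\<^bsub>L\<^esub> # vs)"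
    using alternating_mapD(2)[OF assms(1-3), of "\<zero>\<^bsub>L\<^esub>" "\<zero>\<^bsub>L\<^esub>"] assms(4) by simp
  moreover have "\<psi> (us @ \<zero>\<^bsub>L\<^esub> # vs) \<in> carrier W"
    using assms by (intro alternating_mapD(1)[OF assms(1)]) auto
  ultimately show ?thesis by simp
qed

lemma alt_swap:
  assumes "alt k \<psi>" "set us \<subseteq> carrier L" "set vs \<subseteq> carrier L" "a \<in> carrier L" "b \<in> carrier L"
    "Suc (Suc (length us + length vs)) = k"
  shows "\<psi> (us @ a # b # vs) = \<ominus>\<^bsub>W\<^esub> \<psi> (us @ b # a # vs)"
proof -
  note D = alternating_mapD[OF assms(1)]
  have c: "\<psi> (us @ a # b # vs) \<in> carrier W" "\<psi> (us @ b # a # vs) \<in> carrier W"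
    "\<psi> (us @ b # b # vs) \<in> carrier W" "\<psi> (us @ a # a # vs) \<in> carrier W"
    using assms by (intro D(1); simp)+
  let ?c = "a \<oplus>\<^bsub>L\<^esub> b"
  have "\<zero>\<^bsub>W\<^esub> = \<psi> (us @ ?c # ?c # vs)" using D(4)[of us vs ?c] assms by simp
  also have "\<dots> = \<psi> (us @ a # ?c # vs) \<oplus>\<^bsub>W\<^esub> \<psi> (us @ b # ?c # vs)"
    using D(2)[of us "?c # vs" a b] assms by simp
  also have "\<psi> (us @ a # ?c # vs) = \<psi> (us @ a # a # vs) \<oplus>\<^bsub>W\<^esub> \<psi> (us @ a # b # vs)"
    using D(2)[of "us @ [a]" vs a b] assms by simp
  also have "\<psi> (us @ b # ?c # vs) = \<psi> (us @ b # a # vs) \<oplus>\<^bsub>W\<^esub> \<psi> (us @ b # b # vs)"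
    using D(2)[of "us @ [b]" vs a b] assms by simp
  also have "\<psi> (us @ a # a # vs) = \<zero>\<^bsub>W\<^esub>" using D(4) assms by simp
  also have "\<psi> (us @ b # b # vs) = \<zero>\<^bsub>W\<^esub>" using D(4) assms by simp
  finally have "\<psi> (us @ a # b # vs) \<oplus>\<^bsub>W\<^esub> \<psi> (us @ b # a # vs) = \<zero>\<^bsub>W\<^esub>" using c by simp
  then show ?thesis using c by (metis W.minus_equality)
qed

lemma alt_dup:
  assumes "alt k \<psi>" "set us \<subseteq> carrier L" "set vs \<subseteq> carrier L" "set ws \<subseteq> carrier L" "a \<in> carrier L"
    "Suc (Suc (length us + length vs + length ws)) = k"
  shows "\<psi> (us @ a # vs @ a # ws) = \<zero>\<^bsub>W\<^esub>"
  using assms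
proof (induction vs arbitrary: us)
  case Nil then show ?case using alternating_mapD(4)[OF assms(1)] by simp
next
  case (Cons v vs)
  have "\<psi> (us @ a # (v # vs) @ a # ws) = \<ominus>\<^bsub>W\<^esub> \<psi> (us @ v # a # vs @ a # ws)"
    using alt_swap[OF assms(1), of us "vs @ a # ws" a v] Cons.prems by simp
  also have "\<psi> (us @ v # a # vs @ a # ws) = \<zero>\<^bsub>W\<^esub>"
    using Cons.IH[of "us @ [v]"] Cons.prems by simp
  finally show ?case by simp
qed

lemma alt_not_distinct:
  assumes "alt k \<psi>" "set xs \<subseteq> carrier L" "length xs = k" "\<not> distinct xs"
  shows "\<psi> xs = \<zero>\<^bsub>W\<^esub>"
proof -
  obtain us vs ws a where "xs = us @ [a] @ vs @ [a] @ ws"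
    using not_distinct_decomp[OF assms(4)] by blast
  then show ?thesis using alt_dup[OF assms(1), of us vs ws a] assms by simp
qed

text \<open>Tracking only whether the value is zero makes the sign of the permutation
  irrelevant.\<close>

lemma alt_move:
  assumes "alt k \<psi>" "set us \<subseteq> carrier L" "set vs \<subseteq> carrier L" "a \<in> carrier L"
    "Suc (length us + length vs) = k"
  shows "\<psi> (us @ a # vs) = \<zero>\<^bsub>W\<^esub> \<longleftrightarrow> \<psi> (a # us @ vs) = \<zero>\<^bsub>W\<^esub>"
  using assms
proof (induction us arbitrary: vs rule: rev_induct)
  case Nil then show ?case by simp
next
  case (snoc u us)
  have c: "\<psi> (us @ a # u # vs) \<in> carrier W"
    using snoc.prems by (intro alternating_mapD(1)[OF assms(1)]) auto
  have "\<psi> (us @ u # a # vs) = \<ominus>\<^bsub>W\<^esub> \<psi> (us @ a # u # vs)"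
    using alt_swap[OF assms(1), of us vs u a] snoc.prems by simp
  then have "\<psi> (us @ u # a # vs) = \<zero>\<^bsub>W\<^esub> \<longleftrightarrow> \<psi> (us @ a # u # vs) = \<zero>\<^bsub>W\<^esub>"
    using W.a_inv_inj c W.add.inv_eq_1_iff by simp
  with snoc.IH[of "u # vs"] snoc.prems show ?case by simp
qed

lemma alt_perm:
  assumes "alt k \<psi>" "mset xs = mset ys" "set xs \<subseteq> carrier L" "length xs = k" "\<psi> xs = \<zero>\<^bsub>W\<^esub>"
  shows "\<psi> ys = \<zero>\<^bsub>W\<^esub>"
  using assms
proof (induction xs arbitrary: ys k \<psi>)
  case Nil then show ?case by simp
next
  case (Cons x xs)
  then have "x \<in> set ys" by (metis list.set_intros(1) set_mset_mset)
  then obtain us vs where ys: "ys = us @ x # vs" by (metis split_list)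
  then have m: "mset xs = mset (us @ vs)" using Cons.prems(2) by simp
  have "set ys \<subseteq> carrier L" using Cons.prems(2,3) by (metis set_mset_mset)
  then have s: "set us \<subseteq> carrier L" "set vs \<subseteq> carrier L" using ys by auto
  have l: "length xs = length us + length vs" using m by (metis length_append size_mset)
  have "alt (length xs) (\<lambda>ys. \<psi> (x # ys))" using Cons.prems by (intro alt_Cons) auto
  then have "\<psi> (x # us @ vs) = \<zero>\<^bsub>W\<^esub>"
    using Cons.IH[of "length xs" "\<lambda>ys. \<psi> (x # ys)" "us @ vs"] m Cons.prems by simp
  moreover have "x \<in> carrier L" "Suc (length us + length vs) = k" using Cons.prems l by auto
  ultimately show ?case unfolding ys using alt_move[OF Cons.prems(1) s] by blast
qed

text \<open>With the other arguments fixed, the elements that make the form vanish in one place are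
  a submodule, so it suffices to look at generators. Denominators q do no harm because they act
  invertibly on the values.\<close>

lemma alt_generators:
  assumes alt: "alt k \<psi>" and Y: "Y \<subseteq> carrier L"
    and gen: "\<And>y. y \<in> carrier L \<Longrightarrow> \<exists>q\<in>carrier R. i q \<in> Units S \<and> q \<odot>\<^bsub>L\<^esub> y \<in> module_span R L Y"
    and van: "\<And>xs. set xs \<subseteq> Y \<Longrightarrow> length xs = k \<Longrightarrow> \<psi> xs = \<zero>\<^bsub>W\<^esub>"
    and ys: "set ys \<subseteq> carrier L" "length ys = k"
  shows "\<psi> ys = \<zero>\<^bsub>W\<^esub>"
proof -
  note D = alternating_mapD[OF alt]
  interpret i: ring_hom_ring R S i
    using hom L.R.ring_axioms W.R.ring_axioms by (intro ring_hom_ringI2)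
  \<comment> \<open>The list \<open>vs\<close> holds arguments already replaced by generators,
    \<open>us\<close> those that are still arbitrary; the induction moves one argument from
    \<open>us\<close> to \<open>vs\<close>.\<close>
  have "\<psi> (vs @ us) = \<zero>\<^bsub>W\<^esub>" if "set vs \<subseteq> Y" "set us \<subseteq> carrier L" "length vs + length us = k" for us vs
    using that
  proof (induction us arbitrary: vs)
    case Nil then show ?case using van by simp
  next
    case (Cons u us)
    define Z where "Z = {x \<in> carrier L. \<psi> (vs @ x # us) = \<zero>\<^bsub>W\<^esub>}"
    have vs: "set vs \<subseteq> carrier L" using Cons.prems Y by blast
    have "submodule Z R L"
    proof (rule L.submoduleI)
      show "\<zero>\<^bsub>L\<^esub> \<in> Z" using alt_zero_entry[OF alt, of vs us] Cons.prems vs by (simp add: Z_def)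
      show "a \<oplus>\<^bsub>L\<^esub> b \<in> Z" if "a \<in> Z" "b \<in> Z" for a b
        using that D(2)[of vs us a b] Cons.prems vs by (simp add: Z_def)
      show *: "a \<odot>\<^bsub>L\<^esub> x \<in> Z" if "a \<in> carrier R" "x \<in> Z" for a x
        using that D(3)[of vs us a x] Cons.prems vs by (simp add: Z_def)
      show "\<ominus>\<^bsub>L\<^esub> a \<in> Z" if "a \<in> Z" for a
        using *[of "\<ominus>\<^bsub>R\<^esub> \<one>\<^bsub>R\<^esub>" a] that by (simp add: L.smult_l_minus Z_def)
    qed (auto simp: Z_def)
    moreover have "Y \<subseteq> Z"
    proof
      fix x assume "x \<in> Y"
      then show "x \<in> Z" using Cons.IH[of "vs @ [x]"] Cons.prems Y by (auto simp: Z_def)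
    qed
    ultimately have XZ: "module_span R L Y \<subseteq> Z" by (rule module_span_minimal)
    obtain q where q: "q \<in> carrier R" "i q \<in> Units S" "q \<odot>\<^bsub>L\<^esub> u \<in> module_span R L Y"
      using gen[of u] Cons.prems by auto
    then have "i q \<odot>\<^bsub>W\<^esub> \<psi> (vs @ u # us) = \<zero>\<^bsub>W\<^esub>"
      using D(3)[of vs us q u] Cons.prems vs XZ by (auto simp: Z_def)
    then show ?case
      using W.smult_unit_eq_zero[OF q(2)] D(1)[of "vs @ u # us"] Cons.prems vs by simp
  qed
  from this[of "[]" ys] ys show ?thesis by simp
qed

text \<open>Pigeonhole: among k arguments taken from fewer than k generators one is
  repeated.\<close>

lemma alt_few_generators:
  assumes alt: "alt k \<psi>" and Y: "Y \<subseteq> carrier L" "finite Y" "card Y < k"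
    and gen: "\<And>y. y \<in> carrier L \<Longrightarrow> \<exists>q\<in>carrier R. i q \<in> Units S \<and> q \<odot>\<^bsub>L\<^esub> y \<in> module_span R L Y"
    and ys: "set ys \<subseteq> carrier L" "length ys = k"
  shows "\<psi> ys = \<zero>\<^bsub>W\<^esub>"
proof (rule alt_generators[OF alt Y(1) gen _ ys])
  fix xs assume xs: "set xs \<subseteq> Y" "length xs = k"
  then have "\<not> distinct xs" using Y distinct_card[of xs] card_mono[OF Y(2), of "set xs"] by auto
  then show "\<psi> xs = \<zero>\<^bsub>W\<^esub>" using alt_not_distinct[OF alt] xs Y by auto
qed

section \<open>Products of forms with functionals\<close>

lemma wedge_closed:
  assumes "\<And>x. x \<in> carrier L \<Longrightarrow> \<pi> x \<in> carrier S"
    and "\<And>ys. set ys \<subseteq> carrier L \<Longrightarrow> Suc (length ys) = length xs \<Longrightarrow> \<psi> ys \<in> carrier W"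
    and "set xs \<subseteq> carrier L"
  shows "wedge W \<pi> \<psi> xs \<in> carrier W"
  using assms(2,3)
proof (induction xs arbitrary: \<psi>)
  case Nil then show ?case by simp
next
  case (Cons x xs)
  have "wedge W \<pi> (\<lambda>ys. \<psi> (x # ys)) xs \<in> carrier W" using Cons.prems by (intro Cons.IH) auto
  then show ?case using Cons.prems assms(1) by simp
qed

lemma wedge_zero:
  assumes "\<And>x. x \<in> carrier L \<Longrightarrow> \<pi> x \<in> carrier S"
    and "\<And>ys. set ys \<subseteq> carrier L \<Longrightarrow> Suc (length ys) = length xs \<Longrightarrow> \<psi> ys = \<zero>\<^bsub>W\<^esub>"
    and "set xs \<subseteq> carrier L"
  shows "wedge W \<pi> \<psi> xs = \<zero>\<^bsub>W\<^esub>"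
  using assms(2,3)
proof (induction xs arbitrary: \<psi>)
  case Nil then show ?case by simp
next
  case (Cons x xs)
  have "wedge W \<pi> (\<lambda>ys. \<psi> (x # ys)) xs = \<zero>\<^bsub>W\<^esub>" using Cons.prems by (intro Cons.IH) auto
  then show ?case using Cons.prems assms(1) by (simp add: a_minus_def)
qed

lemma wedge_add:
  assumes "\<And>x. x \<in> carrier L \<Longrightarrow> \<pi> x \<in> carrier S"
    and "\<And>ys. set ys \<subseteq> carrier L \<Longrightarrow> Suc (length ys) = length xs \<Longrightarrow>
       \<psi>1 ys \<in> carrier W \<and> \<psi>2 ys \<in> carrier W \<and> \<psi> ys = \<psi>1 ys \<oplus>\<^bsub>W\<^esub> \<psi>2 ys"
    and "set xs \<subseteq> carrier L"
  shows "wedge W \<pi> \<psi> xs = wedge W \<pi> \<psi>1 xs \<oplus>\<^bsub>W\<^esub> wedge W \<pi> \<psi>2 xs"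
  using assms(2,3)
proof (induction xs arbitrary: \<psi> \<psi>1 \<psi>2)
  case Nil then show ?case by simp
next
  case (Cons x xs)
  have x: "x \<in> carrier L" "set xs \<subseteq> carrier L" using Cons.prems by auto
  have "wedge W \<pi> (\<lambda>ys. \<psi> (x # ys)) xs
      = wedge W \<pi> (\<lambda>ys. \<psi>1 (x # ys)) xs \<oplus>\<^bsub>W\<^esub> wedge W \<pi> (\<lambda>ys. \<psi>2 (x # ys)) xs"
    using Cons.prems by (intro Cons.IH) auto
  moreover have "wedge W \<pi> (\<lambda>ys. \<psi>1 (x # ys)) xs \<in> carrier W" "wedge W \<pi> (\<lambda>ys. \<psi>2 (x # ys)) xs \<in> carrier W"
    using Cons.prems by (intro wedge_closed; auto simp: assms(1))+
  ultimately show ?case using Cons.prems(1)[of xs] x assms(1)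
    by (simp add: W.smult_r_distr a_minus_def W.minus_add W.a_ac)
qed

lemma wedge_smult:
  assumes "\<And>x. x \<in> carrier L \<Longrightarrow> \<pi> x \<in> carrier S" and "c \<in> carrier S"
    and "\<And>ys. set ys \<subseteq> carrier L \<Longrightarrow> Suc (length ys) = length xs \<Longrightarrow>
       \<psi>1 ys \<in> carrier W \<and> \<psi> ys = c \<odot>\<^bsub>W\<^esub> \<psi>1 ys"
    and "set xs \<subseteq> carrier L"
  shows "wedge W \<pi> \<psi> xs = c \<odot>\<^bsub>W\<^esub> wedge W \<pi> \<psi>1 xs"
  using assms(3,4)
proof (induction xs arbitrary: \<psi> \<psi>1)
  case Nil then show ?case using assms(2) by simp
next
  case (Cons x xs)
  have x: "x \<in> carrier L" "set xs \<subseteq> carrier L" using Cons.prems by auto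
  have "wedge W \<pi> (\<lambda>ys. \<psi> (x # ys)) xs = c \<odot>\<^bsub>W\<^esub> wedge W \<pi> (\<lambda>ys. \<psi>1 (x # ys)) xs"
    using Cons.prems by (intro Cons.IH) auto
  moreover have "wedge W \<pi> (\<lambda>ys. \<psi>1 (x # ys)) xs \<in> carrier W"
    using Cons.prems by (intro wedge_closed; auto simp: assms(1))+
  moreover have "\<pi> x \<odot>\<^bsub>W\<^esub> (c \<odot>\<^bsub>W\<^esub> \<psi>1 xs) = c \<odot>\<^bsub>W\<^esub> (\<pi> x \<odot>\<^bsub>W\<^esub> \<psi>1 xs)"
    using Cons.prems(1)[of xs] x assms(1)[OF x(1)] assms(2)
    by (metis W.R.m_comm W.smult_assoc1 length_Cons)
  ultimately show ?case using Cons.prems(1)[of xs] x assms(1,2)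
    by (simp add: W.smult_r_distr a_minus_def W.smult_r_minus)
qed

text \<open>Two equal arguments at the front contribute the same term with opposite signs, and what
  remains is the expansion of a form that itself has two equal arguments. Equal arguments further
  back are reached by induction on the prefix.\<close>

lemma alt_wedge:
  assumes "alt k \<psi>" and \<pi>: "semilinear_map R L i (regular_module S) \<pi>"
  shows "alt (Suc k) (wedge W \<pi> \<psi>)"
proof -
  interpret i: ring_hom_ring R S i
    using hom L.R.ring_axioms W.R.ring_axioms by (intro ring_hom_ringI2)
  have \<pi>c: "\<pi> x \<in> carrier S" if "x \<in> carrier L" for x
    using semilinear_mapD(1)[OF \<pi> that] by (simp add: regular_module_def)
  have \<pi>a: "\<pi> (x \<oplus>\<^bsub>L\<^esub> y) = \<pi> x \<oplus>\<^bsub>S\<^esub> \<pi> y" if "x \<in> carrier L" "y \<in> carrier L" for x y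
    using semilinear_mapD(2)[OF \<pi> that] by (simp add: regular_module_def)
  have \<pi>s: "\<pi> (r \<odot>\<^bsub>L\<^esub> x) = i r \<otimes>\<^bsub>S\<^esub> \<pi> x" if "r \<in> carrier R" "x \<in> carrier L" for r x
    using semilinear_mapD(3)[OF \<pi> that] by (simp add: regular_module_def)
  note wc = wedge_closed[of \<pi>, OF \<pi>c]
  show ?thesis
  proof (rule alternating_mapI)
    fix xs assume "set xs \<subseteq> carrier L" "length xs = Suc k"
    then show "wedge W \<pi> \<psi> xs \<in> carrier W"
      using alternating_mapD(1)[OF assms(1)] by (intro wc) auto
  next
    fix us vs a b
    assume "set us \<subseteq> carrier L" "set vs \<subseteq> carrier L" "a \<in> carrier L" "b \<in> carrier L"
      "Suc (length us + length vs) = Suc k"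
    with assms(1) show "wedge W \<pi> \<psi> (us @ (a \<oplus>\<^bsub>L\<^esub> b) # vs)
        = wedge W \<pi> \<psi> (us @ a # vs) \<oplus>\<^bsub>W\<^esub> wedge W \<pi> \<psi> (us @ b # vs)"
    proof (induction us arbitrary: k \<psi>)
      case Nil
      note D = alternating_mapD[OF Nil.prems(1)]
      have 1: "wedge W \<pi> (\<lambda>ys. \<psi> ((a \<oplus>\<^bsub>L\<^esub> b) # ys)) vs
         = wedge W \<pi> (\<lambda>ys. \<psi> (a # ys)) vs \<oplus>\<^bsub>W\<^esub> wedge W \<pi> (\<lambda>ys. \<psi> (b # ys)) vs"
        by (rule wedge_add) (use Nil D(1) D(2)[of "[]"] \<pi>c in auto)
      have 2: "wedge W \<pi> (\<lambda>ys. \<psi> (a # ys)) vs \<in> carrier W" "wedge W \<pi> (\<lambda>ys. \<psi> (b # ys)) vs \<in> carrier W"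
        by (rule wc; use Nil D(1) in auto)+
      have "\<psi> vs \<in> carrier W" using D(1) Nil by auto
      then show ?case using 1 2 Nil \<pi>c
        by (simp add: \<pi>a W.smult_l_distr a_minus_def W.minus_add W.a_ac)
    next
      case (Cons u us)
      then obtain k' where k: "k = Suc k'" by (cases k) auto
      note D = alternating_mapD[OF Cons.prems(1)]
      have u: "u \<in> carrier L" using Cons.prems by simp
      have 1: "wedge W \<pi> (\<lambda>ys. \<psi> (u # ys)) (us @ (a \<oplus>\<^bsub>L\<^esub> b) # vs)
        = wedge W \<pi> (\<lambda>ys. \<psi> (u # ys)) (us @ a # vs) \<oplus>\<^bsub>W\<^esub> wedge W \<pi> (\<lambda>ys. \<psi> (u # ys)) (us @ b # vs)"
        using Cons.prems k u by (intro Cons.IH[OF alt_Cons]) auto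
      have 2: "wedge W \<pi> (\<lambda>ys. \<psi> (u # ys)) (us @ a # vs) \<in> carrier W"
          "wedge W \<pi> (\<lambda>ys. \<psi> (u # ys)) (us @ b # vs) \<in> carrier W"
        by (rule wc; use Cons.prems D(1) in auto)+
      have 3: "\<psi> (us @ a # vs) \<in> carrier W" "\<psi> (us @ b # vs) \<in> carrier W"
        by (rule D(1); use Cons.prems in auto)+
      have 4: "\<psi> (us @ (a \<oplus>\<^bsub>L\<^esub> b) # vs) = \<psi> (us @ a # vs) \<oplus>\<^bsub>W\<^esub> \<psi> (us @ b # vs)"
        using D(2)[of us vs a b] Cons.prems by simp
      show ?case using 1 2 3 4 \<pi>c u
        by (simp add: W.smult_r_distr a_minus_def W.minus_add W.a_ac)
    qed
  next
    fix us vs r a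
    assume "set us \<subseteq> carrier L" "set vs \<subseteq> carrier L" "r \<in> carrier R" "a \<in> carrier L"
      "Suc (length us + length vs) = Suc k"
    with assms(1) show "wedge W \<pi> \<psi> (us @ (r \<odot>\<^bsub>L\<^esub> a) # vs) = i r \<odot>\<^bsub>W\<^esub> wedge W \<pi> \<psi> (us @ a # vs)"
    proof (induction us arbitrary: k \<psi>)
      case Nil
      note D = alternating_mapD[OF Nil.prems(1)]
      have 1: "wedge W \<pi> (\<lambda>ys. \<psi> ((r \<odot>\<^bsub>L\<^esub> a) # ys)) vs = i r \<odot>\<^bsub>W\<^esub> wedge W \<pi> (\<lambda>ys. \<psi> (a # ys)) vs"
        by (rule wedge_smult) (use Nil D(1) D(3)[of "[]"] \<pi>c in auto)
      have 2: "wedge W \<pi> (\<lambda>ys. \<psi> (a # ys)) vs \<in> carrier W"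
        by (rule wc; use Nil D(1) in auto)+
      have "\<psi> vs \<in> carrier W" using D(1) Nil by auto
      then show ?case using 1 2 Nil \<pi>c
        by (simp add: \<pi>s W.smult_assoc1 a_minus_def W.smult_r_distr W.smult_r_minus)
    next
      case (Cons u us)
      then obtain k' where k: "k = Suc k'" by (cases k) auto
      note D = alternating_mapD[OF Cons.prems(1)]
      have u: "u \<in> carrier L" using Cons.prems by simp
      have 1: "wedge W \<pi> (\<lambda>ys. \<psi> (u # ys)) (us @ (r \<odot>\<^bsub>L\<^esub> a) # vs)
        = i r \<odot>\<^bsub>W\<^esub> wedge W \<pi> (\<lambda>ys. \<psi> (u # ys)) (us @ a # vs)"
        using Cons.prems k u by (intro Cons.IH[OF alt_Cons]) auto
      have 2: "wedge W \<pi> (\<lambda>ys. \<psi> (u # ys)) (us @ a # vs) \<in> carrier W"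
        by (rule wc; use Cons.prems D(1) in auto)+
      have 3: "\<psi> (us @ a # vs) \<in> carrier W"
        by (rule D(1); use Cons.prems in auto)+
      have 4: "\<psi> (us @ (r \<odot>\<^bsub>L\<^esub> a) # vs) = i r \<odot>\<^bsub>W\<^esub> \<psi> (us @ a # vs)"
        using D(3)[of us vs r a] Cons.prems by simp
      have "\<pi> u \<odot>\<^bsub>W\<^esub> (i r \<odot>\<^bsub>W\<^esub> \<psi> (us @ a # vs)) = i r \<odot>\<^bsub>W\<^esub> (\<pi> u \<odot>\<^bsub>W\<^esub> \<psi> (us @ a # vs))"
        using 3 \<pi>c[OF u] Cons.prems(4) by (metis W.R.m_comm W.smult_assoc1 i.hom_closed)
      then show ?case using 1 2 3 4 \<pi>c u Cons.prems(4)
        by (simp add: W.smult_r_distr a_minus_def W.smult_r_minus)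
    qed
  next
    fix us vs a
    assume "set us \<subseteq> carrier L" "set vs \<subseteq> carrier L" "a \<in> carrier L"
      "Suc (Suc (length us + length vs)) = Suc k"
    with assms(1) show "wedge W \<pi> \<psi> (us @ a # a # vs) = \<zero>\<^bsub>W\<^esub>"
    proof (induction us arbitrary: k \<psi>)
      case Nil
      note D = alternating_mapD[OF Nil.prems(1)]
      have 1: "wedge W \<pi> (\<lambda>ys. \<psi> (a # a # ys)) vs = \<zero>\<^bsub>W\<^esub>"
        by (rule wedge_zero) (use Nil D(4)[of "[]"] \<pi>c in auto)
      have "\<psi> (a # vs) \<in> carrier W" using D(1) Nil by auto
      then have "\<pi> a \<odot>\<^bsub>W\<^esub> \<psi> (a # vs) \<in> carrier W" using Nil \<pi>c by simp
      then show ?case using 1 by (simp add: a_minus_def W.r_neg W.a_inv_zero)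
    next
      case (Cons u us)
      then obtain k' where k: "k = Suc k'" by (cases k) auto
      note D = alternating_mapD[OF Cons.prems(1)]
      have u: "u \<in> carrier L" using Cons.prems by simp
      have 1: "wedge W \<pi> (\<lambda>ys. \<psi> (u # ys)) (us @ a # a # vs) = \<zero>\<^bsub>W\<^esub>"
        using Cons.prems k u by (intro Cons.IH[OF alt_Cons]) auto
      have 4: "\<psi> (us @ a # a # vs) = \<zero>\<^bsub>W\<^esub>" using D(4)[of us vs a] Cons.prems by simp
      show ?case using 1 4 \<pi>c u by (simp add: a_minus_def)
    qed
  qed
qed

lemma alt_wedges:
  assumes "alt k \<psi>" and "\<And>a. a < n \<Longrightarrow> semilinear_map R L i (regular_module S) (\<pi> a)"
  shows "alt (n + k) (wedges W \<pi> n \<psi>)"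
  using assms(2) by (induction n) (auto simp: assms(1) intro!: alt_wedge)

lemma wedge_annihilated:
  assumes "alt k \<psi>" "set xs \<subseteq> carrier L" "length xs = Suc k" "\<And>x. x \<in> set xs \<Longrightarrow> \<pi> x = \<zero>\<^bsub>S\<^esub>"
  shows "wedge W \<pi> \<psi> xs = \<zero>\<^bsub>W\<^esub>"
  using assms
proof (induction xs arbitrary: k \<psi>)
  case Nil then show ?case by simp
next
  case (Cons x xs)
  note D = alternating_mapD[OF Cons.prems(1)]
  have "wedge W \<pi> (\<lambda>ys. \<psi> (x # ys)) xs = \<zero>\<^bsub>W\<^esub>"
  proof (cases k)
    case (Suc k')
    then show ?thesis using Cons.prems by (intro Cons.IH[OF alt_Cons]) auto
  qed (use Cons.prems in auto)
  then show ?case using D(1)[of xs] Cons.prems by (simp add: a_minus_def)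
qed

text \<open>Triangularity suffices: the outermost functional kills every argument except its own
  \<open>p n\<close>, which comes first, so its expansion reduces to a single term. The coefficient
  of that term is a unit, and the induction removes one functional at a time.\<close>

lemma wedges_dual:
  assumes "alt (length ys) \<psi>" and \<pi>: "\<And>a. a < n \<Longrightarrow> semilinear_map R L i (regular_module S) (\<pi> a)"
    and p: "\<And>a. a < n \<Longrightarrow> p a \<in> carrier L" "\<And>a. a < n \<Longrightarrow> \<pi> a (p a) \<in> Units S"
      "\<And>a b. a < n \<Longrightarrow> b < a \<Longrightarrow> \<pi> a (p b) = \<zero>\<^bsub>S\<^esub>"
    and y: "set ys \<subseteq> carrier L" "\<And>a y. a < n \<Longrightarrow> y \<in> set ys \<Longrightarrow> \<pi> a y = \<zero>\<^bsub>S\<^esub>"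
    and z: "wedges W \<pi> n \<psi> (map p (rev [0..<n]) @ ys) = \<zero>\<^bsub>W\<^esub>"
  shows "\<psi> ys = \<zero>\<^bsub>W\<^esub>"
  using \<pi> p y z
proof (induction n)
  case 0 then show ?case by simp
next
  case (Suc n)
  let ?r = "map p (rev [0..<n]) @ ys"
  let ?\<psi> = "wedges W \<pi> n \<psi>"
  have alt: "alt (n + length ys) ?\<psi>" using alt_wedges[OF assms(1)] Suc.prems(1) by simp
  have r: "set ?r \<subseteq> carrier L" using Suc.prems by auto
  have c: "?\<psi> ?r \<in> carrier W" using r by (intro alternating_mapD(1)[OF alt]) auto
  have "wedge W (\<pi> n) (\<lambda>ys. ?\<psi> (p n # ys)) ?r = \<zero>\<^bsub>W\<^esub>"
  proof (cases "n + length ys")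
    case (Suc k')
    show ?thesis
      by (rule wedge_annihilated[OF alt_Cons[of k']]) (use Suc alt Suc.prems r in auto)
  qed auto
  then have "\<pi> n (p n) \<odot>\<^bsub>W\<^esub> ?\<psi> ?r = \<zero>\<^bsub>W\<^esub>"
    using Suc.prems(7) W.smult_closed[OF W.R.Units_closed[OF Suc.prems(3)[of n]] c]
    by (simp add: a_minus_def W.a_inv_zero)
  then have "?\<psi> ?r = \<zero>\<^bsub>W\<^esub>"
    using W.smult_unit_eq_zero[OF Suc.prems(3)[of n] c] by simp
  with Suc.prems show ?case by (intro Suc.IH) auto
qed


text \<open>Permuting the arguments, those in the image of \<open>\<phi>\<close> can be assumed to come last.\<close>

lemma alt_many_images:
  assumes alt: "alt (length xs) \<psi>" and xs: "set xs \<subseteq> carrier L"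
    and \<phi>: "\<phi> \<in> carrier L \<rightarrow> carrier L"
    and van: "\<And>\<psi> ys. alt k \<psi> \<Longrightarrow> set ys \<subseteq> carrier L \<Longrightarrow> length ys = k \<Longrightarrow> \<psi> (map \<phi> ys) = \<zero>\<^bsub>W\<^esub>"
    and k: "k \<le> length (filter (\<lambda>x. x \<in> \<phi> ` carrier L) xs)"
  shows "\<psi> xs = \<zero>\<^bsub>W\<^esub>"
proof -
  let ?P = "\<lambda>x. x \<in> \<phi> ` carrier L"
  \<comment> \<open>Exactly k arguments from the image are moved to the end; a surplus of them stays
    among the arguments that are kept fixed.\<close>
  define us where "us = filter (\<lambda>x. \<not> ?P x) xs @ drop k (filter ?P xs)"
  define vs where "vs = take k (filter ?P xs)"
  have sub: "set vs \<subseteq> \<phi> ` carrier L" unfolding vs_def using set_take_subset by fastforce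
  have "\<exists>y\<in>carrier L. \<phi> y = v" if "v \<in> set vs" for v using that sub by blast
  then obtain \<eta> where \<eta>: "\<And>v. v \<in> set vs \<Longrightarrow> \<eta> v \<in> carrier L \<and> \<phi> (\<eta> v) = v" by metis
  have vs: "vs = map \<phi> (map \<eta> vs)" using \<eta> by (simp add: map_idI)
  have m: "mset (us @ vs) = mset xs"
  proof -
    have "mset (drop k (filter ?P xs)) + mset (take k (filter ?P xs)) = mset (filter ?P xs)"
      by (metis append_take_drop_id mset_append union_commute)
    then show ?thesis
      unfolding us_def vs_def using multiset_partition[of "mset xs" ?P]
      by (simp add: mset_filter ac_simps)
  qed
  then have us: "set us \<subseteq> carrier L" using xs by (metis Un_subset_iff set_append set_mset_mset)
  have l: "length us + length vs = length xs" using m by (metis length_append size_mset)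
  have lv: "length vs = k" using k by (simp add: vs_def)
  have "alt k (\<lambda>ys. \<psi> (us @ ys))" using alt us l lv by (intro alt_append) auto
  then have "\<psi> (us @ map \<phi> (map \<eta> vs)) = \<zero>\<^bsub>W\<^esub>"
    using \<eta> lv by (intro van[of "\<lambda>ys. \<psi> (us @ ys)"]) auto
  then have "\<psi> (us @ vs) = \<zero>\<^bsub>W\<^esub>" using vs by simp
  moreover have "set (us @ vs) \<subseteq> carrier L" using m xs by (metis set_mset_mset)
  ultimately show ?thesis using alt_perm[OF alt m] l by simp
qed


text \<open>A substitute for a basis of the base change of \<open>L\<close> to \<open>S\<close>, formulated without the base
  change.\<close>

definition chart :: "nat \<Rightarrow> (nat \<Rightarrow> 'l) \<Rightarrow> (nat \<Rightarrow> 'l \<Rightarrow> 's) \<Rightarrow> bool" where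
  "chart n p \<pi> \<longleftrightarrow>
     (\<forall>k<n. p k \<in> carrier L) \<and> (\<forall>k<n. semilinear_map R L i (regular_module S) (\<pi> k)) \<and>
     (\<forall>k<n. \<pi> k (p k) \<in> Units S) \<and> (\<forall>k<n. \<forall>l<n. k \<noteq> l \<longrightarrow> \<pi> k (p l) = \<zero>\<^bsub>S\<^esub>) \<and>
     (\<forall>y\<in>carrier L. \<exists>q\<in>carrier R. i q \<in> Units S \<and> q \<odot>\<^bsub>L\<^esub> y \<in> module_span R L (p ` {..<n}))"

text \<open>Dualizing \<open>m\<close> of the at most \<open>m + k - 1\<close> generators leaves fewer than \<open>k\<close> dimensions for the
  image of \<open>\<phi>\<close>: the product of the \<open>\<pi> a\<close> with \<open>\<psi>\<close> is alternating of too large a degree.\<close>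

lemma alt_vanishes_on_image:
  assumes alt: "alt k \<psi>" and Y: "Y \<subseteq> carrier L" "finite Y" "card Y < m + k"
    and gen: "\<And>y. y \<in> carrier L \<Longrightarrow> \<exists>q\<in>carrier R. i q \<in> Units S \<and> q \<odot>\<^bsub>L\<^esub> y \<in> module_span R L Y"
    and \<pi>: "\<And>a. a < m \<Longrightarrow> semilinear_map R L i (regular_module S) (\<pi> a)"
    and p: "\<And>a. a < m \<Longrightarrow> p a \<in> carrier L" "\<And>a. a < m \<Longrightarrow> \<pi> a (p a) \<in> Units S"
      "\<And>a b. a < m \<Longrightarrow> b < m \<Longrightarrow> a \<noteq> b \<Longrightarrow> \<pi> a (p b) = \<zero>\<^bsub>S\<^esub>"
    and ys: "set ys \<subseteq> carrier L" "length ys = k" "\<And>a y. a < m \<Longrightarrow> y \<in> set ys \<Longrightarrow> \<pi> a y = \<zero>\<^bsub>S\<^esub>"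
  shows "\<psi> ys = \<zero>\<^bsub>W\<^esub>"
proof (rule wedges_dual[of ys \<psi> m \<pi> p])
  show "wedges W \<pi> m \<psi> (map p (rev [0..<m]) @ ys) = \<zero>\<^bsub>W\<^esub>"
    by (rule alt_few_generators[OF alt_wedges[OF alt \<pi>] Y gen]) (use p ys in auto)
qed (use assms in auto)

end

text \<open>The case of scalar values, in which volume forms exist.\<close>

locale ring_valued_setting = L: module R L + S: cring S
  for R :: "('r, 'x) ring_scheme" and L :: "('r, 'l) module" and S :: "'s ring" +
  fixes i :: "'r \<Rightarrow> 's"
  assumes hom: "i \<in> ring_hom R S"

lemma (in cring) regular_module_is_module: "module R (regular_module R)"
proof (rule moduleI)
  show "abelian_group (regular_module R)"
    by (rule abelian_groupI) (auto simp: regular_module_def a_ac intro: bexI[of _ "\<ominus> _"] l_neg)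
qed (auto simp: regular_module_def is_cring l_distr r_distr m_assoc)

sublocale ring_valued_setting \<subseteq> semilinear_setting R L S "regular_module S" i
proof -
  interpret W: module S "regular_module S" by (rule S.regular_module_is_module)
  show "semilinear_setting R L S (regular_module S) i" by unfold_locales (rule hom)
qed

context ring_valued_setting
begin

lemma alt_const_one: "alt 0 (\<lambda>_. \<one>\<^bsub>S\<^esub>)"
  by (rule alternating_mapI) (auto simp: regular_module_def)

text \<open>The product of the n functionals of a chart is a volume form: its value on the
  \<open>p a\<close> is a unit. If c times this form vanishes, stripping off the functionals one by
  one leaves c itself.\<close>

lemma chart_trivial:
  assumes c: "chart n p \<pi>" and "\<And>\<omega> xs. alt n \<omega> \<Longrightarrow> set xs \<subseteq> carrier L \<Longrightarrow> length xs = n \<Longrightarrow> c \<otimes>\<^bsub>S\<^esub> \<omega> xs = \<zero>\<^bsub>S\<^esub>"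
    and "c \<in> carrier S"
  shows "c = \<zero>\<^bsub>S\<^esub>"
proof -
  let ?W = "regular_module S"
  let ?\<psi> = "\<lambda>_::'l list. c"
  have z: "\<zero>\<^bsub>?W\<^esub> = \<zero>\<^bsub>S\<^esub>" by (simp add: regular_module_def)
  have a0: "alt 0 ?\<psi>" using assms(3) by (intro alternating_mapI) (auto simp: regular_module_def)
  have \<pi>: "semilinear_map R L i ?W (\<pi> a)" if "a < n" for a using c that by (simp add: chart_def)
  have \<pi>c: "\<pi> a x \<in> carrier S" if "a < n" "x \<in> carrier L" for a x
    using semilinear_mapD(1)[OF \<pi>[OF that(1)] that(2)] by (simp add: regular_module_def)
  \<comment> \<open>The expansion commutes with scalars, so starting from the form c of degree 0
    instead of one gives c times the volume form.\<close>
  have s: "wedges ?W \<pi> k ?\<psi> xs = c \<otimes>\<^bsub>S\<^esub> wedges ?W \<pi> k (\<lambda>_. \<one>\<^bsub>S\<^esub>) xs"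
    if "k \<le> n" "set xs \<subseteq> carrier L" "length xs = k" for k xs
    using that
  proof (induction k arbitrary: xs)
    case 0 then show ?case using assms(3) by simp
  next
    case (Suc k)
    have "alt k (wedges ?W \<pi> k (\<lambda>_. \<one>\<^bsub>S\<^esub>))"
      using alt_wedges[OF alt_const_one, of k \<pi>] \<pi> Suc.prems by simp
    then show ?case
      using Suc assms(3) alternating_mapD(1)
        wedge_smult[of "\<pi> k" c xs "wedges ?W \<pi> k (\<lambda>_. \<one>\<^bsub>S\<^esub>)" "wedges ?W \<pi> k ?\<psi>"] \<pi>c
      by (fastforce simp: regular_module_def)
  qed
  have pc: "set (map p (rev [0..<n])) \<subseteq> carrier L" using c by (auto simp: chart_def)
  have "wedges ?W \<pi> n ?\<psi> (map p (rev [0..<n])) = \<zero>\<^bsub>S\<^esub>"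
    using s[of n "map p (rev [0..<n])"] pc assms(2)[of "wedges ?W \<pi> n (\<lambda>_. \<one>\<^bsub>S\<^esub>)"]
      alt_wedges[OF alt_const_one \<pi>, of n] by simp
  then show ?thesis
    using wedges_dual[of "[]" ?\<psi> n \<pi> p] c a0 by (auto simp: chart_def z)
qed

text \<open>With only m < n generators every form of degree n is zero, so even the scalar one
  annihilates the volume form of the larger chart.\<close>

lemma chart_rank_unique:
  assumes "chart n p \<pi>" "chart m q \<kappa>" "m < n"
  shows "\<one>\<^bsub>S\<^esub> = \<zero>\<^bsub>S\<^esub>"
proof (rule chart_trivial[OF assms(1)])
  fix \<omega> xs assume "alt n \<omega>" "set xs \<subseteq> carrier L" "length xs = n"
  moreover have "card (q ` {..<m}) < n" using card_image_le[of "{..<m}" q] assms(3) by simp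
  ultimately have "\<omega> xs = \<zero>\<^bsub>S\<^esub>"
    using alt_few_generators[of n \<omega> "q ` {..<m}" xs] assms(2)
    by (auto simp: chart_def regular_module_def)
  then show "\<one>\<^bsub>S\<^esub> \<otimes>\<^bsub>S\<^esub> \<omega> xs = \<zero>\<^bsub>S\<^esub>" by simp
qed simp

text \<open>If forms of degree \<open>k\<close> vanish on the image of \<open>\<phi>\<close>, then in an evaluation of a form of degree
  \<open>r\<close> on elements of \<open>P\<close> and of the image, every element of \<open>P\<close> has to occur, and a relation between
  these elements modulo the image makes the value vanish.\<close>

lemma relation_coefficient_zero:
  assumes c: "chart r q \<kappa>"
    and \<phi>: "\<phi> \<in> carrier L \<rightarrow> carrier L"
    and van: "\<And>\<psi> ys. alt k \<psi> \<Longrightarrow> set ys \<subseteq> carrier L \<Longrightarrow> length ys = k \<Longrightarrow> \<psi> (map \<phi> ys) = \<zero>\<^bsub>S\<^esub>"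
    and P: "finite P" "P \<subseteq> carrier L" "card P + k \<le> Suc r"
    and gen: "\<And>y. y \<in> carrier L \<Longrightarrow>
      \<exists>u\<in>carrier R. i u \<in> Units S \<and> u \<odot>\<^bsub>L\<^esub> y \<in> module_span R L (P \<union> \<phi> ` carrier L)"
    and v: "v \<in> carrier R"
    and rel: "card P + k \<le> r \<or> (\<exists>x\<in>P. v \<odot>\<^bsub>L\<^esub> x \<in> module_span R L ((P - {x}) \<union> \<phi> ` carrier L))"
  shows "i v = \<zero>\<^bsub>S\<^esub>"
proof (rule chart_trivial[OF c])
  interpret i: ring_hom_ring R S i
    using hom L.R.ring_axioms S.ring_axioms by (intro ring_hom_ringI2)
  have z: "\<zero>\<^bsub>regular_module S\<^esub> = \<zero>\<^bsub>S\<^esub>" by (simp add: regular_module_def)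
  show "i v \<in> carrier S" using v by simp
  fix \<omega> xs assume alt: "alt r \<omega>" and xs: "set xs \<subseteq> carrier L" "length xs = r"
  let ?Q = "\<lambda>x. x \<in> \<phi> ` carrier L"
  \<comment> \<open>On generators the form \<omega> vanishes only after multiplication by i v in the
    last case below, so the reduction to generators is applied to this multiple of \<omega>.\<close>
  define \<theta> where "\<theta> xs = i v \<otimes>\<^bsub>S\<^esub> \<omega> xs" for xs
  note D = alternating_mapD[OF alt]
  have Dc: "set xs \<subseteq> carrier L \<Longrightarrow> length xs = r \<Longrightarrow> \<omega> xs \<in> carrier S" for xs
    using D(1)[of xs] by (simp add: regular_module_def)
  have \<theta>: "alt r \<theta>"
  proof (rule alternating_mapI)
    fix us vs a b
    assume *: "set us \<subseteq> carrier L" "set vs \<subseteq> carrier L" "a \<in> carrier L" "b \<in> carrier L" "Suc (length us + length vs) = r"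
    then show "\<theta> (us @ (a \<oplus>\<^bsub>L\<^esub> b) # vs) = \<theta> (us @ a # vs) \<oplus>\<^bsub>regular_module S\<^esub> \<theta> (us @ b # vs)"
      using D(2)[of us vs a b] Dc[of "us @ a # vs"] Dc[of "us @ b # vs"] v
      by (simp add: \<theta>_def regular_module_def S.r_distr)
  next
    fix us vs s a
    assume *: "set us \<subseteq> carrier L" "set vs \<subseteq> carrier L" "s \<in> carrier R" "a \<in> carrier L" "Suc (length us + length vs) = r"
    then show "\<theta> (us @ (s \<odot>\<^bsub>L\<^esub> a) # vs) = i s \<odot>\<^bsub>regular_module S\<^esub> \<theta> (us @ a # vs)"
      using D(3)[of us vs s a] Dc[of "us @ a # vs"] v
      by (simp add: \<theta>_def regular_module_def S.m_lcomm)
  next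
    fix us vs a
    assume *: "set us \<subseteq> carrier L" "set vs \<subseteq> carrier L" "a \<in> carrier L" "Suc (Suc (length us + length vs)) = r"
    then show "\<theta> (us @ a # a # vs) = \<zero>\<^bsub>regular_module S\<^esub>"
      using D(4)[of us vs a] v by (simp add: \<theta>_def regular_module_def)
  qed (use Dc v in \<open>auto simp: \<theta>_def regular_module_def\<close>)
  have many: "\<omega> xs = \<zero>\<^bsub>S\<^esub>" if "set xs \<subseteq> carrier L" "length xs = r" "k \<le> length (filter ?Q xs)" for xs
    using alt_many_images[of xs \<omega> \<phi> k] alt that \<phi> van by (simp add: z)
  have Y: "P \<union> \<phi> ` carrier L \<subseteq> carrier L" using P \<phi> by auto
  have "\<theta> xs = \<zero>\<^bsub>S\<^esub>"
  proof (rule alt_generators[OF \<theta> Y gen _ xs, unfolded z])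
    fix xs assume xs: "set xs \<subseteq> P \<union> \<phi> ` carrier L" "length xs = r"
    then have xs': "set xs \<subseteq> carrier L" using Y by blast
    let ?ps = "filter (\<lambda>x. \<not> ?Q x) xs"
    have ps: "set ?ps \<subseteq> P" using xs by auto
    have len: "length ?ps + length (filter ?Q xs) = r"
      using xs(2) sum_length_filter_compl[of ?Q xs] by simp
    have "\<omega> xs = \<zero>\<^bsub>S\<^esub> \<or> \<theta> xs = \<zero>\<^bsub>S\<^esub>"
    proof (cases "k \<le> length (filter ?Q xs) \<or> \<not> distinct xs")
      case True
      then show ?thesis using many[OF xs' xs(2)] alt_not_distinct[OF alt xs' xs(2)] by (auto simp: z)
    next
      case False
      then have d: "distinct xs" and f: "length (filter ?Q xs) < k" by auto
      have cp: "card (set ?ps) = length ?ps" using d by (intro distinct_card) simp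
      have "card (set ?ps) \<le> card P" using card_mono[OF P(1) ps] .
      \<comment> \<open>At most card P arguments come from P and at most k - 1 from the image, while
        there are r of them with r + 1 at least card P + k. So equality holds throughout, and the
        arguments outside the image are exactly the elements of P.\<close>
      then have eq: "card P + k = Suc r" "length ?ps = card P" "Suc (length (filter ?Q xs)) = k"
        using cp len f P(3) by linarith+
      then have psP: "set ?ps = P" using card_subset_eq[OF P(1) ps] cp by simp
      from rel eq obtain x where x: "x \<in> P" "v \<odot>\<^bsub>L\<^esub> x \<in> module_span R L ((P - {x}) \<union> \<phi> ` carrier L)" by auto
      have xin: "x \<in> set xs" and xQ: "\<not> ?Q x" using x(1) psP by auto
      then obtain us vs where uv: "xs = us @ x # vs" by (metis split_list)
      have s: "set us \<subseteq> carrier L" "set vs \<subseteq> carrier L" "x \<in> carrier L" using xs' uv by auto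
      have l: "Suc (length us + length vs) = r" using xs(2) uv by simp
      \<comment> \<open>Another element of P in the place of x repeats an argument, and an element
        of the image there raises the number of image arguments to k. Hence the whole span of these
        elements lies in Z, and with it the v-multiple of x.\<close>
      define Z where "Z = {y \<in> carrier L. \<omega> (us @ y # vs) = \<zero>\<^bsub>S\<^esub>}"
      have "submodule Z R L"
      proof (rule L.submoduleI)
        show "\<zero>\<^bsub>L\<^esub> \<in> Z" using alt_zero_entry[OF alt s(1,2) l] by (simp add: Z_def z)
        show "a \<oplus>\<^bsub>L\<^esub> b \<in> Z" if "a \<in> Z" "b \<in> Z" for a b
          using that D(2)[of us vs a b] s l by (simp add: Z_def regular_module_def)
        show *: "a \<odot>\<^bsub>L\<^esub> x \<in> Z" if "a \<in> carrier R" "x \<in> Z" for a x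
          using that D(3)[of us vs a x] s l by (simp add: Z_def regular_module_def)
        show "\<ominus>\<^bsub>L\<^esub> a \<in> Z" if "a \<in> Z" for a
          using *[of "\<ominus>\<^bsub>R\<^esub> \<one>\<^bsub>R\<^esub>" a] that by (simp add: L.smult_l_minus Z_def)
      qed (auto simp: Z_def)
      moreover have "(P - {x}) \<union> \<phi> ` carrier L \<subseteq> Z"
      proof
        fix y assume y: "y \<in> (P - {x}) \<union> \<phi> ` carrier L"
        have yc: "y \<in> carrier L" using y Y by auto
        have sy: "set (us @ y # vs) \<subseteq> carrier L" "length (us @ y # vs) = r" using yc s l by auto
        have "\<omega> (us @ y # vs) = \<zero>\<^bsub>S\<^esub>"
        proof (cases "?Q y")
          case True
          have "length (filter ?Q (us @ y # vs)) = Suc (length (filter ?Q xs))"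
            using True xQ uv by simp
          then show ?thesis using many[OF sy] eq by simp
        next
          case False
          then have "y \<in> set xs" "y \<noteq> x" using y psP by auto
          then have "y \<in> set us \<union> set vs" using uv by auto
          then have "\<not> distinct (us @ y # vs)" by auto
          then show ?thesis using alt_not_distinct[OF alt sy] by (simp add: z)
        qed
        then show "y \<in> Z" using yc by (simp add: Z_def)
      qed
      ultimately have "v \<odot>\<^bsub>L\<^esub> x \<in> Z" using x(2) module_span_minimal by blast
      then have "\<theta> xs = \<zero>\<^bsub>S\<^esub>"
        using D(3)[OF s(1,2) v s(3) l] uv by (simp add: Z_def \<theta>_def regular_module_def)
      then show ?thesis by simp
    qed
    then show "\<theta> xs = \<zero>\<^bsub>S\<^esub>" using v by (auto simp: \<theta>_def)
  qed
  then show "i v \<otimes>\<^bsub>S\<^esub> \<omega> xs = \<zero>\<^bsub>S\<^esub>" by (simp add: \<theta>_def)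
qed

end

section \<open>Exterior powers\<close>

lemma free_moduleD:
  assumes "u \<in> carrier (free_module R V)"
  shows "u x \<in> carrier R" and "finite {x. u x \<noteq> \<zero>\<^bsub>R\<^esub>}" and "u x \<noteq> \<zero>\<^bsub>R\<^esub> \<Longrightarrow> x \<in> V"
  using assms by (auto simp: free_module_def)

lemma (in cring) free_module_is_module: "module R (free_module R V)"
proof (rule moduleI)
  let ?M = "free_module R V"
  have f: "finite {x. u x \<oplus> v x \<noteq> \<zero>}" "{x. u x \<oplus> v x \<noteq> \<zero>} \<subseteq> V"
    if "u \<in> carrier ?M" "v \<in> carrier ?M" for u v
  proof -
    have *: "{x. u x \<oplus> v x \<noteq> \<zero>} \<subseteq> {x. u x \<noteq> \<zero>} \<union> {x. v x \<noteq> \<zero>}" by auto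
    show "finite {x. u x \<oplus> v x \<noteq> \<zero>}"
      by (rule finite_subset[OF *]) (use free_moduleD(2)[OF that(1)] free_moduleD(2)[OF that(2)] in simp)
    show "{x. u x \<oplus> v x \<noteq> \<zero>} \<subseteq> V" using * free_moduleD(3)[OF that(1)] free_moduleD(3)[OF that(2)] by auto
  qed
  have g: "finite {x. a \<otimes> u x \<noteq> \<zero>}" "{x. a \<otimes> u x \<noteq> \<zero>} \<subseteq> V"
    if "u \<in> carrier ?M" "a \<in> carrier R" for u a
  proof -
    have *: "{x. a \<otimes> u x \<noteq> \<zero>} \<subseteq> {x. u x \<noteq> \<zero>}" using that(2) by auto
    show "finite {x. a \<otimes> u x \<noteq> \<zero>}"
      by (rule finite_subset[OF * free_moduleD(2)[OF that(1)]])
    show "{x. a \<otimes> u x \<noteq> \<zero>} \<subseteq> V" using * free_moduleD(3)[OF that(1)] by auto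
  qed
  show "abelian_group ?M"
  proof (rule abelian_groupI)
    fix u v assume uv: "u \<in> carrier ?M" "v \<in> carrier ?M"
    then show "u \<oplus>\<^bsub>?M\<^esub> v \<in> carrier ?M" using f[of u v] free_moduleD(1)[OF uv(1)] free_moduleD(1)[OF uv(2)]
      by (simp add: free_module_def image_subset_iff)
  next
    fix u assume u: "u \<in> carrier ?M"
    let ?v = "\<lambda>x. (\<ominus> \<one>) \<otimes> u x"
    have "?v \<in> carrier ?M" using g[OF u, of "\<ominus> \<one>"] u by (auto simp: free_module_def)
    moreover have "?v \<oplus>\<^bsub>?M\<^esub> u = \<zero>\<^bsub>?M\<^esub>"
      using free_moduleD(1)[OF u] by (auto simp: free_module_def l_minus l_neg)
    ultimately show "\<exists>v\<in>carrier ?M. v \<oplus>\<^bsub>?M\<^esub> u = \<zero>\<^bsub>?M\<^esub>" by blast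
  qed (auto simp: free_module_def fun_eq_iff image_subset_iff a_ac)
  show "\<And>a x. a \<in> carrier R \<Longrightarrow> x \<in> carrier ?M \<Longrightarrow> a \<odot>\<^bsub>?M\<^esub> x \<in> carrier ?M"
    using g by (auto simp: free_module_def)
qed (auto simp: free_module_def fun_eq_iff image_subset_iff l_distr r_distr m_assoc is_cring)

lemma (in cring) free_generator_closed:
  assumes "x \<in> V"
  shows "free_generator R x \<in> carrier (free_module R V)"
proof -
  have "{y. free_generator R x y \<noteq> \<zero>} \<subseteq> {x}" by (auto simp: free_generator_def)
  then show ?thesis
    using assms finite_subset by (fastforce simp: free_module_def free_generator_def image_subset_iff)
qed

text \<open>The universal property of the free module, along a change of rings.\<close>

lemma free_module_semilinear_extension:
  assumes "cring R" "module S W" "i \<in> ring_hom R S" and \<psi>: "\<And>x. x \<in> V \<Longrightarrow> \<psi> x \<in> carrier W"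
  obtains \<Psi> where "semilinear_map R (free_module R V) i W \<Psi>"
    and "\<And>x. x \<in> V \<Longrightarrow> \<Psi> (free_generator R x) = \<psi> x"
proof
  interpret R: cring R by fact
  interpret W: module S W by fact
  interpret i: ring_hom_ring R S i
    using assms(3) R.ring_axioms W.R.ring_axioms by (intro ring_hom_ringI2)
  let ?M = "free_module R V"
  define \<Psi> where "\<Psi> u = (\<Oplus>\<^bsub>W\<^esub>x\<in>{x. u x \<noteq> \<zero>\<^bsub>R\<^esub>}. i (u x) \<odot>\<^bsub>W\<^esub> \<psi> x)" for u
  \<comment> \<open>The sum may be taken over any finite set that contains the support, which
    provides a common index set for u, v and their sum.\<close>
  have \<Psi>: "\<Psi> u = (\<Oplus>\<^bsub>W\<^esub>x\<in>A. i (u x) \<odot>\<^bsub>W\<^esub> \<psi> x)"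
    if u: "u \<in> carrier ?M" and A: "finite A" "{x. u x \<noteq> \<zero>\<^bsub>R\<^esub>} \<subseteq> A" "A \<subseteq> V" for u A
    unfolding \<Psi>_def
    by (rule W.add.finprod_mono_neutral_cong_left) (use free_moduleD[OF u] A \<psi> in auto)
  show "semilinear_map R ?M i W \<Psi>"
  proof (rule semilinear_mapI)
    fix u assume u: "u \<in> carrier ?M"
    show "\<Psi> u \<in> carrier W" unfolding \<Psi>_def
      using free_moduleD[OF u] \<psi> by (intro W.finsum_closed) auto
    fix r assume r: "r \<in> carrier R"
    let ?A = "{x. u x \<noteq> \<zero>\<^bsub>R\<^esub>}"
    interpret M: module R ?M by (rule R.free_module_is_module)
    have ru: "r \<odot>\<^bsub>?M\<^esub> u \<in> carrier ?M" using r u by simp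
    have A: "finite ?A" "?A \<subseteq> V" using free_moduleD[OF u] by auto
    have "\<Psi> (r \<odot>\<^bsub>?M\<^esub> u) = (\<Oplus>\<^bsub>W\<^esub>x\<in>?A. i ((r \<odot>\<^bsub>?M\<^esub> u) x) \<odot>\<^bsub>W\<^esub> \<psi> x)"
      using A ru r by (intro \<Psi>) (auto simp: free_module_def)
    also have "\<dots> = (\<Oplus>\<^bsub>W\<^esub>x\<in>?A. i r \<odot>\<^bsub>W\<^esub> (i (u x) \<odot>\<^bsub>W\<^esub> \<psi> x))"
      using free_moduleD[OF u] r \<psi>
      by (intro W.add.finprod_cong') (auto simp: free_module_def W.smult_assoc1)
    also have "\<dots> = i r \<odot>\<^bsub>W\<^esub> \<Psi> u" unfolding \<Psi>_def
      using A r \<psi> free_moduleD[OF u] by (intro W.finsum_smult_ldistr[symmetric]) auto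
    finally show "\<Psi> (r \<odot>\<^bsub>?M\<^esub> u) = i r \<odot>\<^bsub>W\<^esub> \<Psi> u" .
  next
    fix u v assume u: "u \<in> carrier ?M" and v: "v \<in> carrier ?M"
    interpret M: module R ?M by (rule R.free_module_is_module)
    have add: "(u \<oplus>\<^bsub>?M\<^esub> v) x = u x \<oplus>\<^bsub>R\<^esub> v x" for x by (simp add: free_module_def)
    let ?A = "{x. u x \<noteq> \<zero>\<^bsub>R\<^esub>} \<union> {x. v x \<noteq> \<zero>\<^bsub>R\<^esub>}"
    have sub: "{x. (u \<oplus>\<^bsub>?M\<^esub> v) x \<noteq> \<zero>\<^bsub>R\<^esub>} \<subseteq> ?A" by (auto simp: add)
    have A: "finite ?A" "?A \<subseteq> V" using free_moduleD[OF u] free_moduleD[OF v] by auto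
    have "\<Psi> (u \<oplus>\<^bsub>?M\<^esub> v) = (\<Oplus>\<^bsub>W\<^esub>x\<in>?A. i ((u \<oplus>\<^bsub>?M\<^esub> v) x) \<odot>\<^bsub>W\<^esub> \<psi> x)"
      using M.a_closed[OF u v] A(1) sub A(2) by (rule \<Psi>)
    also have "\<dots> = (\<Oplus>\<^bsub>W\<^esub>x\<in>?A. i (u x) \<odot>\<^bsub>W\<^esub> \<psi> x \<oplus>\<^bsub>W\<^esub> i (v x) \<odot>\<^bsub>W\<^esub> \<psi> x)"
      using free_moduleD[OF u] free_moduleD[OF v] \<psi>
      by (intro W.add.finprod_cong') (auto simp: free_module_def W.smult_l_distr)
    also have "\<dots> = (\<Oplus>\<^bsub>W\<^esub>x\<in>?A. i (u x) \<odot>\<^bsub>W\<^esub> \<psi> x) \<oplus>\<^bsub>W\<^esub> (\<Oplus>\<^bsub>W\<^esub>x\<in>?A. i (v x) \<odot>\<^bsub>W\<^esub> \<psi> x)"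
      using A \<psi> free_moduleD[OF u] free_moduleD[OF v] by (intro W.finsum_addf) auto
    also have "\<dots> = \<Psi> u \<oplus>\<^bsub>W\<^esub> \<Psi> v" using \<Psi>[OF u A(1) _ A(2)] \<Psi>[OF v A(1) _ A(2)] by simp
    finally show "\<Psi> (u \<oplus>\<^bsub>?M\<^esub> v) = \<Psi> u \<oplus>\<^bsub>W\<^esub> \<Psi> v" .
  qed
  fix x assume x: "x \<in> V"
  \<comment> \<open>Over the zero ring the generator has empty support; summing over
    \<open>{x}\<close> covers this case too.\<close>
  have "\<Psi> (free_generator R x) = (\<Oplus>\<^bsub>W\<^esub>y\<in>{x}. i (free_generator R x y) \<odot>\<^bsub>W\<^esub> \<psi> y)"
    using x R.free_generator_closed by (intro \<Psi>) (auto simp: free_generator_def)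
  also have "\<dots> = \<psi> x" using \<psi>[OF x] by (simp add: free_generator_def)
  finally show "\<Psi> (free_generator R x) = \<psi> x" .
qed

lemma semilinear_map_zero:
  assumes "module R L" "module S W" "semilinear_map R L i W \<pi>"
  shows "\<pi> \<zero>\<^bsub>L\<^esub> = \<zero>\<^bsub>W\<^esub>"
proof -
  interpret L: module R L by fact
  interpret W: module S W by fact
  have "\<pi> \<zero>\<^bsub>L\<^esub> \<oplus>\<^bsub>W\<^esub> \<pi> \<zero>\<^bsub>L\<^esub> = \<pi> \<zero>\<^bsub>L\<^esub>"
    using semilinear_mapD(2)[OF assms(3), of "\<zero>\<^bsub>L\<^esub>" "\<zero>\<^bsub>L\<^esub>"] by simp
  then show ?thesis using semilinear_mapD(1)[OF assms(3), of "\<zero>\<^bsub>L\<^esub>"] by simp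
qed

lemma semilinear_map_minus:
  assumes "module R L" "module S W" "semilinear_map R L i W \<pi>" "x \<in> carrier L" "y \<in> carrier L"
  shows "\<pi> (x \<ominus>\<^bsub>L\<^esub> y) = \<pi> x \<ominus>\<^bsub>W\<^esub> \<pi> y"
proof -
  interpret L: module R L by fact
  interpret W: module S W by fact
  note D = semilinear_mapD[OF assms(3)]
  have "\<pi> (\<ominus>\<^bsub>L\<^esub> y) \<oplus>\<^bsub>W\<^esub> \<pi> y = \<zero>\<^bsub>W\<^esub>"
    using D(2)[of "\<ominus>\<^bsub>L\<^esub> y" y] assms semilinear_map_zero[OF assms(1-3)] by (simp add: L.l_neg)
  then have "\<pi> (\<ominus>\<^bsub>L\<^esub> y) = \<ominus>\<^bsub>W\<^esub> \<pi> y" using D(1) assms by (metis L.a_inv_closed W.minus_equality)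
  then show ?thesis using D(2)[of x "\<ominus>\<^bsub>L\<^esub> y"] assms by (simp add: a_minus_def)
qed

lemma semilinear_map_kernel:
  assumes "module R L" "module S W" "i \<in> ring_hom R S" "semilinear_map R L i W \<pi>"
  shows "submodule {x \<in> carrier L. \<pi> x = \<zero>\<^bsub>W\<^esub>} R L"
proof -
  interpret L: module R L by fact
  interpret W: module S W by fact
  interpret i: ring_hom_ring R S i
    using assms(3) L.R.ring_axioms W.R.ring_axioms by (intro ring_hom_ringI2)
  note D = semilinear_mapD[OF assms(4)]
  have "\<pi> (\<ominus>\<^bsub>L\<^esub> y) = \<zero>\<^bsub>W\<^esub>" if "y \<in> carrier L" "\<pi> y = \<zero>\<^bsub>W\<^esub>" for y
    using D(2)[of "\<ominus>\<^bsub>L\<^esub> y" y] D(1)[of "\<ominus>\<^bsub>L\<^esub> y"] that semilinear_map_zero[OF assms(1,2,4)] by (simp add: L.l_neg)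
  then show ?thesis
    using D semilinear_map_zero[OF assms(1,2,4)] by (intro L.submoduleI) auto
qed

section \<open>Quotient modules\<close>

context
  fixes R :: "('r, 'x) ring_scheme" and M :: "('r, 'm) module" and N
  assumes M: "module R M" and N: "submodule N R M"
begin

interpretation M: module R M by (rule M)

interpretation N: abelian_subgroup N M
  using submodule.axioms(1)[OF N]
  by (intro abelian_subgroupI3 additive_subgroup.intro M.abelian_group_axioms)

lemma quotient_module_carrier:
  "carrier (quotient_module M N) = (\<lambda>x. N +>\<^bsub>M\<^esub> x) ` carrier M"
  by (auto simp: quotient_module_def A_RCOSETS_def')

lemma quotient_module_add:
  assumes "x \<in> carrier M" "y \<in> carrier M"
  shows "(N +>\<^bsub>M\<^esub> x) \<oplus>\<^bsub>quotient_module M N\<^esub> (N +>\<^bsub>M\<^esub> y) = N +>\<^bsub>M\<^esub> (x \<oplus>\<^bsub>M\<^esub> y)"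
  using N.a_rcos_sum[OF assms] by (simp add: quotient_module_def)

lemma quotient_module_smult:
  assumes "x \<in> carrier M" "r \<in> carrier R"
  shows "r \<odot>\<^bsub>quotient_module M N\<^esub> (N +>\<^bsub>M\<^esub> x) = N +>\<^bsub>M\<^esub> (r \<odot>\<^bsub>M\<^esub> x)"
proof -
  have "N +>\<^bsub>M\<^esub> (r \<odot>\<^bsub>M\<^esub> x') = N +>\<^bsub>M\<^esub> (r \<odot>\<^bsub>M\<^esub> x)" if x': "x' \<in> N +>\<^bsub>M\<^esub> x" for x'
  proof -
    obtain n where n: "n \<in> N" "x' = n \<oplus>\<^bsub>M\<^esub> x" using x' by (auto simp: a_r_coset_def')
    have "r \<odot>\<^bsub>M\<^esub> x' = r \<odot>\<^bsub>M\<^esub> n \<oplus>\<^bsub>M\<^esub> r \<odot>\<^bsub>M\<^esub> x" using n assms N.a_subset by (auto simp: M.smult_r_distr)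
    moreover have "r \<odot>\<^bsub>M\<^esub> n \<in> N" using n assms N by (simp add: M.submoduleE(4))
    ultimately have "r \<odot>\<^bsub>M\<^esub> x' \<in> N +>\<^bsub>M\<^esub> (r \<odot>\<^bsub>M\<^esub> x)" by (auto simp: a_r_coset_def')
    then show ?thesis
      using M.a_repr_independence[OF _ M.smult_closed[OF assms(2,1)] submodule.axioms(1)[OF N]] by simp
  qed
  moreover have "x \<in> N +>\<^bsub>M\<^esub> x" using assms N.a_rcos_self by simp
  ultimately have "(\<Union>x'\<in>N +>\<^bsub>M\<^esub> x. N +>\<^bsub>M\<^esub> (r \<odot>\<^bsub>M\<^esub> x')) = N +>\<^bsub>M\<^esub> (r \<odot>\<^bsub>M\<^esub> x)"
    by (intro UN_constant_eq ballI)
  then show ?thesis by (simp add: quotient_module_def)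
qed

lemma quotient_module_eq_zero:
  assumes "x \<in> carrier M"
  shows "N +>\<^bsub>M\<^esub> x = \<zero>\<^bsub>quotient_module M N\<^esub> \<longleftrightarrow> x \<in> N"
  using assms N.a_rcos_self[of x] N.a_rcos_const[of x] by (auto simp: quotient_module_def)

lemma quotient_module_is_module: "module R (quotient_module M N)"
proof (rule moduleI)
  let ?Q = "quotient_module M N"
  have z: "\<zero>\<^bsub>?Q\<^esub> = N +>\<^bsub>M\<^esub> \<zero>\<^bsub>M\<^esub>"
    using quotient_module_eq_zero[of "\<zero>\<^bsub>M\<^esub>"] by simp
  show "abelian_group ?Q"
  proof (rule abelian_groupI)
    fix V assume "V \<in> carrier ?Q"
    then obtain x where x: "x \<in> carrier M" "V = N +>\<^bsub>M\<^esub> x" by (auto simp: quotient_module_carrier)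
    then have "N +>\<^bsub>M\<^esub> (\<ominus>\<^bsub>M\<^esub> x) \<in> carrier ?Q" by (auto simp: quotient_module_carrier)
    moreover have "(N +>\<^bsub>M\<^esub> (\<ominus>\<^bsub>M\<^esub> x)) \<oplus>\<^bsub>?Q\<^esub> V = \<zero>\<^bsub>?Q\<^esub>"
      using x by (simp add: z quotient_module_add M.l_neg del: M.a_coset_add_zero)
    ultimately show "\<exists>y\<in>carrier ?Q. y \<oplus>\<^bsub>?Q\<^esub> V = \<zero>\<^bsub>?Q\<^esub>" by blast
  qed (auto simp: quotient_module_carrier quotient_module_add z M.a_ac simp del: M.a_coset_add_zero)
qed (auto simp: quotient_module_carrier quotient_module_add quotient_module_smult
       M.smult_l_distr M.smult_r_distr M.smult_assoc1 M.R.is_cring)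

end

text \<open>The relations of the exterior power are written with list updates, alternating maps with
  a distinguished place between two lists; these facts translate between the two.\<close>

lemma tuples_update:
  assumes "xs \<in> tuples L k" "i < k" "a \<in> carrier L"
  shows "xs[i := a] \<in> tuples L k"
    and "xs[i := a] = take i xs @ a # drop (Suc i) xs"
    and "set (take i xs) \<subseteq> carrier L" "set (drop (Suc i) xs) \<subseteq> carrier L"
    and "Suc (length (take i xs) + length (drop (Suc i) xs)) = k"
  using assms by (auto simp: tuples_def upd_conv_take_nth_drop dest: in_set_takeD in_set_dropD
      intro: set_update_subsetI[THEN subsetD])

text \<open>The interface through which the relations are used from here on; the last fact is the
  minimality of their span.\<close>

lemma free_generator_exterior_relation:
  fixes k :: nat
  assumes L: "module R L"
  defines "T \<equiv> free_module R (tuples L k)" and "N \<equiv> exterior_relations R L k"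
  shows "submodule N R T"
    and "xs \<in> tuples L k \<Longrightarrow> i < k \<Longrightarrow> a \<in> carrier L \<Longrightarrow> b \<in> carrier L \<Longrightarrow>
      free_generator R (xs[i := a \<oplus>\<^bsub>L\<^esub> b]) \<ominus>\<^bsub>T\<^esub>
        (free_generator R (xs[i := a]) \<oplus>\<^bsub>T\<^esub> free_generator R (xs[i := b])) \<in> N"
    and "xs \<in> tuples L k \<Longrightarrow> i < k \<Longrightarrow> r \<in> carrier R \<Longrightarrow> a \<in> carrier L \<Longrightarrow>
      free_generator R (xs[i := r \<odot>\<^bsub>L\<^esub> a]) \<ominus>\<^bsub>T\<^esub> r \<odot>\<^bsub>T\<^esub> free_generator R (xs[i := a]) \<in> N"
    and "xs \<in> tuples L k \<Longrightarrow> i < j \<Longrightarrow> j < k \<Longrightarrow> xs ! i = xs ! j \<Longrightarrow> free_generator R xs \<in> N"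
    and "\<And>N'. submodule N' R T \<Longrightarrow>
      (\<And>xs i a b. xs \<in> tuples L k \<Longrightarrow> i < k \<Longrightarrow> a \<in> carrier L \<Longrightarrow> b \<in> carrier L \<Longrightarrow>
        free_generator R (xs[i := a \<oplus>\<^bsub>L\<^esub> b]) \<ominus>\<^bsub>T\<^esub>
        (free_generator R (xs[i := a]) \<oplus>\<^bsub>T\<^esub> free_generator R (xs[i := b])) \<in> N') \<Longrightarrow>
      (\<And>xs i r a. xs \<in> tuples L k \<Longrightarrow> i < k \<Longrightarrow> r \<in> carrier R \<Longrightarrow> a \<in> carrier L \<Longrightarrow>
        free_generator R (xs[i := r \<odot>\<^bsub>L\<^esub> a]) \<ominus>\<^bsub>T\<^esub> r \<odot>\<^bsub>T\<^esub> free_generator R (xs[i := a]) \<in> N') \<Longrightarrow>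
      (\<And>xs i j. xs \<in> tuples L k \<Longrightarrow> i < j \<Longrightarrow> j < k \<Longrightarrow> xs ! i = xs ! j \<Longrightarrow> free_generator R xs \<in> N') \<Longrightarrow>
      N \<subseteq> N'"
proof -
  interpret L: module R L by fact
  interpret T: module R T unfolding T_def by (rule L.R.free_module_is_module)
  let ?G = "free_generator R"
  define Y where "Y =
        {?G (xs[i := a \<oplus>\<^bsub>L\<^esub> b]) \<ominus>\<^bsub>T\<^esub> (?G (xs[i := a]) \<oplus>\<^bsub>T\<^esub> ?G (xs[i := b])) | xs i a b.
            xs \<in> tuples L k \<and> i < k \<and> a \<in> carrier L \<and> b \<in> carrier L} \<union>
         {?G (xs[i := r \<odot>\<^bsub>L\<^esub> a]) \<ominus>\<^bsub>T\<^esub> r \<odot>\<^bsub>T\<^esub> ?G (xs[i := a]) | xs i r a.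
            xs \<in> tuples L k \<and> i < k \<and> r \<in> carrier R \<and> a \<in> carrier L} \<union>
         {?G xs | xs. xs \<in> tuples L k \<and> (\<exists>i j. i < j \<and> j < k \<and> xs ! i = xs ! j)}"
  have N: "N = module_span R T Y"
    unfolding N_def exterior_relations_def T_def Y_def Let_def by simp
  have G: "?G xs \<in> carrier T" if "xs \<in> tuples L k" for xs
    using L.R.free_generator_closed[OF that] by (simp add: T_def)
  have "?G (xs[i := a]) \<in> carrier T" if "xs \<in> tuples L k" "i < k" "a \<in> carrier L" for xs i a
    using that by (intro G tuples_update)
  then have "Y \<subseteq> carrier T" unfolding Y_def using G by (auto intro!: T.minus_closed T.a_closed T.smult_closed)
  note S = module_span_submodule[OF T.module_axioms this]
  show "submodule N R T" unfolding N by (rule S(1))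
  show "xs \<in> tuples L k \<Longrightarrow> i < k \<Longrightarrow> a \<in> carrier L \<Longrightarrow> b \<in> carrier L \<Longrightarrow>
      ?G (xs[i := a \<oplus>\<^bsub>L\<^esub> b]) \<ominus>\<^bsub>T\<^esub> (?G (xs[i := a]) \<oplus>\<^bsub>T\<^esub> ?G (xs[i := b])) \<in> N"
    unfolding N using S(2) unfolding Y_def by blast
  show "xs \<in> tuples L k \<Longrightarrow> i < k \<Longrightarrow> r \<in> carrier R \<Longrightarrow> a \<in> carrier L \<Longrightarrow>
      ?G (xs[i := r \<odot>\<^bsub>L\<^esub> a]) \<ominus>\<^bsub>T\<^esub> r \<odot>\<^bsub>T\<^esub> ?G (xs[i := a]) \<in> N"
    unfolding N using S(2) unfolding Y_def by blast
  show "xs \<in> tuples L k \<Longrightarrow> i < j \<Longrightarrow> j < k \<Longrightarrow> xs ! i = xs ! j \<Longrightarrow> ?G xs \<in> N"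
    unfolding N using S(2) unfolding Y_def by blast
  fix N'
  assume *: "submodule N' R T"
      "\<And>xs i a b. xs \<in> tuples L k \<Longrightarrow> i < k \<Longrightarrow> a \<in> carrier L \<Longrightarrow> b \<in> carrier L \<Longrightarrow>
        ?G (xs[i := a \<oplus>\<^bsub>L\<^esub> b]) \<ominus>\<^bsub>T\<^esub> (?G (xs[i := a]) \<oplus>\<^bsub>T\<^esub> ?G (xs[i := b])) \<in> N'"
      "\<And>xs i r a. xs \<in> tuples L k \<Longrightarrow> i < k \<Longrightarrow> r \<in> carrier R \<Longrightarrow> a \<in> carrier L \<Longrightarrow>
        ?G (xs[i := r \<odot>\<^bsub>L\<^esub> a]) \<ominus>\<^bsub>T\<^esub> r \<odot>\<^bsub>T\<^esub> ?G (xs[i := a]) \<in> N'"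
      "\<And>xs i j. xs \<in> tuples L k \<Longrightarrow> i < j \<Longrightarrow> j < k \<Longrightarrow> xs ! i = xs ! j \<Longrightarrow> ?G xs \<in> N'"
  have "Y \<subseteq> N'" unfolding Y_def using *(2-4) by auto
  then show "N \<subseteq> N'" unfolding N using *(1) by (rule module_span_minimal[rotated])
qed

text \<open>The form extends to the free module, and the kernel of the extension contains the
  defining relations. In this shape, information on the exterior power is turned into vanishing of
  forms without constructing a map out of the quotient.\<close>

lemma alternating_map_kills_relations:
  assumes L: "module R L" and W: "module S W" and i: "i \<in> ring_hom R S"
    and alt: "alternating_map R L i W k \<psi>"
    and xs: "xs \<in> tuples L k" "free_generator R xs \<in> exterior_relations R L k"
  shows "\<psi> xs = \<zero>\<^bsub>W\<^esub>"
proof -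
  interpret semilinear_setting R L S W i
    using L W i by (simp add: semilinear_setting_def semilinear_setting_axioms_def)
  let ?G = "free_generator R" and ?T = "free_module R (tuples L k)"
  interpret T: module R ?T by (rule L.R.free_module_is_module)
  note D = alternating_mapD[OF alt]
  have Dc: "\<psi> xs \<in> carrier W" if "xs \<in> tuples L k" for xs
    using D(1) that by (auto simp: tuples_def)
  obtain \<Psi> where \<Psi>: "semilinear_map R ?T i W \<Psi>" "\<And>x. x \<in> tuples L k \<Longrightarrow> \<Psi> (?G x) = \<psi> x"
    by (rule free_module_semilinear_extension[where V = "tuples L k", OF L.R.is_cring W i Dc]) auto
  note \<Psi>D = semilinear_mapD[OF \<Psi>(1)]
  have G: "?G xs \<in> carrier ?T" if "xs \<in> tuples L k" for xs
    using L.R.free_generator_closed[OF that] .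
  have "exterior_relations R L k \<subseteq> {x \<in> carrier ?T. \<Psi> x = \<zero>\<^bsub>W\<^esub>}"
  proof (rule free_generator_exterior_relation(5)[OF L semilinear_map_kernel[OF T.module_axioms W i \<Psi>(1)]])
    fix xs j a b assume xs: "xs \<in> tuples L k" "j < k" "a \<in> carrier L" "b \<in> carrier L"
    note u = tuples_update[OF xs(1,2)]
    have c: "a \<oplus>\<^bsub>L\<^esub> b \<in> carrier L" using xs by simp
    have "\<psi> (xs[j := a \<oplus>\<^bsub>L\<^esub> b]) = \<psi> (xs[j := a]) \<oplus>\<^bsub>W\<^esub> \<psi> (xs[j := b])"
      using D(2)[OF u(3)[OF xs(3)] u(4)[OF xs(3)] xs(3,4) u(5)[OF xs(3)]] u(2) xs c by simp
    then show "?G (xs[j := a \<oplus>\<^bsub>L\<^esub> b]) \<ominus>\<^bsub>?T\<^esub> (?G (xs[j := a]) \<oplus>\<^bsub>?T\<^esub> ?G (xs[j := b]))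
        \<in> {x \<in> carrier ?T. \<Psi> x = \<zero>\<^bsub>W\<^esub>}"
      using u(1)[OF c] u(1)[OF xs(3)] u(1)[OF xs(4)] G Dc
      by (simp add: semilinear_map_minus[OF T.module_axioms W \<Psi>(1)] \<Psi>(2) \<Psi>D W.r_neg a_minus_def[of W])
  next
    fix xs j r a assume xs: "xs \<in> tuples L k" "j < k" "r \<in> carrier R" "a \<in> carrier L"
    note u = tuples_update[OF xs(1,2)]
    have c: "r \<odot>\<^bsub>L\<^esub> a \<in> carrier L" using xs by simp
    have ir: "i r \<in> carrier S" using i xs by (simp add: ring_hom_closed)
    have "\<psi> (xs[j := r \<odot>\<^bsub>L\<^esub> a]) = i r \<odot>\<^bsub>W\<^esub> \<psi> (xs[j := a])"
      using D(3)[OF u(3)[OF xs(4)] u(4)[OF xs(4)] xs(3,4) u(5)[OF xs(4)]] u(2) xs c by simp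
    then show "?G (xs[j := r \<odot>\<^bsub>L\<^esub> a]) \<ominus>\<^bsub>?T\<^esub> r \<odot>\<^bsub>?T\<^esub> ?G (xs[j := a])
        \<in> {x \<in> carrier ?T. \<Psi> x = \<zero>\<^bsub>W\<^esub>}"
      using u(1)[OF c] u(1)[OF xs(4)] G Dc xs ir
      by (simp add: semilinear_map_minus[OF T.module_axioms W \<Psi>(1)] \<Psi>(2) \<Psi>D W.r_neg a_minus_def[of W])
  next
    fix xs i' j assume *: "xs \<in> tuples L k" "i' < j" "j < k" "xs ! i' = xs ! j"
    then have "\<not> distinct xs" using nth_eq_iff_index_eq[of xs i' j] by (auto simp: tuples_def)
    then show "?G xs \<in> {x \<in> carrier ?T. \<Psi> x = \<zero>\<^bsub>W\<^esub>}"
      using * G \<Psi>(2) alt_not_distinct[OF alt] by (auto simp: tuples_def)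
  qed
  then have "\<Psi> (?G xs) = \<zero>\<^bsub>W\<^esub>" using xs(2) by blast
  then show ?thesis using \<Psi>(2)[OF xs(1)] by simp
qed

text \<open>The universal form. Inserting it into the results on alternating maps yields statements
  about the exterior power itself.\<close>

lemma exterior_power_alternating:
  assumes L: "module R L"
  shows "module R (exterior_power R L k)"
    and "alternating_map R L (\<lambda>r. r) (exterior_power R L k) k
      (\<lambda>xs. exterior_relations R L k +>\<^bsub>free_module R (tuples L k)\<^esub> free_generator R xs)"
proof -
  interpret L: module R L by fact
  let ?G = "free_generator R" and ?T = "free_module R (tuples L k)" and ?N = "exterior_relations R L k"
  interpret T: module R ?T by (rule L.R.free_module_is_module)
  note rel = free_generator_exterior_relation[OF L, where k = k]
  note Q = quotient_module_add[OF T.module_axioms rel(1)]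
    quotient_module_smult[OF T.module_axioms rel(1)] quotient_module_carrier[OF T.module_axioms rel(1)]
    quotient_module_eq_zero[OF T.module_axioms rel(1)]
  interpret N: abelian_subgroup ?N ?T
    using submodule.axioms(1)[OF rel(1)]
    by (intro abelian_subgroupI3 additive_subgroup.intro T.abelian_group_axioms)
  show "module R (exterior_power R L k)"
    unfolding exterior_power_def by (rule quotient_module_is_module[OF T.module_axioms rel(1)])
  have G: "?G xs \<in> carrier ?T" if "xs \<in> tuples L k" for xs
    using L.R.free_generator_closed[OF that] .
  have eq: "?N +>\<^bsub>?T\<^esub> u = ?N +>\<^bsub>?T\<^esub> v" if *: "u \<ominus>\<^bsub>?T\<^esub> v \<in> ?N" "u \<in> carrier ?T" "v \<in> carrier ?T" for u v
  proof -
    have "u = (u \<ominus>\<^bsub>?T\<^esub> v) \<oplus>\<^bsub>?T\<^esub> v" using * by (simp add: a_minus_def T.a_assoc T.l_neg)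
    then have "u \<in> ?N +>\<^bsub>?T\<^esub> v" using *(1) by (auto simp: a_r_coset_def')
    then show ?thesis using T.a_repr_independence[OF _ *(3) submodule.axioms(1)[OF rel(1)]] by simp
  qed
  have tup: "us @ x # vs \<in> tuples L k"
    if "set us \<subseteq> carrier L" "set vs \<subseteq> carrier L" "x \<in> carrier L" "Suc (length us + length vs) = k" for us vs x
    using that by (auto simp: tuples_def)
  show "alternating_map R L (\<lambda>r. r) (exterior_power R L k) k (\<lambda>xs. ?N +>\<^bsub>?T\<^esub> ?G xs)"
  proof (rule alternating_mapI)
    fix xs assume "set xs \<subseteq> carrier L" "length xs = k"
    then have "xs \<in> tuples L k" by (simp add: tuples_def)
    then show "?N +>\<^bsub>?T\<^esub> ?G xs \<in> carrier (exterior_power R L k)"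
      using G by (auto simp: exterior_power_def Q)
  next
    fix us vs a b
    assume *: "set us \<subseteq> carrier L" "set vs \<subseteq> carrier L" "a \<in> carrier L" "b \<in> carrier L"
      "Suc (length us + length vs) = k"
    have "?G (us @ (a \<oplus>\<^bsub>L\<^esub> b) # vs) \<ominus>\<^bsub>?T\<^esub> (?G (us @ a # vs) \<oplus>\<^bsub>?T\<^esub> ?G (us @ b # vs)) \<in> ?N"
      using rel(2)[of "us @ a # vs" "length us" a b] * tup by simp
    then have "?N +>\<^bsub>?T\<^esub> ?G (us @ (a \<oplus>\<^bsub>L\<^esub> b) # vs) = ?N +>\<^bsub>?T\<^esub> (?G (us @ a # vs) \<oplus>\<^bsub>?T\<^esub> ?G (us @ b # vs))"
      using * tup G by (intro eq) auto
    then show "?N +>\<^bsub>?T\<^esub> ?G (us @ (a \<oplus>\<^bsub>L\<^esub> b) # vs)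
       = (?N +>\<^bsub>?T\<^esub> ?G (us @ a # vs)) \<oplus>\<^bsub>exterior_power R L k\<^esub> (?N +>\<^bsub>?T\<^esub> ?G (us @ b # vs))"
      unfolding exterior_power_def using * tup G by (simp add: Q)
  next
    fix us vs r a
    assume *: "set us \<subseteq> carrier L" "set vs \<subseteq> carrier L" "r \<in> carrier R" "a \<in> carrier L"
      "Suc (length us + length vs) = k"
    have "?G (us @ (r \<odot>\<^bsub>L\<^esub> a) # vs) \<ominus>\<^bsub>?T\<^esub> (r \<odot>\<^bsub>?T\<^esub> ?G (us @ a # vs)) \<in> ?N"
      using rel(3)[of "us @ a # vs" "length us" r a] * tup by simp
    then have "?N +>\<^bsub>?T\<^esub> ?G (us @ (r \<odot>\<^bsub>L\<^esub> a) # vs) = ?N +>\<^bsub>?T\<^esub> (r \<odot>\<^bsub>?T\<^esub> ?G (us @ a # vs))"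
      using * tup G by (intro eq) auto
    then show "?N +>\<^bsub>?T\<^esub> ?G (us @ (r \<odot>\<^bsub>L\<^esub> a) # vs)
       = r \<odot>\<^bsub>exterior_power R L k\<^esub> (?N +>\<^bsub>?T\<^esub> ?G (us @ a # vs))"
      unfolding exterior_power_def using * tup G by (simp add: Q)
  next
    fix us vs a
    assume *: "set us \<subseteq> carrier L" "set vs \<subseteq> carrier L" "a \<in> carrier L"
      "Suc (Suc (length us + length vs)) = k"
    have t: "us @ a # a # vs \<in> tuples L k" using * by (auto simp: tuples_def)
    have "?G (us @ a # a # vs) \<in> ?N"
      by (rule rel(4)[OF t, of "length us" "Suc (length us)"]) (use * in \<open>auto simp: nth_append\<close>)
    then show "?N +>\<^bsub>?T\<^esub> ?G (us @ a # a # vs) = \<zero>\<^bsub>exterior_power R L k\<^esub>"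
      unfolding exterior_power_def using t G by (simp add: Q)
  qed
qed

text \<open>The coefficients are summed over the fibres of f. Removing one point x from the support
  changes the result by u x times the generator of f x, so the result is a combination of generators
  lying in N.\<close>

lemma (in cring) pushforward_in_submodule:
  assumes N: "submodule N R (free_module R V')"
    and gen: "\<And>x. x \<in> V \<Longrightarrow> free_generator R (f x) \<in> N"
    and u: "u \<in> carrier (free_module R V)"
  shows "pushforward R f u \<in> N"
proof -
  interpret T: module R "free_module R V'" by (rule free_module_is_module)
  have "finite A \<Longrightarrow> {x. u x \<noteq> \<zero>} \<subseteq> A \<Longrightarrow> A \<subseteq> V \<Longrightarrow> range u \<subseteq> carrier R \<Longrightarrow> pushforward R f u \<in> N" for A u
  proof (induction A arbitrary: u rule: finite_induct)
    case empty
    then have "pushforward R f u = \<zero>\<^bsub>free_module R V'\<^esub>"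
      by (auto simp: pushforward_def free_module_def)
    then show ?case using T.submodule_zero[OF N] by simp
  next
    case (insert x A)
    let ?v = "u(x := \<zero>)"
    have vA: "{y. ?v y \<noteq> \<zero>} \<subseteq> A" using insert.prems by auto
    have v: "pushforward R f ?v \<in> N" using insert.prems vA by (intro insert.IH) auto
    have uc: "u y \<in> carrier R" for y using insert.prems by auto
    have "f x \<in> V' \<or> True" by simp
    have "pushforward R f u = pushforward R f ?v \<oplus>\<^bsub>free_module R V'\<^esub> u x \<odot>\<^bsub>free_module R V'\<^esub> free_generator R (f x)"
    proof
      fix y
      let ?A = "{z. ?v z \<noteq> \<zero> \<and> f z = y}"
      have fin: "finite ?A" using finite_subset[OF _ insert.hyps(1), of ?A] vA by blast
      have c: "(\<Oplus>z\<in>?A. ?v z) \<in> carrier R" using uc by (intro finsum_closed) auto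
      have e: "(\<Oplus>z\<in>?A. ?v z) = (\<Oplus>z\<in>?A. u z)" using uc by (intro finsum_cong') auto
      have "(\<Oplus>z\<in>{z. u z \<noteq> \<zero> \<and> f z = y}. u z) = (\<Oplus>z\<in>?A. ?v z) \<oplus> (if f x = y then u x else \<zero>)"
      proof (cases "f x = y \<and> u x \<noteq> \<zero>")
        case True
        then have s: "{z. u z \<noteq> \<zero> \<and> f z = y} = insert x ?A" by auto
        show ?thesis unfolding s using fin uc True e c by (simp add: a_comm Pi_def)
      next
        case False
        then have s: "{z. u z \<noteq> \<zero> \<and> f z = y} = ?A" by auto
        show ?thesis unfolding s using False e c by auto
      qed
      then show "pushforward R f u y =
        (pushforward R f ?v \<oplus>\<^bsub>free_module R V'\<^esub> u x \<odot>\<^bsub>free_module R V'\<^esub> free_generator R (f x)) y"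
        using uc by (auto simp: pushforward_def free_module_def free_generator_def)
    qed
    then show ?case using v T.submoduleE(4)[OF N uc gen] T.submoduleE(5)[OF N] insert.prems by simp
  qed
  then show ?thesis using u by (auto simp: free_module_def)
qed

lemma (in cring) pushforward_generator:
  "pushforward R f (free_generator R x) = free_generator R (f x)"
proof
  fix y
  show "pushforward R f (free_generator R x) y = free_generator R (f x) y"
  \<comment> \<open>Over the zero ring the generator has empty support, and both sides are
    zero.\<close>
  proof (cases "f x = y \<and> \<one> \<noteq> \<zero>")
    case True
    then have "{z. free_generator R x z \<noteq> \<zero> \<and> f z = y} = {x}" by (auto simp: free_generator_def)
    then show ?thesis using True by (simp add: pushforward_def free_generator_def)
  next
    case False
    then have "{z. free_generator R x z \<noteq> \<zero> \<and> f z = y} = {}" by (auto simp: free_generator_def)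
    then show ?thesis using False by (auto simp: pushforward_def free_generator_def)
  qed
qed

text \<open>The induced map is a union over all representatives of a class, so it is zero when every
  representative is sent to a relation. By linearity this is a condition on the generators.\<close>

lemma exterior_map_zero_iff:
  assumes L: "module R L" and \<phi>: "\<phi> \<in> carrier L \<rightarrow> carrier L"
  shows "(\<forall>w\<in>carrier (exterior_power R L k). exterior_map R L k \<phi> w = \<zero>\<^bsub>exterior_power R L k\<^esub>) \<longleftrightarrow>
    (\<forall>xs\<in>tuples L k. free_generator R (map \<phi> xs) \<in> exterior_relations R L k)"
proof -
  interpret L: module R L by fact
  let ?G = "free_generator R" and ?T = "free_module R (tuples L k)" and ?N = "exterior_relations R L k"
  interpret T: module R ?T by (rule L.R.free_module_is_module)
  note rel = free_generator_exterior_relation[OF L, where k = k]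
  interpret N: abelian_subgroup ?N ?T
    using submodule.axioms(1)[OF rel(1)]
    by (intro abelian_subgroupI3 additive_subgroup.intro T.abelian_group_axioms)
  have z: "\<zero>\<^bsub>exterior_power R L k\<^esub> = ?N" by (simp add: exterior_power_def quotient_module_def)
  have c: "carrier (exterior_power R L k) = (\<lambda>x. ?N +>\<^bsub>?T\<^esub> x) ` carrier ?T"
    unfolding exterior_power_def by (rule quotient_module_carrier[OF T.module_axioms rel(1)])
  have G: "?G xs \<in> carrier ?T" if "xs \<in> tuples L k" for xs
    using L.R.free_generator_closed[OF that] .
  show ?thesis
  proof (intro iffI ballI)
    fix xs assume *: "\<forall>w\<in>carrier (exterior_power R L k). exterior_map R L k \<phi> w = \<zero>\<^bsub>exterior_power R L k\<^esub>"
      and xs: "xs \<in> tuples L k"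
    have xs': "map \<phi> xs \<in> tuples L k" using xs \<phi> by (auto simp: tuples_def)
    have "exterior_map R L k \<phi> (?N +>\<^bsub>?T\<^esub> ?G xs) = ?N" using * G[OF xs] by (auto simp: c z)
    moreover have "?G xs \<in> ?N +>\<^bsub>?T\<^esub> ?G xs" using G[OF xs] N.a_rcos_self by simp
    ultimately have "?N +>\<^bsub>?T\<^esub> pushforward R (map \<phi>) (?G xs) \<subseteq> ?N" by (auto simp: exterior_map_def)
    then have "?N +>\<^bsub>?T\<^esub> ?G (map \<phi> xs) \<subseteq> ?N" by (simp add: L.R.pushforward_generator)
    then show "?G (map \<phi> xs) \<in> ?N" using N.a_rcos_self[OF G[OF xs']] by blast
  next
    fix w assume *: "\<forall>xs\<in>tuples L k. ?G (map \<phi> xs) \<in> ?N" and "w \<in> carrier (exterior_power R L k)"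
    then obtain u where u: "u \<in> carrier ?T" "w = ?N +>\<^bsub>?T\<^esub> u" by (auto simp: c)
    then have w: "u \<in> w" "w \<subseteq> carrier ?T" using N.a_rcos_self T.a_r_coset_subset_G[OF N.a_subset] by auto
    have "?N +>\<^bsub>?T\<^esub> pushforward R (map \<phi>) v = ?N" if "v \<in> w" for v
      using L.R.pushforward_in_submodule[OF rel(1), of "tuples L k" "map \<phi>" v] * that w N.a_rcos_const by blast
    then show "exterior_map R L k \<phi> w = \<zero>\<^bsub>exterior_power R L k\<^esub>"
      using w(1) by (auto simp: exterior_map_def z)
  qed
qed

section \<open>Localization\<close>

lemma regular_module_simps [simp]:
  "carrier (regular_module R) = carrier R" "\<zero>\<^bsub>regular_module R\<^esub> = \<zero>\<^bsub>R\<^esub>"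
  "x \<oplus>\<^bsub>regular_module R\<^esub> y = x \<oplus>\<^bsub>R\<^esub> y" "x \<odot>\<^bsub>regular_module R\<^esub> y = x \<otimes>\<^bsub>R\<^esub> y"
  by (simp_all add: regular_module_def)

locale localization = module R M for R :: "('r, 'x) ring_scheme" and M :: "('r, 'm) module" +
  fixes s :: 'r
  assumes s_closed [simp]: "s \<in> carrier R"
begin

definition pw :: "nat \<Rightarrow> 'm \<Rightarrow> 'm" where "pw n x = (s [^]\<^bsub>R\<^esub> n) \<odot>\<^bsub>M\<^esub> x"

lemma pw_closed [simp]: "x \<in> carrier M \<Longrightarrow> pw n x \<in> carrier M"
  by (simp add: pw_def)

lemma pw_0 [simp]: "x \<in> carrier M \<Longrightarrow> pw 0 x = x"
  by (simp add: pw_def)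

lemma pw_pw [simp]: "x \<in> carrier M \<Longrightarrow> pw a (pw b x) = pw (a + b) x"
  by (simp add: pw_def smult_assoc1[symmetric] R.nat_pow_mult)

lemma pw_add: "x \<in> carrier M \<Longrightarrow> y \<in> carrier M \<Longrightarrow> pw a (x \<oplus>\<^bsub>M\<^esub> y) = pw a x \<oplus>\<^bsub>M\<^esub> pw a y"
  by (simp add: pw_def smult_r_distr)

lemma pw_smult: "x \<in> carrier M \<Longrightarrow> r \<in> carrier R \<Longrightarrow> pw a (r \<odot>\<^bsub>M\<^esub> x) = r \<odot>\<^bsub>M\<^esub> pw a x"
  by (simp add: pw_def smult_assoc1[symmetric] R.m_comm)

lemma pw_zero [simp]: "pw a \<zero>\<^bsub>M\<^esub> = \<zero>\<^bsub>M\<^esub>"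
  by (simp add: pw_def)

abbreviation "mfrac \<equiv> fraction R M s"
abbreviation "Ms \<equiv> localized_module R M s"
abbreviation "Rs \<equiv> localized_ring R s"
abbreviation "rfrac \<equiv> fraction R (regular_module R) s"

lemma mem_frac: "(m', j) \<in> mfrac m i \<longleftrightarrow> m' \<in> carrier M \<and> (\<exists>l. pw (l + j) m = pw (l + i) m')"
  by (simp add: fraction_def pw_def)

lemma frac_self: "m \<in> carrier M \<Longrightarrow> (m, i) \<in> mfrac m i"
  by (auto simp: mem_frac)

text \<open>Equality of fractions is tested after multiplication by a power of s. For transitivity
  the two powers and the denominator in the middle are collected in one exponent.\<close>

lemma frac_trans:
  assumes "pw (l + j) m = pw (l + i) m'" "pw (l' + k) m' = pw (l' + j) m''"
    "m \<in> carrier M" "m' \<in> carrier M" "m'' \<in> carrier M"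
  shows "pw (l + l' + j + k) m = pw (l + l' + j + i) m''"
proof -
  have "pw (l' + k) (pw (l + j) m) = pw (l' + k) (pw (l + i) m')"
    and "pw (l + i) (pw (l' + k) m') = pw (l + i) (pw (l' + j) m'')" using assms(1,2) by simp_all
  then have "pw (l + l' + j + k) m = pw (l + l' + i + k) m'" "pw (l + l' + i + k) m' = pw (l + l' + j + i) m''"
    using assms(3-5) by (simp_all add: ac_simps)
  then show ?thesis by simp
qed

lemma frac_eqI:
  assumes "pw (l + j) m = pw (l + i) m'" "m \<in> carrier M" "m' \<in> carrier M"
  shows "mfrac m i = mfrac m' j"
proof (rule Set.set_eqI)
  fix x :: "'m \<times> nat" obtain m'' k where x: "x = (m'', k)" by force
  show "x \<in> mfrac m i \<longleftrightarrow> x \<in> mfrac m' j"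
  proof
    assume "x \<in> mfrac m i"
    then obtain l' where l': "m'' \<in> carrier M" "pw (l' + k) m = pw (l' + i) m''" by (auto simp: x mem_frac)
    have "pw (l + l' + i + k) m' = pw (l + l' + i + j) m''"
      by (rule frac_trans[OF assms(1)[symmetric] l'(2)]) (use assms l' in auto)
    then show "x \<in> mfrac m' j" using l' by (auto simp: x mem_frac add.assoc intro!: exI[of _ "l + l' + i"])
  next
    assume "x \<in> mfrac m' j"
    then obtain l' where l': "m'' \<in> carrier M" "pw (l' + k) m' = pw (l' + j) m''" by (auto simp: x mem_frac)
    have "pw (l + l' + j + k) m = pw (l + l' + j + i) m''"
      by (rule frac_trans[OF assms(1) l'(2)]) (use assms l' in auto)
    then show "x \<in> mfrac m i" using l' by (auto simp: x mem_frac add.assoc intro!: exI[of _ "l + l' + j"])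
  qed
qed

lemma frac_eq_iff:
  assumes "m \<in> carrier M" "m' \<in> carrier M"
  shows "mfrac m i = mfrac m' j \<longleftrightarrow> (\<exists>l. pw (l + j) m = pw (l + i) m')"
  using frac_self[OF assms(2), of j] frac_eqI[OF _ assms] mem_frac[of m' j m i] by auto

lemma frac_shift:
  assumes "m \<in> carrier M"
  shows "mfrac (pw a m) (a + i) = mfrac m i"
  using assms by (intro frac_eqI[of 0]) (auto simp: ac_simps)

lemma localized_module_carrier: "carrier Ms = {mfrac m i | m i. m \<in> carrier M}"
  by (simp add: localized_module_def)

lemma localized_moduleE:
  assumes "V \<in> carrier Ms"
  obtains m i where "m \<in> carrier M" "V = mfrac m i"
  using assms by (auto simp: localized_module_carrier)

lemma frac_closed [simp]: "m \<in> carrier M \<Longrightarrow> mfrac m i \<in> carrier Ms"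
  by (auto simp: localized_module_carrier)

lemma localized_module_zero: "\<zero>\<^bsub>Ms\<^esub> = mfrac \<zero>\<^bsub>M\<^esub> 0"
  by (simp add: localized_module_def)

lemma frac_zero: "mfrac \<zero>\<^bsub>M\<^esub> i = \<zero>\<^bsub>Ms\<^esub>"
  unfolding localized_module_zero by (rule frac_eqI[of 0]) auto

lemma frac_eq_zero_iff:
  assumes "m \<in> carrier M"
  shows "mfrac m i = \<zero>\<^bsub>Ms\<^esub> \<longleftrightarrow> (\<exists>l. pw l m = \<zero>\<^bsub>M\<^esub>)"
  using assms by (auto simp: localized_module_zero frac_eq_iff)

lemma localized_module_add:
  assumes "m \<in> carrier M" "m' \<in> carrier M"
  shows "mfrac m i \<oplus>\<^bsub>Ms\<^esub> mfrac m' j = mfrac (pw j m \<oplus>\<^bsub>M\<^esub> pw i m') (i + j)"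
proof -
  \<comment> \<open>Independence of the representatives: the definition takes a union over all of
    them, which is then a union of equal sets.\<close>
  have *: "mfrac (pw j1 m1 \<oplus>\<^bsub>M\<^esub> pw i1 m1') (i1 + j1) = mfrac (pw j m \<oplus>\<^bsub>M\<^esub> pw i m') (i + j)"
    if that1: "(m1, i1) \<in> mfrac m i" "(m1', j1) \<in> mfrac m' j" for m1 i1 m1' j1
  proof -
    obtain l where l: "m1 \<in> carrier M" "pw (l + i1) m = pw (l + i) m1" using that1 by (auto simp: mem_frac)
    obtain k where k: "m1' \<in> carrier M" "pw (k + j1) m' = pw (k + j) m1'" using that1 by (auto simp: mem_frac)
    have "pw (k + j + j1) (pw (l + i1) m) = pw (k + j + j1) (pw (l + i) m1)" using l(2) by simp
    moreover have "pw (l + i + i1) (pw (k + j1) m') = pw (l + i + i1) (pw (k + j) m1')" using k(2) by simp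
    ultimately show ?thesis
      using assms l k by (intro frac_eqI[of "l + k"]) (simp_all add: pw_add ac_simps)
  qed
  have "mfrac m i \<oplus>\<^bsub>Ms\<^esub> mfrac m' j = (\<Union>(m1, i1)\<in>mfrac m i. \<Union>(m1', j1)\<in>mfrac m' j.
      mfrac (pw j1 m1 \<oplus>\<^bsub>M\<^esub> pw i1 m1') (i1 + j1))"
    by (simp add: localized_module_def pw_def)
  also have "\<dots> = mfrac (pw j m \<oplus>\<^bsub>M\<^esub> pw i m') (i + j)"
  proof (rule UN_constant_eq[OF frac_self[OF assms(1)]], clarify)
    fix m1 i1 assume 1: "(m1, i1) \<in> mfrac m i"
    show "(\<Union>(m1', j1)\<in>mfrac m' j. mfrac (pw j1 m1 \<oplus>\<^bsub>M\<^esub> pw i1 m1') (i1 + j1))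
        = mfrac (pw j m \<oplus>\<^bsub>M\<^esub> pw i m') (i + j)"
      by (rule UN_constant_eq[OF frac_self[OF assms(2)]], clarify) (rule *[OF 1])
  qed
  finally show ?thesis .
qed

end

lemma (in cring) localization_regular:
  assumes "s \<in> carrier R" shows "localization R (regular_module R) s"
  using assms regular_module_is_module by (simp add: localization_def localization_axioms_def)

text \<open>The ring R[1/s] is encoded as the localized regular module, so this instance makes the
  results on module fractions available for its elements.\<close>

sublocale localization \<subseteq> reg: localization R "regular_module R" s
  by (rule R.localization_regular) simp

context localization
begin

lemma localized_module_smult:
  assumes "r \<in> carrier R" "m \<in> carrier M"
  shows "rfrac r i \<odot>\<^bsub>Ms\<^esub> mfrac m j = mfrac (r \<odot>\<^bsub>M\<^esub> m) (i + j)"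
proof -
  have *: "mfrac (r1 \<odot>\<^bsub>M\<^esub> m1) (i1 + j1) = mfrac (r \<odot>\<^bsub>M\<^esub> m) (i + j)"
    if that1: "(r1, i1) \<in> rfrac r i" "(m1, j1) \<in> mfrac m j" for r1 i1 m1 j1
  proof -
    obtain l where l: "r1 \<in> carrier R" "s [^]\<^bsub>R\<^esub> (l + i1) \<otimes>\<^bsub>R\<^esub> r = s [^]\<^bsub>R\<^esub> (l + i) \<otimes>\<^bsub>R\<^esub> r1"
      using that1 by (auto simp: reg.mem_frac reg.pw_def)
    obtain k where k: "m1 \<in> carrier M" "pw (k + j1) m = pw (k + j) m1" using that1 by (auto simp: mem_frac)
    have "pw (l + k + (i1 + j1)) (r \<odot>\<^bsub>M\<^esub> m) = (s [^]\<^bsub>R\<^esub> (l + i1) \<otimes>\<^bsub>R\<^esub> r) \<odot>\<^bsub>M\<^esub> pw (k + j1) m"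
      using assms by (simp add: smult_assoc1 pw_smult[symmetric] pw_def[symmetric] ac_simps)
    also have "\<dots> = (s [^]\<^bsub>R\<^esub> (l + i) \<otimes>\<^bsub>R\<^esub> r1) \<odot>\<^bsub>M\<^esub> pw (k + j) m1" using l k by simp
    also have "\<dots> = pw (l + k + (i + j)) (r1 \<odot>\<^bsub>M\<^esub> m1)"
      using l k by (simp add: smult_assoc1 pw_smult[symmetric] pw_def[symmetric] ac_simps)
    finally show ?thesis using assms l k by (intro frac_eqI[of "l + k"]) auto
  qed
  have "rfrac r i \<odot>\<^bsub>Ms\<^esub> mfrac m j = (\<Union>(r1, i1)\<in>rfrac r i. \<Union>(m1, j1)\<in>mfrac m j.
      mfrac (r1 \<odot>\<^bsub>M\<^esub> m1) (i1 + j1))"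
    by (simp add: localized_module_def)
  also have "\<dots> = mfrac (r \<odot>\<^bsub>M\<^esub> m) (i + j)"
  proof (rule UN_constant_eq[OF reg.frac_self], simp add: assms(1), clarify)
    fix r1 i1 assume 1: "(r1, i1) \<in> rfrac r i"
    show "(\<Union>(m1, j1)\<in>mfrac m j. mfrac (r1 \<odot>\<^bsub>M\<^esub> m1) (i1 + j1)) = mfrac (r \<odot>\<^bsub>M\<^esub> m) (i + j)"
      by (rule UN_constant_eq[OF frac_self[OF assms(2)]], clarify) (rule *[OF 1])
  qed
  finally show ?thesis .
qed

lemma localized_module_abelian_group: "abelian_group Ms"
proof (rule abelian_groupI)
  fix V assume "V \<in> carrier Ms"
  then obtain m i where V: "m \<in> carrier M" "V = mfrac m i" by (elim localized_moduleE)
  have "mfrac (\<ominus>\<^bsub>M\<^esub> m) i \<oplus>\<^bsub>Ms\<^esub> V = mfrac (pw i (\<ominus>\<^bsub>M\<^esub> m \<oplus>\<^bsub>M\<^esub> m)) (i + i)"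
    using V by (simp add: localized_module_add pw_add)
  then show "\<exists>y\<in>carrier Ms. y \<oplus>\<^bsub>Ms\<^esub> V = \<zero>\<^bsub>Ms\<^esub>"
    using V by (intro bexI[of _ "mfrac (\<ominus>\<^bsub>M\<^esub> m) i"]) (simp_all add: l_neg M.l_neg frac_zero)
next
  fix V W U assume "V \<in> carrier Ms" "W \<in> carrier Ms" "U \<in> carrier Ms"
  then show "V \<oplus>\<^bsub>Ms\<^esub> W \<oplus>\<^bsub>Ms\<^esub> U = V \<oplus>\<^bsub>Ms\<^esub> (W \<oplus>\<^bsub>Ms\<^esub> U)"
    by (elim localized_moduleE) (simp add: localized_module_add pw_add ac_simps M.a_ac)
next
  fix V W assume "V \<in> carrier Ms" "W \<in> carrier Ms"
  then show "V \<oplus>\<^bsub>Ms\<^esub> W = W \<oplus>\<^bsub>Ms\<^esub> V"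
    by (elim localized_moduleE) (simp add: localized_module_add ac_simps M.a_ac)
next
  fix V W assume "V \<in> carrier Ms" "W \<in> carrier Ms"
  then show "V \<oplus>\<^bsub>Ms\<^esub> W \<in> carrier Ms"
    by (elim localized_moduleE) (simp add: localized_module_add)
next
  fix V assume "V \<in> carrier Ms"
  then show "\<zero>\<^bsub>Ms\<^esub> \<oplus>\<^bsub>Ms\<^esub> V = V"
    by (elim localized_moduleE) (simp add: localized_module_add localized_module_zero)
qed (simp add: localized_module_zero)

lemma localized_ring_simps:
  "carrier Rs = carrier (localized_module R (regular_module R) s)"
  "x \<otimes>\<^bsub>Rs\<^esub> y = x \<odot>\<^bsub>localized_module R (regular_module R) s\<^esub> y" "\<one>\<^bsub>Rs\<^esub> = rfrac \<one>\<^bsub>R\<^esub> 0"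
  "\<zero>\<^bsub>Rs\<^esub> = \<zero>\<^bsub>localized_module R (regular_module R) s\<^esub>"
  "x \<oplus>\<^bsub>Rs\<^esub> y = x \<oplus>\<^bsub>localized_module R (regular_module R) s\<^esub> y"
  by (simp_all add: localized_ring_def Let_def)

lemma localized_ring_add:
  assumes "m \<in> carrier R" "m' \<in> carrier R"
  shows "rfrac m i \<oplus>\<^bsub>Rs\<^esub> rfrac m' j = rfrac (s [^]\<^bsub>R\<^esub> j \<otimes>\<^bsub>R\<^esub> m \<oplus>\<^bsub>R\<^esub> s [^]\<^bsub>R\<^esub> i \<otimes>\<^bsub>R\<^esub> m') (i + j)"
  using reg.localized_module_add[of m m' i j] assms by (simp add: localized_ring_simps reg.pw_def)

lemma rfrac_closed [simp]: "r \<in> carrier R \<Longrightarrow> rfrac r i \<in> carrier Rs"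
  by (simp add: localized_ring_simps)

lemma localized_ringE:
  assumes "V \<in> carrier Rs"
  obtains r i where "r \<in> carrier R" "V = rfrac r i"
  using assms by (auto simp: localized_ring_simps elim: reg.localized_moduleE)

end

lemma (in localization) localized_ring_mult:
  assumes "r \<in> carrier R" "r' \<in> carrier R"
  shows "rfrac r i \<otimes>\<^bsub>Rs\<^esub> rfrac r' j = rfrac (r \<otimes>\<^bsub>R\<^esub> r') (i + j)"
  using reg.localized_module_smult[of r r' i j] assms by (simp add: localized_ring_simps)

lemma (in localization) localized_ring_cring: "cring Rs"
proof (rule cringI)
  have ag: "abelian_group (localized_module R (regular_module R) s)"
    by (rule reg.localized_module_abelian_group)
  show "abelian_group Rs"
    by (rule abelian_groupI) (use abelian_group.a_inv_closed[OF ag] abelian_group.l_neg[OF ag]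
        abelian_groupE[OF ag] in \<open>auto simp: localized_ring_simps\<close>)
  show "comm_monoid Rs"
  proof (rule comm_monoidI)
    fix x y assume "x \<in> carrier Rs" "y \<in> carrier Rs"
    then show "x \<otimes>\<^bsub>Rs\<^esub> y \<in> carrier Rs"
      by (elim localized_ringE) (simp add: localized_ring_mult)
  next
    fix x y z assume "x \<in> carrier Rs" "y \<in> carrier Rs" "z \<in> carrier Rs"
    then show "x \<otimes>\<^bsub>Rs\<^esub> y \<otimes>\<^bsub>Rs\<^esub> z = x \<otimes>\<^bsub>Rs\<^esub> (y \<otimes>\<^bsub>Rs\<^esub> z)"
      by (elim localized_ringE) (simp add: localized_ring_mult R.m_assoc add.assoc)
  next
    fix x y assume "x \<in> carrier Rs" "y \<in> carrier Rs"
    then show "x \<otimes>\<^bsub>Rs\<^esub> y = y \<otimes>\<^bsub>Rs\<^esub> x"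
      by (elim localized_ringE) (simp add: localized_ring_mult R.m_comm add.commute)
  next
    fix x assume "x \<in> carrier Rs"
    then show "\<one>\<^bsub>Rs\<^esub> \<otimes>\<^bsub>Rs\<^esub> x = x"
      by (elim localized_ringE) (simp add: localized_ring_mult localized_ring_simps(3))
  qed (simp add: localized_ring_simps(3))
  fix x y z assume "x \<in> carrier Rs" "y \<in> carrier Rs" "z \<in> carrier Rs"
  then obtain a i b j c k where *: "a \<in> carrier R" "x = rfrac a i" "b \<in> carrier R" "y = rfrac b j"
    "c \<in> carrier R" "z = rfrac c k" by (auto elim!: localized_ringE)
  \<comment> \<open>The two sides come out with denominators s^(i + j + k) and s^(i + k + j + k), so
    the first is expanded by s^k. The module axioms below need the same correction.\<close>
  have "rfrac ((s [^]\<^bsub>R\<^esub> j \<otimes>\<^bsub>R\<^esub> a \<oplus>\<^bsub>R\<^esub> s [^]\<^bsub>R\<^esub> i \<otimes>\<^bsub>R\<^esub> b) \<otimes>\<^bsub>R\<^esub> c) (i + j + k) =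
    rfrac (reg.pw k ((s [^]\<^bsub>R\<^esub> j \<otimes>\<^bsub>R\<^esub> a \<oplus>\<^bsub>R\<^esub> s [^]\<^bsub>R\<^esub> i \<otimes>\<^bsub>R\<^esub> b) \<otimes>\<^bsub>R\<^esub> c)) (k + (i + j + k))"
    using * by (subst reg.frac_shift) auto
  also have "reg.pw k ((s [^]\<^bsub>R\<^esub> j \<otimes>\<^bsub>R\<^esub> a \<oplus>\<^bsub>R\<^esub> s [^]\<^bsub>R\<^esub> i \<otimes>\<^bsub>R\<^esub> b) \<otimes>\<^bsub>R\<^esub> c) =
     s [^]\<^bsub>R\<^esub> (j + k) \<otimes>\<^bsub>R\<^esub> (a \<otimes>\<^bsub>R\<^esub> c) \<oplus>\<^bsub>R\<^esub> s [^]\<^bsub>R\<^esub> (i + k) \<otimes>\<^bsub>R\<^esub> (b \<otimes>\<^bsub>R\<^esub> c)"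
    using * by (simp add: reg.pw_def R.l_distr R.r_distr R.nat_pow_mult[symmetric] R.m_ac)
  finally show "(x \<oplus>\<^bsub>Rs\<^esub> y) \<otimes>\<^bsub>Rs\<^esub> z = x \<otimes>\<^bsub>Rs\<^esub> z \<oplus>\<^bsub>Rs\<^esub> y \<otimes>\<^bsub>Rs\<^esub> z"
    using * by (simp add: localized_ring_mult localized_ring_add ac_simps)
qed

context localization
begin

lemma localized_module_is_module: "module Rs Ms"
proof (rule moduleI)
  fix V W assume V: "V \<in> carrier Rs" and W: "W \<in> carrier Ms"
  then show "V \<odot>\<^bsub>Ms\<^esub> W \<in> carrier Ms"
    by (elim localized_ringE localized_moduleE) (simp add: localized_module_smult)
next
  fix x y z assume "x \<in> carrier Rs" "y \<in> carrier Rs" "z \<in> carrier Ms"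
  then obtain a i b j c k where *: "a \<in> carrier R" "x = rfrac a i" "b \<in> carrier R" "y = rfrac b j"
    "c \<in> carrier M" "z = mfrac c k" by (auto elim!: localized_ringE localized_moduleE)
  have "mfrac ((s [^]\<^bsub>R\<^esub> j \<otimes>\<^bsub>R\<^esub> a \<oplus>\<^bsub>R\<^esub> s [^]\<^bsub>R\<^esub> i \<otimes>\<^bsub>R\<^esub> b) \<odot>\<^bsub>M\<^esub> c) (i + j + k) =
    mfrac (pw k ((s [^]\<^bsub>R\<^esub> j \<otimes>\<^bsub>R\<^esub> a \<oplus>\<^bsub>R\<^esub> s [^]\<^bsub>R\<^esub> i \<otimes>\<^bsub>R\<^esub> b) \<odot>\<^bsub>M\<^esub> c)) (k + (i + j + k))"
    using * by (subst frac_shift) auto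
  also have "pw k ((s [^]\<^bsub>R\<^esub> j \<otimes>\<^bsub>R\<^esub> a \<oplus>\<^bsub>R\<^esub> s [^]\<^bsub>R\<^esub> i \<otimes>\<^bsub>R\<^esub> b) \<odot>\<^bsub>M\<^esub> c) =
     pw (j + k) (a \<odot>\<^bsub>M\<^esub> c) \<oplus>\<^bsub>M\<^esub> pw (i + k) (b \<odot>\<^bsub>M\<^esub> c)"
    using * by (simp add: smult_l_distr smult_r_distr pw_add smult_assoc1 pw_def[symmetric] ac_simps)
  finally show "(x \<oplus>\<^bsub>Rs\<^esub> y) \<odot>\<^bsub>Ms\<^esub> z = x \<odot>\<^bsub>Ms\<^esub> z \<oplus>\<^bsub>Ms\<^esub> y \<odot>\<^bsub>Ms\<^esub> z"
    using * by (simp add: localized_module_smult localized_ring_add localized_module_add ac_simps)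
next
  fix x y z assume "x \<in> carrier Rs" "y \<in> carrier Ms" "z \<in> carrier Ms"
  then obtain a i b j c k where *: "a \<in> carrier R" "x = rfrac a i" "b \<in> carrier M" "y = mfrac b j"
    "c \<in> carrier M" "z = mfrac c k" by (auto elim!: localized_ringE localized_moduleE)
  have "mfrac (a \<odot>\<^bsub>M\<^esub> (pw k b \<oplus>\<^bsub>M\<^esub> pw j c)) (i + (j + k)) =
    mfrac (pw i (a \<odot>\<^bsub>M\<^esub> (pw k b \<oplus>\<^bsub>M\<^esub> pw j c))) (i + (i + (j + k)))"
    using * by (subst frac_shift) auto
  also have "pw i (a \<odot>\<^bsub>M\<^esub> (pw k b \<oplus>\<^bsub>M\<^esub> pw j c)) =
     pw (i + k) (a \<odot>\<^bsub>M\<^esub> b) \<oplus>\<^bsub>M\<^esub> pw (i + j) (a \<odot>\<^bsub>M\<^esub> c)"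
    using * by (simp add: smult_r_distr pw_add pw_smult)
  finally show "x \<odot>\<^bsub>Ms\<^esub> (y \<oplus>\<^bsub>Ms\<^esub> z) = x \<odot>\<^bsub>Ms\<^esub> y \<oplus>\<^bsub>Ms\<^esub> x \<odot>\<^bsub>Ms\<^esub> z"
    using * by (simp add: localized_module_smult localized_module_add ac_simps)
next
  fix x y z assume "x \<in> carrier Rs" "y \<in> carrier Rs" "z \<in> carrier Ms"
  then show "(x \<otimes>\<^bsub>Rs\<^esub> y) \<odot>\<^bsub>Ms\<^esub> z = x \<odot>\<^bsub>Ms\<^esub> (y \<odot>\<^bsub>Ms\<^esub> z)"
    by (elim localized_ringE localized_moduleE)
      (simp add: localized_module_smult localized_ring_mult smult_assoc1 add.assoc)
next
  fix z assume "z \<in> carrier Ms"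
  then show "\<one>\<^bsub>Rs\<^esub> \<odot>\<^bsub>Ms\<^esub> z = z"
    by (elim localized_moduleE) (simp add: localized_module_smult localized_ring_simps(3))
qed (rule localized_ring_cring localized_module_abelian_group)+

lemma rfrac_hom: "(\<lambda>r. rfrac r 0) \<in> ring_hom R Rs"
  by (rule ring_hom_memI) (auto simp: localized_ring_mult localized_ring_add localized_ring_simps(3))

lemma rfrac_unit: "rfrac s 0 \<in> Units Rs"
proof -
  interpret Rs: cring Rs by (rule localized_ring_cring)
  have "rfrac \<one>\<^bsub>R\<^esub> 1 \<otimes>\<^bsub>Rs\<^esub> rfrac s 0 = \<one>\<^bsub>Rs\<^esub>"
    using reg.frac_eqI[of 0 0 s 1 "\<one>\<^bsub>R\<^esub>"] by (simp add: localized_ring_simps(3) localized_ring_mult reg.pw_def)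
  moreover have "rfrac s 0 \<in> carrier Rs" "rfrac \<one>\<^bsub>R\<^esub> 1 \<in> carrier Rs" by simp_all
  ultimately show ?thesis
    using Rs.unit_factor[of "rfrac s 0" "rfrac \<one>\<^bsub>R\<^esub> 1"] Rs.Units_one_closed Rs.m_comm by simp
qed

lemma frac_semilinear: "semilinear_map R M (\<lambda>r. rfrac r 0) Ms (\<lambda>m. mfrac m 0)"
  by (rule semilinear_mapI) (auto simp: localized_module_add localized_module_smult)

text \<open>The universal property of the localization. Only the formula for the values is provided;
  additivity and linearity are read off from it where they are used.\<close>

lemma semilinear_extension_localization:
  fixes W :: "('s, 'w) module"
  assumes W: "module S W" and i: "i \<in> ring_hom R S" and u: "i s \<in> Units S"
    and \<pi>: "semilinear_map R M i W \<pi>"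
  obtains \<epsilon> where "\<And>m a. m \<in> carrier M \<Longrightarrow> \<epsilon> (mfrac m a) = (inv\<^bsub>S\<^esub> (i s) [^]\<^bsub>S\<^esub> a) \<odot>\<^bsub>W\<^esub> \<pi> m"
proof
  interpret W: module S W by fact
  interpret i: ring_hom_ring R S i
    using i R.ring_axioms W.R.ring_axioms by (intro ring_hom_ringI2)
  let ?v = "inv\<^bsub>S\<^esub> (i s)"
  have vc: "?v \<in> carrier S" "i s \<in> carrier S" using u by auto
  note D = semilinear_mapD[OF \<pi>]
  have vs: "?v [^]\<^bsub>S\<^esub> a \<otimes>\<^bsub>S\<^esub> i s [^]\<^bsub>S\<^esub> a = \<one>\<^bsub>S\<^esub>" for a :: nat
    using vc u W.R.nat_pow_distrib[of ?v "i s" a, symmetric] by (simp add: W.R.Units_l_inv)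
  \<comment> \<open>Expanding a fraction by a power of s does not change the value; two
    representatives of one fraction have a common expansion.\<close>
  have cancel: "?v [^]\<^bsub>S\<^esub> (a + b) \<odot>\<^bsub>W\<^esub> \<pi> (pw a m) = ?v [^]\<^bsub>S\<^esub> b \<odot>\<^bsub>W\<^esub> \<pi> m" if m: "m \<in> carrier M" for a b :: nat and m
  proof -
    have "\<pi> (pw a m) = i s [^]\<^bsub>S\<^esub> a \<odot>\<^bsub>W\<^esub> \<pi> m"
      using D(3)[of "s [^]\<^bsub>R\<^esub> a" m] m by (simp add: pw_def i.hom_nat_pow)
    then have "?v [^]\<^bsub>S\<^esub> (a + b) \<odot>\<^bsub>W\<^esub> \<pi> (pw a m) = (?v [^]\<^bsub>S\<^esub> (a + b) \<otimes>\<^bsub>S\<^esub> i s [^]\<^bsub>S\<^esub> a) \<odot>\<^bsub>W\<^esub> \<pi> m"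
      using vc D(1)[OF m] by (simp add: W.smult_assoc1)
    also have "?v [^]\<^bsub>S\<^esub> (a + b) \<otimes>\<^bsub>S\<^esub> i s [^]\<^bsub>S\<^esub> a = ?v [^]\<^bsub>S\<^esub> b \<otimes>\<^bsub>S\<^esub> (?v [^]\<^bsub>S\<^esub> a \<otimes>\<^bsub>S\<^esub> i s [^]\<^bsub>S\<^esub> a)"
      using vc by (simp add: W.R.nat_pow_mult[symmetric] W.R.m_ac)
    finally show ?thesis using vs vc by simp
  qed
  define \<epsilon> :: "('m \<times> nat) set \<Rightarrow> 'w" where "\<epsilon> V = (let (m, a) = SOME x. x \<in> V \<and> fst x \<in> carrier M in ?v [^]\<^bsub>S\<^esub> a \<odot>\<^bsub>W\<^esub> \<pi> m)" for V
  fix m a assume m: "m \<in> carrier M"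
  obtain m' b where e: "(SOME x. x \<in> mfrac m a \<and> fst x \<in> carrier M) = (m', b)" by force
  have "(m', b) \<in> mfrac m a"
    using someI[of "\<lambda>x. x \<in> mfrac m a \<and> fst x \<in> carrier M" "(m, a)"] frac_self[OF m] m e by simp
  then obtain l where l: "m' \<in> carrier M" "pw (l + b) m = pw (l + a) m'" by (auto simp: mem_frac)
  have "?v [^]\<^bsub>S\<^esub> a \<odot>\<^bsub>W\<^esub> \<pi> m = ?v [^]\<^bsub>S\<^esub> (l + b + a) \<odot>\<^bsub>W\<^esub> \<pi> (pw (l + b) m)" using cancel[OF m] by simp
  also have "\<dots> = ?v [^]\<^bsub>S\<^esub> b \<odot>\<^bsub>W\<^esub> \<pi> m'" using cancel[OF l(1), of "l + a" b] l(2) by (simp add: ac_simps)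
  finally show "\<epsilon> (mfrac m a) = ?v [^]\<^bsub>S\<^esub> a \<odot>\<^bsub>W\<^esub> \<pi> m" by (simp add: \<epsilon>_def e)
qed

end

text \<open>The coordinates invert the bijection between coefficient families and elements.
  Linearity and duality both follow from the uniqueness of the coefficients.\<close>

lemma free_module_coordinates:
  assumes M: "module R M" and "free_of_rank R M k"
  obtains b x where "\<And>a. a < k \<Longrightarrow> b a \<in> carrier M"
    and "\<And>a. a < k \<Longrightarrow> semilinear_map R M (\<lambda>r. r) (regular_module R) (x a)"
    and "\<And>a c. a < k \<Longrightarrow> c < k \<Longrightarrow> x a (b c) = (if a = c then \<one>\<^bsub>R\<^esub> else \<zero>\<^bsub>R\<^esub>)"
    and "\<And>y. y \<in> carrier M \<Longrightarrow> y = (\<Oplus>\<^bsub>M\<^esub>a\<in>{..<k}. x a y \<odot>\<^bsub>M\<^esub> b a)"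
proof -
  interpret M: module R M by fact
  obtain b where b: "b \<in> {..<k} \<rightarrow> carrier M"
    and bij: "bij_betw (\<lambda>c. \<Oplus>\<^bsub>M\<^esub>a\<in>{..<k}. c a \<odot>\<^bsub>M\<^esub> b a) ({..<k} \<rightarrow>\<^sub>E carrier R) (carrier M)"
    using assms(2) by (auto simp: free_of_rank_def)
  define F where "F c = (\<Oplus>\<^bsub>M\<^esub>a\<in>{..<k}. c a \<odot>\<^bsub>M\<^esub> b a)" for c
  define x where "x a y = inv_into ({..<k} \<rightarrow>\<^sub>E carrier R) F y a" for a y
  have bij': "bij_betw F ({..<k} \<rightarrow>\<^sub>E carrier R) (carrier M)" using bij by (simp add: F_def[abs_def])
  have xc: "(\<lambda>a. x a y) \<in> {..<k} \<rightarrow>\<^sub>E carrier R" and Fx: "F (\<lambda>a. x a y) = y" if "y \<in> carrier M" for y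
    using that inv_into_into[of y F "{..<k} \<rightarrow>\<^sub>E carrier R"] f_inv_into_f[of y F "{..<k} \<rightarrow>\<^sub>E carrier R"]
      bij_betw_imp_surj_on[OF bij'] by (auto simp: x_def)
  have xcl: "x a y \<in> carrier R" if "y \<in> carrier M" "a < k" for a y using xc[OF that(1)] that(2) by auto
  have uniq: "x a y = c a" if "F c = y" "c \<in> {..<k} \<rightarrow> carrier R" "a < k" for c y a
  proof -
    have c: "restrict c {..<k} \<in> {..<k} \<rightarrow>\<^sub>E carrier R" using that(2) by auto
    have "F (restrict c {..<k}) = F c" unfolding F_def
      using that(2) b by (intro M.finsum_cong') auto
    then have "inv_into ({..<k} \<rightarrow>\<^sub>E carrier R) F y = restrict c {..<k}"
      using inv_into_f_f[OF bij_betw_imp_inj_on[OF bij'] c] that(1) by simp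
    then show ?thesis using that(3) by (simp add: x_def)
  qed
  show thesis
  proof (rule that[of b x])
    show "b a \<in> carrier M" if "a < k" for a using b that by auto
    show "semilinear_map R M (\<lambda>r. r) (regular_module R) (x a)" if a: "a < k" for a
    proof (rule semilinear_mapI)
      fix y assume y: "y \<in> carrier M"
      show "x a y \<in> carrier (regular_module R)" using xcl[OF y a] by (simp add: regular_module_def)
      fix r assume r: "r \<in> carrier R"
      have "F (\<lambda>a. r \<otimes>\<^bsub>R\<^esub> x a y) = r \<odot>\<^bsub>M\<^esub> F (\<lambda>a. x a y)"
        unfolding F_def using r b xcl[OF y]
        by (subst M.finsum_smult_ldistr) (auto intro!: M.finsum_cong' simp: M.smult_assoc1 Pi_def)
      then show "x a (r \<odot>\<^bsub>M\<^esub> y) = r \<odot>\<^bsub>regular_module R\<^esub> x a y"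
        using uniq[of "\<lambda>a. r \<otimes>\<^bsub>R\<^esub> x a y" "r \<odot>\<^bsub>M\<^esub> y" a] Fx[OF y] xcl[OF y] r a by (simp add: regular_module_def)
    next
      fix y z assume y: "y \<in> carrier M" "z \<in> carrier M"
      have "F (\<lambda>a. x a y \<oplus>\<^bsub>R\<^esub> x a z) = (\<Oplus>\<^bsub>M\<^esub>a\<in>{..<k}. x a y \<odot>\<^bsub>M\<^esub> b a \<oplus>\<^bsub>M\<^esub> x a z \<odot>\<^bsub>M\<^esub> b a)"
        unfolding F_def using b xcl[OF y(1)] xcl[OF y(2)]
        by (intro M.finsum_cong') (auto simp: M.smult_l_distr Pi_def)
      also have "\<dots> = F (\<lambda>a. x a y) \<oplus>\<^bsub>M\<^esub> F (\<lambda>a. x a z)"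
        unfolding F_def using b xcl[OF y(1)] xcl[OF y(2)] by (intro M.finsum_addf) (auto simp: Pi_def)
      finally show "x a (y \<oplus>\<^bsub>M\<^esub> z) = x a y \<oplus>\<^bsub>regular_module R\<^esub> x a z"
        using uniq[of "\<lambda>a. x a y \<oplus>\<^bsub>R\<^esub> x a z" "y \<oplus>\<^bsub>M\<^esub> z" a] Fx y xcl a by (simp add: regular_module_def)
    qed
    show "x a (b c) = (if a = c then \<one>\<^bsub>R\<^esub> else \<zero>\<^bsub>R\<^esub>)" if "a < k" "c < k" for a c
    proof (rule uniq)
      have "F (\<lambda>a. if a = c then \<one>\<^bsub>R\<^esub> else \<zero>\<^bsub>R\<^esub>) = (\<Oplus>\<^bsub>M\<^esub>a\<in>{..<k}. if c = a then b a else \<zero>\<^bsub>M\<^esub>)"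
        unfolding F_def using b by (intro M.finsum_cong') (auto simp: Pi_def)
      then show "F (\<lambda>a. if a = c then \<one>\<^bsub>R\<^esub> else \<zero>\<^bsub>R\<^esub>) = b c"
        using M.add.finprod_singleton[of c "{..<k}" b] b that by simp
    qed (use that in auto)
    show "y = (\<Oplus>\<^bsub>M\<^esub>a\<in>{..<k}. x a y \<odot>\<^bsub>M\<^esub> b a)" if "y \<in> carrier M" for y
      using Fx[OF that] by (simp add: F_def)
  qed
qed

text \<open>Common denominators; used to clear denominators in the expansion of an element in a
  basis of M[1/s].\<close>

lemma (in localization) finsum_frac_in_span:
  assumes "finite A" "P \<subseteq> carrier M"
    and "\<And>a. a \<in> A \<Longrightarrow> \<exists>y\<in>module_span R M P. \<exists>e. f a = mfrac y e"
  shows "\<exists>y\<in>module_span R M P. \<exists>e. (\<Oplus>\<^bsub>Ms\<^esub>a\<in>A. f a) = mfrac y e"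
proof -
  interpret Ms: module Rs Ms by (rule localized_module_is_module)
  note S = module_span_submodule[OF module_axioms assms(2)]
  have sub: "y \<in> module_span R M P \<Longrightarrow> y \<in> carrier M" for y using S(3) by auto
  show ?thesis using assms(1,3)
  proof (induction A rule: finite_induct)
    case empty
    then show ?case using submodule_zero[OF S(1)] by (auto simp: localized_module_zero)
  next
    case (insert a A)
    obtain y e where y: "y \<in> module_span R M P" "f a = mfrac y e" using insert.prems by blast
    obtain y' e' where y': "y' \<in> module_span R M P" "(\<Oplus>\<^bsub>Ms\<^esub>a\<in>A. f a) = mfrac y' e'"
      using insert.IH insert.prems by auto
    have fc: "f c \<in> carrier Ms" if c: "c \<in> insert a A" for c
      using insert.prems[OF c] sub by auto
    have "(\<Oplus>\<^bsub>Ms\<^esub>a\<in>insert a A. f a) = f a \<oplus>\<^bsub>Ms\<^esub> (\<Oplus>\<^bsub>Ms\<^esub>a\<in>A. f a)"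
      using insert.hyps fc by (intro Ms.finsum_insert) (auto simp del: insert_iff intro: insertI1 insertI2)
    also have "\<dots> = mfrac (pw e' y \<oplus>\<^bsub>M\<^esub> pw e y') (e + e')"
      using y y' sub by (simp add: localized_module_add)
    finally show ?case
      using submoduleE(5)[OF S(1), of "pw e' y" "pw e y'"] submoduleE(4)[OF S(1)] y(1) y'(1)
      by (auto simp: pw_def)
  qed
qed

text \<open>A basis of M[1/s] is cleared of denominators: the numerators generate M up to powers of
  s, and the dual functionals take powers of s on them instead of ones. These powers are kept
  explicit in the conclusion because, for modules over \<open>T\<close>, they have to be recognized
  as images of elements of \<open>R\<close>.\<close>

lemma (in localization) free_localization_chart:
  fixes S :: "'s ring"
  assumes free: "free_of_rank Rs Ms k" and S: "cring S" and i: "i \<in> ring_hom R S" and u: "i s \<in> Units S"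
  obtains p \<pi> where "semilinear_setting.chart R M S i k p \<pi>"
    and "\<And>a. a < k \<Longrightarrow> \<exists>e. \<pi> a (p a) = i (s [^]\<^bsub>R\<^esub> (e::nat))"
    and "\<And>y. y \<in> carrier M \<Longrightarrow> \<exists>e. s [^]\<^bsub>R\<^esub> (e::nat) \<odot>\<^bsub>M\<^esub> y \<in> module_span R M (p ` {..<k})"
proof -
  interpret ring_valued_setting R M S i
    using S i module_axioms by (simp add: ring_valued_setting_def ring_valued_setting_axioms_def)
  interpret i: ring_hom_ring R S i
    using i R.ring_axioms S.ring_axioms by (intro ring_hom_ringI2)
  interpret Ms: module Rs Ms by (rule localized_module_is_module)
  obtain b x where b: "\<And>a. a < k \<Longrightarrow> b a \<in> carrier Ms"
    and x: "\<And>a. a < k \<Longrightarrow> semilinear_map Rs Ms (\<lambda>r. r) (regular_module Rs) (x a)"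
    and xb: "\<And>a c. a < k \<Longrightarrow> c < k \<Longrightarrow> x a (b c) = (if a = c then \<one>\<^bsub>Rs\<^esub> else \<zero>\<^bsub>Rs\<^esub>)"
    and sum: "\<And>y. y \<in> carrier Ms \<Longrightarrow> y = (\<Oplus>\<^bsub>Ms\<^esub>a\<in>{..<k}. x a y \<odot>\<^bsub>Ms\<^esub> b a)"
    by (rule free_module_coordinates[OF localized_module_is_module free]) auto
  have "\<forall>a<k. \<exists>m e. m \<in> carrier M \<and> b a = mfrac m e" using b by (meson localized_moduleE)
  then obtain p e where p: "\<And>a. a < k \<Longrightarrow> p a \<in> carrier M" "\<And>a. a < k \<Longrightarrow> b a = mfrac (p a) (e a)" by metis
  have isl: "semilinear_map R (regular_module R) i (regular_module S) i"
    by (rule semilinear_mapI) (auto simp: regular_module_def)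
  \<comment> \<open>The extension of i to R[1/s], to be composed with the coordinate functionals of
    the localized module.\<close>
  obtain \<kappa> where \<kappa>: "\<And>r a. r \<in> carrier R \<Longrightarrow> \<kappa> (rfrac r a) = (inv\<^bsub>S\<^esub> (i s) [^]\<^bsub>S\<^esub> a) \<otimes>\<^bsub>S\<^esub> i r"
    using reg.semilinear_extension_localization[OF S.regular_module_is_module i u isl]
    by (auto simp: regular_module_def)
  let ?v = "inv\<^bsub>S\<^esub> (i s)"
  have vc: "?v \<in> carrier S" "i s \<in> carrier S" using u by auto
  have vs: "?v [^]\<^bsub>S\<^esub> a \<otimes>\<^bsub>S\<^esub> i s [^]\<^bsub>S\<^esub> a = \<one>\<^bsub>S\<^esub>" for a :: nat
    using vc u S.nat_pow_distrib[of ?v "i s" a, symmetric] by (simp add: S.Units_l_inv)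
  have \<kappa>h: "\<kappa> \<in> ring_hom Rs S"
  proof (rule ring_hom_memI)
    fix V assume "V \<in> carrier Rs" then show "\<kappa> V \<in> carrier S"
      by (elim localized_ringE) (use vc in \<open>simp add: \<kappa>\<close>)
  next
    fix V W assume "V \<in> carrier Rs" "W \<in> carrier Rs"
    then obtain a c r q where *: "r \<in> carrier R" "V = rfrac r a" "q \<in> carrier R" "W = rfrac q c"
      by (auto elim!: localized_ringE)
    show "\<kappa> (V \<otimes>\<^bsub>Rs\<^esub> W) = \<kappa> V \<otimes>\<^bsub>S\<^esub> \<kappa> W"
      using * vc by (simp add: localized_ring_mult \<kappa> S.nat_pow_mult[symmetric] S.m_ac)
    have "?v [^]\<^bsub>S\<^esub> (a + c) \<otimes>\<^bsub>S\<^esub> (i s [^]\<^bsub>S\<^esub> c \<otimes>\<^bsub>S\<^esub> i r) = (?v [^]\<^bsub>S\<^esub> c \<otimes>\<^bsub>S\<^esub> i s [^]\<^bsub>S\<^esub> c) \<otimes>\<^bsub>S\<^esub> (?v [^]\<^bsub>S\<^esub> a \<otimes>\<^bsub>S\<^esub> i r)"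
      "?v [^]\<^bsub>S\<^esub> (a + c) \<otimes>\<^bsub>S\<^esub> (i s [^]\<^bsub>S\<^esub> a \<otimes>\<^bsub>S\<^esub> i q) = (?v [^]\<^bsub>S\<^esub> a \<otimes>\<^bsub>S\<^esub> i s [^]\<^bsub>S\<^esub> a) \<otimes>\<^bsub>S\<^esub> (?v [^]\<^bsub>S\<^esub> c \<otimes>\<^bsub>S\<^esub> i q)"
      using * vc by (simp_all add: S.nat_pow_mult[symmetric] S.m_ac)
    then show "\<kappa> (V \<oplus>\<^bsub>Rs\<^esub> W) = \<kappa> V \<oplus>\<^bsub>S\<^esub> \<kappa> W"
      using * vc vs by (simp add: localized_ring_add \<kappa> S.r_distr i.hom_nat_pow)
  qed (simp add: localized_ring_simps(3) \<kappa>)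
  interpret \<kappa>: ring_hom_ring Rs S \<kappa>
    using \<kappa>h Ms.R.ring_axioms S.ring_axioms by (intro ring_hom_ringI2)
  have \<kappa>1: "\<kappa> (rfrac r 0) = i r" if "r \<in> carrier R" for r using that by (simp add: \<kappa>)
  define \<pi> where "\<pi> a y = \<kappa> (x a (mfrac y 0))" for a y
  have xcl: "x a V \<in> carrier Rs" if "a < k" "V \<in> carrier Ms" for a V
    using semilinear_mapD(1)[OF x[OF that(1)] that(2)] by (simp add: regular_module_def)
  have xadd: "x a (V \<oplus>\<^bsub>Ms\<^esub> V') = x a V \<oplus>\<^bsub>Rs\<^esub> x a V'" if "a < k" "V \<in> carrier Ms" "V' \<in> carrier Ms" for a V V'
    using semilinear_mapD(2)[OF x[OF that(1)] that(2,3)] by (simp add: regular_module_def)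
  have xsm: "x a (r \<odot>\<^bsub>Ms\<^esub> V) = r \<otimes>\<^bsub>Rs\<^esub> x a V" if "a < k" "r \<in> carrier Rs" "V \<in> carrier Ms" for a r V
    using semilinear_mapD(3)[OF x[OF that(1)] that(2,3)] by (simp add: regular_module_def)
  have \<pi>p: "\<pi> a (p c) = (if a = c then i s [^]\<^bsub>S\<^esub> e c else \<zero>\<^bsub>S\<^esub>)" if "a < k" "c < k" for a c
  proof -
    have "mfrac (p c) 0 = mfrac (pw (e c) (p c)) (e c)" using frac_shift[OF p(1)[OF that(2)], of "e c" 0] by simp
    also have "\<dots> = rfrac (s [^]\<^bsub>R\<^esub> e c) 0 \<odot>\<^bsub>Ms\<^esub> b c" using p that by (simp add: localized_module_smult pw_def)
    finally have "x a (mfrac (p c) 0) = rfrac (s [^]\<^bsub>R\<^esub> e c) 0 \<otimes>\<^bsub>Rs\<^esub> (if a = c then \<one>\<^bsub>Rs\<^esub> else \<zero>\<^bsub>Rs\<^esub>)"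
      using xsm b xb that by simp
    also have "\<dots> = (if a = c then rfrac (s [^]\<^bsub>R\<^esub> e c) 0 else \<zero>\<^bsub>Rs\<^esub>)" by simp
    finally show ?thesis by (simp add: \<pi>_def \<kappa>1 i.hom_nat_pow)
  qed
  have gen: "\<exists>e. s [^]\<^bsub>R\<^esub> (e::nat) \<odot>\<^bsub>M\<^esub> y \<in> module_span R M (p ` {..<k})" if y: "y \<in> carrier M" for y
  proof -
    let ?P = "p ` {..<k}"
    have P: "?P \<subseteq> carrier M" using p by auto
    note Sp = module_span_submodule[OF module_axioms P]
    have "\<exists>y'\<in>module_span R M ?P. \<exists>e. (\<Oplus>\<^bsub>Ms\<^esub>a\<in>{..<k}. x a (mfrac y 0) \<odot>\<^bsub>Ms\<^esub> b a) = mfrac y' e"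
      if y: "y \<in> carrier M" for y
    proof (rule finsum_frac_in_span[OF _ P])
      fix a assume a: "a \<in> {..<k}"
      then obtain r c where r: "r \<in> carrier R" "x a (mfrac y 0) = rfrac r c"
        using xcl[of a "mfrac y 0"] y by (auto elim!: localized_ringE)
      then have "x a (mfrac y 0) \<odot>\<^bsub>Ms\<^esub> b a = mfrac (r \<odot>\<^bsub>M\<^esub> p a) (c + e a)"
        using p a by (simp add: localized_module_smult)
      moreover have "r \<odot>\<^bsub>M\<^esub> p a \<in> module_span R M ?P"
        using submoduleE(4)[OF Sp(1) r(1)] Sp(2) a by auto
      ultimately show "\<exists>y'\<in>module_span R M ?P. \<exists>e. x a (mfrac y 0) \<odot>\<^bsub>Ms\<^esub> b a = mfrac y' e" by blast
    qed simp
    from this[OF y] obtain y' c where y': "y' \<in> module_span R M ?P" "mfrac y 0 = mfrac y' c"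
      using sum[of "mfrac y 0"] y by auto
    then have "y' \<in> carrier M" using Sp(3) by auto
    then obtain l where l: "pw (l + c) y = pw l y'" using y'(2) y by (auto simp: frac_eq_iff)
    then have "s [^]\<^bsub>R\<^esub> (l + c) \<odot>\<^bsub>M\<^esub> y \<in> module_span R M ?P"
      using submoduleE(4)[OF Sp(1) _ y'(1), of "s [^]\<^bsub>R\<^esub> l"] by (simp add: pw_def)
    then show ?thesis by blast
  qed
  have "chart k p \<pi>"
    unfolding chart_def
  proof (intro conjI allI impI ballI)
    show "semilinear_map R M i (regular_module S) (\<pi> a)" if "a < k" for a
    proof (rule semilinear_mapI)
      fix r y assume "r \<in> carrier R" "y \<in> carrier M"
      then show "\<pi> a (r \<odot>\<^bsub>M\<^esub> y) = i r \<odot>\<^bsub>regular_module S\<^esub> \<pi> a y"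
        using xsm[OF that, of "rfrac r 0" "mfrac y 0"] xcl[OF that]
        by (simp add: \<pi>_def localized_module_smult \<kappa>1)
    next
      fix y z assume "y \<in> carrier M" "z \<in> carrier M"
      then show "\<pi> a (y \<oplus>\<^bsub>M\<^esub> z) = \<pi> a y \<oplus>\<^bsub>regular_module S\<^esub> \<pi> a z"
        using xadd[OF that, of "mfrac y 0" "mfrac z 0"] xcl[OF that]
        by (simp add: \<pi>_def localized_module_add)
    qed (use xcl[OF that] in \<open>simp add: \<pi>_def regular_module_def\<close>)
    show "\<pi> a (p a) \<in> Units S" if "a < k" for a using \<pi>p[OF that that] u S.Units_pow_closed by simp
    fix y assume y: "y \<in> carrier M"
    obtain e :: nat where "s [^]\<^bsub>R\<^esub> e \<odot>\<^bsub>M\<^esub> y \<in> module_span R M (p ` {..<k})" using gen[OF y] by blast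
    moreover have "i (s [^]\<^bsub>R\<^esub> e) \<in> Units S" using u S.Units_pow_closed by (simp add: i.hom_nat_pow)
    ultimately show "\<exists>q\<in>carrier R. i q \<in> Units S \<and> q \<odot>\<^bsub>M\<^esub> y \<in> module_span R M (p ` {..<k})"
      by (intro bexI[of _ "s [^]\<^bsub>R\<^esub> e"]) auto
  qed (use p \<pi>p in auto)
  moreover have "\<exists>e. \<pi> a (p a) = i (s [^]\<^bsub>R\<^esub> (e::nat))" if "a < k" for a
    using \<pi>p[OF that that] by (intro exI[of _ "e a"]) (simp add: i.hom_nat_pow)
  ultimately show thesis using gen by (rule that)
qed

section \<open>Tensor products\<close>

lemma pair_ring_simps:
  "carrier (pair_ring A B) = {u. Poly_Mapping.keys u \<subseteq> carrier A \<times> carrier B}"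
  "\<zero>\<^bsub>pair_ring A B\<^esub> = 0" "u \<oplus>\<^bsub>pair_ring A B\<^esub> v = u + v"
  "\<one>\<^bsub>pair_ring A B\<^esub> = frag_of (\<one>\<^bsub>A\<^esub>, \<one>\<^bsub>B\<^esub>)"
  by (simp_all add: pair_ring_def)

locale tensor_setting = A: cring A + B: cring B
  for k :: "('k, 'w) ring_scheme" and f :: "'k \<Rightarrow> 'a" and A :: "('a, 'x) ring_scheme"
    and g :: "'k \<Rightarrow> 'b" and B :: "('b, 'y) ring_scheme" +
  assumes f_closed [simp]: "c \<in> carrier k \<Longrightarrow> f c \<in> carrier A"
    and g_closed [simp]: "c \<in> carrier k \<Longrightarrow> g c \<in> carrier B"
begin

abbreviation "P \<equiv> pair_ring A B"
abbreviation "I \<equiv> tensor_ideal k f A g B"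
abbreviation "T \<equiv> tensor_ring k f A g B"
abbreviation "pt \<equiv> pure_tensor k f A g B"

lemma pair_mult_diff_left: "(u - v) \<otimes>\<^bsub>P\<^esub> w = u \<otimes>\<^bsub>P\<^esub> w - v \<otimes>\<^bsub>P\<^esub> w"
  by (simp add: pair_ring_def frag_extend_diff)

lemma pair_mult_add_left: "(u + v) \<otimes>\<^bsub>P\<^esub> w = u \<otimes>\<^bsub>P\<^esub> w + v \<otimes>\<^bsub>P\<^esub> w"
  by (simp add: pair_ring_def frag_extend_add)

lemma pair_mult_diff_right: "w \<otimes>\<^bsub>P\<^esub> (u - v) = w \<otimes>\<^bsub>P\<^esub> u - w \<otimes>\<^bsub>P\<^esub> v"
proof -
  have "Poly_Mapping.keys w \<subseteq> UNIV" by simp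
  then show ?thesis
  proof (induction w rule: frag_induction)
    case (diff a b)
    then show ?case unfolding pair_mult_diff_left by simp
  qed (auto simp: pair_ring_def frag_extend_diff)
qed

lemma pair_mult_zero [simp]: "0 \<otimes>\<^bsub>P\<^esub> u = 0" "u \<otimes>\<^bsub>P\<^esub> 0 = 0"
proof -
  show "0 \<otimes>\<^bsub>P\<^esub> u = 0" by (simp add: pair_ring_def)
  show "u \<otimes>\<^bsub>P\<^esub> 0 = 0" using pair_mult_diff_right[of u 0 0] by simp
qed

lemma pair_mult_of: "frag_of (a, b) \<otimes>\<^bsub>P\<^esub> frag_of (a', b') = frag_of (a \<otimes>\<^bsub>A\<^esub> a', b \<otimes>\<^bsub>B\<^esub> b')"
  by (simp add: pair_ring_def)

lemma frag_of_closed [simp]: "a \<in> carrier A \<Longrightarrow> b \<in> carrier B \<Longrightarrow> frag_of (a, b) \<in> carrier P"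
  by (simp add: pair_ring_simps keys_frag_of)

lemma pair_diff_closed [simp]: "u \<in> carrier P \<Longrightarrow> v \<in> carrier P \<Longrightarrow> u - v \<in> carrier P"
  using keys_diff[of u v] by (auto simp: pair_ring_simps)

lemma pair_induct [consumes 1, case_names zero diff of]:
  assumes "u \<in> carrier P" "Q 0"
    "\<And>u v. u \<in> carrier P \<Longrightarrow> v \<in> carrier P \<Longrightarrow> Q u \<Longrightarrow> Q v \<Longrightarrow> Q (u - v)"
    "\<And>a b. a \<in> carrier A \<Longrightarrow> b \<in> carrier B \<Longrightarrow> Q (frag_of (a, b))"
  shows "Q u"
  using assms
  by (intro free_Abelian_group_induct[of u "carrier A \<times> carrier B" Q]) (auto simp: pair_ring_simps)

lemma zero_pair_closed: "0 \<in> carrier P"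
  by (simp add: pair_ring_simps)

lemma pair_mult_closed:
  assumes "u \<in> carrier P" "v \<in> carrier P"
  shows "u \<otimes>\<^bsub>P\<^esub> v \<in> carrier P"
  using assms(1)
proof (induction u rule: pair_induct)
  case (of a b)
  show ?case using assms(2)
    by (induction v rule: pair_induct) (use of zero_pair_closed in \<open>auto simp: pair_mult_diff_right pair_mult_of\<close>)
qed (auto simp: pair_mult_diff_left zero_pair_closed)

lemma pair_mult_comm:
  assumes "u \<in> carrier P" "v \<in> carrier P"
  shows "u \<otimes>\<^bsub>P\<^esub> v = v \<otimes>\<^bsub>P\<^esub> u"
  using assms(1)
proof (induction u rule: pair_induct)
  case (of a b)
  show ?case using assms(2)
    by (induction v rule: pair_induct)
      (use of in \<open>auto simp: pair_mult_diff_right pair_mult_diff_left pair_mult_of A.m_comm B.m_comm\<close>)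
qed (auto simp: pair_mult_diff_left pair_mult_diff_right)

lemma pair_mult_assoc:
  assumes "u \<in> carrier P" "v \<in> carrier P" "w \<in> carrier P"
  shows "(u \<otimes>\<^bsub>P\<^esub> v) \<otimes>\<^bsub>P\<^esub> w = u \<otimes>\<^bsub>P\<^esub> (v \<otimes>\<^bsub>P\<^esub> w)"
  using assms(1)
proof (induction u rule: pair_induct)
  case (of a b)
  note ab = of
  show ?case using assms(2)
  proof (induction v rule: pair_induct)
    case (of a' b')
    show ?case using assms(3)
      by (induction w rule: pair_induct)
        (use of ab in \<open>auto simp: pair_mult_diff_right pair_mult_diff_left pair_mult_of A.m_assoc B.m_assoc\<close>)
  qed (auto simp: pair_mult_diff_left pair_mult_diff_right)
qed (auto simp: pair_mult_diff_left pair_mult_diff_right)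

lemma pair_ring_cring: "cring P"
proof (rule cringI)
  have add: "u + v \<in> carrier P" if "u \<in> carrier P" "v \<in> carrier P" for u v
    using that Poly_Mapping.keys_add[of u v] by (auto simp: pair_ring_simps)
  show "abelian_group P"
  proof (rule abelian_groupI)
    fix x assume "x \<in> carrier P"
    then show "\<exists>y\<in>carrier P. y \<oplus>\<^bsub>P\<^esub> x = \<zero>\<^bsub>P\<^esub>"
      by (intro bexI[of _ "- x"]) (auto simp: pair_ring_simps)
  qed (use add in \<open>auto simp: pair_ring_simps(2,3) ac_simps\<close>, auto simp: pair_ring_simps)
  show "comm_monoid P"
  proof (rule comm_monoidI)
    show "\<one>\<^bsub>P\<^esub> \<otimes>\<^bsub>P\<^esub> u = u" if "u \<in> carrier P" for u
      using that unfolding pair_ring_simps(4)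
      by (induction u rule: pair_induct) (auto simp: pair_mult_diff_right pair_mult_of)
    show "u \<otimes>\<^bsub>P\<^esub> v \<otimes>\<^bsub>P\<^esub> w = u \<otimes>\<^bsub>P\<^esub> (v \<otimes>\<^bsub>P\<^esub> w)"
      if "u \<in> carrier P" "v \<in> carrier P" "w \<in> carrier P" for u v w
      using that by (rule pair_mult_assoc)
  qed (auto simp: pair_mult_closed pair_ring_simps(4) intro: pair_mult_comm)
qed (simp add: pair_ring_simps(3) pair_mult_add_left)

sublocale P: cring P by (rule pair_ring_cring)

lemma pair_uminus: "u \<in> carrier P \<Longrightarrow> \<ominus>\<^bsub>P\<^esub> u = - u"
  by (rule P.minus_equality) (auto simp: pair_ring_simps)

lemma pair_minus: "u \<in> carrier P \<Longrightarrow> v \<in> carrier P \<Longrightarrow> u \<ominus>\<^bsub>P\<^esub> v = u - v"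
  by (simp add: a_minus_def pair_uminus pair_ring_simps(3))

definition relations :: "('a \<times> 'b \<Rightarrow>\<^sub>0 int) set" where
  "relations =
     {frag_of (a \<oplus>\<^bsub>A\<^esub> a', b) - frag_of (a, b) - frag_of (a', b) | a a' b.
         a \<in> carrier A \<and> a' \<in> carrier A \<and> b \<in> carrier B} \<union>
      {frag_of (a, b \<oplus>\<^bsub>B\<^esub> b') - frag_of (a, b) - frag_of (a, b') | a b b'.
         a \<in> carrier A \<and> b \<in> carrier B \<and> b' \<in> carrier B} \<union>
      {frag_of (f c \<otimes>\<^bsub>A\<^esub> a, b) - frag_of (a, g c \<otimes>\<^bsub>B\<^esub> b) | c a b.
         c \<in> carrier k \<and> a \<in> carrier A \<and> b \<in> carrier B}"

lemma relationsE:
  assumes "u \<in> relations"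
  obtains a a' b where "a \<in> carrier A" "a' \<in> carrier A" "b \<in> carrier B"
        "u = frag_of (a \<oplus>\<^bsub>A\<^esub> a', b) - frag_of (a, b) - frag_of (a', b)"
      | a b b' where "a \<in> carrier A" "b \<in> carrier B" "b' \<in> carrier B"
        "u = frag_of (a, b \<oplus>\<^bsub>B\<^esub> b') - frag_of (a, b) - frag_of (a, b')"
      | c a b where "c \<in> carrier k" "a \<in> carrier A" "b \<in> carrier B"
        "u = frag_of (f c \<otimes>\<^bsub>A\<^esub> a, b) - frag_of (a, g c \<otimes>\<^bsub>B\<^esub> b)"
  using assms unfolding relations_def
  by (elim UnE CollectE exE conjE)
    ((rule that(1); assumption) | (rule that(2); assumption) | (rule that(3); assumption))+

lemma relations_closed: "relations \<subseteq> carrier P"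
  unfolding relations_def by (auto intro!: pair_diff_closed frag_of_closed)

lemma tensor_ideal_eq: "I = Idl\<^bsub>P\<^esub> relations"
  by (simp add: tensor_ideal_def relations_def)

sublocale I: ideal I P
  unfolding tensor_ideal_eq by (rule P.genideal_ideal[OF relations_closed])

lemma relations_subset: "relations \<subseteq> I"
  unfolding tensor_ideal_eq by (rule P.genideal_self[OF relations_closed])

lemma tensor_ideal_minimal: "ideal H P \<Longrightarrow> relations \<subseteq> H \<Longrightarrow> I \<subseteq> H"
  unfolding tensor_ideal_eq by (rule P.genideal_minimal)

lemma tensor_ring_cring: "cring T"
  unfolding tensor_ring_def by (rule I.quotient_is_cring[OF pair_ring_cring])

sublocale T: cring T by (rule tensor_ring_cring)

lemma proj_hom: "(\<lambda>u. I +>\<^bsub>P\<^esub> u) \<in> ring_hom P T"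
  unfolding tensor_ring_def by (rule I.rcos_ring_hom)

sublocale proj: ring_hom_ring P T "\<lambda>u. I +>\<^bsub>P\<^esub> u"
  using proj_hom P.ring_axioms T.ring_axioms by (intro ring_hom_ringI2)

lemma tensor_carrier: "carrier T = (\<lambda>u. I +>\<^bsub>P\<^esub> u) ` carrier P"
proof -
  have "carrier T = a_rcosets\<^bsub>P\<^esub> I" by (simp only: tensor_ring_def FactRing_def partial_object.simps)
  also have "\<dots> = (\<lambda>u. I +>\<^bsub>P\<^esub> u) ` carrier P" unfolding A_RCOSETS_def' by blast
  finally show ?thesis .
qed

lemma proj_eqI:
  assumes "u \<in> carrier P" "v \<in> carrier P" "u - v \<in> I"
  shows "I +>\<^bsub>P\<^esub> u = I +>\<^bsub>P\<^esub> v"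
proof -
  have "u = (u - v) \<oplus>\<^bsub>P\<^esub> v" by (simp add: pair_ring_simps)
  then have "u \<in> I +>\<^bsub>P\<^esub> v" using assms(3) by (auto simp: a_r_coset_def')
  then show ?thesis
    using P.a_repr_independence[OF _ assms(2) I.additive_subgroup_axioms[unfolded additive_subgroup_def]]
    by blast
qed

lemma pt_eq: "pt a b = I +>\<^bsub>P\<^esub> frag_of (a, b)"
  by (simp add: pure_tensor_def)

lemma pt_closed [simp]: "a \<in> carrier A \<Longrightarrow> b \<in> carrier B \<Longrightarrow> pt a b \<in> carrier T"
  unfolding pt_eq by (rule proj.hom_closed) simp

lemma pt_one: "\<one>\<^bsub>T\<^esub> = pt \<one>\<^bsub>A\<^esub> \<one>\<^bsub>B\<^esub>"
  using proj.hom_one by (simp only: pt_eq pair_ring_simps(4))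

lemma pt_mult:
  assumes "a \<in> carrier A" "b \<in> carrier B" "a' \<in> carrier A" "b' \<in> carrier B"
  shows "pt a b \<otimes>\<^bsub>T\<^esub> pt a' b' = pt (a \<otimes>\<^bsub>A\<^esub> a') (b \<otimes>\<^bsub>B\<^esub> b')"
  using assms proj.hom_mult[of "frag_of (a, b)" "frag_of (a', b')"] by (simp add: pt_eq pair_mult_of)

lemma proj_add: "u \<in> carrier P \<Longrightarrow> v \<in> carrier P \<Longrightarrow> I +>\<^bsub>P\<^esub> (u + v) = (I +>\<^bsub>P\<^esub> u) \<oplus>\<^bsub>T\<^esub> (I +>\<^bsub>P\<^esub> v)"
  using proj.hom_add[of u v] by (simp only: pair_ring_simps(3))

lemma pair_add_closed [simp]: "u \<in> carrier P \<Longrightarrow> v \<in> carrier P \<Longrightarrow> u + v \<in> carrier P"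
  using P.a_closed by (simp add: pair_ring_simps(3))

lemma pt_add_left:
  assumes "a \<in> carrier A" "a' \<in> carrier A" "b \<in> carrier B"
  shows "pt (a \<oplus>\<^bsub>A\<^esub> a') b = pt a b \<oplus>\<^bsub>T\<^esub> pt a' b"
proof -
  have "frag_of (a \<oplus>\<^bsub>A\<^esub> a', b) - frag_of (a, b) - frag_of (a', b) \<in> relations"
    unfolding relations_def using assms by blast
  then have "frag_of (a \<oplus>\<^bsub>A\<^esub> a', b) - (frag_of (a, b) + frag_of (a', b)) \<in> I"
    using relations_subset by (auto simp: diff_diff_eq)
  then have "I +>\<^bsub>P\<^esub> frag_of (a \<oplus>\<^bsub>A\<^esub> a', b) = I +>\<^bsub>P\<^esub> (frag_of (a, b) + frag_of (a', b))"
    using assms by (intro proj_eqI) auto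
  then show ?thesis using assms by (simp add: pt_eq proj_add)
qed

lemma pt_add_right:
  assumes "a \<in> carrier A" "b \<in> carrier B" "b' \<in> carrier B"
  shows "pt a (b \<oplus>\<^bsub>B\<^esub> b') = pt a b \<oplus>\<^bsub>T\<^esub> pt a b'"
proof -
  have "frag_of (a, b \<oplus>\<^bsub>B\<^esub> b') - frag_of (a, b) - frag_of (a, b') \<in> relations"
    unfolding relations_def using assms by blast
  then have "frag_of (a, b \<oplus>\<^bsub>B\<^esub> b') - (frag_of (a, b) + frag_of (a, b')) \<in> I"
    using relations_subset by (auto simp: diff_diff_eq)
  then have "I +>\<^bsub>P\<^esub> frag_of (a, b \<oplus>\<^bsub>B\<^esub> b') = I +>\<^bsub>P\<^esub> (frag_of (a, b) + frag_of (a, b'))"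
    using assms by (intro proj_eqI) auto
  then show ?thesis using assms by (simp add: pt_eq proj_add)
qed

lemma pt_balanced:
  assumes "c \<in> carrier k" "a \<in> carrier A" "b \<in> carrier B"
  shows "pt (f c \<otimes>\<^bsub>A\<^esub> a) b = pt a (g c \<otimes>\<^bsub>B\<^esub> b)"
proof -
  have "frag_of (f c \<otimes>\<^bsub>A\<^esub> a, b) - frag_of (a, g c \<otimes>\<^bsub>B\<^esub> b) \<in> relations"
    unfolding relations_def using assms by blast
  then show ?thesis unfolding pt_eq using assms relations_subset by (intro proj_eqI) auto
qed

lemma tensor_induct [consumes 1, case_names zero diff pure]:
  assumes t: "t \<in> carrier T" and "Q \<zero>\<^bsub>T\<^esub>"
    and diff: "\<And>s t. s \<in> carrier T \<Longrightarrow> t \<in> carrier T \<Longrightarrow> Q s \<Longrightarrow> Q t \<Longrightarrow> Q (s \<ominus>\<^bsub>T\<^esub> t)"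
    and pure: "\<And>a b. a \<in> carrier A \<Longrightarrow> b \<in> carrier B \<Longrightarrow> Q (pt a b)"
  shows "Q t"
proof -
  obtain u where u: "u \<in> carrier P" "t = I +>\<^bsub>P\<^esub> u" using t by (auto simp: tensor_carrier)
  have "Q (I +>\<^bsub>P\<^esub> u)" using u(1)
  proof (induction u rule: pair_induct)
    case zero then show ?case using assms(2) proj.hom_zero by (simp add: pair_ring_simps)
  next
    case (diff u v)
    have "I +>\<^bsub>P\<^esub> (u - v) = (I +>\<^bsub>P\<^esub> u) \<ominus>\<^bsub>T\<^esub> (I +>\<^bsub>P\<^esub> v)"
      using diff proj.hom_add[of u "\<ominus>\<^bsub>P\<^esub> v"] by (simp add: pair_minus[symmetric] a_minus_def)
    then show ?case using diff assms(3) by simp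
  next
    case (of a b) then show ?case using pure by (simp add: pt_eq)
  qed
  then show ?thesis using u by simp
qed

text \<open>The tensor relations generate an ideal of the ring of pairs, whereas the map to be
  induced is only additive, and its kernel need not be an ideal. The proof uses N, the largest ideal
  inside the kernel; it contains the relations because the product of a relation with a pair is
  again a relation.\<close>

lemma tensor_lift:
  fixes W :: "('w', 'z) ring_scheme"
  assumes W: "abelian_group W"
    and \<beta>: "\<And>a b. a \<in> carrier A \<Longrightarrow> b \<in> carrier B \<Longrightarrow> \<beta> a b \<in> carrier W"
    and add1: "\<And>a a' b. a \<in> carrier A \<Longrightarrow> a' \<in> carrier A \<Longrightarrow> b \<in> carrier B \<Longrightarrow>
      \<beta> (a \<oplus>\<^bsub>A\<^esub> a') b = \<beta> a b \<oplus>\<^bsub>W\<^esub> \<beta> a' b"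
    and add2: "\<And>a b b'. a \<in> carrier A \<Longrightarrow> b \<in> carrier B \<Longrightarrow> b' \<in> carrier B \<Longrightarrow>
      \<beta> a (b \<oplus>\<^bsub>B\<^esub> b') = \<beta> a b \<oplus>\<^bsub>W\<^esub> \<beta> a b'"
    and bal: "\<And>c a b. c \<in> carrier k \<Longrightarrow> a \<in> carrier A \<Longrightarrow> b \<in> carrier B \<Longrightarrow>
      \<beta> (f c \<otimes>\<^bsub>A\<^esub> a) b = \<beta> a (g c \<otimes>\<^bsub>B\<^esub> b)"
  obtains h where "\<And>t. t \<in> carrier T \<Longrightarrow> h t \<in> carrier W"
    and "\<And>s t. s \<in> carrier T \<Longrightarrow> t \<in> carrier T \<Longrightarrow> h (s \<oplus>\<^bsub>T\<^esub> t) = h s \<oplus>\<^bsub>W\<^esub> h t"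
    and "\<And>a b. a \<in> carrier A \<Longrightarrow> b \<in> carrier B \<Longrightarrow> h (pt a b) = \<beta> a b"
proof -
  interpret W: abelian_group W by fact
  obtain H where H: "H \<in> hom (free_Abelian_group (carrier A \<times> carrier B)) (add_monoid W)"
    and H_of: "\<And>x. x \<in> carrier A \<times> carrier B \<Longrightarrow> H (frag_of x) = (\<lambda>(a, b). \<beta> a b) x"
    by (rule comm_group.free_Abelian_group_universal[OF W.a_comm_group, of "\<lambda>(a, b). \<beta> a b" "carrier A \<times> carrier B"])
      (use \<beta> in auto)
  have Wcancel: "x \<oplus>\<^bsub>W\<^esub> y \<ominus>\<^bsub>W\<^esub> x \<ominus>\<^bsub>W\<^esub> y = \<zero>\<^bsub>W\<^esub>" if "x \<in> carrier W" "y \<in> carrier W" for x y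
  proof -
    have "x \<oplus>\<^bsub>W\<^esub> y \<ominus>\<^bsub>W\<^esub> x = y"
      using that by (simp add: a_minus_def W.a_comm[of x y] W.a_assoc W.r_neg)
    then show ?thesis using that by (simp add: a_minus_def W.r_neg)
  qed
  have Hc: "H u \<in> carrier W" if "u \<in> carrier P" for u
    using hom_in_carrier[OF H] that by (simp add: pair_ring_simps)
  have Hadd: "H (u + v) = H u \<oplus>\<^bsub>W\<^esub> H v" if "u \<in> carrier P" "v \<in> carrier P" for u v
    using hom_mult[OF H] that by (simp add: pair_ring_simps)
  have Hz: "H 0 = \<zero>\<^bsub>W\<^esub>" using Hadd[of 0 0] Hc[of 0] by (simp add: pair_ring_simps)
  have Hd: "H (u - v) = H u \<ominus>\<^bsub>W\<^esub> H v" if "u \<in> carrier P" "v \<in> carrier P" for u v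
  proof -
    have "H u = H (u - v) \<oplus>\<^bsub>W\<^esub> H v" using Hadd[of "u - v" v] that by simp
    then show ?thesis using Hc that by (simp add: a_minus_def W.a_assoc W.r_neg)
  qed
  define N where "N = {u \<in> carrier P. \<forall>v\<in>carrier P. H (v \<otimes>\<^bsub>P\<^esub> u) = \<zero>\<^bsub>W\<^esub>}"
  have N: "ideal N P"
  proof (rule idealI)
    show "subgroup N (add_monoid P)"
    proof (rule P.add.subgroupI)
      show "N \<noteq> {}" using Hz by (auto simp: N_def pair_ring_simps intro!: exI[of _ 0])
      fix a assume a: "a \<in> N"
      have "H (v \<otimes>\<^bsub>P\<^esub> (\<ominus>\<^bsub>P\<^esub> a)) = \<zero>\<^bsub>W\<^esub>" if v: "v \<in> carrier P" for v
      proof -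
        have "v \<otimes>\<^bsub>P\<^esub> (\<ominus>\<^bsub>P\<^esub> a) = 0 - v \<otimes>\<^bsub>P\<^esub> a"
          using v a pair_mult_diff_right[of v 0 a] by (simp add: N_def pair_uminus)
        moreover have "H (0 - v \<otimes>\<^bsub>P\<^esub> a) = H 0 \<ominus>\<^bsub>W\<^esub> H (v \<otimes>\<^bsub>P\<^esub> a)"
          using v a by (intro Hd) (auto simp: N_def zero_pair_closed pair_mult_closed)
        ultimately show ?thesis using v a Hz by (simp add: N_def a_minus_def W.r_neg)
      qed
      then show "\<ominus>\<^bsub>P\<^esub> a \<in> N" using a by (simp add: N_def)
    next
      fix a b assume "a \<in> N" "b \<in> N"
      then show "a \<oplus>\<^bsub>P\<^esub> b \<in> N"
        by (auto simp: N_def P.r_distr) (auto simp: pair_ring_simps(3) Hadd P.m_closed)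
    qed (auto simp: N_def)
    fix a x assume *: "a \<in> N" "x \<in> carrier P"
    show "x \<otimes>\<^bsub>P\<^esub> a \<in> N" using * by (auto simp: N_def P.m_assoc[symmetric])
    then show "a \<otimes>\<^bsub>P\<^esub> x \<in> N" using * by (simp add: N_def P.m_comm)
  qed (rule P.ring_axioms)
  \<comment> \<open>Pairs generate the ring of pairs additively, so membership in N can be tested on
    products with pairs.\<close>
  have rel: "u \<in> N" if u: "u \<in> carrier P"
    and z: "\<And>a b. a \<in> carrier A \<Longrightarrow> b \<in> carrier B \<Longrightarrow> H (frag_of (a, b) \<otimes>\<^bsub>P\<^esub> u) = \<zero>\<^bsub>W\<^esub>" for u
  proof -
    have "H (v \<otimes>\<^bsub>P\<^esub> u) = \<zero>\<^bsub>W\<^esub>" if "v \<in> carrier P" for v using that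
      by (induction v rule: pair_induct)
        (use z u in \<open>auto simp: Hz pair_mult_diff_left Hd P.m_closed a_minus_def W.r_neg\<close>)
    then show ?thesis using u by (simp add: N_def)
  qed
  have "relations \<subseteq> N"
  proof
    fix u assume u: "u \<in> relations"
    then show "u \<in> N"
    proof (cases rule: relationsE)
      case 1
      show ?thesis
      proof (rule rel)
        fix a0 b0 assume "a0 \<in> carrier A" "b0 \<in> carrier B"
        then show "H (frag_of (a0, b0) \<otimes>\<^bsub>P\<^esub> u) = \<zero>\<^bsub>W\<^esub>"
          using 1 by (simp add: pair_mult_diff_right pair_mult_of Hd H_of A.r_distr add1 \<beta> Wcancel)
      qed (use u relations_closed in auto)
    next
      case 2
      show ?thesis
      proof (rule rel)
        fix a0 b0 assume "a0 \<in> carrier A" "b0 \<in> carrier B"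
        then show "H (frag_of (a0, b0) \<otimes>\<^bsub>P\<^esub> u) = \<zero>\<^bsub>W\<^esub>"
          using 2 by (simp add: pair_mult_diff_right pair_mult_of Hd H_of B.r_distr add2 \<beta> Wcancel)
      qed (use u relations_closed in auto)
    next
      case (3 c a b)
      show ?thesis
      proof (rule rel)
        fix a0 b0 assume "a0 \<in> carrier A" "b0 \<in> carrier B"
        then show "H (frag_of (a0, b0) \<otimes>\<^bsub>P\<^esub> u) = \<zero>\<^bsub>W\<^esub>"
          using 3 bal[of c "a0 \<otimes>\<^bsub>A\<^esub> a" "b0 \<otimes>\<^bsub>B\<^esub> b"]
          by (simp add: pair_mult_diff_right pair_mult_of Hd H_of \<beta> A.m_lcomm B.m_lcomm a_minus_def W.r_neg)
      qed (use u relations_closed in auto)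
    qed
  qed
  then have IN: "I \<subseteq> N" by (rule tensor_ideal_minimal[OF N])
  have HI: "H u = \<zero>\<^bsub>W\<^esub>" if "u \<in> I" for u
  proof -
    have "u \<in> N" using that IN by blast
    then have u: "u \<in> carrier P" "\<forall>v\<in>carrier P. H (v \<otimes>\<^bsub>P\<^esub> u) = \<zero>\<^bsub>W\<^esub>" by (simp_all add: N_def)
    then have "H (\<one>\<^bsub>P\<^esub> \<otimes>\<^bsub>P\<^esub> u) = \<zero>\<^bsub>W\<^esub>" using P.one_closed by blast
    then show ?thesis using u by simp
  qed
  define h where "h V = H (SOME u. u \<in> V)" for V
  have h: "h (I +>\<^bsub>P\<^esub> u) = H u" if "u \<in> carrier P" for u
  proof -
    have "(SOME v. v \<in> I +>\<^bsub>P\<^esub> u) \<in> I +>\<^bsub>P\<^esub> u" using I.a_rcos_self[OF that] by (rule someI)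
    then obtain v where "v \<in> I" "(SOME v. v \<in> I +>\<^bsub>P\<^esub> u) = v + u"
      by (auto simp: a_r_coset_def' pair_ring_simps(3))
    then show ?thesis using Hadd[of v u] HI[of v] that I.a_Hcarr Hc[OF that] by (simp add: h_def)
  qed
  show thesis
  proof (rule that[of h])
    show "h t \<in> carrier W" if "t \<in> carrier T" for t
      using that h Hc by (auto simp: tensor_carrier)
    show "h (s \<oplus>\<^bsub>T\<^esub> t) = h s \<oplus>\<^bsub>W\<^esub> h t" if "s \<in> carrier T" "t \<in> carrier T" for s t
      using that by (auto simp: tensor_carrier proj_add[symmetric] h Hadd)
    show "h (pt a b) = \<beta> a b" if "a \<in> carrier A" "b \<in> carrier B" for a b
      using that H_of[of "(a, b)"] by (simp add: pt_eq h)
  qed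
qed

end

text \<open>The base change is a union over the representatives of a coset. It is a single coset
  because the induced ring homomorphism on pairs kills the tensor relations, hence the ideal that
  they generate.\<close>

lemma tensor_base_change_hom:
  assumes E: "tensor_setting k f A g E" and B: "tensor_setting k f A g' B"
    and r: "r \<in> ring_hom E B" and g': "\<And>c. c \<in> carrier k \<Longrightarrow> r (g c) = g' c"
  shows "tensor_base_change k f A g' B r \<in> ring_hom (tensor_ring k f A g E) (tensor_ring k f A g' B)"
    and "\<And>a e. a \<in> carrier A \<Longrightarrow> e \<in> carrier E \<Longrightarrow>
      tensor_base_change k f A g' B r (pure_tensor k f A g E a e) = pure_tensor k f A g' B a (r e)"
proof -
  interpret E: tensor_setting k f A g E by fact
  interpret B: tensor_setting k f A g' B by fact
  interpret r: ring_hom_ring E B r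
    using r E.B.ring_axioms B.B.ring_axioms by (intro ring_hom_ringI2)
  let ?ext = "frag_extend (\<lambda>(a, e). frag_of (a, r e))"
  let ?h = "tensor_base_change k f A g' B r"
  have extc: "?ext u \<in> carrier B.P" if "u \<in> carrier E.P" for u
    using that
    by (induction u rule: E.pair_induct) (auto simp: frag_extend_diff pair_ring_simps(1,2) keys_frag_of dest!: keys_diff[THEN subsetD])
  have extm: "?ext (u \<otimes>\<^bsub>E.P\<^esub> v) = ?ext u \<otimes>\<^bsub>B.P\<^esub> ?ext v" if u: "u \<in> carrier E.P" and v: "v \<in> carrier E.P" for u v
    using u
  proof (induction u rule: E.pair_induct)
    case (of a b)
    show ?case using v
      by (induction v rule: E.pair_induct)
        (use of in \<open>auto simp: E.pair_mult_diff_right B.pair_mult_diff_right frag_extend_diff E.pair_mult_of B.pair_mult_of\<close>)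
  qed (auto simp: E.pair_mult_diff_left B.pair_mult_diff_left frag_extend_diff)
  define \<Phi> where "\<Phi> u = B.I +>\<^bsub>B.P\<^esub> ?ext u" for u
  have \<Phi>: "\<Phi> \<in> ring_hom E.P B.T"
  proof (rule ring_hom_memI)
    show "\<Phi> \<one>\<^bsub>E.P\<^esub> = \<one>\<^bsub>B.T\<^esub>"
      using B.pt_one by (simp add: \<Phi>_def pair_ring_simps(4) B.pt_eq)
  qed (auto simp: \<Phi>_def extc extm E.pair_mult_closed pair_ring_simps(3) frag_extend_add B.proj_add)
  interpret \<Phi>: ring_hom_ring E.P B.T \<Phi>
    using \<Phi> E.P.ring_axioms B.T.ring_axioms by (intro ring_hom_ringI2)
  have \<Phi>d: "\<Phi> (u - v) = \<Phi> u \<ominus>\<^bsub>B.T\<^esub> \<Phi> v" if "u \<in> carrier E.P" "v \<in> carrier E.P" for u v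
    using that \<Phi>.hom_add[of u "\<ominus>\<^bsub>E.P\<^esub> v"] by (simp add: E.pair_minus[symmetric] a_minus_def)
  have \<Phi>of: "\<Phi> (frag_of (a, e)) = B.pt a (r e)" for a e by (simp add: \<Phi>_def B.pt_eq)
  have "E.relations \<subseteq> a_kernel E.P B.T \<Phi>"
  proof
    fix u assume u: "u \<in> E.relations"
    then have "\<Phi> u = \<zero>\<^bsub>B.T\<^esub>"
    proof (cases rule: E.relationsE)
      case 1 then show ?thesis
        by (simp add: \<Phi>d \<Phi>of B.pt_add_left a_minus_def B.T.a_ac B.T.r_neg B.T.minus_add B.T.r_neg1 B.T.r_neg2)
    next
      case 2 then show ?thesis
        by (simp add: \<Phi>d \<Phi>of B.pt_add_right a_minus_def B.T.a_ac B.T.r_neg B.T.minus_add B.T.r_neg1 B.T.r_neg2)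
    next
      case (3 c a b) then show ?thesis
        using B.pt_balanced[of c a "r b"] by (simp add: \<Phi>d \<Phi>of g' a_minus_def B.T.r_neg)
    qed
    moreover have "u \<in> carrier E.P" using u E.relations_closed by (rule subsetD[rotated])
    ultimately show "u \<in> a_kernel E.P B.T \<Phi>" unfolding a_kernel_def' by blast
  qed
  then have IK: "E.I \<subseteq> a_kernel E.P B.T \<Phi>" by (rule E.tensor_ideal_minimal[OF \<Phi>.kernel_is_ideal])
  have h: "?h (E.I +>\<^bsub>E.P\<^esub> u) = \<Phi> u" if u: "u \<in> carrier E.P" for u
  proof -
    have "\<Phi> v = \<Phi> u" if "v \<in> E.I +>\<^bsub>E.P\<^esub> u" for v
    proof -
      from that have "\<exists>w\<in>E.I. v = w \<oplus>\<^bsub>E.P\<^esub> u" unfolding a_r_coset_def' by blast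
      then obtain w where w: "w \<in> E.I" "v = w \<oplus>\<^bsub>E.P\<^esub> u" by blast
      have "w \<in> a_kernel E.P B.T \<Phi>" using w(1) IK by (rule subsetD[rotated])
      then have "\<Phi> w = \<zero>\<^bsub>B.T\<^esub>" "w \<in> carrier E.P" unfolding a_kernel_def' by blast+
      then show ?thesis using w u by simp
    qed
    then have "(\<Union>v\<in>E.I +>\<^bsub>E.P\<^esub> u. \<Phi> v) = \<Phi> u"
      by (intro UN_constant_eq[OF E.I.a_rcos_self[OF u]] ballI)
    then show ?thesis by (simp add: tensor_base_change_def \<Phi>_def)
  qed
  show "?h \<in> ring_hom E.T B.T"
  proof (rule ring_hom_memI)
    fix s assume "s \<in> carrier E.T" then show "?h s \<in> carrier B.T" by (auto simp: E.tensor_carrier h)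
  next
    fix s t assume "s \<in> carrier E.T" "t \<in> carrier E.T"
    then obtain u v where *: "u \<in> carrier E.P" "s = E.I +>\<^bsub>E.P\<^esub> u" "v \<in> carrier E.P" "t = E.I +>\<^bsub>E.P\<^esub> v"
      by (auto simp: E.tensor_carrier)
    show "?h (s \<otimes>\<^bsub>E.T\<^esub> t) = ?h s \<otimes>\<^bsub>B.T\<^esub> ?h t"
      using * h[of "u \<otimes>\<^bsub>E.P\<^esub> v"] h[of u] h[of v] by (simp add: E.pair_mult_closed)
    show "?h (s \<oplus>\<^bsub>E.T\<^esub> t) = ?h s \<oplus>\<^bsub>B.T\<^esub> ?h t"
      using * h[of "u \<oplus>\<^bsub>E.P\<^esub> v"] h[of u] h[of v] by simp
  next
    show "?h \<one>\<^bsub>E.T\<^esub> = \<one>\<^bsub>B.T\<^esub>" using h[of "\<one>\<^bsub>E.P\<^esub>"] by simp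
  qed
  show "?h (E.pt a e) = B.pt a (r e)" if "a \<in> carrier A" "e \<in> carrier E" for a e
    using h[of "frag_of (a, e)"] that by (simp add: E.pt_eq \<Phi>of)
qed

section \<open>Integral elements\<close>

text \<open>The values at \<open>x\<close> of polynomials of degree less than \<open>d\<close> over \<open>S\<close>, in Horner form, and of
  monic polynomials of degree \<open>d\<close>.\<close>

primrec low_values :: "('a, 'b) ring_scheme \<Rightarrow> 'a set \<Rightarrow> 'a \<Rightarrow> nat \<Rightarrow> 'a set" where
  "low_values A S x 0 = {\<zero>\<^bsub>A\<^esub>}"
| "low_values A S x (Suc d) = {s \<oplus>\<^bsub>A\<^esub> x \<otimes>\<^bsub>A\<^esub> l | s l. s \<in> S \<and> l \<in> low_values A S x d}"

definition monic_values :: "('a, 'b) ring_scheme \<Rightarrow> 'a set \<Rightarrow> 'a \<Rightarrow> nat \<Rightarrow> 'a set" where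
  "monic_values A S x d = {x [^]\<^bsub>A\<^esub> d \<oplus>\<^bsub>A\<^esub> l | l. l \<in> low_values A S x d}"

locale integral_setting = cring A for A :: "('a, 'b) ring_scheme" (structure) and S :: "'a set" +
  assumes S: "subring S A"
begin

lemma S_closed [simp]: "s \<in> S \<Longrightarrow> s \<in> carrier A"
  using subringE(1)[OF S] by auto

lemma S_rules [simp]: "\<zero> \<in> S" "\<one> \<in> S" "s \<in> S \<Longrightarrow> \<ominus> s \<in> S" "s \<in> S \<Longrightarrow> t \<in> S \<Longrightarrow> s \<oplus> t \<in> S"
  "s \<in> S \<Longrightarrow> t \<in> S \<Longrightarrow> s \<otimes> t \<in> S"
  using subringE(2,3,5,6,7)[OF S] by auto

abbreviation "low \<equiv> low_values A S"
abbreviation "mnc \<equiv> monic_values A S"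

lemma low_closed: "x \<in> carrier A \<Longrightarrow> l \<in> low x d \<Longrightarrow> l \<in> carrier A"
  by (induction d arbitrary: l) auto

lemma low_SucI: "s \<in> S \<Longrightarrow> l \<in> low x d \<Longrightarrow> s \<oplus> x \<otimes> l \<in> low x (Suc d)"
  by auto

lemma low_zero: "x \<in> carrier A \<Longrightarrow> \<zero> \<in> low x d"
proof (induction d)
  case (Suc d)
  then have "\<zero> \<oplus> x \<otimes> \<zero> \<in> low x (Suc d)" by (intro low_SucI) auto
  then show ?case using Suc by (simp del: low_values.simps)
qed simp

lemma low_add: "x \<in> carrier A \<Longrightarrow> l \<in> low x d \<Longrightarrow> m \<in> low x d \<Longrightarrow> l \<oplus> m \<in> low x d"
proof (induction d arbitrary: l m)
  case (Suc d)
  then obtain s l' t m' where *: "s \<in> S" "l' \<in> low x d" "l = s \<oplus> x \<otimes> l'"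
      "t \<in> S" "m' \<in> low x d" "m = t \<oplus> x \<otimes> m'" by auto
  then have c: "l' \<in> carrier A" "m' \<in> carrier A" using Suc.prems low_closed by auto
  then have "l \<oplus> m = (s \<oplus> t) \<oplus> x \<otimes> (l' \<oplus> m')" using * Suc.prems by (simp add: r_distr a_ac)
  moreover have "l' \<oplus> m' \<in> low x d" using Suc.IH * Suc.prems by simp
  moreover have "s \<oplus> t \<in> S" using * by simp
  ultimately show ?case using low_SucI by simp
qed simp

lemma low_smult: "x \<in> carrier A \<Longrightarrow> l \<in> low x d \<Longrightarrow> t \<in> S \<Longrightarrow> t \<otimes> l \<in> low x d"
proof (induction d arbitrary: l)
  case (Suc d)
  then obtain s l' where *: "s \<in> S" "l' \<in> low x d" "l = s \<oplus> x \<otimes> l'" by auto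
  then have c: "l' \<in> carrier A" using Suc.prems low_closed by auto
  then have "t \<otimes> l = t \<otimes> s \<oplus> x \<otimes> (t \<otimes> l')" using * Suc.prems by (simp add: r_distr m_ac)
  moreover have "t \<otimes> s \<in> S" "t \<otimes> l' \<in> low x d" using Suc.IH * Suc.prems by simp_all
  ultimately show ?case using low_SucI by simp
qed simp

lemma low_minus: "x \<in> carrier A \<Longrightarrow> l \<in> low x d \<Longrightarrow> \<ominus> l \<in> low x d"
  using low_smult[of x l d "\<ominus> \<one>"] low_closed[of x l d] by (simp add: l_minus)

lemma low_shift: "x \<in> carrier A \<Longrightarrow> l \<in> low x d \<Longrightarrow> x \<otimes> l \<in> low x (Suc d)"
proof -
  assume x: "x \<in> carrier A" and l: "l \<in> low x d"
  have "\<zero> \<oplus> x \<otimes> l \<in> low x (Suc d)" using l by (intro low_SucI) auto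
  then show ?thesis using x low_closed[OF x l] by simp
qed

lemma low_Suc: "x \<in> carrier A \<Longrightarrow> l \<in> low x d \<Longrightarrow> l \<in> low x (Suc d)"
proof (induction d arbitrary: l)
  case 0 then show ?case using low_zero[of x "Suc 0"] by simp
next
  case (Suc d) then show ?case by fastforce
qed

lemma low_mono: "x \<in> carrier A \<Longrightarrow> l \<in> low x d \<Longrightarrow> d \<le> e \<Longrightarrow> l \<in> low x e"
  by (induction e) (auto simp: le_Suc_eq simp del: low_values.simps(2) intro: low_Suc)

lemma low_const: "x \<in> carrier A \<Longrightarrow> s \<in> S \<Longrightarrow> s \<in> low x (Suc 0)"
  by force

lemma low_pow_mult: "x \<in> carrier A \<Longrightarrow> l \<in> low x d \<Longrightarrow> x [^] (k::nat) \<otimes> l \<in> low x (k + d)"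
proof (induction k)
  case (Suc k)
  have "x [^] Suc k \<otimes> l = x \<otimes> (x [^] k \<otimes> l)"
    using Suc.prems low_closed[OF Suc.prems(1,2)] by (simp add: m_ac)
  then show ?case using low_shift[OF Suc.prems(1) Suc.IH[OF Suc.prems]] by simp
qed (use low_closed in auto)

lemma low_mult: "x \<in> carrier A \<Longrightarrow> l \<in> low x d \<Longrightarrow> m \<in> low x e \<Longrightarrow> l \<otimes> m \<in> low x (d + e)"
proof (induction d arbitrary: l)
  case 0 then show ?case using low_zero low_closed by simp
next
  case (Suc d)
  then obtain s l' where *: "s \<in> S" "l' \<in> low x d" "l = s \<oplus> x \<otimes> l'" by auto
  then have c: "l' \<in> carrier A" "m \<in> carrier A" using Suc.prems low_closed by auto
  then have e: "l \<otimes> m = s \<otimes> m \<oplus> x \<otimes> (l' \<otimes> m)" using * Suc.prems(1) by (simp add: l_distr m_assoc)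
  have "s \<otimes> m \<in> low x (Suc d + e)"
    using low_mono[OF _ low_smult[OF _ Suc.prems(3) *(1)], of "Suc d + e"] Suc.prems by simp
  moreover have "x \<otimes> (l' \<otimes> m) \<in> low x (Suc d + e)"
    using low_shift[OF Suc.prems(1) Suc.IH[OF Suc.prems(1) *(2) Suc.prems(3)]] by simp
  ultimately show ?case unfolding e by (intro low_add Suc.prems)
qed

lemma mon_closed: "x \<in> carrier A \<Longrightarrow> m \<in> mnc x d \<Longrightarrow> m \<in> carrier A"
  using low_closed by (auto simp: monic_values_def)

lemma mon_add_low: "x \<in> carrier A \<Longrightarrow> m \<in> mnc x d \<Longrightarrow> l \<in> low x d \<Longrightarrow> m \<oplus> l \<in> mnc x d"
proof -
  assume x: "x \<in> carrier A" and m: "m \<in> mnc x d" and l: "l \<in> low x d"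
  obtain l' where l': "l' \<in> low x d" "m = x [^] d \<oplus> l'" using m by (auto simp: monic_values_def)
  then have "m \<oplus> l = x [^] d \<oplus> (l' \<oplus> l)" using low_closed[OF x] l x by (simp add: a_assoc)
  then show ?thesis using low_add[OF x l'(1) l] by (auto simp: monic_values_def)
qed

lemma mon_mult:
  assumes "x \<in> carrier A" "m \<in> mnc x d" "n \<in> mnc x e"
  shows "m \<otimes> n \<in> mnc x (d + e)"
proof -
  obtain l l' where *: "l \<in> low x d" "m = x [^] d \<oplus> l" "l' \<in> low x e" "n = x [^] e \<oplus> l'"
    using assms by (auto simp: monic_values_def)
  then have c: "l \<in> carrier A" "l' \<in> carrier A" using assms low_closed by auto
  have "m \<otimes> n = x [^] (d + e) \<oplus> (x [^] d \<otimes> l' \<oplus> x [^] e \<otimes> l \<oplus> l \<otimes> l')"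
    using c * assms by (simp add: l_distr r_distr nat_pow_mult[symmetric] a_ac m_comm)
  moreover have "x [^] d \<otimes> l' \<oplus> x [^] e \<otimes> l \<oplus> l \<otimes> l' \<in> low x (d + e)"
    using low_pow_mult[OF assms(1) *(3), of d] low_pow_mult[OF assms(1) *(1), of e]
      low_mult[OF assms(1) *(1,3)] assms(1) by (intro low_add) (auto simp: add.commute)
  ultimately show ?thesis by (auto simp: monic_values_def)
qed

lemma eval_in_low:
  assumes "x \<in> carrier A" "set p \<subseteq> S"
  shows "eval p x \<in> low x (length p)"
  using assms(2)
proof (induction p)
  case (Cons a p)
  have "x [^] length p \<otimes> a \<in> low x (length p + Suc 0)"
    using low_pow_mult[OF assms(1) low_const[OF assms(1)]] Cons.prems by simp
  moreover have "eval p x \<in> low x (Suc (length p))" using Cons assms(1) by (intro low_Suc) auto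
  moreover have "eval (a # p) x = x [^] length p \<otimes> a \<oplus> eval p x"
    using Cons.prems assms(1) by (simp add: m_comm)
  ultimately show ?case using low_add[OF assms(1)] by (simp del: low_values.simps)
qed simp

lemma low_as_eval:
  assumes "x \<in> carrier A" "l \<in> low x d"
  shows "\<exists>p. length p = d \<and> set p \<subseteq> S \<and> eval p x = l"
  using assms(2)
proof (induction d arbitrary: l)
  case (Suc d)
  then obtain s l' where *: "s \<in> S" "l' \<in> low x d" "l = s \<oplus> x \<otimes> l'" by auto
  obtain p where p: "length p = d" "set p \<subseteq> S" "eval p x = l'" using Suc.IH *(2) by blast
  have "l' \<in> carrier A" using *(2) low_closed assms(1) by simp
  moreover have "set p \<subseteq> carrier A" using p(2) S_closed by blast
  ultimately have "eval (p @ [s]) x = l"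
    using eval_append_aux[of p s x] * p assms(1) by (simp add: a_comm m_comm)
  then show ?case using p *(1) by (intro exI[of _ "p @ [s]"]) auto
qed simp

text \<open>Polynomials are lists with nonzero leading coefficient, so a monic one exists only if
  one differs from zero. The Horner values avoid polynomials in the arguments that follow.\<close>

lemma integral_iff:
  assumes "x \<in> carrier A" "\<one> \<noteq> \<zero>"
  shows "integral_over A S x \<longleftrightarrow> (\<exists>d. \<zero> \<in> mnc x d)"
proof
  assume "integral_over A S x"
  then obtain P where P: "polynomial S P" "P \<noteq> []" "hd P = \<one>" "eval P x = \<zero>"
    by (auto simp: integral_over_def univ_poly_carrier)
  then obtain p where p: "P = \<one> # p" by (cases P) auto
  have s: "set p \<subseteq> S" using P p by (auto simp: polynomial_def)
  have "\<zero> = x [^] length p \<oplus> eval p x" using P(4) assms(1) unfolding p by simp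
  then have "\<zero> \<in> mnc x (length p)"
    using eval_in_low[OF assms(1) s] unfolding monic_values_def by blast
  then show "\<exists>d. \<zero> \<in> mnc x d" ..
next
  assume "\<exists>d. \<zero> \<in> mnc x d"
  then obtain d l where l: "l \<in> low x d" "\<zero> = x [^] d \<oplus> l" by (auto simp: monic_values_def)
  obtain p where p: "length p = d" "set p \<subseteq> S" "eval p x = l" using low_as_eval[OF assms(1) l(1)] by blast
  then have "eval (\<one> # p) x = \<zero>" "polynomial S (\<one> # p)"
    using l assms by (auto simp: polynomial_def)
  then show "integral_over A S x"
    unfolding integral_over_def by (intro bexI[of _ "\<one> # p"]) (simp_all add: univ_poly_carrier[symmetric])
qed

text \<open>Elimination of the unknowns of a linear system whose matrix has monic diagonal entries of
  degree \<open>d\<close> and off-diagonal entries of lower degree: this replaces the determinant trick.\<close>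

lemma elimination:
  assumes "finite J" "x \<in> carrier A" "i0 \<notin> J"
    and "\<And>i. i \<in> insert i0 J \<Longrightarrow> v i \<in> carrier A"
    and "\<And>i. i \<in> insert i0 J \<Longrightarrow> M i i \<in> mnc x d"
    and "\<And>i j. i \<in> insert i0 J \<Longrightarrow> j \<in> insert i0 J \<Longrightarrow> i \<noteq> j \<Longrightarrow> M i j \<in> low x d"
    and "\<And>i. i \<in> insert i0 J \<Longrightarrow> (\<Oplus>j\<in>insert i0 J. M i j \<otimes> v j) = \<zero>"
  shows "\<exists>d'. \<exists>m\<in>mnc x d'. m \<otimes> v i0 = \<zero>"
  using assms
proof (induction J arbitrary: M d rule: finite_induct)
  case empty
  have "M i0 i0 \<in> mnc x d" using empty.prems by simp
  moreover from this have "M i0 i0 \<otimes> v i0 = \<zero>"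
    using empty.prems(6)[of i0] empty.prems(3)[of i0] mon_closed[OF empty.prems(1)] by simp
  ultimately show ?case by blast
next
  case (insert n J)
  let ?I = "insert i0 J"
  note x = insert.prems(1)
  have I: "finite ?I" "n \<notin> ?I" "insert i0 (insert n J) = insert n ?I" using insert.hyps insert.prems by auto
  have v: "v i \<in> carrier A" if "i \<in> insert n ?I" for i using insert.prems(3) that by auto
  have Md: "M i i \<in> mnc x d" if "i \<in> insert n ?I" for i using insert.prems(4) that by auto
  have Mo: "M i j \<in> low x d" if "i \<in> insert n ?I" "j \<in> insert n ?I" "i \<noteq> j" for i j
    using insert.prems(5) that by auto
  have Mc: "M i j \<in> carrier A" if "i \<in> insert n ?I" "j \<in> insert n ?I" for i j
    using Md Mo low_closed[OF x] mon_closed[OF x] that by metis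
  \<comment> \<open>Elimination of \<open>v n\<close> without fractions, with pivot
    \<open>M n n\<close>. The diagonal entries become monic of degree d + d, and the correction, a
    product of two values of degree below d, stays below d + d.\<close>
  define M' where "M' i j = M n n \<otimes> M i j \<ominus> M i n \<otimes> M n j" for i j
  define \<Sigma> where "\<Sigma> i = (\<Oplus>j\<in>?I. M i j \<otimes> v j)" for i
  have \<Sigma>c: "\<Sigma> i \<in> carrier A" if "i \<in> insert n ?I" for i
    unfolding \<Sigma>_def using that Mc v by (intro finsum_closed) auto
  have row: "M i n \<otimes> v n \<oplus> \<Sigma> i = \<zero>" if "i \<in> insert n ?I" for i
    using insert.prems(6)[of i] that I(1,2) Mc[OF that] v unfolding \<Sigma>_def I(3) by (subst (asm) finsum_insert) auto
  show ?case
  proof (rule insert.IH[of M' "d + d"])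
    show "x \<in> carrier A" by (rule x)
    show "i0 \<notin> J" using insert.prems by simp
    show "v i \<in> carrier A" if "i \<in> ?I" for i using v that by simp
    show "M' i i \<in> mnc x (d + d)" if "i \<in> ?I" for i
    proof -
      have "i \<noteq> n" using that I by auto
      then have "M i n \<otimes> M n i \<in> low x (d + d)" using that by (intro low_mult x Mo) auto
      then show ?thesis unfolding M'_def a_minus_def
        using that by (intro mon_add_low mon_mult x Md low_minus) auto
    qed
    show "M' i j \<in> low x (d + d)" if "i \<in> ?I" "j \<in> ?I" "i \<noteq> j" for i j
    proof -
      have ne: "i \<noteq> n" "j \<noteq> n" using that I by auto
      then have 1: "M i n \<otimes> M n j \<in> low x (d + d)" using that by (intro low_mult x Mo) auto
      obtain l where l: "l \<in> low x d" "M n n = x [^] d \<oplus> l" using Md[of n] by (auto simp: monic_values_def)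
      have Mij: "M i j \<in> low x d" using Mo that by simp
      have "M n n \<otimes> M i j = x [^] d \<otimes> M i j \<oplus> l \<otimes> M i j"
        using l low_closed[OF x] Mij x by (simp add: l_distr)
      then have "M n n \<otimes> M i j \<in> low x (d + d)"
        using low_pow_mult[OF x Mij, of d] low_mult[OF x l(1) Mij] low_add[OF x] by simp
      then show ?thesis unfolding M'_def a_minus_def using 1 by (intro low_add low_minus x)
    qed
    show "(\<Oplus>j\<in>?I. M' i j \<otimes> v j) = \<zero>" if i: "i \<in> ?I" for i
    proof -
      have i': "i \<in> insert n ?I" "n \<in> insert n ?I" using i by auto
      have "(\<Oplus>j\<in>?I. M' i j \<otimes> v j) = (\<Oplus>j\<in>?I. M n n \<otimes> (M i j \<otimes> v j) \<oplus> (\<ominus> M i n) \<otimes> (M n j \<otimes> v j))"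
        using Mc v i' by (intro finsum_cong') (auto simp: M'_def a_minus_def l_distr m_assoc l_minus)
      also have "\<dots> = (\<Oplus>j\<in>?I. M n n \<otimes> (M i j \<otimes> v j)) \<oplus> (\<Oplus>j\<in>?I. (\<ominus> M i n) \<otimes> (M n j \<otimes> v j))"
        using Mc v i' by (intro finsum_addf) auto
      also have "\<dots> = M n n \<otimes> \<Sigma> i \<oplus> (\<ominus> M i n) \<otimes> \<Sigma> n"
        unfolding \<Sigma>_def using I(1) Mc v i' by (subst (1 2) finsum_rdistr) auto
      also have "\<Sigma> i = \<ominus> (M i n \<otimes> v n)"
        using row[OF i'(1)] \<Sigma>c[OF i'(1)] Mc[OF i'] v[OF i'(2)] minus_equality by (metis a_comm m_closed minus_minus)
      also have "\<Sigma> n = \<ominus> (M n n \<otimes> v n)"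
        using row[OF i'(2)] \<Sigma>c[OF i'(2)] Mc[OF i'(2) i'(2)] v[OF i'(2)] minus_equality by (metis a_comm m_closed minus_minus)
      finally show ?thesis
        using Mc[OF i'] Mc[OF i'(2) i'(2)] v[OF i'(2)] by (simp add: l_minus r_minus m_ac l_neg)
    qed
  qed
qed

text \<open>The matrix of u minus the coefficients c has monic entries of degree one on its diagonal
  and constants elsewhere. Elimination gives a monic value in u that annihilates
  \<open>v i0\<close>, which is one.\<close>

lemma integral_of_finite_module:
  assumes "finite J" "i0 \<in> J" "v i0 = \<one>" "\<And>i. i \<in> J \<Longrightarrow> v i \<in> carrier A" and u: "u \<in> carrier A"
    and c: "\<And>i j. i \<in> J \<Longrightarrow> j \<in> J \<Longrightarrow> c i j \<in> S"
    and eq: "\<And>i. i \<in> J \<Longrightarrow> u \<otimes> v i = (\<Oplus>j\<in>J. c i j \<otimes> v j)"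
    and "\<one> \<noteq> \<zero>"
  shows "integral_over A S u"
proof -
  let ?J = "J - {i0}"
  have J: "insert i0 ?J = J" using assms by auto
  define M where "M i j = (if i = j then u else \<zero>) \<ominus> c i j" for i j
  have "\<exists>d'. \<exists>m\<in>mnc u d'. m \<otimes> v i0 = \<zero>"
  proof (rule elimination[of ?J u i0 v M "Suc 0"], unfold J)
    show "M i i \<in> mnc u (Suc 0)" if "i \<in> J" for i
      using low_minus[OF u low_const[OF u c[OF that that]]] u unfolding M_def monic_values_def a_minus_def
      by (intro CollectI exI[of _ "\<ominus> c i i"]) (simp add: numeral_nat)
    show "M i j \<in> low u (Suc 0)" if "i \<in> J" "j \<in> J" "i \<noteq> j" for i j
      using low_minus[OF u low_const[OF u c[OF that(1,2)]]] that c by (simp add: M_def a_minus_def del: low_values.simps)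
    show "(\<Oplus>j\<in>J. M i j \<otimes> v j) = \<zero>" if i: "i \<in> J" for i
    proof -
      have cc: "c i j \<in> carrier A" if "j \<in> J" for j using c[OF i that] by simp
      have "(\<Oplus>j\<in>J. M i j \<otimes> v j) = (\<Oplus>j\<in>J. (if i = j then u \<otimes> v j else \<zero>) \<oplus> (\<ominus> \<one>) \<otimes> (c i j \<otimes> v j))"
        using assms(4) u cc by (intro finsum_cong') (auto simp: M_def a_minus_def l_distr l_minus)
      also have "\<dots> = (\<Oplus>j\<in>J. (if i = j then u \<otimes> v j else \<zero>)) \<oplus> (\<Oplus>j\<in>J. (\<ominus> \<one>) \<otimes> (c i j \<otimes> v j))"
        using assms(4) u cc by (intro finsum_addf) auto
      also have "(\<Oplus>j\<in>J. (if i = j then u \<otimes> v j else \<zero>)) = u \<otimes> v i"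
        using add.finprod_singleton[of i J "\<lambda>j. u \<otimes> v j"] i assms(1,4) u by auto
      also have "(\<Oplus>j\<in>J. (\<ominus> \<one>) \<otimes> (c i j \<otimes> v j)) = (\<ominus> \<one>) \<otimes> (u \<otimes> v i)"
        unfolding eq[OF i] using assms(1,4) cc by (subst finsum_rdistr) auto
      finally show ?thesis using u assms(4)[OF i] by (simp add: l_minus r_neg)
    qed
  qed (use assms in auto)
  then obtain d m where "m \<in> mnc u d" "m \<otimes> v i0 = \<zero>" by blast
  then have "\<zero> \<in> mnc u d" using assms(3) mon_closed[OF u] by simp
  then show ?thesis using integral_iff[OF u assms(8)] by blast
qed

text \<open>Multiplication by x. It makes the degrees of two integral equations positive, so that
  one is among the products of powers used as generators.\<close>

lemma mon_zero_Suc: "x \<in> carrier A \<Longrightarrow> \<zero> \<in> mnc x d \<Longrightarrow> \<zero> \<in> mnc x (Suc d)"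
proof -
  assume x: "x \<in> carrier A" and z: "\<zero> \<in> mnc x d"
  have "\<zero> \<oplus> x \<otimes> \<one> \<in> low x (Suc (Suc 0))" by (rule low_add[OF x low_zero[OF x] low_shift[OF x low_const[OF x]]]) simp
  have "x \<in> mnc x (Suc 0)" using x low_zero[OF x, of "Suc 0"] unfolding monic_values_def
    by (intro CollectI exI[of _ "\<zero>"]) (simp add: numeral_nat del: low_values.simps)
  from mon_mult[OF x this z] show ?thesis using x by simp
qed

text \<open>For \<open>x^a\<close> and \<open>y^b\<close> in the span of the lower powers, the span of the \<open>x^i y^j\<close> with \<open>i < a\<close>
  and \<open>j < b\<close> is stable under both \<open>x\<close> and \<open>y\<close>.\<close>

lemma integral_sum_product:
  assumes x: "x \<in> carrier A" "integral_over A S x" and y: "y \<in> carrier A" "integral_over A S y"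
    and nt: "\<one> \<noteq> \<zero>"
  shows "integral_over A S (x \<oplus> y)" "integral_over A S (x \<otimes> y)"
proof -
  obtain a' b' where "\<zero> \<in> mnc x a'" "\<zero> \<in> mnc y b'" using integral_iff x y nt by metis
  then have "\<zero> \<in> mnc x (Suc a')" "\<zero> \<in> mnc y (Suc b')" using mon_zero_Suc x y by auto
  then obtain a b where ab: "0 < a" "0 < b" and m: "\<zero> \<in> mnc x a" "\<zero> \<in> mnc y b" by blast
  obtain lx where lx: "lx \<in> low x a" "x [^] a \<oplus> lx = \<zero>" using m(1) by (auto simp: monic_values_def)
  obtain ly where ly: "ly \<in> low y b" "y [^] b \<oplus> ly = \<zero>" using m(2) by (auto simp: monic_values_def)
  have pxa: "x [^] a = \<ominus> lx" using lx low_closed[OF x(1)] x(1) by (metis minus_equality nat_pow_closed)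
  have pyb: "y [^] b = \<ominus> ly" using ly low_closed[OF y(1)] y(1) by (metis minus_equality nat_pow_closed)
  define J where "J = {..<a} \<times> {..<b}"
  define v where "v = (\<lambda>(i::nat, j::nat). x [^] i \<otimes> y [^] j)"
  define V where "V = {\<Oplus>j\<in>J. c j \<otimes> v j | c. c \<in> J \<rightarrow> S}"
  have fJ: "finite J" by (simp add: J_def)
  have vc: "v j \<in> carrier A" for j using x y by (cases j) (simp add: v_def)
  have Vc: "w \<in> carrier A" if "w \<in> V" for w using that vc S_closed by (auto simp: V_def Pi_def intro!: finsum_closed)
  have Vadd: "w \<oplus> w' \<in> V" if ww: "w \<in> V" "w' \<in> V" for w w'
  proof -
    obtain c c' where c: "c \<in> J \<rightarrow> S" "w = (\<Oplus>j\<in>J. c j \<otimes> v j)" "c' \<in> J \<rightarrow> S" "w' = (\<Oplus>j\<in>J. c' j \<otimes> v j)"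
      using ww by (auto simp: V_def)
    have "w \<oplus> w' = (\<Oplus>j\<in>J. c j \<otimes> v j \<oplus> c' j \<otimes> v j)"
      unfolding c(2,4) using vc c(1,3) by (intro finsum_addf[symmetric]) (auto simp: Pi_def)
    also have "\<dots> = (\<Oplus>j\<in>J. (c j \<oplus> c' j) \<otimes> v j)"
      using vc c by (intro finsum_cong') (auto simp: Pi_def l_distr)
    finally show ?thesis unfolding V_def using c(1,3)
      by (intro CollectI exI[of _ "\<lambda>j. c j \<oplus> c' j"]) (auto simp: Pi_def)
  qed
  have Vs: "s \<otimes> w \<in> V" if sw: "s \<in> S" "w \<in> V" for s w
  proof -
    obtain c where c: "c \<in> J \<rightarrow> S" "w = (\<Oplus>j\<in>J. c j \<otimes> v j)" using sw by (auto simp: V_def)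
    have "s \<otimes> w = (\<Oplus>j\<in>J. s \<otimes> (c j \<otimes> v j))" 
      unfolding c(2) using vc sw fJ c(1) by (intro finsum_rdistr) (auto simp: Pi_def)
    also have "\<dots> = (\<Oplus>j\<in>J. (s \<otimes> c j) \<otimes> v j)" using vc c that by (intro finsum_cong') (auto simp: Pi_def m_assoc)
    finally show ?thesis unfolding V_def using c(1) that
      by (intro CollectI exI[of _ "\<lambda>j. s \<otimes> c j"]) (auto simp: Pi_def)
  qed
  have Vv: "v i \<in> V" if "i \<in> J" for i
  proof -
    have "(\<Oplus>j\<in>J. (if i = j then \<one> else \<zero>) \<otimes> v j) = (\<Oplus>j\<in>J. if i = j then v j else \<zero>)"
      using vc by (intro finsum_cong') auto
    also have "\<dots> = v i" using add.finprod_singleton[of i J v] that fJ vc by auto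
    finally show ?thesis unfolding V_def
      by (intro CollectI exI[of _ "\<lambda>j. if i = j then \<one> else \<zero>"]) auto
  qed
  have V0: "\<zero> \<in> V" using Vs[of \<zero> "v (0, 0)"] Vv[of "(0, 0)"] ab vc by (auto simp: J_def)
  \<comment> \<open>Unfolding the Horner form collects the factors x in x^e; the bound on d + e
    keeps every exponent that occurs below a.\<close>
  have lowx: "x [^] e \<otimes> l \<otimes> y [^] j \<in> V" if "l \<in> low x d" "d + e \<le> a" "j < b" for l d e j
    using that
  proof (induction d arbitrary: l e)
    case 0 then show ?case using V0 x y by simp
  next
    case (Suc d)
    then obtain s l' where *: "s \<in> S" "l' \<in> low x d" "l = s \<oplus> x \<otimes> l'" by auto
    have l': "l' \<in> carrier A" using *(2) low_closed x by auto
    have "x [^] e \<otimes> l \<otimes> y [^] j = s \<otimes> v (e, j) \<oplus> x [^] Suc e \<otimes> l' \<otimes> y [^] j"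
      using * l' x y by (simp add: v_def l_distr r_distr m_ac)
    moreover have "s \<otimes> v (e, j) \<in> V" using Suc.prems * by (intro Vs Vv) (auto simp: J_def)
    moreover have "x [^] Suc e \<otimes> l' \<otimes> y [^] j \<in> V" using Suc.prems * by (intro Suc.IH) auto
    ultimately show ?case using Vadd by simp
  qed
  have lowy: "y [^] e \<otimes> l \<otimes> x [^] j \<in> V" if "l \<in> low y d" "d + e \<le> b" "j < a" for l d e j
    using that
  proof (induction d arbitrary: l e)
    case 0 then show ?case using V0 x y by simp
  next
    case (Suc d)
    then obtain s l' where *: "s \<in> S" "l' \<in> low y d" "l = s \<oplus> y \<otimes> l'" by auto
    have l': "l' \<in> carrier A" using *(2) low_closed y by auto
    have "y [^] e \<otimes> l \<otimes> x [^] j = s \<otimes> v (j, e) \<oplus> y [^] Suc e \<otimes> l' \<otimes> x [^] j"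
      using * l' x y by (simp add: v_def l_distr r_distr m_ac)
    moreover have "s \<otimes> v (j, e) \<in> V" using Suc.prems * by (intro Vs Vv) (auto simp: J_def)
    moreover have "y [^] Suc e \<otimes> l' \<otimes> x [^] j \<in> V" using Suc.prems * by (intro Suc.IH) auto
    ultimately show ?case using Vadd by simp
  qed
  have xv: "x \<otimes> v j \<in> V" if "j \<in> J" for j
  proof (cases j)
    case (Pair i k)
    show ?thesis
    proof (cases "Suc i < a")
      case True
      then have "x \<otimes> v j = v (Suc i, k)" using x y Pair by (simp add: v_def m_ac)
      then show ?thesis using Vv True that Pair by (auto simp: J_def)
    next
      case False
      then have i: "Suc i = a" "k < b" using that Pair by (auto simp: J_def)
      have "x \<otimes> v j = x [^] Suc i \<otimes> y [^] k" using x y Pair by (simp add: v_def m_ac)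
      also have "\<dots> = x [^] (0::nat) \<otimes> (\<ominus> lx) \<otimes> y [^] k" using i pxa x low_closed[OF x(1) lx(1)] by simp
      also have "\<dots> \<in> V" using lowx[OF low_minus[OF x(1) lx(1)], of 0 k] i by simp
      finally show ?thesis .
    qed
  qed
  have yv: "y \<otimes> v j \<in> V" if "j \<in> J" for j
  proof (cases j)
    case (Pair i k)
    show ?thesis
    proof (cases "Suc k < b")
      case True
      then have "y \<otimes> v j = v (i, Suc k)" using x y Pair by (simp add: v_def m_ac)
      then show ?thesis using Vv True that Pair by (auto simp: J_def)
    next
      case False
      then have i: "Suc k = b" "i < a" using that Pair by (auto simp: J_def)
      have "y \<otimes> v j = y [^] Suc k \<otimes> x [^] i" using x y Pair by (simp add: v_def m_ac)
      also have "\<dots> = y [^] (0::nat) \<otimes> (\<ominus> ly) \<otimes> x [^] i" using i pyb y low_closed[OF y(1) ly(1)] by simp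
      also have "\<dots> \<in> V" using lowy[OF low_minus[OF y(1) ly(1)], of 0 i] i by simp
      finally show ?thesis .
    qed
  qed
  have Vsum: "(\<Oplus>j\<in>J'. w j) \<in> V" if "finite J'" "\<And>j. j \<in> J' \<Longrightarrow> w j \<in> V" for w and J' :: "(nat \<times> nat) set"
    using that
  proof (induction J' rule: finite_induct)
    case (insert j J')
    then have "(\<Oplus>j\<in>insert j J'. w j) = w j \<oplus> (\<Oplus>j\<in>J'. w j)" using Vc by (intro finsum_insert) auto
    then show ?case using insert Vadd by simp
  qed (simp add: V0)
  have xV: "x \<otimes> w \<in> V" if "w \<in> V" for w
  proof -
    obtain c where c: "c \<in> J \<rightarrow> S" "w = (\<Oplus>j\<in>J. c j \<otimes> v j)" using \<open>w \<in> V\<close> by (auto simp: V_def)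
    have "x \<otimes> w = (\<Oplus>j\<in>J. x \<otimes> (c j \<otimes> v j))" 
      unfolding c(2) using vc x fJ c(1) by (intro finsum_rdistr) (auto simp: Pi_def)
    also have "\<dots> = (\<Oplus>j\<in>J. c j \<otimes> (x \<otimes> v j))" using vc x c by (intro finsum_cong') (auto simp: Pi_def m_lcomm)
    also have "\<dots> \<in> V"
    proof (rule Vsum[OF fJ])
      fix j assume j: "j \<in> J"
      then show "c j \<otimes> (x \<otimes> v j) \<in> V" using Vs[OF funcset_mem[OF c(1) j] xv[OF j]] by simp
    qed
    finally show ?thesis .
  qed
  have integral: "integral_over A S u" if u: "u \<in> carrier A" "\<And>j. j \<in> J \<Longrightarrow> u \<otimes> v j \<in> V" for u
  proof -
    have "\<forall>i\<in>J. \<exists>c. c \<in> J \<rightarrow> S \<and> u \<otimes> v i = (\<Oplus>j\<in>J. c j \<otimes> v j)"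
      using u(2) unfolding V_def mem_Collect_eq by blast
    then obtain c where "\<And>i. i \<in> J \<Longrightarrow> c i \<in> J \<rightarrow> S \<and> u \<otimes> v i = (\<Oplus>j\<in>J. c i j \<otimes> v j)" by metis
    then show ?thesis using ab vc u nt
      by (intro integral_of_finite_module[OF fJ, of "(0, 0)" v u c]) (auto simp: J_def v_def)
  qed
  show "integral_over A S (x \<oplus> y)"
    using x y vc xv yv Vadd by (intro integral) (auto simp: l_distr)
  show "integral_over A S (x \<otimes> y)"
  proof (rule integral)
    show "x \<otimes> y \<otimes> v j \<in> V" if "j \<in> J" for j
      using xV[OF yv[OF that]] x y vc by (simp add: m_assoc)
  qed (use x y in simp)
qed

lemma integral_base:
  assumes "s \<in> S" "\<one> \<noteq> \<zero>" shows "integral_over A S s"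
proof -
  have "\<zero> = s [^] Suc 0 \<oplus> \<ominus> s" using assms by (simp add: numeral_nat r_neg)
  moreover have "\<ominus> s \<in> low s (Suc 0)" using low_const[of s "\<ominus> s"] assms by simp
  ultimately have "\<zero> \<in> mnc s (Suc 0)" unfolding monic_values_def by blast
  then show ?thesis using integral_iff[of s] assms by auto
qed

lemma integral_closure_subring:
  assumes E: "subring E A" and "S \<subseteq> E" and nt: "\<one> \<noteq> \<zero>"
  shows "subring {x \<in> E. integral_over A S x} A"
proof (rule subringI)
  note E' = subringE[OF E]
  have Ec: "x \<in> carrier A" if "x \<in> E" for x using E'(1) that by auto
  show "{x \<in> E. integral_over A S x} \<subseteq> carrier A" using E'(1) by auto
  show "\<one> \<in> {x \<in> E. integral_over A S x}" using E'(3) integral_base nt by simp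
  fix x y assume x: "x \<in> {x \<in> E. integral_over A S x}" and y: "y \<in> {x \<in> E. integral_over A S x}"
  show "x \<oplus> y \<in> {x \<in> E. integral_over A S x}" "x \<otimes> y \<in> {x \<in> E. integral_over A S x}"
    using x y E'(6,7) integral_sum_product[of x y] Ec nt by auto
  have "\<ominus> x = (\<ominus> \<one>) \<otimes> x" using Ec x by (simp add: l_minus)
  then show "\<ominus> x \<in> {x \<in> E. integral_over A S x}"
    using x E'(5)[of x] integral_sum_product(2)[of "\<ominus> \<one>" x] integral_base[of "\<ominus> \<one>"] Ec[of x] nt
    by simp
qed

end

text \<open>If n + 1 is the degree, multiplying the equation by a^n turns it into a monic equation
  for a times x.\<close>

lemma (in integral_setting) integral_leading_multiple:
  assumes x: "x \<in> carrier A" and a: "a \<in> S" and q: "set q \<subseteq> S" "q \<noteq> []"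
    and z: "eval (a # q) x = \<zero>" and nt: "\<one> \<noteq> \<zero>"
  shows "integral_over A S (a \<otimes> x)"
proof -
  let ?y = "a \<otimes> x"
  have y: "?y \<in> carrier A" and ac: "a \<in> carrier A" using a x by auto
  have low: "a [^] m \<otimes> eval q' x \<in> low ?y (length q')" if "set q' \<subseteq> S" "length q' \<le> Suc m" for q' and m :: nat
    using that
  proof (induction q')
    case (Cons b q')
    let ?l = "length q'"
    have b: "b \<in> S" and l: "?l \<le> m" using Cons.prems by auto
    have "a [^] m = a [^] (m - ?l) \<otimes> a [^] ?l" using ac l by (simp add: nat_pow_mult)
    then have "a [^] m \<otimes> (b \<otimes> x [^] ?l) = ?y [^] ?l \<otimes> (a [^] (m - ?l) \<otimes> b)"
      using ac b x by (simp add: nat_pow_distrib m_ac)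
    moreover have "a [^] k \<in> S" for k :: nat using a by (induction k) auto
    ultimately have "a [^] m \<otimes> (b \<otimes> x [^] ?l) \<in> low ?y (Suc ?l)"
      using low_pow_mult[OF y low_const[OF y], of "a [^] (m - ?l) \<otimes> b" ?l] b by simp
    moreover have "a [^] m \<otimes> eval q' x \<in> low ?y (Suc ?l)" using Cons y by (intro low_Suc) auto
    moreover have "eval q' x \<in> carrier A" using Cons.prems x S_closed by (intro eval_in_carrier) auto
    then have "a [^] m \<otimes> eval (b # q') x = a [^] m \<otimes> (b \<otimes> x [^] ?l) \<oplus> a [^] m \<otimes> eval q' x"
      using ac b x by (simp add: r_distr)
    ultimately show ?case using low_add[OF y] by (simp del: low_values.simps eval.simps)
  qed (use ac in simp)
  obtain n where n: "length q = Suc n" using q(2) by (cases q) auto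
  have ev: "eval q x \<in> carrier A" using q x S_closed by (intro eval_in_carrier) auto
  have "a [^] n \<otimes> (a \<otimes> x [^] Suc n \<oplus> eval q x) = \<zero>" using z ac n by simp
  moreover have "a [^] n \<otimes> (a \<otimes> x [^] Suc n \<oplus> eval q x) = ?y [^] Suc n \<oplus> a [^] n \<otimes> eval q x"
    using ac x ev by (simp add: r_distr nat_pow_distrib m_ac)
  ultimately have "\<zero> = ?y [^] Suc n \<oplus> a [^] n \<otimes> eval q x" by simp
  moreover have "a [^] n \<otimes> eval q x \<in> low ?y (Suc n)" using low[of q n] q n by simp
  ultimately have "\<zero> \<in> mnc ?y (Suc n)" unfolding monic_values_def by blast
  then show ?thesis using integral_iff[OF y nt] by blast
qed

lemma integral_over_hom:
  assumes "cring A" "cring B" "h \<in> ring_hom A B" "\<one>\<^bsub>B\<^esub> \<noteq> \<zero>\<^bsub>B\<^esub>" "S \<subseteq> carrier A" "x \<in> carrier A" "integral_over A S x"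
    "h ` S \<subseteq> S'"
  shows "integral_over B S' (h x)"
proof -
  interpret A: cring A by fact
  interpret B: cring B by fact
  interpret h: ring_hom_ring A B h using assms A.ring_axioms B.ring_axioms by (intro ring_hom_ringI2)
  obtain P where P: "polynomial\<^bsub>A\<^esub> S P" "P \<noteq> []" "hd P = \<one>\<^bsub>A\<^esub>" "A.eval P x = \<zero>\<^bsub>A\<^esub>"
    using assms(7) by (auto simp: integral_over_def univ_poly_carrier)
  have s: "set P \<subseteq> S" using P by (auto simp: polynomial_def)
  have "polynomial\<^bsub>B\<^esub> S' (map h P)"
    using s P assms(4,8) by (auto simp: polynomial_def hd_map)
  moreover have "B.eval (map h P) (h x) = \<zero>\<^bsub>B\<^esub>"
    using h.eval_hom'[of x P] s assms P(4) by auto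
  ultimately show ?thesis using P
    unfolding integral_over_def by (intro bexI[of _ "map h P"]) (auto simp: univ_poly_carrier[symmetric] hd_map)
qed

text \<open>A monic polynomial that splits is a product of linear factors; splitting off one root
  after the other keeps all coefficients in the subring containing the roots.\<close>

lemma (in field) monic_integral_roots:
  assumes spl: "\<And>p. p \<in> carrier (poly_ring R) \<Longrightarrow> splitted p"
    and D: "subring D R"
    and p: "polynomial (carrier R) p" "p \<noteq> []" "hd p = \<one>"
    and roots: "\<And>a. a \<in> carrier R \<Longrightarrow> eval p a = \<zero> \<Longrightarrow> a \<in> D"
  shows "polynomial D p"
  using p roots
proof (induction "length p" arbitrary: p rule: less_induct)
  case less
  show ?case
  proof (cases "degree p = 0")
    case True
    then have "p = [\<one>]" using less.prems by (cases p) auto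
    then show ?thesis using subringE(3)[OF D] by (auto simp: polynomial_def)
  next
    case False
    have pc: "p \<in> carrier (poly_ring R)" using less.prems by (simp add: univ_poly_carrier)
    have "size (roots p) = degree p" using spl[OF pc] by (simp add: splitted_def)
    then have "roots p \<noteq> {#}" using False by auto
    then obtain a where "a \<in># roots p" by blast
    then have r: "is_root p a" using roots_mem_iff_is_root[OF pc] by simp
    then have a: "a \<in> carrier R" "eval p a = \<zero>" by (auto simp: is_root_def)
    obtain q where q: "q \<in> carrier (poly_ring R)" "p = [\<one>, \<ominus> a] \<otimes>\<^bsub>poly_ring R\<^esub> q"
      using is_root_imp_pdivides[OF pc r] by (auto simp: pdivides_def)
    have b: "polynomial (carrier R) [\<one>, \<ominus> a]" using a by (auto simp: polynomial_def)
    have q': "polynomial (carrier R) q" "p = poly_mult [\<one>, \<ominus> a] q"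
      using q by (auto simp: univ_poly_carrier univ_poly_mult)
    have qn: "q \<noteq> []" using q' less.prems(2) poly_mult_zero(2)[of "[\<one>, \<ominus> a]"] a by auto
    have "hd p = \<one> \<otimes> hd q"
      using poly_mult_lead_coeff[OF carrier_is_subring b q'(1)] qn q'(2) by simp
    then have hq: "hd q = \<one>" using less.prems(3) q'(1) qn lead_coeff_in_carrier[OF carrier_is_subring, of "hd q" "tl q"] by auto
    have "degree p = Suc (degree q)"
      using poly_mult_degree_eq[OF carrier_is_subring b q'(1)] qn q'(2) by simp
    then have len: "length q < length p" by (cases q; cases p) auto
    have "polynomial D q"
    proof (rule less.hyps[OF len q'(1) qn hq])
      fix c assume c: "c \<in> carrier R" "eval q c = \<zero>"
      have "eval p c = eval [\<one>, \<ominus> a] c \<otimes> eval q c"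
        unfolding q'(2) using polynomial_in_carrier[OF carrier_is_subring q'(1)] a c by (intro eval_poly_mult) auto
      then show "c \<in> D" using c a less.prems(4) by simp
    qed
    moreover have "polynomial D [\<one>, \<ominus> a]"
      using less.prems(4)[OF a] subringE(3,5)[OF D] by (auto simp: polynomial_def)
    ultimately show ?thesis unfolding q'(2) by (intro poly_mult_closed[OF D])
  qed
qed

section \<open>The field extension\<close>

text \<open>These closure properties suffice to make the image in a ring a subring, since the ring
  axioms of the image are inherited from the target.\<close>

lemma padic_integers_closed:
  assumes "0 < p"
  shows "\<one>\<^bsub>padic_integers p\<^esub> \<in> carrier (padic_integers p)"
    and "\<zero>\<^bsub>padic_integers p\<^esub> \<in> carrier (padic_integers p)"
    and "x \<in> carrier (padic_integers p) \<Longrightarrow> y \<in> carrier (padic_integers p) \<Longrightarrow>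
      x \<oplus>\<^bsub>padic_integers p\<^esub> y \<in> carrier (padic_integers p)"
    and "x \<in> carrier (padic_integers p) \<Longrightarrow> y \<in> carrier (padic_integers p) \<Longrightarrow>
      x \<otimes>\<^bsub>padic_integers p\<^esub> y \<in> carrier (padic_integers p)"
    and "x \<in> carrier (padic_integers p) \<Longrightarrow>
      \<exists>y\<in>carrier (padic_integers p). x \<oplus>\<^bsub>padic_integers p\<^esub> y = \<zero>\<^bsub>padic_integers p\<^esub>"
    and "\<zero>\<^bsub>padic_integers p\<^esub> \<oplus>\<^bsub>padic_integers p\<^esub> \<zero>\<^bsub>padic_integers p\<^esub> = \<zero>\<^bsub>padic_integers p\<^esub>"
proof -
  have pos: "0 < int p ^ n" for n using assms by simp
  have mm: "a mod int p ^ Suc n mod int p ^ n = a mod int p ^ n"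
    "a mod (int p ^ n * int p) mod int p ^ n = a mod int p ^ n"
    "a mod (int p * int p ^ n) mod int p ^ n = a mod int p ^ n" for a n
    by (rule mod_mod_cancel; simp)+
  have bd: "a mod int p ^ n \<in> {0..<int p ^ n}" for a n using pos[of n] by simp
  show "\<one>\<^bsub>padic_integers p\<^esub> \<in> carrier (padic_integers p)"
    using bd by (simp add: padic_integers_def mm del: power_Suc)
  show "\<zero>\<^bsub>padic_integers p\<^esub> \<in> carrier (padic_integers p)"
    using pos by (simp add: padic_integers_def)
  show "\<zero>\<^bsub>padic_integers p\<^esub> \<oplus>\<^bsub>padic_integers p\<^esub> \<zero>\<^bsub>padic_integers p\<^esub> = \<zero>\<^bsub>padic_integers p\<^esub>"
    by (simp add: padic_integers_def)
  assume "x \<in> carrier (padic_integers p)"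
  then have x: "x n \<in> {0..<int p ^ n}" "x (Suc n) mod int p ^ n = x n" for n
    by (simp_all add: padic_integers_def)
  let ?y = "\<lambda>n. (- x n) mod int p ^ n"
  have "?y \<in> carrier (padic_integers p)"
    using bd x(2) by (simp add: padic_integers_def mm del: power_Suc) (metis mod_minus_eq)
  moreover have "x \<oplus>\<^bsub>padic_integers p\<^esub> ?y = \<zero>\<^bsub>padic_integers p\<^esub>"
    by (simp add: padic_integers_def mod_simps)
  ultimately show "\<exists>y\<in>carrier (padic_integers p). x \<oplus>\<^bsub>padic_integers p\<^esub> y = \<zero>\<^bsub>padic_integers p\<^esub>" by blast
  assume "y \<in> carrier (padic_integers p)"
  then have y: "y n \<in> {0..<int p ^ n}" "y (Suc n) mod int p ^ n = y n" for n
    by (simp_all add: padic_integers_def)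
  show "x \<oplus>\<^bsub>padic_integers p\<^esub> y \<in> carrier (padic_integers p)"
    using bd x(2) y(2) by (simp add: padic_integers_def mm del: power_Suc) (metis mod_add_eq)
  show "x \<otimes>\<^bsub>padic_integers p\<^esub> y \<in> carrier (padic_integers p)"
    using bd x(2) y(2) by (simp add: padic_integers_def mm del: power_Suc) (metis mod_mult_eq)
qed

lemma padic_image_subring:
  assumes "0 < p" "ring k" "z \<in> ring_hom (padic_integers p) k"
  shows "subring (z ` carrier (padic_integers p)) k"
proof -
  interpret k: ring k by fact
  note P = padic_integers_closed[OF assms(1)] and h = ring_hom_memE[OF assms(3)]
  \<comment> \<open>Preservation of zero is deduced from 0 + 0 = 0 and cancellation in the
    target.\<close>
  have z0: "z \<zero>\<^bsub>padic_integers p\<^esub> = \<zero>\<^bsub>k\<^esub>"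
    using h(3)[OF P(2) P(2)] P(6) h(1)[OF P(2)] by simp
  show ?thesis
  proof (rule k.subringI)
    show "z ` carrier (padic_integers p) \<subseteq> carrier k" using h(1) by auto
    show "\<one>\<^bsub>k\<^esub> \<in> z ` carrier (padic_integers p)" using h(4) P(1) by force
    fix a assume a: "a \<in> z ` carrier (padic_integers p)"
    then obtain x where x: "x \<in> carrier (padic_integers p)" "a = z x" by auto
    obtain y where y: "y \<in> carrier (padic_integers p)" "x \<oplus>\<^bsub>padic_integers p\<^esub> y = \<zero>\<^bsub>padic_integers p\<^esub>"
      using P(5)[OF x(1)] by auto
    have "z x \<oplus>\<^bsub>k\<^esub> z y = \<zero>\<^bsub>k\<^esub>" using h(3)[OF x(1) y(1)] y(2) z0 by simp
    then have "\<ominus>\<^bsub>k\<^esub> a = z y" using x y h(1) k.minus_equality[of "z y" "z x"] k.a_comm by simp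
    then show "\<ominus>\<^bsub>k\<^esub> a \<in> z ` carrier (padic_integers p)" using y by simp
    fix b assume b: "b \<in> z ` carrier (padic_integers p)"
    show "a \<oplus>\<^bsub>k\<^esub> b \<in> z ` carrier (padic_integers p)" using a b h(3) P(3) by (force simp: image_iff)
    show "a \<otimes>\<^bsub>k\<^esub> b \<in> z ` carrier (padic_integers p)" using a b h(2) P(4) by (force simp: image_iff)
  qed
qed

text \<open>The generated field is the field of fractions of S: by induction every element has a
  denominator in S, and for inverses numerator and denominator change roles.\<close>

lemma (in field) generate_field_fraction:
  assumes S: "subring S R" and x: "x \<in> generate_field R S"
  shows "\<exists>c\<in>S. c \<noteq> \<zero> \<and> c \<otimes> x \<in> S"
  using x
proof induction
  note E = subringE[OF S]
  have Sc: "s \<in> carrier R" if "s \<in> S" for s using E(1) that by auto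
  case one then show ?case using E(3) by (intro bexI[of _ \<one>]) auto
next
  case (incl h) then show ?case using subringE(1,3)[OF S] by (intro bexI[of _ \<one>]) auto
next
  case (a_inv h)
  then obtain c where "c \<in> S" "c \<noteq> \<zero>" "c \<otimes> h \<in> S" by auto
  moreover have "h \<in> carrier R" using a_inv generate_field_in_carrier[OF subringE(1)[OF S]] by auto
  ultimately show ?case using subringE(1,5)[OF S] by (intro bexI[of _ c]) (auto simp: r_minus subset_eq)
next
  case (m_inv h)
  then obtain c where c: "c \<in> S" "c \<noteq> \<zero>" "c \<otimes> h \<in> S" by auto
  have h: "h \<in> carrier R" using m_inv generate_field_in_carrier[OF subringE(1)[OF S]] by auto
  have cc: "c \<in> carrier R" using c(1) subringE(1)[OF S] by auto
  have hU: "h \<in> Units R" using h m_inv by (simp add: field_Units)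
  have "(c \<otimes> h) \<otimes> inv h = c" using hU cc h by (simp add: m_assoc)
  then show ?case using c cc h m_inv integral[of c h] by (intro bexI[of _ "c \<otimes> h"]) auto
next
  case (eng_add h1 h2)
  then obtain c d where c: "c \<in> S" "c \<noteq> \<zero>" "c \<otimes> h1 \<in> S" "d \<in> S" "d \<noteq> \<zero>" "d \<otimes> h2 \<in> S" by auto
  have h: "h1 \<in> carrier R" "h2 \<in> carrier R" "c \<in> carrier R" "d \<in> carrier R"
    using eng_add c generate_field_in_carrier[OF subringE(1)[OF S]] subringE(1)[OF S] by auto
  have "(c \<otimes> d) \<otimes> (h1 \<oplus> h2) = d \<otimes> (c \<otimes> h1) \<oplus> c \<otimes> (d \<otimes> h2)" using h by (simp add: r_distr m_ac)
  then show ?case using c h integral[of c d] subringE(6,7)[OF S] by (intro bexI[of _ "c \<otimes> d"]) auto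
next
  case (eng_mult h1 h2)
  then obtain c d where c: "c \<in> S" "c \<noteq> \<zero>" "c \<otimes> h1 \<in> S" "d \<in> S" "d \<noteq> \<zero>" "d \<otimes> h2 \<in> S" by auto
  have h: "h1 \<in> carrier R" "h2 \<in> carrier R" "c \<in> carrier R" "d \<in> carrier R"
    using eng_mult c generate_field_in_carrier[OF subringE(1)[OF S]] subringE(1)[OF S] by auto
  have "(c \<otimes> d) \<otimes> (h1 \<otimes> h2) = (c \<otimes> h1) \<otimes> (d \<otimes> h2)" using h by (simp add: m_ac)
  then show ?case using c h integral[of c d] subringE(6,7)[OF S] by (intro bexI[of _ "c \<otimes> d"]) auto
qed

lemma (in domain) common_denominator:
  assumes S: "subring S R" and q: "set q \<subseteq> carrier R" "\<And>x. x \<in> set q \<Longrightarrow> \<exists>c\<in>S. c \<noteq> \<zero> \<and> c \<otimes> x \<in> S"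
  shows "\<exists>c\<in>S. c \<noteq> \<zero> \<and> (\<forall>x\<in>set q. c \<otimes> x \<in> S)"
  using q
proof (induction q)
  case Nil then show ?case using subringE(3)[OF S] by (intro bexI[of _ \<one>]) auto
next
  case (Cons a q)
  obtain c where c: "c \<in> S" "c \<noteq> \<zero>" "\<forall>x\<in>set q. c \<otimes> x \<in> S" using Cons by auto
  obtain d where d: "d \<in> S" "d \<noteq> \<zero>" "d \<otimes> a \<in> S" using Cons.prems(2)[of a] by auto
  have cc: "c \<in> carrier R" "d \<in> carrier R" using c d subringE(1)[OF S] by auto
  have "(c \<otimes> d) \<otimes> a = c \<otimes> (d \<otimes> a)" using cc Cons.prems by (simp add: m_assoc)
  moreover have "(c \<otimes> d) \<otimes> x = d \<otimes> (c \<otimes> x)" if "x \<in> set q" for x using cc Cons.prems that by (simp add: m_ac subset_eq)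
  ultimately show ?case using c d cc integral[of c d] subringE(6)[OF S] by (intro bexI[of _ "c \<otimes> d"]) auto
qed

lemma (in domain) eval_scale:
  assumes "set q \<subseteq> carrier R" "c \<in> carrier R" "x \<in> carrier R"
  shows "eval (map ((\<otimes>) c) q) x = c \<otimes> eval q x"
  using assms(1) by (induction q) (use assms in \<open>auto simp: r_distr m_assoc eval_in_carrier\<close>)

lemma (in ring) eval_as_finsum:
  assumes "set p \<subseteq> carrier R" "x \<in> carrier R"
  shows "eval p x = (\<Oplus>k\<in>{..<length p}. coeff p k \<otimes> x [^] k)"
  using assms(1)
proof (induction p)
  case (Cons a p)
  have c: "coeff p k \<in> carrier R" for k using Cons.prems by simp
  have eq: "(\<Oplus>k\<in>{..<length p}. coeff (a # p) k \<otimes> x [^] k) = (\<Oplus>k\<in>{..<length p}. coeff p k \<otimes> x [^] k)"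
    using c assms(2) by (intro finsum_cong') auto
  have s: "{..<Suc (length p)} = insert (length p) {..<length p}" by auto
  have "(\<Oplus>k\<in>{..<length (a # p)}. coeff (a # p) k \<otimes> x [^] k)
      = a \<otimes> x [^] length p \<oplus> (\<Oplus>k\<in>{..<length p}. coeff (a # p) k \<otimes> x [^] k)"
    unfolding length_Cons s using Cons.prems assms(2) c by (subst finsum_insert) auto
  then show ?case unfolding eq using Cons by simp
qed simp

locale local_extension =
  fixes p :: nat and z :: "(nat \<Rightarrow> int) \<Rightarrow> 'c" and C :: "'c ring" and K :: "'c set"
    and F :: "'f ring" and i :: "'c \<Rightarrow> 'f" and \<zeta> :: 'f and OK :: "'c ring" and OF :: "'f ring"
  assumes p: "Factorial_Ring.prime p"
    and C_closure: "algebraic_closure C K"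
    and K_local: "padic_local_field p z (C\<lparr>carrier := K\<rparr>)"
    and F_field: "field F"
    and i_hom: "i \<in> ring_hom (C\<lparr>carrier := K\<rparr>) F"
    and F_finite: "ring.finite_dimension F (i ` K) (carrier F)"
    and OK: "OK = ring_of_integers C (z ` carrier (padic_integers p)) K"
    and OF: "OF = ring_of_integers F (i ` z ` carrier (padic_integers p)) (carrier F)"
    and \<zeta>: "\<zeta> \<in> carrier OF"
    and OF_generated: "carrier OF = ring.simple_extension F (i ` carrier OK) \<zeta>"

sublocale local_extension \<subseteq> C: algebraic_closure C K by (rule C_closure)
sublocale local_extension \<subseteq> F: field F by (rule F_field)

context local_extension
begin

abbreviation "Z \<equiv> z ` carrier (padic_integers p)"
abbreviation "CK \<equiv> C\<lparr>carrier := K\<rparr>"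

lemma K_subfield: "subfield K C" ..

lemma K_closed [simp]: "x \<in> K \<Longrightarrow> x \<in> carrier C"
  using subfieldE(3)[OF K_subfield] by auto

lemma CK_field: "field CK" by (rule C.subfield_iff(2)[OF K_subfield])

sublocale CK: field CK by (rule CK_field)

lemma p_pos: "0 < p" using p by (simp add: prime_gt_0_nat)

lemma z_hom: "z \<in> ring_hom (padic_integers p) CK"
  using K_local by (simp add: padic_local_field_def)

lemma Z_subring_CK: "subring Z CK"
  by (rule padic_image_subring[OF p_pos CK.ring_axioms z_hom])

lemma Z_subset_K: "Z \<subseteq> K" using subringE(1)[OF Z_subring_CK] by simp

lemma z_hom_C: "z \<in> ring_hom (padic_integers p) C"
  using ring_hom_memE[OF z_hom] by (intro ring_hom_memI) auto

lemma Z_subring: "subring Z C"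
  by (rule padic_image_subring[OF p_pos C.ring_axioms z_hom_C])

sublocale i: ring_hom_ring CK F i
  using i_hom CK.ring_axioms F.ring_axioms by (intro ring_hom_ringI2)

lemma i_inj: "inj_on i K"
  using non_trivial_field_hom_is_inj[OF i_hom CK_field F_field] by simp

lemma i_closed [simp]: "x \<in> K \<Longrightarrow> i x \<in> carrier F" using i.hom_closed by simp

lemma i_add: "x \<in> K \<Longrightarrow> y \<in> K \<Longrightarrow> i (x \<oplus>\<^bsub>C\<^esub> y) = i x \<oplus>\<^bsub>F\<^esub> i y" using i.hom_add[of x y] by simp
lemma i_mult: "x \<in> K \<Longrightarrow> y \<in> K \<Longrightarrow> i (x \<otimes>\<^bsub>C\<^esub> y) = i x \<otimes>\<^bsub>F\<^esub> i y" using i.hom_mult[of x y] by simp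
lemma i_one: "i \<one>\<^bsub>C\<^esub> = \<one>\<^bsub>F\<^esub>" using i.hom_one by simp
lemma i_zero: "i \<zero>\<^bsub>C\<^esub> = \<zero>\<^bsub>F\<^esub>" using i.hom_zero by simp

lemma i_eq_zero: "x \<in> K \<Longrightarrow> i x = \<zero>\<^bsub>F\<^esub> \<longleftrightarrow> x = \<zero>\<^bsub>C\<^esub>"
  using inj_onD[OF i_inj, of x "\<zero>\<^bsub>C\<^esub>"] i_zero subringE(2)[OF subfieldE(1)[OF K_subfield]] by auto

lemma iK_subfield: "subfield (i ` K) F"
  using i.img_is_subfield(2)[OF CK.carrier_is_subfield] by simp

lemma iZ_subring: "subring (i ` Z) F"
  by (rule i.img_is_subring[OF Z_subring_CK])

sublocale intC: integral_setting C Z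
  by (intro integral_setting.intro integral_setting_axioms.intro C.is_cring Z_subring)

sublocale intF: integral_setting F "i ` Z"
  by (intro integral_setting.intro integral_setting_axioms.intro F.is_cring iZ_subring)

lemma OK_carrier: "carrier OK = {x \<in> K. integral_over C Z x}"
  by (simp add: OK ring_of_integers_def)

lemma OF_carrier: "carrier OF = {x \<in> carrier F. integral_over F (i ` Z) x}"
  by (simp add: OF ring_of_integers_def)

lemma OK_subring: "subring (carrier OK) C"
  unfolding OK_carrier
  by (rule intC.integral_closure_subring[OF subfieldE(1)[OF K_subfield] Z_subset_K C.one_not_zero])

lemma OF_subring: "subring (carrier OF) F"
  unfolding OF_carrier using subringE(1)[OF iZ_subring]
  by (intro intF.integral_closure_subring F.carrier_is_subring F.one_not_zero)

lemma OF_record: "OF = F\<lparr>carrier := carrier OF\<rparr>" by (simp add: OF ring_of_integers_def)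

lemma OF_cring: "cring OF"
  using F.subcring_iff[OF subringE(1)[OF OF_subring]] OF_record F.subcringI'[OF OF_subring] by simp

lemma OK_in_K: "x \<in> carrier OK \<Longrightarrow> x \<in> K" by (simp add: OK_carrier)
lemma OF_in_F: "x \<in> carrier OF \<Longrightarrow> x \<in> carrier F" by (simp add: OF_carrier)

lemma \<zeta>_closed [simp]: "\<zeta> \<in> carrier F" using \<zeta> OF_in_F by simp

lemma i_OK: "x \<in> carrier OK \<Longrightarrow> i x \<in> carrier OF"
proof -
  assume x: "x \<in> carrier OK"
  have "integral_over CK Z x"
    using x C.univ_poly_consistent[OF subfieldE(1)[OF K_subfield]] C.eval_consistent[OF subfieldE(1)[OF K_subfield]]
    unfolding OK_carrier integral_over_def by (simp add: univ_poly_def polynomial_def)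
  then have "integral_over F (i ` Z) (i x)"
    using x Z_subset_K OK_in_K by (intro integral_over_hom[OF CK.is_cring F.is_cring i_hom]) auto
  then show ?thesis using x by (simp add: OF_carrier OK_in_K)
qed

text \<open>By the tower of finite extensions, x is algebraic over the fraction field of the image
  of \<open>Z\<close>. After clearing denominators, the leading coefficient of its equation is a
  suitable multiplier.\<close>

lemma exists_integral_multiple:
  assumes x: "x \<in> carrier F"
  shows "\<exists>c\<in>Z. c \<noteq> \<zero>\<^bsub>C\<^esub> \<and> i c \<otimes>\<^bsub>F\<^esub> x \<in> carrier OF"
proof -
  let ?Q = "generate_field CK Z"
  have Zc: "Z \<subseteq> carrier CK" using Z_subset_K by simp
  have Q: "subfield ?Q CK" by (rule CK.generate_field_is_subfield[OF Zc])
  have iQ: "subfield (i ` ?Q) F" using i.img_is_subfield(2)[OF Q] by simp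
  have "CK.finite_dimension ?Q K" using K_local by (simp add: padic_local_field_def)
  then obtain n where "CK.dimension n ?Q K" by (rule CK.finite_dimensionE')
  then have "F.dimension n (i ` ?Q) (i ` K)"
    using i.inj_hom_dimension[OF Q F.one_not_zero i_inj] by simp
  then have fin: "F.finite_dimension (i ` ?Q) (carrier F)"
    using F.telescopic_base_dim(1)[OF iQ iK_subfield F.finite_dimensionI F_finite] by simp
  have "(F.algebraic over (i ` ?Q)) x"
    using F.finite_dimension_imp_algebraic[OF iQ F.carrier_is_subring fin x] .
  then obtain q where q: "q \<in> carrier (univ_poly F (i ` ?Q))" "q \<noteq> []" "F.eval q x = \<zero>\<^bsub>F\<^esub>"
    using F.algebraicE[OF subfieldE(1)[OF iQ] x] by blast
  then have qs: "set q \<subseteq> i ` ?Q" "hd q \<noteq> \<zero>\<^bsub>F\<^esub>" by (auto simp: univ_poly_carrier[symmetric] polynomial_def)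
  have qc: "set q \<subseteq> carrier F" using qs(1) subfieldE(3)[OF iQ] by blast
  have "\<exists>c\<in>i ` Z. c \<noteq> \<zero>\<^bsub>F\<^esub> \<and> c \<otimes>\<^bsub>F\<^esub> y \<in> i ` Z" if "y \<in> set q" for y
  proof -
    obtain w where w: "w \<in> ?Q" "y = i w" using qs(1) \<open>y \<in> set q\<close> by auto
    have wK: "w \<in> K" using w(1) subfieldE(3)[OF Q] by auto
    obtain c where c: "c \<in> Z" "c \<noteq> \<zero>\<^bsub>C\<^esub>" "c \<otimes>\<^bsub>C\<^esub> w \<in> Z"
      using CK.generate_field_fraction[OF Z_subring_CK w(1)] by auto
    have cK: "c \<in> K" using c(1) Z_subset_K by blast
    have "i c \<otimes>\<^bsub>F\<^esub> y = i (c \<otimes>\<^bsub>C\<^esub> w)" using i_mult[OF cK wK] w(2) by simp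
    moreover have "i c \<noteq> \<zero>\<^bsub>F\<^esub>" using i_eq_zero[OF cK] c(2) by simp
    ultimately show ?thesis using c by (intro bexI[of _ "i c"]) auto
  qed
  then obtain c where c: "c \<in> i ` Z" "c \<noteq> \<zero>\<^bsub>F\<^esub>" "\<forall>y\<in>set q. c \<otimes>\<^bsub>F\<^esub> y \<in> i ` Z"
    using F.common_denominator[OF iZ_subring qc] by blast
  have cc: "c \<in> carrier F" using c(1) by (auto dest: Z_subset_K[THEN subsetD])
  obtain a q' where aq: "q = a # q'" using q(2) by (cases q) auto
  have ac: "a \<in> carrier F" "a \<noteq> \<zero>\<^bsub>F\<^esub>" using aq qc qs(2) by auto
  define b where "b = c \<otimes>\<^bsub>F\<^esub> a"
  have b: "b \<in> i ` Z" "b \<noteq> \<zero>\<^bsub>F\<^esub>" using c aq F.integral[of c a] cc ac by (auto simp: b_def)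
  have "F.eval (map ((\<otimes>\<^bsub>F\<^esub>) c) q) x = \<zero>\<^bsub>F\<^esub>" using F.eval_scale[OF qc cc x] q(3) cc by simp
  then have e: "F.eval (b # map ((\<otimes>\<^bsub>F\<^esub>) c) q') x = \<zero>\<^bsub>F\<^esub>" unfolding aq b_def by simp
  have "q' \<noteq> []"
  proof
    assume "q' = []"
    then have "b = \<zero>\<^bsub>F\<^esub>" using e cc ac x by (simp add: b_def)
    then show False using b by simp
  qed
  then have "integral_over F (i ` Z) (b \<otimes>\<^bsub>F\<^esub> x)"
    using b(1) c(3) aq e x by (intro intF.integral_leading_multiple[of x b "map ((\<otimes>\<^bsub>F\<^esub>) c) q'"]) auto
  moreover obtain d where d: "d \<in> Z" "b = i d" using b(1) by auto
  moreover have "d \<noteq> \<zero>\<^bsub>C\<^esub>" using b(2) d i_zero by auto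
  moreover have "b \<in> carrier F" using cc ac by (simp add: b_def)
  ultimately show ?thesis using x by (auto simp: OF_carrier)
qed

text \<open>Every element of \<open>F\<close> is an integral element divided by one from the image
  of \<open>Z\<close>, so the description of \<open>OF\<close> as a ring generated by \<zeta> passes
  to the fields.\<close>

lemma F_generated: "F.simple_extension (i ` K) \<zeta> = carrier F"
proof
  have iKc: "i ` K \<subseteq> carrier F" by auto
  show "F.simple_extension (i ` K) \<zeta> \<subseteq> carrier F"
    by (rule F.simple_extension_in_carrier[OF iKc \<zeta>_closed])
  note E = subringE[OF F.simple_extension_is_subring[OF subfieldE(1)[OF iK_subfield] \<zeta>_closed]]
  show "carrier F \<subseteq> F.simple_extension (i ` K) \<zeta>"
  proof
    fix x assume x: "x \<in> carrier F"
    obtain c where c: "c \<in> Z" "c \<noteq> \<zero>\<^bsub>C\<^esub>" "i c \<otimes>\<^bsub>F\<^esub> x \<in> carrier OF"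
      using exists_integral_multiple[OF x] by blast
    have cK: "c \<in> K" using c Z_subset_K by auto
    have "i ` carrier OK \<subseteq> i ` K" using OK_in_K by auto
    then have 1: "i c \<otimes>\<^bsub>F\<^esub> x \<in> F.simple_extension (i ` K) \<zeta>"
      using c(3) F.mono_simple_extension[of "i ` carrier OK" "i ` K" \<zeta>] unfolding OF_generated by blast
    have ic: "i c \<noteq> \<zero>\<^bsub>F\<^esub>" "i c \<in> carrier F" using cK c i_eq_zero by auto
    have "inv\<^bsub>F\<^esub> (i c) \<in> i ` K" using F.subfield_m_inv(1)[OF iK_subfield, of "i c"] cK ic by auto
    then have 2: "inv\<^bsub>F\<^esub> (i c) \<in> F.simple_extension (i ` K) \<zeta>"
      using F.simple_extension_incl[OF iKc \<zeta>_closed] by blast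
    have U: "i c \<in> Units F" using ic by (simp add: F.field_Units)
    have "inv\<^bsub>F\<^esub> (i c) \<otimes>\<^bsub>F\<^esub> (i c \<otimes>\<^bsub>F\<^esub> x) = x"
      using U x ic by (simp add: F.m_assoc[symmetric])
    then show "x \<in> F.simple_extension (i ` K) \<zeta>" using E(6)[OF 2 1] by simp
  qed
qed

lemma \<zeta>_algebraic: "(F.algebraic over (i ` K)) \<zeta>"
  using F.finite_dimension_imp_algebraic[OF iK_subfield F.carrier_is_subring F_finite \<zeta>_closed] .

abbreviation "minpoly_F \<equiv> F.Irr (i ` K) \<zeta>"

text \<open>This is [F : K], by \<open>dim_F\<close> below.\<close>

definition N :: nat where "N = degree minpoly_F"

lemmas minpoly_F = F.IrrE[OF iK_subfield \<zeta>_closed \<zeta>_algebraic]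

lemma dim_F: "ring.dim F (i ` K) (carrier F) = N"
  using F.dimI[OF iK_subfield F.dimension_simple_extension[OF iK_subfield \<zeta>_closed \<zeta>_algebraic]]
  unfolding F_generated N_def over_def .

lemma minpoly_F_props:
  "minpoly_F \<noteq> []" "set minpoly_F \<subseteq> i ` K" "length minpoly_F = Suc N"
proof -
  show n: "minpoly_F \<noteq> []"
  proof
    assume "minpoly_F = []"
    then have "\<zero>\<^bsub>univ_poly F (i ` K)\<^esub> = minpoly_F" by (simp add: univ_poly_zero)
    then show False using minpoly_F(2) by (simp add: ring_irreducible_def)
  qed
  then show "set minpoly_F \<subseteq> i ` K" using minpoly_F(1) by (simp add: univ_poly_carrier[symmetric] polynomial_def)
  show "length minpoly_F = Suc N" using n by (cases minpoly_F) (auto simp: N_def)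
qed

lemma powers_independent:
  assumes "set q \<subseteq> i ` K" "length q = N" "F.eval q \<zeta> = \<zero>\<^bsub>F\<^esub>"
  shows "set q \<subseteq> {\<zero>\<^bsub>F\<^esub>}"
proof -
  have "F.combine q (F.exp_base \<zeta> N) = \<zero>\<^bsub>F\<^esub>" using F.combine_eq_eval[of q \<zeta>] assms by simp
  moreover have "F.independent (i ` K) (F.exp_base \<zeta> N)"
    unfolding N_def by (rule F.exp_base_independent[OF iK_subfield \<zeta>_closed \<zeta>_algebraic])
  moreover have "length (F.exp_base \<zeta> N) = N" by (simp add: F.exp_base_def)
  ultimately show ?thesis using F.independent_imp_trivial_combine[OF iK_subfield _ assms(1)] assms(2) by fastforce
qed

text \<open>It carries polynomials with coefficients in the image of \<open>K\<close> to polynomials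
  over \<open>C\<close>, where the conjugates of \<zeta> lie.\<close>

definition \<kappa> :: "'f \<Rightarrow> 'c" where "\<kappa> = inv_into K i"

lemma \<kappa>_i [simp]: "x \<in> K \<Longrightarrow> \<kappa> (i x) = x" using i_inj by (simp add: \<kappa>_def)

lemma \<kappa>_hom: "\<kappa> \<in> ring_hom (F\<lparr>carrier := i ` K\<rparr>) C"
proof -
  note E = subringE[OF subfieldE(1)[OF K_subfield]]
  show ?thesis
  proof (rule ring_hom_memI)
    fix x assume "x \<in> carrier (F\<lparr>carrier := i ` K\<rparr>)" then show "\<kappa> x \<in> carrier C" by auto
  next
    fix x y assume "x \<in> carrier (F\<lparr>carrier := i ` K\<rparr>)" "y \<in> carrier (F\<lparr>carrier := i ` K\<rparr>)"
    then obtain a b where ab: "a \<in> K" "x = i a" "b \<in> K" "y = i b" by auto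
    show "\<kappa> (x \<otimes>\<^bsub>F\<lparr>carrier := i ` K\<rparr>\<^esub> y) = \<kappa> x \<otimes>\<^bsub>C\<^esub> \<kappa> y"
      using ab E(6) \<kappa>_i by (simp add: i_mult[symmetric])
    show "\<kappa> (x \<oplus>\<^bsub>F\<lparr>carrier := i ` K\<rparr>\<^esub> y) = \<kappa> x \<oplus>\<^bsub>C\<^esub> \<kappa> y"
      using ab E(7) \<kappa>_i by (simp add: i_add[symmetric])
  next
    show "\<kappa> \<one>\<^bsub>F\<lparr>carrier := i ` K\<rparr>\<^esub> = \<one>\<^bsub>C\<^esub>" using E(3) \<kappa>_i by (simp add: i_one[symmetric])
  qed
qed

definition minpoly :: "'c list" where "minpoly = map \<kappa> minpoly_F"

lemma map_i_minpoly: "map i minpoly = minpoly_F"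
proof -
  have "i (\<kappa> x) = x" if "x \<in> set minpoly_F" for x
    using minpoly_F_props(2) that by (auto simp: \<kappa>_def f_inv_into_f)
  then show ?thesis by (simp add: minpoly_def map_idI)
qed

lemma minpoly_props: "set minpoly \<subseteq> K" "length minpoly = Suc N" "hd minpoly = \<one>\<^bsub>C\<^esub>" "polynomial\<^bsub>C\<^esub> K minpoly"
proof -
  show s: "set minpoly \<subseteq> K" using minpoly_F_props(2) by (auto simp: minpoly_def)
  show "length minpoly = Suc N" using minpoly_F_props by (simp add: minpoly_def)
  show h: "hd minpoly = \<one>\<^bsub>C\<^esub>"
    using minpoly_F(3) minpoly_F_props(1) \<kappa>_i[of "\<one>\<^bsub>C\<^esub>"] subringE(3)[OF subfieldE(1)[OF K_subfield]]
    by (simp add: minpoly_def hd_map i_one)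
  show "polynomial\<^bsub>C\<^esub> K minpoly" using s h by (auto simp: polynomial_def)
qed

text \<open>The minimal polynomial divides a monic polynomial over the image of \<open>Z\<close>
  that has the root \<zeta>; after transport to \<open>C\<close>, every root of the former is a root
  of the latter.\<close>

lemma minpoly_root_integral:
  assumes a: "a \<in> carrier C" "C.eval minpoly a = \<zero>\<^bsub>C\<^esub>"
  shows "integral_over C Z a"
proof -
  let ?FK = "F\<lparr>carrier := i ` K\<rparr>"
  have iKsub: "subring (i ` K) F" by (rule subfieldE(1)[OF iK_subfield])
  interpret FK: field ?FK by (rule F.subfield_iff(2)[OF iK_subfield])
  interpret \<kappa>: ring_hom_ring ?FK C \<kappa>
    using \<kappa>_hom FK.ring_axioms C.ring_axioms by (intro ring_hom_ringI2)
  obtain Q where Q: "polynomial\<^bsub>F\<^esub> (i ` Z) Q" "Q \<noteq> []" "hd Q = \<one>\<^bsub>F\<^esub>" "F.eval Q \<zeta> = \<zero>\<^bsub>F\<^esub>"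
    using \<zeta> by (auto simp: OF_carrier integral_over_def univ_poly_carrier)
  have sQ: "set Q \<subseteq> i ` Z" using Q by (auto simp: polynomial_def)
  have QK: "Q \<in> carrier (univ_poly F (i ` K))"
    using Q sQ image_mono[OF Z_subset_K, of i] by (simp add: univ_poly_carrier[symmetric] polynomial_def)
  have "minpoly_F divides\<^bsub>univ_poly F (i ` K)\<^esub> Q"
    using F.Irr_minimal[OF iK_subfield \<zeta>_closed \<zeta>_algebraic QK Q(4)]
      F.pdivides_iff_shell[OF iK_subfield minpoly_F(1) QK] by simp
  then obtain q where q: "q \<in> carrier (univ_poly F (i ` K))" "Q = F.poly_mult minpoly_F q"
    by (auto simp: factor_def univ_poly_mult)
  have sq: "set q \<subseteq> i ` K" using q(1) by (auto simp: univ_poly_carrier[symmetric] polynomial_def)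
  have "C.normalize (map \<kappa> (FK.poly_mult minpoly_F q)) = C.poly_mult minpoly (map \<kappa> q)"
    unfolding minpoly_def using minpoly_F_props(2) sq by (intro \<kappa>.poly_mult_hom') auto
  then have n: "C.normalize (map \<kappa> Q) = C.poly_mult minpoly (map \<kappa> q)"
    using q(2) F.poly_mult_consistent[OF iKsub] by simp
  have "\<kappa> x \<in> Z" if x: "x \<in> i ` Z" for x
  proof -
    obtain w where "w \<in> Z" "x = i w" using x by blast
    moreover from this(1) have "w \<in> K" using Z_subset_K by blast
    ultimately show ?thesis by simp
  qed
  then have sQZ: "set (map \<kappa> Q) \<subseteq> Z" using sQ by (simp only: set_map) blast
  have hQ: "hd (map \<kappa> Q) = \<one>\<^bsub>C\<^esub>"
    using Q(2,3) \<kappa>_i[of "\<one>\<^bsub>C\<^esub>"] subringE(3)[OF subfieldE(1)[OF K_subfield]] by (simp add: hd_map i_one)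
  have pQ: "polynomial\<^bsub>C\<^esub> Z (map \<kappa> Q)" using sQZ hQ by (auto simp: polynomial_def)
  have "C.eval (C.poly_mult minpoly (map \<kappa> q)) a = C.eval minpoly a \<otimes>\<^bsub>C\<^esub> C.eval (map \<kappa> q) a"
    using minpoly_props(1) sq a by (intro C.eval_poly_mult) auto
  moreover have "C.eval (map \<kappa> q) a \<in> carrier C" using sq a by (intro C.eval_in_carrier) auto
  ultimately have "C.eval (map \<kappa> Q) a = \<zero>\<^bsub>C\<^esub>"
    using n a(2) C.normalize_polynomial[OF pQ] by simp
  then show ?thesis using pQ hQ Q(2)
    unfolding integral_over_def by (intro bexI[of _ "map \<kappa> Q"]) (auto simp: univ_poly_carrier[symmetric])
qed

text \<open>All roots are integral and the polynomial splits over \<open>C\<close>, so its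
  coefficients are integral as well. No theory of integrally closed rings is involved.\<close>

lemma minpoly_OK: "set minpoly \<subseteq> carrier OK"
proof -
  let ?D = "{x \<in> carrier C. integral_over C Z x}"
  have D: "subring ?D C"
    using subringE(1)[OF Z_subring] by (intro intC.integral_closure_subring C.carrier_is_subring C.one_not_zero)
  have "polynomial\<^bsub>C\<^esub> ?D minpoly"
  proof (rule C.monic_integral_roots[OF _ D])
    show "C.splitted p" if "p \<in> carrier (poly_ring C)" for p using C.roots_over_carrier[OF that] .
    show "polynomial\<^bsub>C\<^esub> (carrier C) minpoly" using minpoly_props(1,3) by (auto simp: polynomial_def)
    show "minpoly \<noteq> []" using minpoly_props(2) by auto
    show "hd minpoly = \<one>\<^bsub>C\<^esub>" by (rule minpoly_props(3))
  qed (auto intro: minpoly_root_integral)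
  then show ?thesis using minpoly_props(1,2) by (auto simp: polynomial_def OK_carrier)
qed

end

section \<open>Integral coordinates with respect to the powers of \<zeta>\<close>

lemma (in ring) coeff_map_rev: "k < n \<Longrightarrow> coeff (map f (rev [0..<n])) k = f k"
  using coeff_nth[of k "map f (rev [0..<n])"] by (simp add: rev_nth)

context local_extension
begin

lemma minpoly_F_relation: "\<exists>m. minpoly_F = \<one>\<^bsub>F\<^esub> # m \<and> length m = N \<and> set m \<subseteq> i ` carrier OK \<and>
   \<zeta> [^]\<^bsub>F\<^esub> N = \<ominus>\<^bsub>F\<^esub> F.eval m \<zeta>"
proof -
  obtain m where m: "minpoly_F = \<one>\<^bsub>F\<^esub> # m" using minpoly_F_props(1) minpoly_F(3) by (cases minpoly_F) auto
  have l: "length m = N" using minpoly_F_props(3) m by simp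
  have "set minpoly_F \<subseteq> i ` carrier OK" using minpoly_OK map_i_minpoly by (metis image_mono set_map)
  then have s: "set m \<subseteq> i ` carrier OK" using m by simp
  have mc: "set m \<subseteq> carrier F" using minpoly_F_props(2) m by auto
  have "\<zeta> [^]\<^bsub>F\<^esub> N \<oplus>\<^bsub>F\<^esub> F.eval m \<zeta> = \<zero>\<^bsub>F\<^esub>" using minpoly_F(4) l unfolding m by simp
  then have "\<zeta> [^]\<^bsub>F\<^esub> N = \<ominus>\<^bsub>F\<^esub> F.eval m \<zeta>"
    using F.minus_equality F.eval_in_carrier[OF mc \<zeta>_closed] by simp
  then show ?thesis using m l s by blast
qed

lemma iOK_subring: "subring (i ` carrier OK) F"
proof -
  have "subring (carrier OK) CK"
    unfolding OK_carrier
  proof -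
    note E = subringE[OF OK_subring]
    have "\<ominus>\<^bsub>CK\<^esub> x = \<ominus>\<^bsub>C\<^esub> x" if "x \<in> K" for x
      using that CK.minus_equality[of "\<ominus>\<^bsub>C\<^esub> x" x] subringE(5)[OF subfieldE(1)[OF K_subfield]] C.l_neg by simp
    then have "subring (carrier OK) CK"
      using E OK_in_K by (intro CK.subringI) auto
    then show "subring {x \<in> K. integral_over C Z x} CK" by (simp add: OK_carrier)
  qed
  then show ?thesis by (rule i.img_is_subring)
qed

text \<open>The calculus of Horner values once more, now with coefficients in the image of
  \<open>OK\<close> and used to describe spans of powers of \<zeta> rather than integrality.\<close>

sublocale powers: integral_setting F "i ` carrier OK"
  by (intro integral_setting.intro integral_setting_axioms.intro F.is_cring iOK_subring)

text \<open>The powers below N suffice because \<zeta>^N can be rewritten by the minimal polynomial;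
  by \<open>minpoly_OK\<close> this does not leave the coefficients from \<open>OK\<close>.\<close>

lemma OF_low: "a \<in> carrier OF \<Longrightarrow> a \<in> low_values F (i ` carrier OK) \<zeta> N"
  unfolding OF_generated
proof (induction a rule: F.simple_extension.induct)
  case zero then show ?case using powers.low_zero by simp
next
  case (lin k1 k2)
  let ?low = "low_values F (i ` carrier OK) \<zeta>"
  obtain m where m: "length m = N" "set m \<subseteq> i ` carrier OK" "\<zeta> [^]\<^bsub>F\<^esub> N = \<ominus>\<^bsub>F\<^esub> F.eval m \<zeta>"
    using minpoly_F_relation by blast
  have "k2 \<oplus>\<^bsub>F\<^esub> \<zeta> \<otimes>\<^bsub>F\<^esub> k1 \<in> ?low (Suc N)" using lin powers.low_SucI by simp
  then obtain q where q: "length q = Suc N" "set q \<subseteq> i ` carrier OK" "F.eval q \<zeta> = k2 \<oplus>\<^bsub>F\<^esub> \<zeta> \<otimes>\<^bsub>F\<^esub> k1"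
    using powers.low_as_eval[OF \<zeta>_closed] by blast
  then obtain a r where ar: "q = a # r" "length r = N" by (cases q) auto
  have pw: "\<zeta> [^]\<^bsub>F\<^esub> N \<in> ?low N"
    unfolding m(3) using powers.low_minus[OF \<zeta>_closed powers.eval_in_low[OF \<zeta>_closed m(2)]] m(1) by simp
  have "a \<otimes>\<^bsub>F\<^esub> \<zeta> [^]\<^bsub>F\<^esub> N \<oplus>\<^bsub>F\<^esub> F.eval r \<zeta> \<in> ?low N"
    using powers.low_smult[OF \<zeta>_closed pw, of a] powers.eval_in_low[OF \<zeta>_closed, of r] ar q
    by (intro powers.low_add[OF \<zeta>_closed]) auto
  then have "k2 \<oplus>\<^bsub>F\<^esub> \<zeta> \<otimes>\<^bsub>F\<^esub> k1 \<in> ?low N" using q(3) ar by simp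
  moreover have "k1 \<in> carrier F" "k2 \<in> carrier F"
    using powers.low_closed[OF \<zeta>_closed lin.IH] powers.S_closed[OF lin.hyps(2)] by auto
  ultimately show ?case by (simp add: F.a_comm F.m_comm)
qed

lemma OF_coordinates_exist:
  assumes "a \<in> carrier OF"
  shows "\<exists>c. (\<forall>k<N. c k \<in> carrier OK) \<and> a = (\<Oplus>\<^bsub>F\<^esub>k\<in>{..<N}. i (c k) \<otimes>\<^bsub>F\<^esub> \<zeta> [^]\<^bsub>F\<^esub> k)"
proof -
  obtain q where q: "length q = N" "set q \<subseteq> i ` carrier OK" "F.eval q \<zeta> = a"
    using powers.low_as_eval[OF \<zeta>_closed OF_low[OF assms]] by blast
  have qc: "set q \<subseteq> carrier F" using q(2) powers.S_closed by blast
  have c: "F.coeff q k \<in> i ` carrier OK" if "k < N" for k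
  proof -
    have "F.coeff q k \<in> set q"
      unfolding F.coeff_img_restrict[of q, symmetric] using that q(1) by simp
    then show ?thesis using q(2) by (rule subsetD[rotated])
  qed
  have "a = (\<Oplus>\<^bsub>F\<^esub>k\<in>{..<N}. F.coeff q k \<otimes>\<^bsub>F\<^esub> \<zeta> [^]\<^bsub>F\<^esub> k)"
    using F.eval_as_finsum[OF qc \<zeta>_closed] q by simp
  also have "\<dots> = (\<Oplus>\<^bsub>F\<^esub>k\<in>{..<N}. i (\<kappa> (F.coeff q k)) \<otimes>\<^bsub>F\<^esub> \<zeta> [^]\<^bsub>F\<^esub> k)"
  proof (intro F.finsum_cong')
    show "(\<lambda>k. i (\<kappa> (F.coeff q k)) \<otimes>\<^bsub>F\<^esub> \<zeta> [^]\<^bsub>F\<^esub> k) \<in> {..<N} \<rightarrow> carrier F"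
      using c OK_in_K by fastforce
    show "F.coeff q k \<otimes>\<^bsub>F\<^esub> \<zeta> [^]\<^bsub>F\<^esub> k = i (\<kappa> (F.coeff q k)) \<otimes>\<^bsub>F\<^esub> \<zeta> [^]\<^bsub>F\<^esub> k" if "k \<in> {..<N}" for k
      using c[of k] that OK_in_K by force
  qed simp
  finally have "a = (\<Oplus>\<^bsub>F\<^esub>k\<in>{..<N}. i (\<kappa> (F.coeff q k)) \<otimes>\<^bsub>F\<^esub> \<zeta> [^]\<^bsub>F\<^esub> k)" .
  moreover have "\<kappa> (F.coeff q k) \<in> carrier OK" if "k < N" for k using c[OF that] OK_in_K by force
  ultimately show ?thesis by (intro exI[of _ "\<lambda>k. \<kappa> (F.coeff q k)"]) simp
qed

lemma OF_coordinates_unique: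
  assumes c: "\<And>k. k < N \<Longrightarrow> c k \<in> K" "\<And>k. k < N \<Longrightarrow> d k \<in> K"
    and eq: "(\<Oplus>\<^bsub>F\<^esub>k\<in>{..<N}. i (c k) \<otimes>\<^bsub>F\<^esub> \<zeta> [^]\<^bsub>F\<^esub> k) = (\<Oplus>\<^bsub>F\<^esub>k\<in>{..<N}. i (d k) \<otimes>\<^bsub>F\<^esub> \<zeta> [^]\<^bsub>F\<^esub> k)"
    and k: "k < N"
  shows "c k = d k"
proof -
  note E = subringE[OF subfieldE(1)[OF K_subfield]]
  let ?e = "\<lambda>k. c k \<oplus>\<^bsub>C\<^esub> \<ominus>\<^bsub>C\<^esub> \<one>\<^bsub>C\<^esub> \<otimes>\<^bsub>C\<^esub> d k"
  let ?q = "map (\<lambda>k. i (?e k)) (rev [0..<N])"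
  have m1: "\<ominus>\<^bsub>C\<^esub> \<one>\<^bsub>C\<^esub> \<in> K" using E(3,5) by simp
  have eK: "?e k \<in> K" if "k < N" for k using c that E(6,7) m1 by simp
  have qK: "set ?q \<subseteq> i ` K" using eK by auto
  have im1: "i (\<ominus>\<^bsub>C\<^esub> \<one>\<^bsub>C\<^esub>) = \<ominus>\<^bsub>F\<^esub> \<one>\<^bsub>F\<^esub>"
  proof -
    have "i (\<ominus>\<^bsub>C\<^esub> \<one>\<^bsub>C\<^esub>) \<oplus>\<^bsub>F\<^esub> \<one>\<^bsub>F\<^esub> = \<zero>\<^bsub>F\<^esub>"
      using i_add[OF m1 E(3)] by (simp add: i_one i_zero C.l_neg)
    then show ?thesis using m1 F.minus_equality[of "i (\<ominus>\<^bsub>C\<^esub> \<one>\<^bsub>C\<^esub>)" "\<one>\<^bsub>F\<^esub>"] by simp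
  qed
  have ie: "i (?e k) = i (c k) \<oplus>\<^bsub>F\<^esub> \<ominus>\<^bsub>F\<^esub> \<one>\<^bsub>F\<^esub> \<otimes>\<^bsub>F\<^esub> i (d k)" if "k < N" for k
    using c that m1 E(6) im1 by (simp add: i_add i_mult)
  let ?S = "\<lambda>c. \<Oplus>\<^bsub>F\<^esub>k\<in>{..<N}. i (c k) \<otimes>\<^bsub>F\<^esub> \<zeta> [^]\<^bsub>F\<^esub> k"
  have "F.eval ?q \<zeta> = (\<Oplus>\<^bsub>F\<^esub>k\<in>{..<N}. F.coeff ?q k \<otimes>\<^bsub>F\<^esub> \<zeta> [^]\<^bsub>F\<^esub> k)"
  proof -
    have "set ?q \<subseteq> carrier F" using qK by auto
    from F.eval_as_finsum[OF this \<zeta>_closed] show ?thesis by (simp only: length_map length_rev length_upt diff_zero)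
  qed
  also have "\<dots> = (\<Oplus>\<^bsub>F\<^esub>k\<in>{..<N}. i (c k) \<otimes>\<^bsub>F\<^esub> \<zeta> [^]\<^bsub>F\<^esub> k \<oplus>\<^bsub>F\<^esub> \<ominus>\<^bsub>F\<^esub> \<one>\<^bsub>F\<^esub> \<otimes>\<^bsub>F\<^esub> (i (d k) \<otimes>\<^bsub>F\<^esub> \<zeta> [^]\<^bsub>F\<^esub> k))"
  proof (rule F.finsum_cong')
    show "(\<lambda>k. i (c k) \<otimes>\<^bsub>F\<^esub> \<zeta> [^]\<^bsub>F\<^esub> k \<oplus>\<^bsub>F\<^esub> \<ominus>\<^bsub>F\<^esub> \<one>\<^bsub>F\<^esub> \<otimes>\<^bsub>F\<^esub> (i (d k) \<otimes>\<^bsub>F\<^esub> \<zeta> [^]\<^bsub>F\<^esub> k)) \<in> {..<N} \<rightarrow> carrier F"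
      using c by auto
    fix k assume k: "k \<in> {..<N}"
    then have "F.coeff ?q k = i (?e k)" by (intro F.coeff_map_rev) simp
    then show "F.coeff ?q k \<otimes>\<^bsub>F\<^esub> \<zeta> [^]\<^bsub>F\<^esub> k = i (c k) \<otimes>\<^bsub>F\<^esub> \<zeta> [^]\<^bsub>F\<^esub> k \<oplus>\<^bsub>F\<^esub> \<ominus>\<^bsub>F\<^esub> \<one>\<^bsub>F\<^esub> \<otimes>\<^bsub>F\<^esub> (i (d k) \<otimes>\<^bsub>F\<^esub> \<zeta> [^]\<^bsub>F\<^esub> k)"
      using ie[of k] c[of k] k by (simp add: F.l_distr F.m_assoc)
  qed simp
  also have "\<dots> = ?S c \<oplus>\<^bsub>F\<^esub> (\<Oplus>\<^bsub>F\<^esub>k\<in>{..<N}. \<ominus>\<^bsub>F\<^esub> \<one>\<^bsub>F\<^esub> \<otimes>\<^bsub>F\<^esub> (i (d k) \<otimes>\<^bsub>F\<^esub> \<zeta> [^]\<^bsub>F\<^esub> k))"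
    using c by (intro F.finsum_addf) auto
  also have "(\<Oplus>\<^bsub>F\<^esub>k\<in>{..<N}. \<ominus>\<^bsub>F\<^esub> \<one>\<^bsub>F\<^esub> \<otimes>\<^bsub>F\<^esub> (i (d k) \<otimes>\<^bsub>F\<^esub> \<zeta> [^]\<^bsub>F\<^esub> k)) = \<ominus>\<^bsub>F\<^esub> \<one>\<^bsub>F\<^esub> \<otimes>\<^bsub>F\<^esub> ?S d"
    using c by (intro F.finsum_rdistr[symmetric]) auto
  also have "?S c \<oplus>\<^bsub>F\<^esub> \<ominus>\<^bsub>F\<^esub> \<one>\<^bsub>F\<^esub> \<otimes>\<^bsub>F\<^esub> ?S d = \<zero>\<^bsub>F\<^esub>"
  proof -
    have "?S d \<in> carrier F" using c by (intro F.finsum_closed) auto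
    then show ?thesis unfolding eq by (simp add: F.l_minus F.r_neg)
  qed
  finally have "set ?q \<subseteq> {\<zero>\<^bsub>F\<^esub>}" using powers_independent[OF qK] by simp
  moreover have "i (?e k) \<in> set ?q" using k by auto
  ultimately have "i (?e k) = \<zero>\<^bsub>F\<^esub>" by blast
  then have z: "?e k = \<zero>\<^bsub>C\<^esub>" using i_eq_zero[OF eK[OF k]] by simp
  have cc: "c k \<in> carrier C" "d k \<in> carrier C" using c k by auto
  have "c k = \<ominus>\<^bsub>C\<^esub> (\<ominus>\<^bsub>C\<^esub> \<one>\<^bsub>C\<^esub> \<otimes>\<^bsub>C\<^esub> d k)"
    using z cc C.minus_equality[of "c k" "\<ominus>\<^bsub>C\<^esub> \<one>\<^bsub>C\<^esub> \<otimes>\<^bsub>C\<^esub> d k"] by simp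
  then show "c k = d k" using cc by (simp add: C.l_minus)
qed

text \<open>All coefficients are chosen at once, so the values for different k belong to the same
  expansion; uniqueness of the expansion makes them linear over \<open>OK\<close>.\<close>

definition coord :: "nat \<Rightarrow> 'f \<Rightarrow> 'c" where
  "coord k a = (SOME c. (\<forall>k<N. c k \<in> carrier OK) \<and> a = (\<Oplus>\<^bsub>F\<^esub>k\<in>{..<N}. i (c k) \<otimes>\<^bsub>F\<^esub> \<zeta> [^]\<^bsub>F\<^esub> k)) k"

lemma coord:
  assumes "a \<in> carrier OF"
  shows "k < N \<Longrightarrow> coord k a \<in> carrier OK"
    and "a = (\<Oplus>\<^bsub>F\<^esub>k\<in>{..<N}. i (coord k a) \<otimes>\<^bsub>F\<^esub> \<zeta> [^]\<^bsub>F\<^esub> k)"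
  using someI_ex[OF OF_coordinates_exist[OF assms]] unfolding coord_def by blast+

lemma coord_eqI:
  assumes "\<And>k. k < N \<Longrightarrow> c k \<in> carrier OK" "a \<in> carrier OF"
    "a = (\<Oplus>\<^bsub>F\<^esub>k\<in>{..<N}. i (c k) \<otimes>\<^bsub>F\<^esub> \<zeta> [^]\<^bsub>F\<^esub> k)" "k < N"
  shows "coord k a = c k"
  using OF_coordinates_unique[of "\<lambda>k. coord k a" c k] coord[OF assms(2)] assms OK_in_K by simp

lemma coord_add:
  assumes "a \<in> carrier OF" "b \<in> carrier OF" "k < N"
  shows "coord k (a \<oplus>\<^bsub>F\<^esub> b) = coord k a \<oplus>\<^bsub>C\<^esub> coord k b"
proof (rule coord_eqI)
  note K = OK_in_K[OF coord(1)[OF assms(1)]] OK_in_K[OF coord(1)[OF assms(2)]]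
  have "a \<oplus>\<^bsub>F\<^esub> b = (\<Oplus>\<^bsub>F\<^esub>k\<in>{..<N}. i (coord k a) \<otimes>\<^bsub>F\<^esub> \<zeta> [^]\<^bsub>F\<^esub> k) \<oplus>\<^bsub>F\<^esub> (\<Oplus>\<^bsub>F\<^esub>k\<in>{..<N}. i (coord k b) \<otimes>\<^bsub>F\<^esub> \<zeta> [^]\<^bsub>F\<^esub> k)"
    using coord(2)[OF assms(1)] coord(2)[OF assms(2)] by simp
  also have "\<dots> = (\<Oplus>\<^bsub>F\<^esub>k\<in>{..<N}. i (coord k a) \<otimes>\<^bsub>F\<^esub> \<zeta> [^]\<^bsub>F\<^esub> k \<oplus>\<^bsub>F\<^esub> i (coord k b) \<otimes>\<^bsub>F\<^esub> \<zeta> [^]\<^bsub>F\<^esub> k)"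
    using K by (intro F.finsum_addf[symmetric]) auto
  also have "\<dots> = (\<Oplus>\<^bsub>F\<^esub>k\<in>{..<N}. i (coord k a \<oplus>\<^bsub>C\<^esub> coord k b) \<otimes>\<^bsub>F\<^esub> \<zeta> [^]\<^bsub>F\<^esub> k)"
    using K subringE(7)[OF subfieldE(1)[OF K_subfield]]
    by (intro F.finsum_cong') (auto simp: i_add F.l_distr)
  finally show "a \<oplus>\<^bsub>F\<^esub> b = (\<Oplus>\<^bsub>F\<^esub>k\<in>{..<N}. i (coord k a \<oplus>\<^bsub>C\<^esub> coord k b) \<otimes>\<^bsub>F\<^esub> \<zeta> [^]\<^bsub>F\<^esub> k)" .
qed (use assms subringE(7)[OF OF_subring] subringE(7)[OF OK_subring] coord(1) in auto)

lemma coord_smult: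
  assumes "a \<in> carrier OF" "s \<in> carrier OK" "k < N"
  shows "coord k (i s \<otimes>\<^bsub>F\<^esub> a) = s \<otimes>\<^bsub>C\<^esub> coord k a"
proof (rule coord_eqI)
  note K = OK_in_K[OF coord(1)[OF assms(1)]] OK_in_K[OF assms(2)]
  have "i s \<otimes>\<^bsub>F\<^esub> a = i s \<otimes>\<^bsub>F\<^esub> (\<Oplus>\<^bsub>F\<^esub>k\<in>{..<N}. i (coord k a) \<otimes>\<^bsub>F\<^esub> \<zeta> [^]\<^bsub>F\<^esub> k)"
    using coord(2)[OF assms(1)] by simp
  also have "\<dots> = (\<Oplus>\<^bsub>F\<^esub>k\<in>{..<N}. i s \<otimes>\<^bsub>F\<^esub> (i (coord k a) \<otimes>\<^bsub>F\<^esub> \<zeta> [^]\<^bsub>F\<^esub> k))"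
    using K by (intro F.finsum_rdistr) auto
  also have "\<dots> = (\<Oplus>\<^bsub>F\<^esub>k\<in>{..<N}. i (s \<otimes>\<^bsub>C\<^esub> coord k a) \<otimes>\<^bsub>F\<^esub> \<zeta> [^]\<^bsub>F\<^esub> k)"
    using K subringE(6)[OF subfieldE(1)[OF K_subfield]]
    by (intro F.finsum_cong') (auto simp: i_mult F.m_assoc)
  finally show "i s \<otimes>\<^bsub>F\<^esub> a = (\<Oplus>\<^bsub>F\<^esub>k\<in>{..<N}. i (s \<otimes>\<^bsub>C\<^esub> coord k a) \<otimes>\<^bsub>F\<^esub> \<zeta> [^]\<^bsub>F\<^esub> k)" .
qed (use assms subringE(6)[OF OF_subring] subringE(6)[OF OK_subring] coord(1) i_OK in auto)

lemma \<zeta>_pow_OF: "\<zeta> [^]\<^bsub>F\<^esub> (k::nat) \<in> carrier OF"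
  using \<zeta> subringE(3,6)[OF OF_subring] by (induction k) auto

lemma coord_power:
  assumes "k < N" "l < N"
  shows "coord k (\<zeta> [^]\<^bsub>F\<^esub> l) = (if k = l then \<one>\<^bsub>C\<^esub> else \<zero>\<^bsub>C\<^esub>)"
proof (rule coord_eqI)
  have "(\<Oplus>\<^bsub>F\<^esub>k\<in>{..<N}. i (if k = l then \<one>\<^bsub>C\<^esub> else \<zero>\<^bsub>C\<^esub>) \<otimes>\<^bsub>F\<^esub> \<zeta> [^]\<^bsub>F\<^esub> k)
      = (\<Oplus>\<^bsub>F\<^esub>k\<in>{..<N}. if l = k then \<zeta> [^]\<^bsub>F\<^esub> k else \<zero>\<^bsub>F\<^esub>)"
    by (intro F.finsum_cong') (auto simp: i_one i_zero)
  also have "\<dots> = \<zeta> [^]\<^bsub>F\<^esub> l"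
    using F.add.finprod_singleton[of l "{..<N}" "\<lambda>k. \<zeta> [^]\<^bsub>F\<^esub> k"] assms by auto
  finally show "\<zeta> [^]\<^bsub>F\<^esub> l = (\<Oplus>\<^bsub>F\<^esub>k\<in>{..<N}. i (if k = l then \<one>\<^bsub>C\<^esub> else \<zero>\<^bsub>C\<^esub>) \<otimes>\<^bsub>F\<^esub> \<zeta> [^]\<^bsub>F\<^esub> k)" ..
qed (use assms \<zeta>_pow_OF subringE(2,3)[OF OK_subring] in auto)

section \<open>Embeddings of \<open>F\<close> and roots of the minimal polynomial\<close>

lemma field_embedding_hom:
  assumes "\<phi> \<in> field_embeddings K i F C"
  shows "\<phi> \<in> ring_hom F C" and "\<phi> \<in> extensional (carrier F)" and "x \<in> K \<Longrightarrow> \<phi> (i x) = x"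
  using assms by (auto simp: field_embeddings_def)

lemma embedding_root:
  assumes "\<phi> \<in> field_embeddings K i F C"
  shows "\<phi> \<zeta> \<in> carrier C" "C.eval minpoly (\<phi> \<zeta>) = \<zero>\<^bsub>C\<^esub>"
proof -
  note h = field_embedding_hom[OF assms]
  interpret \<phi>: ring_hom_ring F C \<phi> using h(1) F.ring_axioms C.ring_axioms by (intro ring_hom_ringI2)
  show "\<phi> \<zeta> \<in> carrier C" by simp
  have "set minpoly_F \<subseteq> carrier F" using minpoly_F_props(2) by auto
  then have "\<phi> (F.eval minpoly_F \<zeta>) = C.eval (map \<phi> minpoly_F) (\<phi> \<zeta>)"
    by (intro \<phi>.eval_hom') auto
  moreover have "map \<phi> minpoly_F = minpoly"
  proof -
    have "\<phi> (i x) = x" if "x \<in> set minpoly" for x using h(3) minpoly_props(1) that by blast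
    then show ?thesis unfolding map_i_minpoly[symmetric] by (simp add: map_idI)
  qed
  ultimately show "C.eval minpoly (\<phi> \<zeta>) = \<zero>\<^bsub>C\<^esub>" using minpoly_F(4) by simp
qed

lemma embedding_eqI:
  assumes \<phi>: "\<phi> \<in> field_embeddings K i F C" and \<psi>: "\<psi> \<in> field_embeddings K i F C" and eq: "\<phi> \<zeta> = \<psi> \<zeta>"
  shows "\<phi> = \<psi>"
proof (rule extensionalityI[OF field_embedding_hom(2)[OF \<phi>] field_embedding_hom(2)[OF \<psi>]])
  interpret \<phi>: ring_hom_ring F C \<phi>
    using field_embedding_hom(1)[OF \<phi>] F.ring_axioms C.ring_axioms by (intro ring_hom_ringI2)
  interpret \<psi>: ring_hom_ring F C \<psi>
    using field_embedding_hom(1)[OF \<psi>] F.ring_axioms C.ring_axioms by (intro ring_hom_ringI2)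
  fix x assume "x \<in> carrier F"
  then have "x \<in> F.simple_extension (i ` K) \<zeta>" by (simp add: F_generated)
  then show "\<phi> x = \<psi> x"
  proof (induction rule: F.simple_extension.induct)
    case (lin k1 k2)
    obtain w where w: "w \<in> K" "k2 = i w" using lin.hyps(2) by blast
    have "k1 \<in> carrier F" "k2 \<in> carrier F" using lin.hyps(1) F_generated w by simp_all
    moreover have "\<phi> k2 = \<psi> k2"
      using field_embedding_hom(3)[OF \<phi> w(1)] field_embedding_hom(3)[OF \<psi> w(1)] w(2) by simp
    ultimately show ?case using lin.IH eq by (simp add: \<phi>.hom_add \<psi>.hom_add \<phi>.hom_mult \<psi>.hom_mult)
  qed simp
qed

text \<open>Thus the linear factors of \<open>e_poly\<close> belong to distinct roots of
  \<open>minpoly\<close>. This gives its degree and its divisibility property without any appeal to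
  separability.\<close>

lemma embedding_inj: "inj_on (\<lambda>\<phi>. \<phi> \<zeta>) (field_embeddings K i F C)"
  using embedding_eqI by (auto intro: inj_onI)

lemma embeddings_finite: "finite (field_embeddings K i F C)"
proof -
  have "minpoly \<in> carrier (poly_ring C)"
    using minpoly_props by (auto simp: univ_poly_carrier[symmetric] polynomial_def)
  moreover have "minpoly \<noteq> []" using minpoly_props(2) by auto
  ultimately have "(\<lambda>\<phi>. \<phi> \<zeta>) ` field_embeddings K i F C \<subseteq> set_mset (C.roots minpoly)"
    using embedding_root C.roots_mem_iff_is_root by (auto simp: C.is_root_def)
  then have "finite ((\<lambda>\<phi>. \<phi> \<zeta>) ` field_embeddings K i F C)" by (rule finite_subset) simp
  then show ?thesis using embedding_inj by (rule finite_imageD)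
qed

end

section \<open>Products of distinct linear factors\<close>

context domain
begin

text \<open>This is \<open>e_poly\<close> reindexed by the values of the embeddings at \<zeta>, so
  that its properties can be proved for sets of field elements.\<close>

definition root_product :: "'a set \<Rightarrow> 'a list" where
  "root_product Y = (\<Otimes>\<^bsub>poly_ring R\<^esub>y\<in>Y. [\<one>, \<ominus> y])"

lemma linear_factor_closed: "y \<in> carrier R \<Longrightarrow> [\<one>, \<ominus> y] \<in> carrier (poly_ring R)"
  by (auto simp: univ_poly_carrier[symmetric] polynomial_def)

lemma root_product_insert:
  assumes "finite Y" "y \<notin> Y" "insert y Y \<subseteq> carrier R"
  shows "root_product (insert y Y) = poly_mult [\<one>, \<ominus> y] (root_product Y)"
proof -
  interpret UP: cring "poly_ring R" using univ_poly_is_cring[OF carrier_is_subring] .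
  have "root_product (insert y Y) = [\<one>, \<ominus> y] \<otimes>\<^bsub>poly_ring R\<^esub> root_product Y"
    unfolding root_product_def using assms linear_factor_closed by (intro UP.finprod_insert) auto
  then show ?thesis by (simp only: univ_poly_mult)
qed

lemma root_product_empty: "root_product {} = [\<one>]"
proof -
  interpret UP: cring "poly_ring R" using univ_poly_is_cring[OF carrier_is_subring] .
  show ?thesis unfolding root_product_def UP.finprod_empty by (simp add: univ_poly_one)
qed

lemma root_product_props:
  assumes D: "subring D R" and "finite Y" "Y \<subseteq> D"
  shows "polynomial D (root_product Y)" "length (root_product Y) = Suc (card Y)"
    "hd (root_product Y) = \<one>" "\<And>y. y \<in> Y \<Longrightarrow> eval (root_product Y) y = \<zero>"
proof -
  have "polynomial D (root_product Y) \<and> length (root_product Y) = Suc (card Y) \<and>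
    hd (root_product Y) = \<one> \<and> (\<forall>y\<in>Y. eval (root_product Y) y = \<zero>)"
    using assms(2,3)
  proof (induction Y rule: finite_induct)
    case empty
    then show ?case using subringE(3)[OF D] by (auto simp: root_product_empty polynomial_def)
  next
    case (insert y Y)
    have Dc: "D \<subseteq> carrier R" using subringE(1)[OF D] .
    have eq: "root_product (insert y Y) = poly_mult [\<one>, \<ominus> y] (root_product Y)"
      using insert Dc by (intro root_product_insert) auto
    have lf: "polynomial D [\<one>, \<ominus> y]" using insert.prems subringE(3,5)[OF D] by (auto simp: polynomial_def)
    have IH: "polynomial D (root_product Y)" "length (root_product Y) = Suc (card Y)"
      "hd (root_product Y) = \<one>" "\<forall>y\<in>Y. eval (root_product Y) y = \<zero>" using insert by auto
    have ne: "root_product Y \<noteq> []" using IH(2) by auto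
    have P: "polynomial D (root_product (insert y Y))" unfolding eq by (rule poly_mult_closed[OF D lf IH(1)])
    have h: "hd (root_product (insert y Y)) = \<one>"
      unfolding eq using poly_mult_lead_coeff[OF D lf IH(1)] ne IH(3) by (simp del: poly_mult.simps)
    have "degree (root_product (insert y Y)) = Suc (degree (root_product Y))"
      unfolding eq using poly_mult_degree_eq[OF D lf IH(1)] ne by (simp del: poly_mult.simps)
    moreover have "root_product (insert y Y) \<noteq> []"
      unfolding eq using poly_mult_integral[OF D lf IH(1)] ne by (auto simp del: poly_mult.simps)
    ultimately have l: "length (root_product (insert y Y)) = Suc (card (insert y Y))"
      using IH(2) insert.hyps by (cases "root_product (insert y Y)") auto
    have "eval (root_product (insert y Y)) x = \<zero>" if x: "x \<in> insert y Y" for x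
    proof -
      have xc: "x \<in> carrier R" "y \<in> carrier R" using x insert.prems Dc by auto
      have "set (root_product Y) \<subseteq> carrier R" using polynomial_incl[OF IH(1)] Dc by blast
      then have "eval (root_product (insert y Y)) x = eval [\<one>, \<ominus> y] x \<otimes> eval (root_product Y) x"
        and "eval (root_product Y) x \<in> carrier R"
        unfolding eq using xc by (auto intro!: eval_poly_mult eval_in_carrier simp del: poly_mult.simps eval.simps)
      then show ?thesis using x IH(4) xc by (auto simp: r_neg)
    qed
    then show ?case using P h l by blast
  qed
  then show "polynomial D (root_product Y)" "length (root_product Y) = Suc (card Y)"
    "hd (root_product Y) = \<one>" "\<And>y. y \<in> Y \<Longrightarrow> eval (root_product Y) y = \<zero>" by auto
qed

text \<open>Injectivity of \<tau> keeps the factors distinct. The use is for automorphisms of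
  \<open>C\<close> that permute the roots.\<close>

lemma root_product_map:
  assumes \<tau>: "\<tau> \<in> ring_hom R R" "inj_on \<tau> (carrier R)" and Y: "finite Y" "Y \<subseteq> carrier R"
  shows "map \<tau> (root_product Y) = root_product (\<tau> ` Y)"
  using Y
proof (induction Y rule: finite_induct)
  case empty then show ?case using ring_hom_one[OF \<tau>(1)] by (simp add: root_product_empty)
next
  interpret \<tau>: ring_hom_ring R R \<tau> using \<tau>(1) ring_axioms by (intro ring_hom_ringI2)
  case (insert y Y)
  note P = root_product_props[OF carrier_is_subring]
  have s: "set (root_product Y) \<subseteq> carrier R" using polynomial_incl[OF P(1)[of Y]] insert by auto
  have ni: "\<tau> y \<notin> \<tau> ` Y" 
  proof
    assume "\<tau> y \<in> \<tau> ` Y"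
    then obtain w where "w \<in> Y" "\<tau> y = \<tau> w" by blast
    then show False using inj_onD[OF \<tau>(2), of y w] insert by auto
  qed
  have eq: "root_product (insert y Y) = poly_mult [\<one>, \<ominus> y] (root_product Y)"
    using insert by (intro root_product_insert) auto
  have "normalize (map \<tau> (root_product (insert y Y))) = poly_mult (map \<tau> [\<one>, \<ominus> y]) (map \<tau> (root_product Y))"
    unfolding eq using s insert.prems by (intro \<tau>.poly_mult_hom') auto
  also have "\<dots> = poly_mult [\<one>, \<ominus> (\<tau> y)] (root_product (\<tau> ` Y))"
    using insert by (simp del: poly_mult.simps)
  also have "\<dots> = root_product (insert (\<tau> y) (\<tau> ` Y))"
    using insert ni by (intro root_product_insert[symmetric]) auto
  finally have "normalize (map \<tau> (root_product (insert y Y))) = root_product (\<tau> ` insert y Y)" by simp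
  moreover have "polynomial (carrier R) (map \<tau> (root_product (insert y Y)))"
  proof -
    have "root_product (insert y Y) \<noteq> []" using P(2)[of "insert y Y"] insert by auto
    moreover have "set (root_product (insert y Y)) \<subseteq> carrier R" using polynomial_incl[OF P(1)[of "insert y Y"]] insert by auto
    ultimately show ?thesis using P(3)[of "insert y Y"] insert by (auto simp: polynomial_def hd_map)
  qed
  ultimately show ?case using normalize_polynomial by simp
qed

text \<open>A remainder of degree less than \<open>card Y\<close> that vanishes on \<open>Y\<close> is zero.\<close>

lemma root_product_divides:
  assumes "field R" and D: "subring D R" and Y: "finite Y" "Y \<subseteq> carrier R"
    and rp: "polynomial D (root_product Y)" and q: "polynomial D q"
    and roots: "\<And>y. y \<in> Y \<Longrightarrow> eval q y = \<zero>"
  shows "\<exists>b. polynomial D b \<and> q = poly_mult (root_product Y) b"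
proof -
  interpret field R by fact
  note P = rp root_product_props(2-)[OF carrier_is_subring Y]
  have Dc: "D \<subseteq> carrier R" using subringE(1)[OF D] .
  have "root_product Y \<noteq> []" using P(2) by auto
  \<comment> \<open>Division with remainder stays over the subring \<open>D\<close> because the
    divisor is monic.\<close>
  moreover have "\<one> \<in> Units (R\<lparr>carrier := D\<rparr>)" using subringE(3)[OF D] by (auto simp: Units_def intro!: bexI[of _ \<one>])
  ultimately obtain b r where b: "polynomial D b" and r: "polynomial D r"
    and eq: "q = (root_product Y \<otimes>\<^bsub>univ_poly R D\<^esub> b) \<oplus>\<^bsub>univ_poly R D\<^esub> r"
    and dr: "r = [] \<or> degree r < degree (root_product Y)"
    using long_division_theorem[OF D q P(1)] P(3) by auto
  have rc: "r \<in> carrier (poly_ring R)"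
    using r Dc by (auto simp: univ_poly_carrier[symmetric] polynomial_def)
  have sc: "set (root_product Y) \<subseteq> carrier R" "set b \<subseteq> carrier R" "set r \<subseteq> carrier R"
    using P(1) b r Dc by (auto dest!: polynomial_incl)
  have "r = []"
  proof (rule ccontr)
    assume rn: "r \<noteq> []"
    have "Y \<subseteq> set_mset (roots r)"
    proof
      fix y assume y: "y \<in> Y"
      then have yc: "y \<in> carrier R" using Y Dc by auto
      have mc: "set (poly_mult (root_product Y) b) \<subseteq> carrier R"
        using sc poly_mult_in_carrier by simp
      have "eval q y = eval (poly_mult (root_product Y) b) y \<oplus> eval r y"
        unfolding eq univ_poly_mult univ_poly_add using mc sc(3) yc by (rule eval_poly_add)
      also have "eval (poly_mult (root_product Y) b) y = eval (root_product Y) y \<otimes> eval b y"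
        using sc(1,2) yc by (rule eval_poly_mult)
      finally have "eval r y = \<zero>"
        using P(4)[OF y] roots[OF y] eval_in_carrier[OF sc(2) yc] eval_in_carrier[OF sc(3) yc] by simp
      then show "y \<in> set_mset (roots r)" using roots_mem_iff_is_root[OF rc] yc rn by (simp add: is_root_def)
    qed
    then have "card Y \<le> card (set_mset (roots r))" by (intro card_mono) auto
    also have "\<dots> \<le> size (roots r)"
      using size_mset_mono[OF mset_set_set_mset_msubset, of "roots r"] by simp
    also have "\<dots> \<le> degree r" by (rule size_roots_le_degree[OF rc])
    finally show False using dr rn P(2) by simp
  qed
  moreover have "poly_add (poly_mult (root_product Y) b) [] = poly_mult (root_product Y) b"
    using poly_add_zero(1)[OF D poly_mult_closed[OF D P(1) b]] .
  ultimately show ?thesis using b eq by (auto simp: univ_poly_mult univ_poly_add simp del: poly_add.simps)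
qed

end

section \<open>The coefficients of the polynomials \<open>e_poly\<close>\<close>

context local_extension
begin

lemma e_poly_eq_root_product:
  assumes "S \<subseteq> field_embeddings K i F C"
  shows "e_poly C \<zeta> S = C.root_product ((\<lambda>\<phi>. \<phi> \<zeta>) ` S)"
proof -
  interpret UP: cring "poly_ring C" using C.univ_poly_is_cring[OF C.carrier_is_subring] .
  have "finite S" using embeddings_finite assms finite_subset by auto
  moreover have "inj_on (\<lambda>\<phi>. \<phi> \<zeta>) S" using embedding_inj assms inj_on_subset by blast
  ultimately show ?thesis
    unfolding e_poly_def C.root_product_def
    using assms embedding_root(1) C.linear_factor_closed by (subst UP.finprod_reindex) auto
qed

text \<open>An automorphism that permutes S permutes the roots, so applying it to the coefficients
  gives the same polynomial.\<close>

lemma e_poly_fixed: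
  assumes S: "S \<subseteq> field_embeddings K i F C" and \<tau>: "\<tau> \<in> galois_group C K" "compose (carrier F) \<tau> ` S = S"
    and x: "x \<in> set (e_poly C \<zeta> S)"
  shows "\<tau> x = x"
proof -
  let ?Y = "(\<lambda>\<phi>. \<phi> \<zeta>) ` S"
  have fin: "finite ?Y" using embeddings_finite S finite_subset by auto
  have Yc: "?Y \<subseteq> carrier C" using S embedding_root(1) by auto
  have h: "\<tau> \<in> ring_hom C C" "inj_on \<tau> (carrier C)"
    using \<tau>(1) by (auto simp: galois_group_def ring_iso_def bij_betw_def)
  have "\<tau> ` ?Y = (\<lambda>\<phi>. \<phi> \<zeta>) ` (compose (carrier F) \<tau> ` S)"
    by (auto simp: image_iff compose_def)
  then have "\<tau> ` ?Y = ?Y" using \<tau>(2) by simp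
  then have "map \<tau> (C.root_product ?Y) = map id (C.root_product ?Y)"
    using C.root_product_map[OF h fin Yc] by simp
  then have "\<forall>x\<in>set (C.root_product ?Y). \<tau> x = id x" by (simp only: map_eq_conv)
  then show ?thesis using x unfolding e_poly_eq_root_product[OF S] by simp
qed

text \<open>The coefficients are integral since the conjugates of \<zeta> are, and they lie in the
  reflex field by Galois invariance.\<close>

lemma e_poly_integral:
  assumes S: "S \<subseteq> field_embeddings K i F C" and E: "subring E C" "reflex_field C K F S \<subseteq> E"
  shows "set (e_poly C \<zeta> S) \<subseteq> {x \<in> E. integral_over C Z x}"
proof
  let ?D = "{x \<in> carrier C. integral_over C Z x}"
  have D: "subring ?D C"
    using subringE(1)[OF Z_subring] by (intro intC.integral_closure_subring C.carrier_is_subring C.one_not_zero)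
  fix x assume x: "x \<in> set (e_poly C \<zeta> S)"
  have "finite ((\<lambda>\<phi>. \<phi> \<zeta>) ` S)" using embeddings_finite S finite_subset by auto
  moreover have "(\<lambda>\<phi>. \<phi> \<zeta>) ` S \<subseteq> ?D" using S embedding_root minpoly_root_integral by auto
  ultimately have "x \<in> ?D"
    using x C.polynomial_incl[OF C.root_product_props(1)[OF D]] unfolding e_poly_eq_root_product[OF S] by blast
  moreover have "x \<in> reflex_field C K F S"
    using calculation e_poly_fixed[OF S _ _ x] by (auto simp: reflex_field_def)
  ultimately show "x \<in> {x \<in> E. integral_over C Z x}" using E(2) by auto
qed

lemma K_in_reflex_field: "K \<subseteq> reflex_field C K F S"
  by (auto simp: reflex_field_def galois_group_def)

end

section \<open>Functionals on the tensor product\<close>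

text \<open>Such sequences will be the values on powers of \<open>x\<close> of functionals that
  vanish on multiples of a monic polynomial of degree D.\<close>

lemma (in cring) linear_recurrence_exists:
  fixes D :: nat and e init :: "nat \<Rightarrow> 'a"
  assumes e: "\<And>t. t < D \<Longrightarrow> e t \<in> carrier R" and init: "\<And>t. init t \<in> carrier R"
  shows "\<exists>u. (\<forall>k. u k \<in> carrier R) \<and> (\<forall>k<D. u k = init k) \<and>
    (\<forall>k. u (k + D) = \<ominus> (\<Oplus>t\<in>{..<D}. e t \<otimes> u (k + t)))"
proof (cases "D = 0")
  case True
  then show ?thesis by (intro exI[of _ "\<lambda>_. \<zero>"]) auto
next
  case False
  define nxt where "nxt w = \<ominus> (\<Oplus>t\<in>{..<D}. e t \<otimes> w t)" for w :: "nat \<Rightarrow> 'a"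
  \<comment> \<open>The state of the recurrence: for t < D, \<open>w k t\<close> is the term with
    index k + t. One step shifts this window and puts the next term at its end.\<close>
  define w where "w = rec_nat init (\<lambda>_ w t. if Suc t < D then w (Suc t) else nxt w)"
  have w0: "w 0 = init" and wS: "w (Suc k) t = (if Suc t < D then w k (Suc t) else nxt (w k))" for k t
    by (simp_all add: w_def)
  have wc: "w k t \<in> carrier R" for k t
  proof (induction k arbitrary: t)
    case (Suc k)
    then show ?case using e unfolding wS nxt_def by auto
  qed (simp add: w0 init)
  have shift: "w k t = w (k + t) 0" if "t < D" for k t
    using that
  proof (induction t arbitrary: k)
    case (Suc t)
    then show ?case using wS[of k t] Suc.IH[of "Suc k"] by simp
  qed simp
  have "w (k + D) 0 = \<ominus> (\<Oplus>t\<in>{..<D}. e t \<otimes> w (k + t) 0)" for k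
  proof -
    have "w (k + D) 0 = w (Suc k) (D - 1)" using shift[of "D - 1" "Suc k"] False by simp
    also have "\<dots> = nxt (w k)" using wS[of k "D - 1"] False by simp
    also have "\<dots> = \<ominus> (\<Oplus>t\<in>{..<D}. e t \<otimes> w (k + t) 0)"
    proof -
      have "(\<Oplus>t\<in>{..<D}. e t \<otimes> w k t) = (\<Oplus>t\<in>{..<D}. e t \<otimes> w (k + t) 0)"
      proof (rule finsum_cong')
        fix t assume "t \<in> {..<D}"
        then show "e t \<otimes> w k t = e t \<otimes> w (k + t) 0" using shift[of t k] by simp
      qed (use wc e in auto)
      then show ?thesis by (simp only: nxt_def)
    qed
    finally show ?thesis .
  qed
  moreover have "w k 0 = init k" if "k < D" for k using shift[OF that, of 0] w0 by simp
  ultimately show ?thesis using wc by (intro exI[of _ "\<lambda>k. w k 0"]) auto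
qed

locale tensor_extension = local_extension p z C K F i \<zeta> OK OF
  for p :: nat and z :: "(nat \<Rightarrow> int) \<Rightarrow> 'c" and C :: "'c ring" and K :: "'c set"
    and F :: "'f ring" and i :: "'c \<Rightarrow> 'f" and \<zeta> :: 'f and OK :: "'c ring" and OF :: "'f ring" +
  fixes E :: "'c set" and OE :: "'c ring" and R :: "'r ring" and \<rho> :: "'c \<Rightarrow> 'r"
  assumes E: "subring E C" "K \<subseteq> E"
    and OE: "OE = ring_of_integers C (z ` carrier (padic_integers p)) E"
    and R_cring: "cring R" and \<rho>_hom: "\<rho> \<in> ring_hom OE R"
begin

lemma OE_carrier: "carrier OE = {x \<in> E. integral_over C Z x}"
  by (simp add: OE ring_of_integers_def)

lemma OE_subring: "subring (carrier OE) C"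
  unfolding OE_carrier using E Z_subset_K
  by (intro intC.integral_closure_subring C.one_not_zero) auto

lemma OE_record: "OE = C\<lparr>carrier := carrier OE\<rparr>" by (simp add: OE ring_of_integers_def)

lemma OE_cring: "cring OE"
  using C.subcring_iff[OF subringE(1)[OF OE_subring]] OE_record C.subcringI'[OF OE_subring] by simp

lemma OK_in_OE: "x \<in> carrier OK \<Longrightarrow> x \<in> carrier OE"
  using E(2) by (auto simp: OK_carrier OE_carrier)

lemma OE_closed: "x \<in> carrier OE \<Longrightarrow> x \<in> carrier C"
  using subringE(1)[OF OE_subring] by auto

lemma ring_simps [simp]:
  "x \<otimes>\<^bsub>OE\<^esub> y = x \<otimes>\<^bsub>C\<^esub> y" "x \<oplus>\<^bsub>OE\<^esub> y = x \<oplus>\<^bsub>C\<^esub> y" "\<one>\<^bsub>OE\<^esub> = \<one>\<^bsub>C\<^esub>" "\<zero>\<^bsub>OE\<^esub> = \<zero>\<^bsub>C\<^esub>"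
  "a \<otimes>\<^bsub>OF\<^esub> b = a \<otimes>\<^bsub>F\<^esub> b" "a \<oplus>\<^bsub>OF\<^esub> b = a \<oplus>\<^bsub>F\<^esub> b" "\<one>\<^bsub>OF\<^esub> = \<one>\<^bsub>F\<^esub>" "\<zero>\<^bsub>OF\<^esub> = \<zero>\<^bsub>F\<^esub>"
  by (simp_all add: OE OF ring_of_integers_def)

sublocale R: cring R by (rule R_cring)
sublocale OE: cring OE by (rule OE_cring)
sublocale OF: cring OF by (rule OF_cring)

sublocale \<rho>: ring_hom_ring OE R \<rho>
  using \<rho>_hom OE.ring_axioms R.ring_axioms by (intro ring_hom_ringI2)

sublocale TE: tensor_setting OK i OF id OE
  by unfold_locales (auto simp: i_OK OK_in_OE)

sublocale TR: tensor_setting OK i OF \<rho> R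
  by unfold_locales (auto simp: i_OK OK_in_OE)

abbreviation "T \<equiv> tensor_ring OK i OF \<rho> R"
abbreviation "pt \<equiv> pure_tensor OK i OF \<rho> R"

definition j :: "'r \<Rightarrow> ('f \<times> 'r \<Rightarrow>\<^sub>0 int) set" where "j = pt \<one>\<^bsub>OF\<^esub>"

definition x :: "('f \<times> 'r \<Rightarrow>\<^sub>0 int) set" where "x = pt \<zeta> \<one>\<^bsub>R\<^esub>"

lemma one_OF: "\<one>\<^bsub>F\<^esub> \<in> carrier OF" using subringE(3)[OF OF_subring] .

lemma j_hom: "j \<in> ring_hom R T"
proof (rule ring_hom_memI)
  fix r s assume rs: "r \<in> carrier R" "s \<in> carrier R"
  show "j r \<in> carrier T" using rs one_OF by (simp add: j_def)
  show "j (r \<otimes>\<^bsub>R\<^esub> s) = j r \<otimes>\<^bsub>T\<^esub> j s"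
    using rs one_OF TR.pt_mult[of "\<one>\<^bsub>F\<^esub>" r "\<one>\<^bsub>F\<^esub>" s] by (simp add: j_def)
  show "j (r \<oplus>\<^bsub>R\<^esub> s) = j r \<oplus>\<^bsub>T\<^esub> j s" using rs one_OF by (simp add: j_def TR.pt_add_right)
qed (use TR.pt_one in \<open>simp add: j_def\<close>)

sublocale j: ring_hom_ring R T j
  using j_hom R.ring_axioms TR.T.ring_axioms by (intro ring_hom_ringI2)

lemma x_closed [simp]: "x \<in> carrier T" using \<zeta> by (simp add: x_def)

lemma pt_pow: "pt (\<zeta> [^]\<^bsub>F\<^esub> (k::nat)) \<one>\<^bsub>R\<^esub> = x [^]\<^bsub>T\<^esub> k"
proof (induction k)
  case 0 then show ?case using TR.pt_one by simp
next
  case (Suc k)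
  then show ?case using TR.pt_mult[of "\<zeta> [^]\<^bsub>F\<^esub> k" "\<one>\<^bsub>R\<^esub>" \<zeta> "\<one>\<^bsub>R\<^esub>"] \<zeta> \<zeta>_pow_OF[of k] by (simp add: x_def)
qed

lemma pt_OK: "s \<in> carrier OK \<Longrightarrow> pt (i s) \<one>\<^bsub>R\<^esub> = j (\<rho> s)"
  using TR.pt_balanced[of s "\<one>\<^bsub>OF\<^esub>" "\<one>\<^bsub>R\<^esub>"] one_OF OK_in_OE[of s] by (simp add: OK_in_K j_def)

lemma pt_eq_j: "a \<in> carrier OF \<Longrightarrow> r \<in> carrier R \<Longrightarrow> pt a r = j r \<otimes>\<^bsub>T\<^esub> pt a \<one>\<^bsub>R\<^esub>"
  using TR.pt_mult[of "\<one>\<^bsub>OF\<^esub>" r a "\<one>\<^bsub>R\<^esub>"] one_OF OF_in_F by (simp add: j_def)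

lemma pt_hom: "(\<lambda>a. pt a \<one>\<^bsub>R\<^esub>) \<in> ring_hom OF T"
proof (rule ring_hom_memI)
  fix a b assume ab: "a \<in> carrier OF" "b \<in> carrier OF"
  show "pt a \<one>\<^bsub>R\<^esub> \<in> carrier T" using ab by simp
  show "pt (a \<otimes>\<^bsub>OF\<^esub> b) \<one>\<^bsub>R\<^esub> = pt a \<one>\<^bsub>R\<^esub> \<otimes>\<^bsub>T\<^esub> pt b \<one>\<^bsub>R\<^esub>"
    using TR.pt_mult[OF ab(1) R.one_closed ab(2) R.one_closed] by simp
  show "pt (a \<oplus>\<^bsub>OF\<^esub> b) \<one>\<^bsub>R\<^esub> = pt a \<one>\<^bsub>R\<^esub> \<oplus>\<^bsub>T\<^esub> pt b \<one>\<^bsub>R\<^esub>"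
    using TR.pt_add_left[OF ab R.one_closed] by simp
qed (use TR.pt_one in simp)

abbreviation "TM \<equiv> restrict_scalars j (regular_module T)"

lemma restrict_scalars_module:
  assumes "module T V"
  shows "module R (restrict_scalars j V)"
proof -
  interpret V: module T V by fact
  have ag: "abelian_group (restrict_scalars j V)"
    by (rule abelian_groupI) (auto simp: restrict_scalars_def V.a_ac intro: bexI[of _ "\<ominus>\<^bsub>V\<^esub> _"] V.l_neg)
  show ?thesis
    by (rule moduleI[OF R_cring ag])
      (auto simp: restrict_scalars_def V.smult_l_distr V.smult_r_distr V.smult_assoc1)
qed

lemma restrict_scalars_simps [simp]:
  "carrier (restrict_scalars j V) = carrier V" "\<zero>\<^bsub>restrict_scalars j V\<^esub> = \<zero>\<^bsub>V\<^esub>"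
  "v \<oplus>\<^bsub>restrict_scalars j V\<^esub> w = v \<oplus>\<^bsub>V\<^esub> w" "r \<odot>\<^bsub>restrict_scalars j V\<^esub> v = j r \<odot>\<^bsub>V\<^esub> v"
  by (simp_all add: restrict_scalars_def)

lemma TM_module: "module R TM"
  by (rule restrict_scalars_module[OF TR.T.regular_module_is_module])

sublocale TM: module R TM by (rule TM_module)

text \<open>Stated for every submodule H rather than as a formula for a span, so that kernels of
  functionals can be inserted. A pure tensor of a and r is r times that of a and one, and a is a
  polynomial in \<zeta> over \<open>OK\<close>.\<close>

lemma T_spanned_by_powers:
  assumes H: "submodule H R TM" and pow: "\<And>k::nat. x [^]\<^bsub>T\<^esub> k \<in> H"
  shows "carrier T \<subseteq> H"
proof
  note E = TM.submoduleE[OF H]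
  have closed: "\<zero>\<^bsub>T\<^esub> \<in> H" "s \<in> H \<Longrightarrow> t \<in> H \<Longrightarrow> s \<oplus>\<^bsub>T\<^esub> t \<in> H" "r \<in> carrier R \<Longrightarrow> t \<in> H \<Longrightarrow> j r \<otimes>\<^bsub>T\<^esub> t \<in> H" for s t r
    using TM.submodule_zero[OF H] E(4)[of r t] E(5)[of s t] by simp_all
  have sub: "t \<in> carrier T" if "t \<in> H" for t using E(1) that by auto
  interpret pt1: ring_hom_ring OF T "\<lambda>a. pt a \<one>\<^bsub>R\<^esub>"
    using pt_hom OF.ring_axioms TR.T.ring_axioms by (intro ring_hom_ringI2)
  have pt1: "pt a \<one>\<^bsub>R\<^esub> \<in> H" if a: "a \<in> carrier OF" for a
  proof -
    have "pt (F.eval (map i q) \<zeta>) \<one>\<^bsub>R\<^esub> \<in> H" if "set q \<subseteq> carrier OK" for q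
      using that
    proof (induction q)
      case Nil then show ?case using pt1.hom_zero closed(1) by simp
    next
      case (Cons s q)
      have s: "s \<in> carrier OK" "i s \<in> carrier OF" using Cons.prems i_OK by auto
      have "set (map i q) \<subseteq> carrier OF" using Cons.prems i_OK by auto
      then have ev: "F.eval (map i q) \<zeta> \<in> carrier OF"
        using OF.eval_in_carrier[of "map i q" \<zeta>] \<zeta> F.eval_consistent[OF OF_subring] OF_record by simp
      have m: "i s \<otimes>\<^bsub>F\<^esub> \<zeta> [^]\<^bsub>F\<^esub> length q \<in> carrier OF" using subringE(6)[OF OF_subring s(2) \<zeta>_pow_OF] .
      have "pt (F.eval (map i (s # q)) \<zeta>) \<one>\<^bsub>R\<^esub> = pt (i s \<otimes>\<^bsub>F\<^esub> \<zeta> [^]\<^bsub>F\<^esub> length q) \<one>\<^bsub>R\<^esub> \<oplus>\<^bsub>T\<^esub> pt (F.eval (map i q) \<zeta>) \<one>\<^bsub>R\<^esub>"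
        using pt1.hom_add[OF m ev] by simp
      also have "pt (i s \<otimes>\<^bsub>F\<^esub> \<zeta> [^]\<^bsub>F\<^esub> length q) \<one>\<^bsub>R\<^esub> = j (\<rho> s) \<otimes>\<^bsub>T\<^esub> x [^]\<^bsub>T\<^esub> length q"
        using pt1.hom_mult[OF s(2) \<zeta>_pow_OF[of "length q"]]
        by (simp only: ring_simps pt_OK[OF s(1)] pt_pow)
      finally have eq: "pt (F.eval (map i (s # q)) \<zeta>) \<one>\<^bsub>R\<^esub>
        = j (\<rho> s) \<otimes>\<^bsub>T\<^esub> x [^]\<^bsub>T\<^esub> length q \<oplus>\<^bsub>T\<^esub> pt (F.eval (map i q) \<zeta>) \<one>\<^bsub>R\<^esub>" .
      have "\<rho> s \<in> carrier R" using OK_in_OE[OF s(1)] by simp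
      moreover have "pt (F.eval (map i q) \<zeta>) \<one>\<^bsub>R\<^esub> \<in> H" using Cons by simp
      ultimately show ?case unfolding eq by (intro closed(2,3) pow)
    qed
    moreover obtain q where q: "set q \<subseteq> i ` carrier OK" and "F.eval q \<zeta> = a"
      using powers.low_as_eval[OF \<zeta>_closed OF_low[OF a]] by blast
    moreover have "q = map i (map (inv_into (carrier OK) i) q)" "set (map (inv_into (carrier OK) i) q) \<subseteq> carrier OK"
      using f_inv_into_f[OF subsetD[OF q]] inv_into_into[OF subsetD[OF q]]
      by (auto intro!: map_idI[symmetric])
    ultimately show ?thesis by metis
  qed
  fix t assume t: "t \<in> carrier T"
  have "t \<in> H \<and> t \<in> carrier T" using t
  proof (induction t rule: TR.tensor_induct)
    case (diff s t)
    have "\<ominus>\<^bsub>T\<^esub> t = j (\<ominus>\<^bsub>R\<^esub> \<one>\<^bsub>R\<^esub>) \<otimes>\<^bsub>T\<^esub> t" using diff by (simp add: TR.T.l_minus)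
    then show ?case using diff closed(2) closed(3)[of "\<ominus>\<^bsub>R\<^esub> \<one>\<^bsub>R\<^esub>" t] by (simp add: a_minus_def)
  next
    case (pure a r)
    then show ?case using closed(3)[OF _ pt1] pt_eq_j[of a r] by simp
  qed (use closed in auto)
  then show "t \<in> H" ..
qed

text \<open>The linear functional on polynomials with values \<open>u\<close> on the powers of the variable, applied to
  \<open>q\<close> times the \<open>k\<close>-th power of the variable.\<close>

primrec seq_eval :: "(nat \<Rightarrow> 'r) \<Rightarrow> 'c list \<Rightarrow> nat \<Rightarrow> 'r" where
  "seq_eval u [] k = \<zero>\<^bsub>R\<^esub>"
| "seq_eval u (a # q) k = \<rho> a \<otimes>\<^bsub>R\<^esub> u (k + length q) \<oplus>\<^bsub>R\<^esub> seq_eval u q k"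

context
  fixes u :: "nat \<Rightarrow> 'r"
  assumes u: "\<And>k. u k \<in> carrier R"
begin

lemma seq_eval_closed: "set q \<subseteq> carrier OE \<Longrightarrow> seq_eval u q k \<in> carrier R"
  by (induction q) (auto simp: u)

lemma seq_eval_append:
  "set q \<subseteq> carrier OE \<Longrightarrow> set r \<subseteq> carrier OE \<Longrightarrow>
    seq_eval u (q @ r) k = seq_eval u q (k + length r) \<oplus>\<^bsub>R\<^esub> seq_eval u r k"
  by (induction q) (auto simp: u R.a_assoc seq_eval_closed ac_simps)

lemma seq_eval_replicate: "seq_eval u (replicate n \<zero>\<^bsub>C\<^esub>) k = \<zero>\<^bsub>R\<^esub>"
  using \<rho>.hom_zero by (induction n) (auto simp: u)

lemma seq_eval_normalize: "set q \<subseteq> carrier OE \<Longrightarrow> seq_eval u (C.normalize q) k = seq_eval u q k"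
  using \<rho>.hom_zero by (induction q) (auto simp: u seq_eval_closed)

lemma seq_eval_map2:
  "length q = length r \<Longrightarrow> set q \<subseteq> carrier OE \<Longrightarrow> set r \<subseteq> carrier OE \<Longrightarrow>
    seq_eval u (map2 (\<oplus>\<^bsub>C\<^esub>) q r) k = seq_eval u q k \<oplus>\<^bsub>R\<^esub> seq_eval u r k"
proof (induction q r rule: list_induct2)
  case (Cons a q b r)
  then show ?case using \<rho>.hom_add[of a b]
    by (simp add: u seq_eval_closed R.l_distr R.a_ac)
qed simp

lemma seq_eval_poly_add:
  assumes "set q \<subseteq> carrier OE" "set r \<subseteq> carrier OE"
  shows "seq_eval u (C.poly_add q r) k = seq_eval u q k \<oplus>\<^bsub>R\<^esub> seq_eval u r k"
proof -
  note S = subringE[OF OE_subring]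
  have *: "seq_eval u (C.poly_add q r) k = seq_eval u q k \<oplus>\<^bsub>R\<^esub> seq_eval u r k"
    if l: "length q \<ge> length r" and q: "set q \<subseteq> carrier OE" and r: "set r \<subseteq> carrier OE" for q r
  proof -
    let ?r = "replicate (length q - length r) \<zero>\<^bsub>C\<^esub> @ r"
    have r': "set ?r \<subseteq> carrier OE" "length q = length ?r" using r S(2) l by auto
    have z: "set (replicate (length q - length r) \<zero>\<^bsub>C\<^esub>) \<subseteq> carrier OE" using S(2) by auto
    have m: "set (map2 (\<oplus>\<^bsub>C\<^esub>) q ?r) \<subseteq> carrier OE"
    proof
      fix w assume "w \<in> set (map2 (\<oplus>\<^bsub>C\<^esub>) q ?r)"
      then obtain a b where "(a, b) \<in> set (zip q ?r)" "w = a \<oplus>\<^bsub>C\<^esub> b" by auto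
      then show "w \<in> carrier OE"
        using set_zip_leftD[of a b q ?r] set_zip_rightD[of a b q ?r] q r'(1) S(7)[of a b] by blast
    qed
    have "seq_eval u (C.poly_add q r) k = seq_eval u (map2 (\<oplus>\<^bsub>C\<^esub>) q ?r) k"
      using l seq_eval_normalize[OF m] by simp
    then show ?thesis
      using seq_eval_map2[OF r'(2) q r'(1)] seq_eval_append[OF z r] seq_eval_replicate seq_eval_closed[OF r] by simp
  qed
  show ?thesis
  proof (cases "length q \<ge> length r")
    case False
    then have "C.poly_add q r = C.poly_add r q" by simp
    then show ?thesis using *[of q r] False assms seq_eval_closed by (simp add: R.a_comm del: C.poly_add.simps)
  qed (use * assms in blast)
qed

lemma seq_eval_scale:
  "a \<in> carrier OE \<Longrightarrow> set q \<subseteq> carrier OE \<Longrightarrow>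
    seq_eval u (map ((\<otimes>\<^bsub>C\<^esub>) a) q) k = \<rho> a \<otimes>\<^bsub>R\<^esub> seq_eval u q k"
proof (induction q)
  case (Cons b q)
  then show ?case using \<rho>.hom_mult[of a b] by (simp add: u seq_eval_closed R.r_distr R.m_assoc)
qed simp

text \<open>The polynomials whose recurrence a given sequence obeys form an ideal; in this way the
  recurrence of a divisor implies that of \<open>minpoly\<close>.\<close>

lemma seq_eval_poly_mult_zero:
  assumes z: "\<And>k. seq_eval u r k = \<zero>\<^bsub>R\<^esub>" and r: "set r \<subseteq> carrier OE" and q: "set q \<subseteq> carrier OE"
  shows "seq_eval u (C.poly_mult q r) k = \<zero>\<^bsub>R\<^esub>"
  using q
proof (induction q)
  case (Cons a q)
  note S = subringE[OF OE_subring]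
  let ?m = "map ((\<otimes>\<^bsub>C\<^esub>) a) r @ replicate (length q) \<zero>\<^bsub>C\<^esub>"
  have 1: "set (map ((\<otimes>\<^bsub>C\<^esub>) a) r) \<subseteq> carrier OE" "set (replicate (length q) \<zero>\<^bsub>C\<^esub>) \<subseteq> carrier OE"
    using Cons.prems r S(2,6) by auto
  have 2: "set (C.poly_mult q r) \<subseteq> carrier OE"
    using C.poly_mult_is_polynomial[OF OE_subring, of q r] Cons.prems r by (auto dest!: C.polynomial_incl)
  have "seq_eval u (C.poly_mult (a # q) r) k = seq_eval u ?m k \<oplus>\<^bsub>R\<^esub> seq_eval u (C.poly_mult q r) k"
    using 1 2 seq_eval_poly_add[of ?m "C.poly_mult q r"] by (simp del: C.poly_add.simps)
  also have "seq_eval u ?m k = \<zero>\<^bsub>R\<^esub>"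
    using seq_eval_append[OF 1] seq_eval_replicate seq_eval_scale[of a r] z Cons.prems r by simp
  finally show ?case using Cons by simp
qed simp

end

end

section \<open>From recurrent sequences to functionals\<close>

context tensor_extension
begin

definition poly_value :: "'c list \<Rightarrow> ('f \<times> 'r \<Rightarrow>\<^sub>0 int) set" where
  "poly_value q = TR.T.eval (map (\<lambda>a. j (\<rho> a)) q) x"

lemma poly_value_Nil [simp]: "poly_value [] = \<zero>\<^bsub>T\<^esub>"
  by (simp add: poly_value_def)

lemma poly_value_Cons: "poly_value (a # q) = j (\<rho> a) \<otimes>\<^bsub>T\<^esub> x [^]\<^bsub>T\<^esub> length q \<oplus>\<^bsub>T\<^esub> poly_value q"
  by (simp add: poly_value_def)

lemma poly_value_closed [simp]: "set q \<subseteq> carrier OE \<Longrightarrow> poly_value q \<in> carrier T"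
  unfolding poly_value_def by (rule TR.T.eval_in_carrier) auto

lemma seq_eval_finsum:
  assumes u: "\<And>k. u k \<in> carrier R" and q: "set q \<subseteq> carrier OE"
  shows "seq_eval u q k = (\<Oplus>\<^bsub>R\<^esub>t\<in>{..<length q}. \<rho> (C.coeff q t) \<otimes>\<^bsub>R\<^esub> u (k + t))"
  using q
proof (induction q)
  case (Cons a q)
  have c: "C.coeff q t \<in> carrier OE" if "t < length q" for t
    using Cons.prems C.coeff_nth[OF that] nth_mem[of "length q - 1 - t" q] that by auto
  have "(\<Oplus>\<^bsub>R\<^esub>t\<in>{..<length (a # q)}. \<rho> (C.coeff (a # q) t) \<otimes>\<^bsub>R\<^esub> u (k + t))
      = \<rho> a \<otimes>\<^bsub>R\<^esub> u (k + length q) \<oplus>\<^bsub>R\<^esub> (\<Oplus>\<^bsub>R\<^esub>t\<in>{..<length q}. \<rho> (C.coeff (a # q) t) \<otimes>\<^bsub>R\<^esub> u (k + t))"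
    using c u Cons.prems by (auto simp: lessThan_Suc)
  also have "(\<Oplus>\<^bsub>R\<^esub>t\<in>{..<length q}. \<rho> (C.coeff (a # q) t) \<otimes>\<^bsub>R\<^esub> u (k + t))
      = (\<Oplus>\<^bsub>R\<^esub>t\<in>{..<length q}. \<rho> (C.coeff q t) \<otimes>\<^bsub>R\<^esub> u (k + t))"
    using c u by (intro R.finsum_cong') auto
  finally show ?case using Cons by simp
qed simp

lemma eval_OF:
  assumes "set q \<subseteq> carrier OK" shows "F.eval (map i q) \<zeta> \<in> carrier OF"
proof -
  have "set (map i q) \<subseteq> carrier OF" using assms i_OK by auto
  then show ?thesis
    using OF.eval_in_carrier[of "map i q" \<zeta>] \<zeta> F.eval_consistent[OF OF_subring] OF_record by simp
qed

lemma coord_OE: "a \<in> carrier OF \<Longrightarrow> k < N \<Longrightarrow> coord k a \<in> carrier OE"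
  using coord(1) OK_in_OE by blast

text \<open>The functional on \<open>OF\<close> with prescribed values \<open>u k\<close> on the
  basis of powers of \<zeta> with exponents below N.\<close>

definition coord_sum :: "(nat \<Rightarrow> 'r) \<Rightarrow> 'f \<Rightarrow> 'r" where
  "coord_sum u a = (\<Oplus>\<^bsub>R\<^esub>k\<in>{..<N}. \<rho> (coord k a) \<otimes>\<^bsub>R\<^esub> u k)"

context
  fixes u :: "nat \<Rightarrow> 'r"
  assumes u: "\<And>k. u k \<in> carrier R"
begin

lemma coord_sum_closed: "a \<in> carrier OF \<Longrightarrow> coord_sum u a \<in> carrier R"
  unfolding coord_sum_def using coord_OE u by (intro R.finsum_closed) auto

lemma coord_sum_add:
  assumes "a \<in> carrier OF" "b \<in> carrier OF"
  shows "coord_sum u (a \<oplus>\<^bsub>F\<^esub> b) = coord_sum u a \<oplus>\<^bsub>R\<^esub> coord_sum u b"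
proof -
  note O = coord_OE[OF assms(1)] coord_OE[OF assms(2)]
  have "coord_sum u (a \<oplus>\<^bsub>F\<^esub> b) = (\<Oplus>\<^bsub>R\<^esub>k\<in>{..<N}. \<rho> (coord k a) \<otimes>\<^bsub>R\<^esub> u k \<oplus>\<^bsub>R\<^esub> \<rho> (coord k b) \<otimes>\<^bsub>R\<^esub> u k)"
    unfolding coord_sum_def
  proof (rule R.finsum_cong')
    fix k assume "k \<in> {..<N}"
    then show "\<rho> (coord k (a \<oplus>\<^bsub>F\<^esub> b)) \<otimes>\<^bsub>R\<^esub> u k = \<rho> (coord k a) \<otimes>\<^bsub>R\<^esub> u k \<oplus>\<^bsub>R\<^esub> \<rho> (coord k b) \<otimes>\<^bsub>R\<^esub> u k"
      using coord_add[OF assms, of k] \<rho>.hom_add[OF O(1)[of k] O(2)[of k]] O u by (simp add: R.l_distr)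
  qed (use O u in auto)
  also have "\<dots> = coord_sum u a \<oplus>\<^bsub>R\<^esub> coord_sum u b"
    unfolding coord_sum_def using O u by (intro R.finsum_addf) auto
  finally show ?thesis .
qed

lemma coord_sum_smult:
  assumes "a \<in> carrier OF" "s \<in> carrier OK"
  shows "coord_sum u (i s \<otimes>\<^bsub>F\<^esub> a) = \<rho> s \<otimes>\<^bsub>R\<^esub> coord_sum u a"
proof -
  note O = coord_OE[OF assms(1)] OK_in_OE[OF assms(2)]
  have "coord_sum u (i s \<otimes>\<^bsub>F\<^esub> a) = (\<Oplus>\<^bsub>R\<^esub>k\<in>{..<N}. \<rho> s \<otimes>\<^bsub>R\<^esub> (\<rho> (coord k a) \<otimes>\<^bsub>R\<^esub> u k))"
    unfolding coord_sum_def
  proof (rule R.finsum_cong')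
    fix k assume "k \<in> {..<N}"
    then show "\<rho> (coord k (i s \<otimes>\<^bsub>F\<^esub> a)) \<otimes>\<^bsub>R\<^esub> u k = \<rho> s \<otimes>\<^bsub>R\<^esub> (\<rho> (coord k a) \<otimes>\<^bsub>R\<^esub> u k)"
      using coord_smult[OF assms, of k] \<rho>.hom_mult[OF O(2) O(1)[of k]] O u by (simp add: R.m_assoc)
  qed (use O u in auto)
  also have "\<dots> = \<rho> s \<otimes>\<^bsub>R\<^esub> coord_sum u a"
    unfolding coord_sum_def using O u by (intro R.finsum_rdistr[symmetric]) auto
  finally show ?thesis .
qed

text \<open>The hypothesis is limited to exponents below k + length q, so that it can be supplied by
  the induction hypothesis in \<open>coord_sum_power\<close>.\<close>

lemma coord_sum_eval:
  assumes "set q \<subseteq> carrier OK" "\<And>t. t < k + length q \<Longrightarrow> coord_sum u (\<zeta> [^]\<^bsub>F\<^esub> t) = u t"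
  shows "coord_sum u (F.eval (map i q) \<zeta> \<otimes>\<^bsub>F\<^esub> \<zeta> [^]\<^bsub>F\<^esub> k) = seq_eval u q k"
  using assms
proof (induction q)
  case Nil
  have "coord_sum u \<zero>\<^bsub>F\<^esub> = \<zero>\<^bsub>R\<^esub>"
    using coord_sum_add[of "\<zero>\<^bsub>F\<^esub>" "\<zero>\<^bsub>F\<^esub>"] coord_sum_closed[of "\<zero>\<^bsub>F\<^esub>"] subringE(2)[OF OF_subring]
      R.add.l_cancel_one'[of "coord_sum u \<zero>\<^bsub>F\<^esub>" "coord_sum u \<zero>\<^bsub>F\<^esub>"] by simp
  then show ?case by simp
next
  case (Cons s q)
  have s: "s \<in> carrier OK" "i s \<in> carrier F" "set q \<subseteq> carrier OK" using Cons.prems OK_in_K by auto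
  note ev = eval_OF[OF s(3)]
  have pw: "\<zeta> [^]\<^bsub>F\<^esub> (length q + k) \<in> carrier OF" "\<zeta> [^]\<^bsub>F\<^esub> k \<in> carrier OF" by (rule \<zeta>_pow_OF)+
  have "F.eval (map i (s # q)) \<zeta> \<otimes>\<^bsub>F\<^esub> \<zeta> [^]\<^bsub>F\<^esub> k
      = i s \<otimes>\<^bsub>F\<^esub> \<zeta> [^]\<^bsub>F\<^esub> (length q + k) \<oplus>\<^bsub>F\<^esub> F.eval (map i q) \<zeta> \<otimes>\<^bsub>F\<^esub> \<zeta> [^]\<^bsub>F\<^esub> k"
    using s OF_in_F[OF ev] by (simp add: F.l_distr F.m_assoc F.nat_pow_mult)
  also have "coord_sum u \<dots> = \<rho> s \<otimes>\<^bsub>R\<^esub> coord_sum u (\<zeta> [^]\<^bsub>F\<^esub> (length q + k))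
      \<oplus>\<^bsub>R\<^esub> coord_sum u (F.eval (map i q) \<zeta> \<otimes>\<^bsub>F\<^esub> \<zeta> [^]\<^bsub>F\<^esub> k)"
    using coord_sum_add[of "i s \<otimes>\<^bsub>F\<^esub> \<zeta> [^]\<^bsub>F\<^esub> (length q + k)" "F.eval (map i q) \<zeta> \<otimes>\<^bsub>F\<^esub> \<zeta> [^]\<^bsub>F\<^esub> k"]
      coord_sum_smult[OF pw(1) s(1)] subringE(6)[OF OF_subring] i_OK[OF s(1)] pw ev by simp
  also have "\<dots> = seq_eval u (s # q) k"
    using Cons.IH s(3) Cons.prems(2) by (simp add: add.commute)
  finally show ?case .
qed

text \<open>From exponent N on both sides obey the recurrence of \<open>minpoly\<close>: u by
  hypothesis, the powers because \<zeta> is a root.\<close>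

lemma coord_sum_power:
  assumes rec: "\<And>k. seq_eval u minpoly k = \<zero>\<^bsub>R\<^esub>"
  shows "coord_sum u (\<zeta> [^]\<^bsub>F\<^esub> (t::nat)) = u t"
proof (induction t rule: less_induct)
  case (less t)
  show ?case
  proof (cases "t < N")
    case True
    have "coord_sum u (\<zeta> [^]\<^bsub>F\<^esub> t) = (\<Oplus>\<^bsub>R\<^esub>k\<in>{..<N}. if t = k then u k else \<zero>\<^bsub>R\<^esub>)"
      unfolding coord_sum_def
    proof (rule R.finsum_cong')
      fix k assume "k \<in> {..<N}"
      then show "\<rho> (coord k (\<zeta> [^]\<^bsub>F\<^esub> t)) \<otimes>\<^bsub>R\<^esub> u k = (if t = k then u k else \<zero>\<^bsub>R\<^esub>)"
        using coord_power[of k t] True u \<rho>.hom_one \<rho>.hom_zero by simp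
    qed (use u in auto)
    then show ?thesis using R.add.finprod_singleton[of t "{..<N}" u] True u by auto
  next
    case False
    define k where "k = t - N"
    then have t: "t = N + k" using False by simp
    obtain m where m: "minpoly = \<one>\<^bsub>C\<^esub> # m" "length m = N"
      using minpoly_props(2,3) by (cases minpoly) auto
    have mO: "set m \<subseteq> carrier OK" using minpoly_OK m(1) by simp
    note ev = eval_OF[OF mO]
    have "F.eval (map i minpoly) \<zeta> = \<zero>\<^bsub>F\<^esub>" using minpoly_F(4) map_i_minpoly by simp
    then have "(\<zeta> [^]\<^bsub>F\<^esub> N \<oplus>\<^bsub>F\<^esub> F.eval (map i m) \<zeta>) \<otimes>\<^bsub>F\<^esub> \<zeta> [^]\<^bsub>F\<^esub> k = \<zero>\<^bsub>F\<^esub> \<otimes>\<^bsub>F\<^esub> \<zeta> [^]\<^bsub>F\<^esub> k"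
      using m by (simp add: i_one)
    then have 0: "\<zeta> [^]\<^bsub>F\<^esub> t \<oplus>\<^bsub>F\<^esub> F.eval (map i m) \<zeta> \<otimes>\<^bsub>F\<^esub> \<zeta> [^]\<^bsub>F\<^esub> k = \<zero>\<^bsub>F\<^esub>"
      using OF_in_F[OF ev] by (simp add: F.l_distr F.nat_pow_mult t)
    have "coord_sum u (\<zeta> [^]\<^bsub>F\<^esub> t) \<oplus>\<^bsub>R\<^esub> seq_eval u m k = coord_sum u \<zero>\<^bsub>F\<^esub>"
      using coord_sum_add[of "\<zeta> [^]\<^bsub>F\<^esub> t" "F.eval (map i m) \<zeta> \<otimes>\<^bsub>F\<^esub> \<zeta> [^]\<^bsub>F\<^esub> k"]
        subringE(6)[OF OF_subring ev \<zeta>_pow_OF[of k]] \<zeta>_pow_OF[of t] 0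
        coord_sum_eval[OF mO, of k] less m(2) t by simp
    also have "\<dots> = \<zero>\<^bsub>R\<^esub>" using coord_sum_eval[of "[]" 0] by simp
    also have "\<dots> = u t \<oplus>\<^bsub>R\<^esub> seq_eval u m k" using rec[of k] m u \<rho>.hom_one t by (simp add: add.commute)
    finally show ?thesis
      using R.add.right_cancel[of "seq_eval u m k" "coord_sum u (\<zeta> [^]\<^bsub>F\<^esub> t)" "u t"] u
        seq_eval_closed[of u m k] coord_sum_closed[OF \<zeta>_pow_OF] mO OK_in_OE by auto
  qed
qed

text \<open>The ring \<open>T\<close> is the polynomial ring over \<open>R\<close> modulo
  \<open>minpoly\<close>, so a functional amounts to a sequence with the corresponding recurrence.
  It is obtained from \<open>coord_sum\<close> by the universal property of the tensor
  product.\<close>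

lemma functional_of_sequence:
  assumes rec: "\<And>k. seq_eval u minpoly k = \<zero>\<^bsub>R\<^esub>"
  shows "\<exists>c. semilinear_map R TM (\<lambda>r. r) (regular_module R) c \<and> (\<forall>k::nat. c (x [^]\<^bsub>T\<^esub> k) = u k)"
proof -
  obtain c where c: "\<And>t. t \<in> carrier T \<Longrightarrow> c t \<in> carrier R"
    and c_add: "\<And>s t. s \<in> carrier T \<Longrightarrow> t \<in> carrier T \<Longrightarrow> c (s \<oplus>\<^bsub>T\<^esub> t) = c s \<oplus>\<^bsub>R\<^esub> c t"
    and c_pt: "\<And>a b. a \<in> carrier OF \<Longrightarrow> b \<in> carrier R \<Longrightarrow> c (pt a b) = b \<otimes>\<^bsub>R\<^esub> coord_sum u a"
  proof (rule TR.tensor_lift[of R "\<lambda>a r. r \<otimes>\<^bsub>R\<^esub> coord_sum u a"])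
    show "abelian_group R" by (rule R.abelian_group_axioms)
    fix s a b assume h: "s \<in> carrier OK" "a \<in> carrier OF" "b \<in> carrier R"
    show "b \<otimes>\<^bsub>R\<^esub> coord_sum u (i s \<otimes>\<^bsub>OF\<^esub> a) = (\<rho> s \<otimes>\<^bsub>R\<^esub> b) \<otimes>\<^bsub>R\<^esub> coord_sum u a"
      using h coord_sum_smult[OF h(2,1)] coord_sum_closed[OF h(2)] OK_in_OE[OF h(1)]
      by (simp add: R.m_ac)
  qed (auto simp: coord_sum_closed coord_sum_add R.l_distr R.r_distr)
  have c0: "c \<zero>\<^bsub>T\<^esub> = \<zero>\<^bsub>R\<^esub>"
    using c_add[of "\<zero>\<^bsub>T\<^esub>" "\<zero>\<^bsub>T\<^esub>"] c[of "\<zero>\<^bsub>T\<^esub>"] R.add.l_cancel_one'[of "c \<zero>\<^bsub>T\<^esub>" "c \<zero>\<^bsub>T\<^esub>"] by simp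
  have c_neg: "c (\<ominus>\<^bsub>T\<^esub> t) = \<ominus>\<^bsub>R\<^esub> c t" if t: "t \<in> carrier T" for t
  proof (rule R.minus_equality[symmetric])
    show "c (\<ominus>\<^bsub>T\<^esub> t) \<oplus>\<^bsub>R\<^esub> c t = \<zero>\<^bsub>R\<^esub>" using c_add[of "\<ominus>\<^bsub>T\<^esub> t" t] t c0 by (simp add: TR.T.l_neg)
  qed (use c t in auto)
  have c_smult: "c (j r \<otimes>\<^bsub>T\<^esub> t) = r \<otimes>\<^bsub>R\<^esub> c t" if r: "r \<in> carrier R" and t: "t \<in> carrier T" for r t
    using t
  proof (induction t rule: TR.tensor_induct)
    case zero then show ?case using r c0 by simp
  next
    case (diff s t)
    have "j r \<otimes>\<^bsub>T\<^esub> (s \<ominus>\<^bsub>T\<^esub> t) = j r \<otimes>\<^bsub>T\<^esub> s \<oplus>\<^bsub>T\<^esub> \<ominus>\<^bsub>T\<^esub> (j r \<otimes>\<^bsub>T\<^esub> t)"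
      using r diff by (simp add: a_minus_def TR.T.r_distr TR.T.r_minus)
    then show ?case using r diff c by (simp add: c_add c_neg a_minus_def R.r_distr R.r_minus)
  next
    case (pure a b)
    have "j r \<otimes>\<^bsub>T\<^esub> pt a b = pt a (r \<otimes>\<^bsub>R\<^esub> b)"
      using TR.pt_mult[OF _ r pure, of "\<one>\<^bsub>F\<^esub>"] one_OF OF_in_F[OF pure(1)] by (simp add: j_def)
    then show ?case using r pure coord_sum_closed by (simp add: c_pt R.m_assoc)
  qed
  have "c (x [^]\<^bsub>T\<^esub> k) = u k" for k :: nat
    using c_pt[OF \<zeta>_pow_OF[of k] R.one_closed] coord_sum_power[OF rec] u by (simp add: pt_pow)
  then show ?thesis using c c_add c_smult
    by (intro exI[of _ c] conjI allI semilinear_mapI) (auto simp: regular_module_simps)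
qed

end

end

section \<open>The quotient of \<open>T\<close> by a monic divisor of the minimal polynomial\<close>

context tensor_extension
begin

text \<open>The l-th unit vector is continued by the recurrence of the monic polynomial e. As e
  divides \<open>minpoly\<close>, the sequence comes from a functional; this vanishes on e times
  every power of \<open>x\<close>, hence on all multiples of e.\<close>

lemma functional_exists:
  assumes e: "set e \<subseteq> carrier OE" "length e = Suc D" "hd e = \<one>\<^bsub>C\<^esub>"
    and b: "set b \<subseteq> carrier OE" "minpoly = C.poly_mult b e" and l: "l < D"
  shows "\<exists>c. semilinear_map R TM (\<lambda>r. r) (regular_module R) c \<and>
    (\<forall>k<D. c (x [^]\<^bsub>T\<^esub> k) = (if k = l then \<one>\<^bsub>R\<^esub> else \<zero>\<^bsub>R\<^esub>)) \<and>
    (\<forall>t\<in>carrier T. c (poly_value e \<otimes>\<^bsub>T\<^esub> t) = \<zero>\<^bsub>R\<^esub>)"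
proof -
  obtain e' where e': "e = \<one>\<^bsub>C\<^esub> # e'" "length e' = D" using e by (cases e) auto
  have e'O: "set e' \<subseteq> carrier OE" using e(1) e'(1) by simp
  have co: "\<rho> (C.coeff e' t) \<in> carrier R" if "t < D" for t
    using subsetD[OF e'O nth_mem[of "length e' - 1 - t" e']] C.coeff_nth[of t e'] e'(2) that by simp
  have ic: "(if k = l then \<one>\<^bsub>R\<^esub> else \<zero>\<^bsub>R\<^esub>) \<in> carrier R" for k by simp
  obtain u where u: "\<And>k. u k \<in> carrier R" and init: "\<And>k. k < D \<Longrightarrow> u k = (if k = l then \<one>\<^bsub>R\<^esub> else \<zero>\<^bsub>R\<^esub>)"
    and rec: "\<And>k. u (k + D) = \<ominus>\<^bsub>R\<^esub> (\<Oplus>\<^bsub>R\<^esub>t\<in>{..<D}. \<rho> (C.coeff e' t) \<otimes>\<^bsub>R\<^esub> u (k + t))"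
    using R.linear_recurrence_exists[of D "\<lambda>t. \<rho> (C.coeff e' t)" "\<lambda>k. if k = l then \<one>\<^bsub>R\<^esub> else \<zero>\<^bsub>R\<^esub>", OF co ic] by blast
  have ez: "seq_eval u e k = \<zero>\<^bsub>R\<^esub>" for k
    using rec[of k] seq_eval_finsum[OF u e'O, of "\<lambda>k. k" k] seq_eval_closed[of u e' k] u e'O e' \<rho>.hom_one
    by (simp add: R.l_neg)
  have "seq_eval u minpoly k = \<zero>\<^bsub>R\<^esub>" for k
    unfolding b(2) by (rule seq_eval_poly_mult_zero[OF u ez e(1) b(1)])
  then obtain c where c: "semilinear_map R TM (\<lambda>r. r) (regular_module R) c" and cx: "\<And>k::nat. c (x [^]\<^bsub>T\<^esub> k) = u k"
    using functional_of_sequence[of u] u by blast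
  note cD = semilinear_mapD[OF c, simplified regular_module_simps restrict_scalars_simps]
  have c0: "c \<zero>\<^bsub>T\<^esub> = \<zero>\<^bsub>R\<^esub>"
    using cD(2)[of "\<zero>\<^bsub>T\<^esub>" "\<zero>\<^bsub>T\<^esub>"] cD(1)[of "\<zero>\<^bsub>T\<^esub>"] R.add.l_cancel_one'[of "c \<zero>\<^bsub>T\<^esub>" "c \<zero>\<^bsub>T\<^esub>"] by simp
  have cq: "c (poly_value q \<otimes>\<^bsub>T\<^esub> x [^]\<^bsub>T\<^esub> k) = seq_eval u q k" if "set q \<subseteq> carrier OE" for q and k :: nat
    using that
  proof (induction q)
    case Nil then show ?case by (simp add: c0)
  next
    case (Cons a q)
    have "poly_value (a # q) \<otimes>\<^bsub>T\<^esub> x [^]\<^bsub>T\<^esub> k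
        = j (\<rho> a) \<otimes>\<^bsub>T\<^esub> x [^]\<^bsub>T\<^esub> (length q + k) \<oplus>\<^bsub>T\<^esub> poly_value q \<otimes>\<^bsub>T\<^esub> x [^]\<^bsub>T\<^esub> k"
      using Cons.prems by (simp add: poly_value_Cons TR.T.l_distr TR.T.m_assoc TR.T.nat_pow_mult)
    then show ?case using Cons cD cx by (simp add: add.commute)
  qed
  let ?H = "{t \<in> carrier T. c (poly_value e \<otimes>\<^bsub>T\<^esub> t) = \<zero>\<^bsub>R\<^esub>}"
  have pe: "poly_value e \<in> carrier T" using e(1) by simp
  have "semilinear_map R TM (\<lambda>r. r) (regular_module R) (\<lambda>t. c (poly_value e \<otimes>\<^bsub>T\<^esub> t))"
  proof (rule semilinear_mapI)
    fix r t assume "r \<in> carrier R" "t \<in> carrier TM"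
    then show "c (poly_value e \<otimes>\<^bsub>T\<^esub> (r \<odot>\<^bsub>TM\<^esub> t)) = r \<odot>\<^bsub>regular_module R\<^esub> c (poly_value e \<otimes>\<^bsub>T\<^esub> t)"
      using pe cD(3)[of r "poly_value e \<otimes>\<^bsub>T\<^esub> t"] by (simp add: TR.T.m_lcomm)
  qed (use pe cD in \<open>auto simp: TR.T.r_distr\<close>)
  from semilinear_map_kernel[OF TM_module R.regular_module_is_module _ this]
  have "submodule ?H R TM" by (simp add: ring_hom_memI)
  then have "carrier T \<subseteq> ?H" by (rule T_spanned_by_powers) (use cq[OF e(1)] ez in simp)
  then show ?thesis using c cx init by (intro exI[of _ c]) auto
qed

text \<open>The counterpart of \<open>functional_exists\<close>: e is monic, so powers from D on can
  be reduced modulo multiples of e. Together the two say that T / e T is free on the first D powers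
  of \<open>x\<close>.\<close>

lemma T_spanned_by_small_powers:
  assumes e: "set e \<subseteq> carrier OE" "length e = Suc D" "hd e = \<one>\<^bsub>C\<^esub>"
    and H: "submodule H R TM" "\<And>k. k < D \<Longrightarrow> x [^]\<^bsub>T\<^esub> k \<in> H"
      "\<And>t. t \<in> carrier T \<Longrightarrow> poly_value e \<otimes>\<^bsub>T\<^esub> t \<in> H"
  shows "carrier T \<subseteq> H"
proof (rule T_spanned_by_powers[OF H(1)])
  note E = TM.submoduleE[OF H(1)]
  have closed: "s \<in> H \<Longrightarrow> t \<in> H \<Longrightarrow> s \<oplus>\<^bsub>T\<^esub> t \<in> H" "r \<in> carrier R \<Longrightarrow> t \<in> H \<Longrightarrow> j r \<otimes>\<^bsub>T\<^esub> t \<in> H" for s t r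
    using E(4)[of r t] E(5)[of s t] by simp_all
  have zero: "\<zero>\<^bsub>T\<^esub> \<in> H" using TM.submodule_zero[OF H(1)] by simp
  obtain e' where e': "e = \<one>\<^bsub>C\<^esub> # e'" "length e' = D" using e by (cases e) auto
  have pv: "poly_value q \<otimes>\<^bsub>T\<^esub> x [^]\<^bsub>T\<^esub> k \<in> H"
    if "set q \<subseteq> carrier OE" "\<And>t. t < length q + k \<Longrightarrow> x [^]\<^bsub>T\<^esub> t \<in> H" for q and k :: nat
    using that
  proof (induction q)
    case (Cons a q)
    have "poly_value (a # q) \<otimes>\<^bsub>T\<^esub> x [^]\<^bsub>T\<^esub> k
        = j (\<rho> a) \<otimes>\<^bsub>T\<^esub> x [^]\<^bsub>T\<^esub> (length q + k) \<oplus>\<^bsub>T\<^esub> poly_value q \<otimes>\<^bsub>T\<^esub> x [^]\<^bsub>T\<^esub> k"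
      using Cons.prems by (simp add: poly_value_Cons TR.T.l_distr TR.T.m_assoc TR.T.nat_pow_mult)
    then show ?case using Cons by (auto intro!: closed)
  qed (simp add: zero)
  fix k :: nat
  show "x [^]\<^bsub>T\<^esub> k \<in> H"
  proof (induction k rule: less_induct)
    case (less k)
    show ?case
    proof (cases "k < D")
      case False
      then obtain l where k: "k = D + l" by (metis le_add_diff_inverse not_less)
      have e'O: "set e' \<subseteq> carrier OE" using e(1) e'(1) by simp
      let ?y = "poly_value e' \<otimes>\<^bsub>T\<^esub> x [^]\<^bsub>T\<^esub> l"
      have yc: "?y \<in> carrier T" using e'O by simp
      have "poly_value e \<otimes>\<^bsub>T\<^esub> x [^]\<^bsub>T\<^esub> l = x [^]\<^bsub>T\<^esub> k \<oplus>\<^bsub>T\<^esub> ?y"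
        using e' e'O \<rho>.hom_one by (simp add: poly_value_Cons TR.T.l_distr TR.T.nat_pow_mult k)
      then have "x [^]\<^bsub>T\<^esub> k = (poly_value e \<otimes>\<^bsub>T\<^esub> x [^]\<^bsub>T\<^esub> l) \<ominus>\<^bsub>T\<^esub> ?y"
        using yc by (simp add: a_minus_def TR.T.a_assoc TR.T.r_neg)
      also have "\<dots> = (poly_value e \<otimes>\<^bsub>T\<^esub> x [^]\<^bsub>T\<^esub> l) \<oplus>\<^bsub>T\<^esub> j (\<ominus>\<^bsub>R\<^esub> \<one>\<^bsub>R\<^esub>) \<otimes>\<^bsub>T\<^esub> ?y"
        using yc by (simp add: a_minus_def TR.T.l_minus)
      also have "\<dots> \<in> H"
        using pv[OF e'O, of l] less e'(2) k by (intro closed H(3)) auto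
      finally show ?thesis .
    qed (use H(2) in auto)
  qed
qed

end

lemma (in module) submodule_of_closed:
  assumes "H \<subseteq> carrier M" "\<zero>\<^bsub>M\<^esub> \<in> H" "\<And>a b. a \<in> H \<Longrightarrow> b \<in> H \<Longrightarrow> a \<oplus>\<^bsub>M\<^esub> b \<in> H"
    and smult: "\<And>a y. a \<in> carrier R \<Longrightarrow> y \<in> H \<Longrightarrow> a \<odot>\<^bsub>M\<^esub> y \<in> H"
  shows "submodule H R M"
proof (rule submoduleI)
  fix a assume a: "a \<in> H"
  then have "a \<in> carrier M" using assms(1) by auto
  then have "\<ominus>\<^bsub>M\<^esub> a = (\<ominus> \<one>) \<odot>\<^bsub>M\<^esub> a" by (simp add: smult_l_minus)
  then show "\<ominus>\<^bsub>M\<^esub> a \<in> H" using smult[OF _ a, of "\<ominus> \<one>"] by simp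
qed (use assms in auto)

context tensor_extension
begin

text \<open>The index \<open>a * D + l\<close> stands for the product of the \<open>l\<close>-th power of \<open>x\<close> with the \<open>a\<close>-th
  generator over \<open>T\<close>.\<close>

lemma free_tensor_chart:
  fixes V :: "(('f \<times> 'r \<Rightarrow>\<^sub>0 int) set, 'm) module" and S :: "'s ring"
  assumes e: "set e \<subseteq> carrier OE" "length e = Suc D" "hd e = \<one>\<^bsub>C\<^esub>"
    and b: "set b \<subseteq> carrier OE" "minpoly = C.poly_mult b e"
    and V: "module T V" and s: "s \<in> carrier R"
    and free: "free_of_rank (localized_ring T (j s)) (localized_module T V (j s)) k"
    and S: "cring S" and \<theta>: "\<theta> \<in> ring_hom R S" and u: "\<theta> s \<in> Units S"
  obtains w \<pi> where
    "\<And>n. n < k * D \<Longrightarrow> w n \<in> carrier V"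
    "\<And>n. n < k * D \<Longrightarrow> semilinear_map R (restrict_scalars j V) \<theta> (regular_module S) (\<pi> n)"
    "\<And>n. n < k * D \<Longrightarrow> \<pi> n (w n) \<in> Units S"
    "\<And>m n. n < k * D \<Longrightarrow> m < k * D \<Longrightarrow> n \<noteq> m \<Longrightarrow> \<pi> n (w m) = \<zero>\<^bsub>S\<^esub>"
    "\<And>n y. n < k * D \<Longrightarrow> y \<in> carrier V \<Longrightarrow> \<pi> n (poly_value e \<odot>\<^bsub>V\<^esub> y) = \<zero>\<^bsub>S\<^esub>"
    "\<And>y. y \<in> carrier V \<Longrightarrow> \<exists>a::nat. s [^]\<^bsub>R\<^esub> a \<odot>\<^bsub>restrict_scalars j V\<^esub> y \<in>
       module_span R (restrict_scalars j V) (w ` {..<k * D} \<union> (\<lambda>y. poly_value e \<odot>\<^bsub>V\<^esub> y) ` carrier V)"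
proof -
  interpret V: module T V by fact
  interpret S: cring S by fact
  interpret \<theta>: ring_hom_ring R S \<theta> using \<theta> R.ring_axioms S.ring_axioms by (intro ring_hom_ringI2)
  interpret VR: module R "restrict_scalars j V" by (rule restrict_scalars_module[OF V])
  interpret loc: localization T V "j s" using s by unfold_locales simp
  interpret locR: localization R TM s using s by unfold_locales
  interpret Tj: cring loc.Rs by (rule loc.localized_ring_cring)
  interpret fr: ring_hom_ring T loc.Rs "\<lambda>r. loc.rfrac r 0"
    using loc.rfrac_hom TR.T.ring_axioms Tj.ring_axioms by (intro ring_hom_ringI2)
  interpret rv: ring_valued_setting T V loc.Rs "\<lambda>r. loc.rfrac r 0"
    by unfold_locales (rule loc.rfrac_hom)
  let ?VR = "restrict_scalars j V" and ?\<epsilon> = "poly_value e"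
  obtain q \<xi> where chart: "rv.chart k q \<xi>"
    and \<xi>q: "\<And>a. a < k \<Longrightarrow> \<exists>n. \<xi> a (q a) = loc.rfrac (j s [^]\<^bsub>T\<^esub> (n::nat)) 0"
    and span: "\<And>y. y \<in> carrier V \<Longrightarrow> \<exists>n. j s [^]\<^bsub>T\<^esub> (n::nat) \<odot>\<^bsub>V\<^esub> y \<in> module_span T V (q ` {..<k})"
    using loc.free_localization_chart[OF free loc.localized_ring_cring loc.rfrac_hom loc.rfrac_unit] by blast
  have q: "q a \<in> carrier V" and \<xi>: "semilinear_map T V (\<lambda>r. loc.rfrac r 0) (regular_module loc.Rs) (\<xi> a)"
    and \<xi>0: "\<And>b. b < k \<Longrightarrow> a \<noteq> b \<Longrightarrow> \<xi> a (q b) = \<zero>\<^bsub>loc.Rs\<^esub>" if "a < k" for a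
    using chart that unfolding rv.chart_def by auto
  note \<xi>D = semilinear_mapD[OF \<xi>, simplified regular_module_simps]
  have pe: "?\<epsilon> \<in> carrier T" using e(1) by simp
  have pows: "j s [^]\<^bsub>T\<^esub> n = j (s [^]\<^bsub>R\<^esub> n)" for n :: nat using s by (simp add: j.hom_nat_pow)
  \<comment> \<open>Inverting s on the \<open>R\<close>-module \<open>T\<close> and inverting j s in
    the ring \<open>T\<close> give literally the same sets of pairs, so functionals extended along
    the first localization are functions on the second.\<close>
  have fr_eq: "fraction R TM s t n = loc.rfrac t n" for t n
    using s by (simp add: fraction_def pows)
  let ?w = "\<theta> s" and ?v = "inv\<^bsub>S\<^esub> (\<theta> s)"
  have vc: "?v \<in> carrier S" "?w \<in> carrier S" using u by auto
  have vw: "?v [^]\<^bsub>S\<^esub> n \<otimes>\<^bsub>S\<^esub> ?w [^]\<^bsub>S\<^esub> n = \<one>\<^bsub>S\<^esub>" for n :: nat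
    using vc u S.nat_pow_distrib[of ?v ?w n, symmetric] by (simp add: S.Units_l_inv)
  \<comment> \<open>What is needed of the l-th functional after extension to the localization of
    \<open>T\<close>. The duality with the powers of \<open>x\<close> carries an extra power of s
    because a chart over \<open>T\<close> takes such a power as its value on its own
    generators.\<close>
  define good where "good l \<eta> \<longleftrightarrow> (\<forall>y\<in>carrier loc.Rs. \<eta> y \<in> carrier S) \<and>
      (\<forall>y\<in>carrier loc.Rs. \<forall>y'\<in>carrier loc.Rs. \<eta> (y \<oplus>\<^bsub>loc.Rs\<^esub> y') = \<eta> y \<oplus>\<^bsub>S\<^esub> \<eta> y') \<and>
      (\<forall>r\<in>carrier R. \<forall>y\<in>carrier loc.Rs. \<eta> (loc.rfrac (j r) 0 \<otimes>\<^bsub>loc.Rs\<^esub> y) = \<theta> r \<otimes>\<^bsub>S\<^esub> \<eta> y) \<and>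
      (\<forall>y\<in>carrier loc.Rs. \<eta> (loc.rfrac ?\<epsilon> 0 \<otimes>\<^bsub>loc.Rs\<^esub> y) = \<zero>\<^bsub>S\<^esub>) \<and>
      (\<forall>l'<D. \<forall>n::nat. \<eta> (loc.rfrac (x [^]\<^bsub>T\<^esub> l' \<otimes>\<^bsub>T\<^esub> j s [^]\<^bsub>T\<^esub> n) 0) = (if l' = l then ?w [^]\<^bsub>S\<^esub> n else \<zero>\<^bsub>S\<^esub>))" for l \<eta>
  have "\<exists>\<eta>. good l \<eta>" if l: "l < D" for l
  proof -
    obtain c where c: "semilinear_map R TM (\<lambda>r. r) (regular_module R) c"
      and cx: "\<And>k. k < D \<Longrightarrow> c (x [^]\<^bsub>T\<^esub> k) = (if k = l then \<one>\<^bsub>R\<^esub> else \<zero>\<^bsub>R\<^esub>)"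
      and ce: "\<And>t. t \<in> carrier T \<Longrightarrow> c (?\<epsilon> \<otimes>\<^bsub>T\<^esub> t) = \<zero>\<^bsub>R\<^esub>"
      using functional_exists[OF e b l] by blast
    note cD = semilinear_mapD[OF c, simplified regular_module_simps restrict_scalars_simps]
    have "semilinear_map R TM \<theta> (regular_module S) (\<lambda>t. \<theta> (c t))"
      using cD by (intro semilinear_mapI) auto
    then obtain \<eta> where "\<And>t n. t \<in> carrier TM \<Longrightarrow>
        \<eta> (fraction R TM s t n) = (?v [^]\<^bsub>S\<^esub> n) \<odot>\<^bsub>regular_module S\<^esub> \<theta> (c t)"
      using locR.semilinear_extension_localization[OF S.regular_module_is_module \<theta> u] by blast
    then have \<eta>: "\<eta> (loc.rfrac t n) = ?v [^]\<^bsub>S\<^esub> n \<otimes>\<^bsub>S\<^esub> \<theta> (c t)" if "t \<in> carrier T" for t n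
      using that by (simp add: fr_eq)
    show ?thesis unfolding good_def
    proof (intro exI[of _ \<eta>] conjI ballI allI impI)
      fix y assume "y \<in> carrier loc.Rs"
      then obtain t n where t: "t \<in> carrier T" "y = loc.rfrac t n" by (rule loc.localized_ringE)
      show "\<eta> y \<in> carrier S" using t cD(1) vc by (simp add: \<eta>)
      show "\<eta> (loc.rfrac ?\<epsilon> 0 \<otimes>\<^bsub>loc.Rs\<^esub> y) = \<zero>\<^bsub>S\<^esub>"
        using t pe vc by (simp add: loc.localized_ring_mult \<eta> ce)
      fix y' assume "y' \<in> carrier loc.Rs"
      then obtain t' n' where t': "t' \<in> carrier T" "y' = loc.rfrac t' n'" by (rule loc.localized_ringE)
      have d: "\<theta> (c t) \<in> carrier S" "\<theta> (c t') \<in> carrier S" using t t' cD(1) by auto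
      have "\<eta> (y \<oplus>\<^bsub>loc.Rs\<^esub> y') = (?v [^]\<^bsub>S\<^esub> n \<otimes>\<^bsub>S\<^esub> ?v [^]\<^bsub>S\<^esub> n') \<otimes>\<^bsub>S\<^esub>
          (?w [^]\<^bsub>S\<^esub> n' \<otimes>\<^bsub>S\<^esub> \<theta> (c t) \<oplus>\<^bsub>S\<^esub> ?w [^]\<^bsub>S\<^esub> n \<otimes>\<^bsub>S\<^esub> \<theta> (c t'))"
        using t t' s vc cD by (simp add: loc.localized_ring_add \<eta> pows S.nat_pow_mult \<theta>.hom_nat_pow)
      also have "\<dots> = ?v [^]\<^bsub>S\<^esub> n \<otimes>\<^bsub>S\<^esub> (?v [^]\<^bsub>S\<^esub> n' \<otimes>\<^bsub>S\<^esub> ?w [^]\<^bsub>S\<^esub> n') \<otimes>\<^bsub>S\<^esub> \<theta> (c t)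
          \<oplus>\<^bsub>S\<^esub> ?v [^]\<^bsub>S\<^esub> n' \<otimes>\<^bsub>S\<^esub> (?v [^]\<^bsub>S\<^esub> n \<otimes>\<^bsub>S\<^esub> ?w [^]\<^bsub>S\<^esub> n) \<otimes>\<^bsub>S\<^esub> \<theta> (c t')"
        using d vc by (simp add: S.r_distr S.m_ac)
      also have "\<dots> = \<eta> y \<oplus>\<^bsub>S\<^esub> \<eta> y'" using t t' d vc by (simp add: vw \<eta>)
      finally show "\<eta> (y \<oplus>\<^bsub>loc.Rs\<^esub> y') = \<eta> y \<oplus>\<^bsub>S\<^esub> \<eta> y'" .
    next
      fix r y assume r: "r \<in> carrier R" and "y \<in> carrier loc.Rs"
      then obtain t n where t: "t \<in> carrier T" "y = loc.rfrac t n" using loc.localized_ringE by blast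
      show "\<eta> (loc.rfrac (j r) 0 \<otimes>\<^bsub>loc.Rs\<^esub> y) = \<theta> r \<otimes>\<^bsub>S\<^esub> \<eta> y"
        using t r vc cD by (simp add: loc.localized_ring_mult \<eta> S.m_lcomm)
    next
      fix l' and n :: nat assume "l' < D"
      have "c (x [^]\<^bsub>T\<^esub> l' \<otimes>\<^bsub>T\<^esub> j s [^]\<^bsub>T\<^esub> n) = s [^]\<^bsub>R\<^esub> n \<otimes>\<^bsub>R\<^esub> c (x [^]\<^bsub>T\<^esub> l')"
        using cD(3)[of "s [^]\<^bsub>R\<^esub> n" "x [^]\<^bsub>T\<^esub> l'"] s by (simp add: pows TR.T.m_comm)
      then show "\<eta> (loc.rfrac (x [^]\<^bsub>T\<^esub> l' \<otimes>\<^bsub>T\<^esub> j s [^]\<^bsub>T\<^esub> n) 0) = (if l' = l then ?w [^]\<^bsub>S\<^esub> n else \<zero>\<^bsub>S\<^esub>)"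
        using s vc cx[OF \<open>l' < D\<close>] by (subst \<eta>) (simp_all add: \<theta>.hom_nat_pow)
    qed
  qed
  then obtain \<eta> where \<eta>: "\<And>l. l < D \<Longrightarrow> good l (\<eta> l)" by metis
  then have \<eta>c: "\<And>l y. l < D \<Longrightarrow> y \<in> carrier loc.Rs \<Longrightarrow> \<eta> l y \<in> carrier S"
    and \<eta>a: "\<And>l y y'. l < D \<Longrightarrow> y \<in> carrier loc.Rs \<Longrightarrow> y' \<in> carrier loc.Rs \<Longrightarrow>
        \<eta> l (y \<oplus>\<^bsub>loc.Rs\<^esub> y') = \<eta> l y \<oplus>\<^bsub>S\<^esub> \<eta> l y'"
    and \<eta>s: "\<And>l r y. l < D \<Longrightarrow> r \<in> carrier R \<Longrightarrow> y \<in> carrier loc.Rs \<Longrightarrow>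
        \<eta> l (loc.rfrac (j r) 0 \<otimes>\<^bsub>loc.Rs\<^esub> y) = \<theta> r \<otimes>\<^bsub>S\<^esub> \<eta> l y"
    and \<eta>e: "\<And>l y. l < D \<Longrightarrow> y \<in> carrier loc.Rs \<Longrightarrow> \<eta> l (loc.rfrac ?\<epsilon> 0 \<otimes>\<^bsub>loc.Rs\<^esub> y) = \<zero>\<^bsub>S\<^esub>"
    and \<eta>x: "\<And>l l' n. l < D \<Longrightarrow> l' < D \<Longrightarrow>
        \<eta> l (loc.rfrac (x [^]\<^bsub>T\<^esub> l' \<otimes>\<^bsub>T\<^esub> j s [^]\<^bsub>T\<^esub> (n::nat)) 0) = (if l' = l then ?w [^]\<^bsub>S\<^esub> n else \<zero>\<^bsub>S\<^esub>)"
    unfolding good_def by blast+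
  define w where "w n = x [^]\<^bsub>T\<^esub> (n mod D) \<odot>\<^bsub>V\<^esub> q (n div D)" for n
  \<comment> \<open>A composition: the coordinate over \<open>T\<close> with index n div D takes
    values in the localization of \<open>T\<close>, and from these the coefficient of the power with
    exponent n mod D is extracted modulo e.\<close>
  define \<pi> where "\<pi> n y = \<eta> (n mod D) (\<xi> (n div D) y)" for n y
  have idx: "n mod D < D" "n div D < k" if "n < k * D" for n
    using that by (auto simp: less_mult_imp_div_less) (metis mod_less_divisor mult_0_right not_gr_zero not_less_zero)
  have pc: "w n \<in> carrier V" if "n < k * D" for n using idx[OF that] q by (simp add: w_def)
  have \<eta>0: "\<eta> l \<zero>\<^bsub>loc.Rs\<^esub> = \<zero>\<^bsub>S\<^esub>" if "l < D" for l
    using \<eta>e[OF that, of "\<zero>\<^bsub>loc.Rs\<^esub>"] pe by simp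
  have \<pi>w: "\<pi> n (w m) = (if n = m then \<pi> n (w m) else \<zero>\<^bsub>S\<^esub>)" "n = m \<longrightarrow> \<pi> n (w m) \<in> Units S"
    if n: "n < k * D" and m: "m < k * D" for n m
  proof -
    have eq: "\<pi> n (w m) = \<eta> (n mod D) (loc.rfrac (x [^]\<^bsub>T\<^esub> (m mod D)) 0 \<otimes>\<^bsub>loc.Rs\<^esub> \<xi> (n div D) (q (m div D)))"
      using idx[OF n] idx[OF m] q by (simp add: \<pi>_def w_def \<xi>D(3))
    have "\<pi> n (w m) = \<zero>\<^bsub>S\<^esub>" if "n div D \<noteq> m div D"
      unfolding eq using \<xi>0[OF idx(2)[OF n] idx(2)[OF m] that] \<eta>0 idx[OF n] by simp
    moreover have "\<exists>a::nat. \<pi> n (w m) = (if m mod D = n mod D then ?w [^]\<^bsub>S\<^esub> a else \<zero>\<^bsub>S\<^esub>)"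
      if d: "n div D = m div D"
    proof -
      obtain a where a: "\<xi> (n div D) (q (n div D)) = loc.rfrac (j s [^]\<^bsub>T\<^esub> (a::nat)) 0" using \<xi>q[OF idx(2)[OF n]] by blast
      show ?thesis unfolding eq d[symmetric] a
        using \<eta>x[OF idx(1)[OF n] idx(1)[OF m], of a] s by (intro exI[of _ a]) (simp add: loc.localized_ring_mult del: fr.hom_mult)
    qed
    moreover have "n = m" if "n div D = m div D" "n mod D = m mod D"
    proof -
      have "n = n div D * D + n mod D" by simp
      also have "\<dots> = m div D * D + m mod D" by (simp only: that)
      finally show ?thesis by simp
    qed
    ultimately show "\<pi> n (w m) = (if n = m then \<pi> n (w m) else \<zero>\<^bsub>S\<^esub>)" "n = m \<longrightarrow> \<pi> n (w m) \<in> Units S"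
      using S.Units_pow_closed[OF u] by (cases "n div D = m div D"; cases "n mod D = m mod D"; auto)+
  qed
  have \<pi>s: "semilinear_map R ?VR \<theta> (regular_module S) (\<pi> n)" if n: "n < k * D" for n
    using \<xi>D[OF idx(2)[OF n]] \<eta>c[OF idx(1)[OF n]] \<eta>a[OF idx(1)[OF n]] \<eta>s[OF idx(1)[OF n]]
    by (intro semilinear_mapI) (simp_all add: \<pi>_def)
  have \<pi>e: "\<pi> n (?\<epsilon> \<odot>\<^bsub>V\<^esub> y) = \<zero>\<^bsub>S\<^esub>" if n: "n < k * D" and y: "y \<in> carrier V" for n y
    using \<xi>D(1,3)[OF idx(2)[OF n]] \<eta>e[OF idx(1)[OF n]] y pe by (simp add: \<pi>_def)
  let ?Y = "w ` {..<k * D} \<union> (\<lambda>y. ?\<epsilon> \<odot>\<^bsub>V\<^esub> y) ` carrier V"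
  let ?H = "module_span R ?VR ?Y"
  have Yc: "?Y \<subseteq> carrier ?VR" using pc pe by auto
  note sp = module_span_submodule[OF VR.module_axioms Yc]
  note E = VR.submoduleE[OF sp(1)]
  have Hc: "y \<in> ?H \<Longrightarrow> z \<in> ?H \<Longrightarrow> y \<oplus>\<^bsub>V\<^esub> z \<in> ?H" "r \<in> carrier R \<Longrightarrow> y \<in> ?H \<Longrightarrow> j r \<odot>\<^bsub>V\<^esub> y \<in> ?H"
    "y \<in> ?H \<Longrightarrow> y \<in> carrier V" "\<zero>\<^bsub>V\<^esub> \<in> ?H" for y z r
    using E(4)[of r y] E(5)[of y z] sp(3) VR.submodule_zero[OF sp(1)] by auto
  \<comment> \<open>The largest submodule over \<open>T\<close> inside the span over
    \<open>R\<close>. Through it, generation over \<open>T\<close> by the \<open>q a\<close> becomes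
    generation over \<open>R\<close> by their products with powers of \<open>x\<close>, modulo
    multiples of e.\<close>
  let ?HT = "{y \<in> carrier V. \<forall>t\<in>carrier T. t \<odot>\<^bsub>V\<^esub> y \<in> ?H}"
  have "submodule ?HT T V"
    using Hc by (intro V.submodule_of_closed) (auto simp: V.smult_r_distr V.smult_assoc1[symmetric])
  moreover have "q a \<in> ?HT" if a: "a < k" for a
  proof -
    let ?I = "{t \<in> carrier T. t \<odot>\<^bsub>V\<^esub> q a \<in> ?H}"
    have "submodule ?I R TM"
      using Hc q[OF a] by (intro TM.submodule_of_closed) (auto simp: V.smult_l_distr V.smult_assoc1)
    moreover have "x [^]\<^bsub>T\<^esub> l \<in> ?I" if l: "l < D" for l
    proof -
      have "a * D + l < k * D" using a l
        by (metis add.commute less_le_trans mult_Suc mult_le_mono1 nat_add_left_cancel_less Suc_leI)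
      moreover have "w (a * D + l) = x [^]\<^bsub>T\<^esub> l \<odot>\<^bsub>V\<^esub> q a" using l by (simp add: w_def)
      ultimately show ?thesis using sp(2) by (auto simp: image_iff)
    qed
    moreover have "?\<epsilon> \<otimes>\<^bsub>T\<^esub> t \<in> ?I" if t: "t \<in> carrier T" for t
      using sp(2) t q[OF a] pe by (auto simp: V.smult_assoc1)
    ultimately have "carrier T \<subseteq> ?I" by (rule T_spanned_by_small_powers[OF e])
    then show ?thesis using q[OF a] by auto
  qed
  ultimately have T_span: "module_span T V (q ` {..<k}) \<subseteq> ?HT" by (intro module_span_minimal) auto
  have "\<exists>a::nat. s [^]\<^bsub>R\<^esub> a \<odot>\<^bsub>?VR\<^esub> y \<in> ?H" if y: "y \<in> carrier V" for y
  proof -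
    obtain a where "j s [^]\<^bsub>T\<^esub> (a::nat) \<odot>\<^bsub>V\<^esub> y \<in> module_span T V (q ` {..<k})" using span[OF y] by blast
    then have "\<one>\<^bsub>T\<^esub> \<odot>\<^bsub>V\<^esub> (j s [^]\<^bsub>T\<^esub> a \<odot>\<^bsub>V\<^esub> y) \<in> ?H" using T_span by blast
    then show ?thesis using y s by (auto simp: pows)
  qed
  then show thesis using \<pi>w \<pi>s \<pi>e pc by (intro that[of w \<pi>]) metis+
qed

end

section \<open>Gluing\<close>

context module
begin

text \<open>Induction on a + b in place of the binomial theorem: one factor of the power is
  distributed, and the r-multiple or t-multiple of w then needs one power less.\<close>

lemma add_power_in_submodule:
  assumes H: "submodule H R M" and r: "r \<in> carrier R" "t \<in> carrier R"
  shows "w \<in> carrier M \<Longrightarrow> (r [^] a) \<odot>\<^bsub>M\<^esub> w \<in> H \<Longrightarrow> (t [^] b) \<odot>\<^bsub>M\<^esub> w \<in> H \<Longrightarrow>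
    ((r \<oplus> t) [^] (a + b :: nat)) \<odot>\<^bsub>M\<^esub> w \<in> H"
proof (induction "a + b" arbitrary: a b w)
  case 0
  then show ?case by simp
next
  case (Suc n)
  note E = submoduleE[OF H]
  have w: "w \<in> carrier M" by fact
  show ?case
  proof (cases "a = 0 \<or> b = 0")
    case True
    then have "w \<in> H" using Suc.prems by auto
    then show ?thesis using E(4) r by simp
  next
    case False
    then obtain a' b' where ab: "a = Suc a'" "b = Suc b'" by (metis not0_implies_Suc)
    have c: "t [^] b \<odot>\<^bsub>M\<^esub> (r \<odot>\<^bsub>M\<^esub> w) = r \<odot>\<^bsub>M\<^esub> (t [^] b \<odot>\<^bsub>M\<^esub> w)" "r [^] a \<odot>\<^bsub>M\<^esub> (t \<odot>\<^bsub>M\<^esub> w) = t \<odot>\<^bsub>M\<^esub> (r [^] a \<odot>\<^bsub>M\<^esub> w)"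
      using r w by (simp_all add: smult_assoc1[symmetric] R.m_comm del: R.nat_pow_Suc)
    have c': "r [^] a' \<odot>\<^bsub>M\<^esub> (r \<odot>\<^bsub>M\<^esub> w) = r [^] a \<odot>\<^bsub>M\<^esub> w" "t [^] b' \<odot>\<^bsub>M\<^esub> (t \<odot>\<^bsub>M\<^esub> w) = t [^] b \<odot>\<^bsub>M\<^esub> w"
      using r w by (simp_all add: ab smult_assoc1[symmetric])
    have "(r \<oplus> t) [^] (a' + b) \<odot>\<^bsub>M\<^esub> (r \<odot>\<^bsub>M\<^esub> w) \<in> H"
      using Suc.hyps(2) ab r w Suc.prems c(1) c'(1) E(4)[OF r(1) Suc.prems(3)]
      by (intro Suc.hyps(1)) (auto simp del: R.nat_pow_Suc)
    moreover have "(r \<oplus> t) [^] (a + b') \<odot>\<^bsub>M\<^esub> (t \<odot>\<^bsub>M\<^esub> w) \<in> H"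
      using Suc.hyps(2) ab r w Suc.prems c(2) c'(2) E(4)[OF r(2) Suc.prems(2)]
      by (intro Suc.hyps(1)) (auto simp del: R.nat_pow_Suc)
    moreover have "((r \<oplus> t) [^] (a + b)) \<odot>\<^bsub>M\<^esub> w =
        (r \<oplus> t) [^] (a' + b) \<odot>\<^bsub>M\<^esub> (r \<odot>\<^bsub>M\<^esub> w) \<oplus>\<^bsub>M\<^esub> (r \<oplus> t) [^] (a + b') \<odot>\<^bsub>M\<^esub> (t \<odot>\<^bsub>M\<^esub> w)"
      using r w ab by (simp add: smult_assoc1 smult_l_distr smult_r_distr)
    ultimately show ?thesis using E(5) by simp
  qed
qed

text \<open>The scalars some power of which moves w into H form an ideal. It contains Y, hence the
  unit element.\<close>

lemma submodule_local_membership: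
  assumes H: "submodule H R M" and Y: "Y \<subseteq> carrier R" "Idl Y = carrier R" and w: "w \<in> carrier M"
    and loc: "\<And>s. s \<in> Y \<Longrightarrow> \<exists>l::nat. (s [^] l) \<odot>\<^bsub>M\<^esub> w \<in> H"
  shows "w \<in> H"
proof -
  note E = submoduleE[OF H]
  let ?I = "{r \<in> carrier R. \<exists>l::nat. (r [^] l) \<odot>\<^bsub>M\<^esub> w \<in> H}"
  have mult: "a \<otimes> r \<in> ?I" if rI: "r \<in> ?I" and a: "a \<in> carrier R" for r a
  proof -
    obtain l where l: "(r [^] (l::nat)) \<odot>\<^bsub>M\<^esub> w \<in> H" and r: "r \<in> carrier R" using rI by blast
    have "((a \<otimes> r) [^] l) \<odot>\<^bsub>M\<^esub> w = a [^] l \<odot>\<^bsub>M\<^esub> (r [^] l \<odot>\<^bsub>M\<^esub> w)"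
      using r a w by (simp add: R.nat_pow_distrib smult_assoc1)
    then show ?thesis using E(4)[OF _ l, of "a [^] l"] that r by (auto intro!: exI[of _ l])
  qed
  have "ideal ?I R"
  proof (rule idealI[OF R.ring_axioms])
    show "subgroup ?I (add_monoid R)"
    proof (rule R.add.subgroupI)
      have "(\<zero> [^] (1::nat)) \<odot>\<^bsub>M\<^esub> w \<in> H" using w submodule_zero[OF H] by simp
      then show "?I \<noteq> {}" by blast
    next
      fix a assume a: "a \<in> ?I"
      have "\<ominus> \<one> \<otimes> a = \<ominus> a" using a by (simp add: R.l_minus)
      then show "\<ominus> a \<in> ?I" using mult[OF a, of "\<ominus> \<one>"] by simp
    next
      fix a b assume "a \<in> ?I" "b \<in> ?I"
      then show "a \<oplus> b \<in> ?I" using add_power_in_submodule[OF H _ _ w] by blast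
    qed auto
  qed (use mult R.m_comm in auto)
  moreover have "Y \<subseteq> ?I" using Y loc by auto
  ultimately have "carrier R \<subseteq> ?I" using R.genideal_minimal[of ?I Y] Y by simp
  then show ?thesis using w by auto
qed

lemma power_torsion_submodule:
  assumes H: "submodule H R M" and t: "t \<in> carrier R"
  shows "submodule {y \<in> carrier M. \<exists>l::nat. (t [^] l) \<odot>\<^bsub>M\<^esub> y \<in> H} R M"
proof (rule submodule_of_closed)
  note E = submoduleE[OF H]
  have up: "(t [^] (l + l' :: nat)) \<odot>\<^bsub>M\<^esub> y \<in> H" if "(t [^] l) \<odot>\<^bsub>M\<^esub> y \<in> H" "y \<in> carrier M" for l l' :: nat and y
    using E(4)[OF _ that(1), of "t [^] l'"] that t
    by (simp add: smult_assoc1[symmetric] R.nat_pow_mult add.commute)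
  show "\<zero>\<^bsub>M\<^esub> \<in> {y \<in> carrier M. \<exists>l::nat. (t [^] l) \<odot>\<^bsub>M\<^esub> y \<in> H}"
    using t submodule_zero[OF H] by simp
  fix a b assume a: "a \<in> {y \<in> carrier M. \<exists>l::nat. (t [^] l) \<odot>\<^bsub>M\<^esub> y \<in> H}" 
  then obtain l where l: "(t [^] (l::nat)) \<odot>\<^bsub>M\<^esub> a \<in> H" "a \<in> carrier M" by blast
  { assume "b \<in> {y \<in> carrier M. \<exists>l::nat. (t [^] l) \<odot>\<^bsub>M\<^esub> y \<in> H}"
    then obtain l' where l': "(t [^] (l'::nat)) \<odot>\<^bsub>M\<^esub> b \<in> H" "b \<in> carrier M" by blast
    have "(t [^] (l + l')) \<odot>\<^bsub>M\<^esub> (a \<oplus>\<^bsub>M\<^esub> b) \<in> H"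
      using E(5)[OF up[OF l, of l'] up[OF l', of l]] l(2) l'(2) t by (simp add: smult_r_distr add.commute)
    then show "a \<oplus>\<^bsub>M\<^esub> b \<in> {y \<in> carrier M. \<exists>l::nat. (t [^] l) \<odot>\<^bsub>M\<^esub> y \<in> H}" using l l' by blast }
  { fix c assume c: "c \<in> carrier R"
    have "(t [^] l) \<odot>\<^bsub>M\<^esub> (c \<odot>\<^bsub>M\<^esub> a) = c \<odot>\<^bsub>M\<^esub> ((t [^] l) \<odot>\<^bsub>M\<^esub> a)"
      using c l t by (simp add: smult_assoc1[symmetric] R.m_comm)
    then show "c \<odot>\<^bsub>M\<^esub> a \<in> {y \<in> carrier M. \<exists>l::nat. (t [^] l) \<odot>\<^bsub>M\<^esub> y \<in> H}"
      using E(4)[OF c l(1)] c l by (auto intro!: exI[of _ l]) }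
qed auto

text \<open>Refinement of a cover inside D(t): the gluing lemma is applied to the submodule of those
  elements that some power of t moves into H.\<close>

lemma local_membership_step:
  assumes H: "submodule H R M" and Y: "Y \<subseteq> carrier R" "Idl Y = carrier R" and w: "w \<in> carrier M"
    and t: "t \<in> carrier R" and loc: "\<And>s. s \<in> Y \<Longrightarrow> \<exists>l::nat. ((t \<otimes> s) [^] l) \<odot>\<^bsub>M\<^esub> w \<in> H"
  shows "\<exists>l::nat. (t [^] l) \<odot>\<^bsub>M\<^esub> w \<in> H"
proof -
  have "w \<in> {y \<in> carrier M. \<exists>l::nat. (t [^] l) \<odot>\<^bsub>M\<^esub> y \<in> H}"
  proof (rule submodule_local_membership[OF power_torsion_submodule[OF H t] Y w])
    fix s assume s: "s \<in> Y"
    then obtain l where l: "((t \<otimes> s) [^] (l::nat)) \<odot>\<^bsub>M\<^esub> w \<in> H" using loc by blast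
    have "s \<in> carrier R" using s Y by auto
    then have "(t [^] l) \<odot>\<^bsub>M\<^esub> ((s [^] l) \<odot>\<^bsub>M\<^esub> w) \<in> H" "(s [^] l) \<odot>\<^bsub>M\<^esub> w \<in> carrier M"
      using l t w by (simp_all add: R.nat_pow_distrib smult_assoc1)
    then show "\<exists>l::nat. (s [^] l) \<odot>\<^bsub>M\<^esub> w \<in> {y \<in> carrier M. \<exists>l::nat. (t [^] l) \<odot>\<^bsub>M\<^esub> y \<in> H}" by blast
  qed
  then show ?thesis by blast
qed

text \<open>The three covers come from the three local freeness hypotheses, and their products form
  a common refinement.\<close>

lemma submodule_local_membership_three:
  assumes H: "submodule H R M" and w: "w \<in> carrier M"
    and Y: "Y \<subseteq> carrier R" "Idl Y = carrier R" "Y' \<subseteq> carrier R" "Idl Y' = carrier R"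
      "Y'' \<subseteq> carrier R" "Idl Y'' = carrier R"
    and loc: "\<And>s s' s''. s \<in> Y \<Longrightarrow> s' \<in> Y' \<Longrightarrow> s'' \<in> Y'' \<Longrightarrow>
      \<exists>l::nat. (((s \<otimes> s') \<otimes> s'') [^] l) \<odot>\<^bsub>M\<^esub> w \<in> H"
  shows "w \<in> H"
proof (rule submodule_local_membership[OF H Y(1,2) w])
  fix s assume s: "s \<in> Y"
  show "\<exists>l::nat. (s [^] l) \<odot>\<^bsub>M\<^esub> w \<in> H"
  proof (rule local_membership_step[OF H Y(3,4) w])
    fix s' assume s': "s' \<in> Y'"
    show "\<exists>l::nat. ((s \<otimes> s') [^] l) \<odot>\<^bsub>M\<^esub> w \<in> H"
      by (rule local_membership_step[OF H Y(5,6) w]) (use loc s s' Y in auto)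
  qed (use s Y in auto)
qed

lemma submodule_finsum:
  assumes H: "submodule H R M" and "finite A" "\<And>a. a \<in> A \<Longrightarrow> f a \<in> H"
  shows "(\<Oplus>\<^bsub>M\<^esub>a\<in>A. f a) \<in> H"
  using assms(2,3)
proof (induction A rule: finite_induct)
  case empty
  then show ?case using submodule_zero[OF H] by simp
next
  note E = submoduleE[OF H]
  case (insert a A)
  have "f a \<in> carrier M" "f \<in> A \<rightarrow> carrier M" using insert E(1) by auto
  then show ?case using insert E(5) by simp
qed

end

section \<open>Spans and finite sums under semilinear maps\<close>

lemma span_union_submodule:
  fixes R (structure) and M :: "('r, 'm) module" and m :: nat
  assumes "module R M" and H: "submodule H R M" and q: "\<And>n. n < m \<Longrightarrow> q n \<in> carrier M"
    and z: "z \<in> module_span R M (q ` {..<m} \<union> H)"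
  obtains v y where "\<And>n. n < m \<Longrightarrow> v n \<in> carrier R" "y \<in> H"
    "z = (\<Oplus>\<^bsub>M\<^esub>n\<in>{..<m}. v n \<odot>\<^bsub>M\<^esub> q n) \<oplus>\<^bsub>M\<^esub> y"
proof -
  interpret module R M by fact
  note E = submoduleE[OF H]
  let ?sum = "\<lambda>v. \<Oplus>\<^bsub>M\<^esub>n\<in>{..<m}. v n \<odot>\<^bsub>M\<^esub> q n"
  let ?G = "{?sum v \<oplus>\<^bsub>M\<^esub> y | v y. v \<in> {..<m} \<rightarrow> carrier R \<and> y \<in> H}"
  have sc: "?sum v \<in> carrier M" if "v \<in> {..<m} \<rightarrow> carrier R" for v
    using that q by (intro finsum_closed) auto
  have yc: "y \<in> carrier M" if "y \<in> H" for y using that E(1) by auto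
  have GI: "z \<in> ?G" if "z = ?sum v \<oplus>\<^bsub>M\<^esub> y" "v \<in> {..<m} \<rightarrow> carrier R" "y \<in> H" for z v y using that by blast
  have sum0: "?sum (\<lambda>_. \<zero>) = \<zero>\<^bsub>M\<^esub>"
  proof -
    have "?sum (\<lambda>_. \<zero>) = (\<Oplus>\<^bsub>M\<^esub>n\<in>{..<m}. \<zero>\<^bsub>M\<^esub>)" using q by (intro finsum_cong') auto
    then show ?thesis by simp
  qed
  have "submodule ?G R M"
  proof (rule submodule_of_closed)
    show "?G \<subseteq> carrier M" using sc yc by auto
    show "\<zero>\<^bsub>M\<^esub> \<in> ?G"
      by (rule GI[of _ "\<lambda>_. \<zero>" "\<zero>\<^bsub>M\<^esub>"]) (use sum0 submodule_zero[OF H] in auto)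
  next
    fix a b assume "a \<in> ?G" "b \<in> ?G"
    then obtain v y v' y' where v: "v \<in> {..<m} \<rightarrow> carrier R" "y \<in> H" "a = ?sum v \<oplus>\<^bsub>M\<^esub> y"
      and v': "v' \<in> {..<m} \<rightarrow> carrier R" "y' \<in> H" "b = ?sum v' \<oplus>\<^bsub>M\<^esub> y'" by blast
    have vv: "v n \<in> carrier R" "v' n \<in> carrier R" if "n < m" for n using v(1) v'(1) that by auto
    have "?sum (\<lambda>n. v n \<oplus> v' n) = (\<Oplus>\<^bsub>M\<^esub>n\<in>{..<m}. v n \<odot>\<^bsub>M\<^esub> q n \<oplus>\<^bsub>M\<^esub> v' n \<odot>\<^bsub>M\<^esub> q n)"
      using vv q by (intro finsum_cong') (auto simp: smult_l_distr)
    also have "\<dots> = ?sum v \<oplus>\<^bsub>M\<^esub> ?sum v'" using vv q by (intro finsum_addf) auto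
    finally have "a \<oplus>\<^bsub>M\<^esub> b = ?sum (\<lambda>n. v n \<oplus> v' n) \<oplus>\<^bsub>M\<^esub> (y \<oplus>\<^bsub>M\<^esub> y')"
      using v v' sc yc by (simp add: a_ac)
    then show "a \<oplus>\<^bsub>M\<^esub> b \<in> ?G" by (rule GI) (use vv E(5) v v' in auto)
  next
    fix c a assume c: "c \<in> carrier R" and "a \<in> ?G"
    then obtain v y where v: "v \<in> {..<m} \<rightarrow> carrier R" "y \<in> H" "a = ?sum v \<oplus>\<^bsub>M\<^esub> y" by blast
    have vv: "v n \<in> carrier R" if "n < m" for n using v(1) that by auto
    have "c \<odot>\<^bsub>M\<^esub> ?sum v = (\<Oplus>\<^bsub>M\<^esub>n\<in>{..<m}. c \<odot>\<^bsub>M\<^esub> (v n \<odot>\<^bsub>M\<^esub> q n))"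
      using c vv q by (intro finsum_smult_ldistr) auto
    also have "\<dots> = ?sum (\<lambda>n. c \<otimes> v n)" using c vv q by (intro finsum_cong') (auto simp: smult_assoc1)
    finally have "c \<odot>\<^bsub>M\<^esub> a = ?sum (\<lambda>n. c \<otimes> v n) \<oplus>\<^bsub>M\<^esub> c \<odot>\<^bsub>M\<^esub> y"
      using v sc yc c by (simp add: smult_r_distr)
    then show "c \<odot>\<^bsub>M\<^esub> a \<in> ?G" by (rule GI) (use vv E(4) v c in auto)
  qed
  moreover have "q ` {..<m} \<subseteq> ?G"
  proof
    fix z assume "z \<in> q ` {..<m}"
    then obtain a where a: "a < m" "z = q a" by auto
    have "?sum (\<lambda>n. if n = a then \<one> else \<zero>) = (\<Oplus>\<^bsub>M\<^esub>n\<in>{..<m}. if a = n then q n else \<zero>\<^bsub>M\<^esub>)"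
      using q by (intro finsum_cong') auto
    also have "\<dots> = q a" using add.finprod_singleton[of a "{..<m}" q] a q by auto
    finally have "z = ?sum (\<lambda>n. if n = a then \<one> else \<zero>) \<oplus>\<^bsub>M\<^esub> \<zero>\<^bsub>M\<^esub>" using a q by simp
    then show "z \<in> ?G" by (rule GI) (use submodule_zero[OF H] in auto)
  qed
  moreover have "H \<subseteq> ?G"
  proof
    fix z assume z: "z \<in> H"
    have "z = ?sum (\<lambda>_. \<zero>) \<oplus>\<^bsub>M\<^esub> z" unfolding sum0 using yc[OF z] by simp
    then show "z \<in> ?G" by (rule GI) (use z in auto)
  qed
  ultimately have "z \<in> ?G" using z module_span_minimal[of ?G R M "q ` {..<m} \<union> H"] by blast
  then obtain v y where "v \<in> {..<m} \<rightarrow> carrier R" "y \<in> H" "z = ?sum v \<oplus>\<^bsub>M\<^esub> y" by blast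
  then show thesis by (intro that[of v y]) auto
qed

lemma semilinear_map_finsum:
  assumes L: "module R L" and W: "module S W" and i: "semilinear_map R L i W \<pi>"
    and "finite A" "\<And>a. a \<in> A \<Longrightarrow> f a \<in> carrier L"
  shows "\<pi> (\<Oplus>\<^bsub>L\<^esub>a\<in>A. f a) = (\<Oplus>\<^bsub>W\<^esub>a\<in>A. \<pi> (f a))"
proof -
  interpret L: module R L by fact
  interpret W: module S W by fact
  note D = semilinear_mapD[OF i]
  show ?thesis
    using assms(4,5)
  proof (induction A rule: finite_induct)
    case empty
    then show ?case using semilinear_map_zero[OF L W i] by simp
  next
    case (insert a A)
    have c: "f \<in> A \<rightarrow> carrier L" "f a \<in> carrier L" using insert by auto
    then have "(\<lambda>a. \<pi> (f a)) \<in> A \<rightarrow> carrier W" using D(1) by auto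
    then show ?case using insert c D(1,2) by simp
  qed
qed

lemma semilinear_map_span:
  assumes L: "module R L" and W: "module S W" and i: "i \<in> ring_hom R S" "semilinear_map R L i W \<pi>"
    and Y: "Y \<subseteq> carrier L" and z: "z \<in> module_span R L Y"
  shows "\<pi> z \<in> module_span S W (\<pi> ` Y)"
proof -
  interpret L: module R L by fact
  interpret W: module S W by fact
  note D = semilinear_mapD[OF i(2)]
  have "\<pi> ` Y \<subseteq> carrier W" using Y D(1) by auto
  note sp = module_span_submodule[OF W this]
  note E = W.submoduleE[OF sp(1)]
  have "submodule {y \<in> carrier L. \<pi> y \<in> module_span S W (\<pi> ` Y)} R L"
  proof (rule L.submodule_of_closed)
    show "\<zero>\<^bsub>L\<^esub> \<in> {y \<in> carrier L. \<pi> y \<in> module_span S W (\<pi> ` Y)}"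
      using semilinear_map_zero[OF L W i(2)] W.submodule_zero[OF sp(1)] by simp
  qed (use D E(4,5) ring_hom_closed[OF i(1)] in auto)
  moreover have "Y \<subseteq> {y \<in> carrier L. \<pi> y \<in> module_span S W (\<pi> ` Y)}" using Y sp(2) by auto
  ultimately show ?thesis using module_span_minimal z by blast
qed

section \<open>Transfer along a surjection\<close>

text \<open>The maps \<epsilon> and \<phi> will be multiplication by the same element of
  \<open>T\<close> on \<open>M\<close> and on \<open>L\<close>. Only their linearity over
  \<open>R\<close> is recorded, so the transfer takes place over \<open>R\<close> alone.\<close>

locale intertwined_surjection = M: module R M + L: module R L
  for R :: "('r, 'x) ring_scheme" and M :: "('r, 'm) module" and L :: "('r, 'l) module" +
  fixes g :: "'m \<Rightarrow> 'l" and \<epsilon> :: "'m \<Rightarrow> 'm" and \<phi> :: "'l \<Rightarrow> 'l"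
  assumes g: "semilinear_map R M (\<lambda>r. r) L g" "g ` carrier M = carrier L"
    and \<epsilon>: "semilinear_map R M (\<lambda>r. r) M \<epsilon>" and \<phi>: "semilinear_map R L (\<lambda>r. r) L \<phi>"
    and g\<epsilon>: "\<And>y. y \<in> carrier M \<Longrightarrow> g (\<epsilon> y) = \<phi> (g y)"
begin

lemmas gD = semilinear_mapD[OF g(1)]
lemmas \<epsilon>D = semilinear_mapD[OF \<epsilon>]
lemmas \<phi>D = semilinear_mapD[OF \<phi>]

lemma identity_hom: "(\<lambda>r. r) \<in> ring_hom R R" by (rule ring_hom_memI) auto

lemma image_submodule: "submodule (\<epsilon> ` carrier M) R M"
proof (rule M.submodule_of_closed)
  show "\<zero>\<^bsub>M\<^esub> \<in> \<epsilon> ` carrier M"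
    using semilinear_map_zero[OF M.module_axioms M.module_axioms \<epsilon>] M.zero_closed by (metis imageI)
next
  fix a b assume "a \<in> \<epsilon> ` carrier M" "b \<in> \<epsilon> ` carrier M"
  then obtain a' b' where "a' \<in> carrier M" "b' \<in> carrier M" "a = \<epsilon> a'" "b = \<epsilon> b'" by blast
  then show "a \<oplus>\<^bsub>M\<^esub> b \<in> \<epsilon> ` carrier M" using \<epsilon>D(2)[symmetric] by auto
next
  fix c a assume "c \<in> carrier R" "a \<in> \<epsilon> ` carrier M"
  then show "c \<odot>\<^bsub>M\<^esub> a \<in> \<epsilon> ` carrier M" using \<epsilon>D(3)[symmetric] by auto
qed (use \<epsilon>D in auto)

lemma g_minus: "a \<in> carrier M \<Longrightarrow> b \<in> carrier M \<Longrightarrow> g (a \<ominus>\<^bsub>M\<^esub> b) = g a \<ominus>\<^bsub>L\<^esub> g b"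
  using semilinear_map_minus[OF M.module_axioms L.module_axioms g(1)] .

text \<open>The functionals vanish on the kernel of \<open>g\<close>, hence they descend to \<open>L\<close>.\<close>

lemma alternating_vanishes_on_image:
  assumes sl: "semilinear_setting R L S W i"
    and ker: "\<And>y. y \<in> carrier M \<Longrightarrow> g y = \<zero>\<^bsub>L\<^esub> \<Longrightarrow> y \<in> \<epsilon> ` carrier M"
    and q: "\<And>n. n < m \<Longrightarrow> q n \<in> carrier M"
      "\<And>n. n < m \<Longrightarrow> semilinear_map R M i (regular_module S) (\<pi> n)"
      "\<And>n. n < m \<Longrightarrow> \<pi> n (q n) \<in> Units S"
      "\<And>a n. n < m \<Longrightarrow> a < m \<Longrightarrow> n \<noteq> a \<Longrightarrow> \<pi> n (q a) = \<zero>\<^bsub>S\<^esub>"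
      "\<And>n y. n < m \<Longrightarrow> y \<in> carrier M \<Longrightarrow> \<pi> n (\<epsilon> y) = \<zero>\<^bsub>S\<^esub>"
    and chart: "semilinear_setting.chart R L S i r b \<kappa>" "r < m + k"
    and alt: "alternating_map R L i W k \<psi>" and ys: "set ys \<subseteq> carrier L" "length ys = k"
  shows "\<psi> (map \<phi> ys) = \<zero>\<^bsub>W\<^esub>"
proof -
  interpret semilinear_setting R L S W i by fact
  define \<pi>' where "\<pi>' n y = \<pi> n (SOME w. w \<in> carrier M \<and> g w = y)" for n y
  have \<pi>': "\<pi>' n (g y) = \<pi> n y" if n: "n < m" and y: "y \<in> carrier M" for n y
  proof -
    note D = semilinear_mapD[OF q(2)[OF n], simplified regular_module_simps]
    define w where "w = (SOME w. w \<in> carrier M \<and> g w = g y)"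
    have "\<exists>w. w \<in> carrier M \<and> g w = g y" using y by blast
    from someI_ex[OF this] have w: "w \<in> carrier M" "g w = g y" by (simp_all add: w_def)
    have "g (w \<ominus>\<^bsub>M\<^esub> y) = \<zero>\<^bsub>L\<^esub>" using g_minus[OF w(1) y] w(2) gD(1)[OF y] by (simp add: a_minus_def L.r_neg)
    then obtain v where v: "v \<in> carrier M" "w \<ominus>\<^bsub>M\<^esub> y = \<epsilon> v" using ker w y by blast
    have "w = y \<oplus>\<^bsub>M\<^esub> \<epsilon> v" using w y by (simp add: v(2)[symmetric] a_minus_def M.a_ac M.r_neg M.r_neg1)
    then have "\<pi> n w = \<pi> n y" using D(1,2) q(5)[OF n v(1)] y v(1) \<epsilon>D(1) by simp
    then show ?thesis by (simp add: \<pi>'_def w_def)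
  qed
  have sl': "semilinear_map R L i (regular_module S) (\<pi>' n)" if n: "n < m" for n
  proof (rule semilinear_mapI)
    note D = semilinear_mapD[OF q(2)[OF n]]
    fix y assume y: "y \<in> carrier L"
    then obtain y' where y': "y' \<in> carrier M" "y = g y'" using g(2) by blast
    show "\<pi>' n y \<in> carrier (regular_module S)" using D(1) y' \<pi>'[OF n] by simp
    { fix w assume w: "w \<in> carrier L"
      then obtain w' where w': "w' \<in> carrier M" "w = g w'" using g(2) by blast
      show "\<pi>' n (y \<oplus>\<^bsub>L\<^esub> w) = \<pi>' n y \<oplus>\<^bsub>regular_module S\<^esub> \<pi>' n w"
        using D(2)[OF y'(1) w'(1)] y' w' \<pi>'[OF n] gD(2)[symmetric] by simp }
    { fix c assume c: "c \<in> carrier R"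
      show "\<pi>' n (c \<odot>\<^bsub>L\<^esub> y) = i c \<odot>\<^bsub>regular_module S\<^esub> \<pi>' n y"
        using D(3)[OF c y'(1)] c y' \<pi>'[OF n] gD(3)[symmetric] by simp }
  qed
  have b: "b ` {..<r} \<subseteq> carrier L" "finite (b ` {..<r})" "card (b ` {..<r}) < m + k"
    and gen: "\<And>y. y \<in> carrier L \<Longrightarrow> \<exists>q\<in>carrier R. i q \<in> Units S \<and> q \<odot>\<^bsub>L\<^esub> y \<in> module_span R L (b ` {..<r})"
    using chart card_image_le[of "{..<r}" b] unfolding chart_def by auto
  show ?thesis
  proof (rule alt_vanishes_on_image[OF alt b gen sl', where p = "\<lambda>n. g (q n)"])
    fix n y assume n: "n < m" and "y \<in> set (map \<phi> ys)"
    then obtain w where w: "w \<in> carrier L" "y = \<phi> w" using ys by auto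
    then obtain w' where "w' \<in> carrier M" "w = g w'" using g(2) by blast
    then show "\<pi>' n y = \<zero>\<^bsub>S\<^esub>" using w g\<epsilon>[symmetric] \<pi>'[OF n] \<epsilon>D(1) q(5)[OF n] by simp
  qed (use q \<pi>' gD \<phi>D ys in auto)
qed

text \<open>The relation is pushed to \<open>L\<close> by g and solved for its n-th term; this is
  the input for the counting argument of \<open>relation_coefficient_zero\<close>, with the images
  of the \<open>q n\<close> as the finite set.\<close>

lemma relation_coefficients_vanish:
  fixes S :: "'s ring"
  assumes rv: "ring_valued_setting R L S i"
    and q: "\<And>n. n < m \<Longrightarrow> q n \<in> carrier M"
    and gen: "\<And>y. y \<in> carrier M \<Longrightarrow> \<exists>c\<in>carrier R. i c \<in> Units S \<and>
      c \<odot>\<^bsub>M\<^esub> y \<in> module_span R M (q ` {..<m} \<union> \<epsilon> ` carrier M)"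
    and chart: "semilinear_setting.chart R L S i r b \<kappa>" "m + k \<le> Suc r"
    and van: "\<And>\<psi> ys. alternating_map R L i (regular_module S) k \<psi> \<Longrightarrow> set ys \<subseteq> carrier L \<Longrightarrow>
      length ys = k \<Longrightarrow> \<psi> (map \<phi> ys) = \<zero>\<^bsub>S\<^esub>"
    and v: "\<And>n. n < m \<Longrightarrow> v n \<in> carrier R" and y: "y \<in> carrier M"
    and rel: "g ((\<Oplus>\<^bsub>M\<^esub>n\<in>{..<m}. v n \<odot>\<^bsub>M\<^esub> q n) \<oplus>\<^bsub>M\<^esub> \<epsilon> y) = \<zero>\<^bsub>L\<^esub>" and n: "n < m"
  shows "i (v n) = \<zero>\<^bsub>S\<^esub>"
proof -
  interpret ring_valued_setting R L S i by fact
  let ?P = "(\<lambda>n. g (q n)) ` {..<m}"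
  have P: "finite ?P" "?P \<subseteq> carrier L" "card ?P \<le> m"
    using q gD(1) card_image_le[of "{..<m}" "\<lambda>n. g (q n)"] by auto
  have \<phi>': "\<phi> \<in> carrier L \<rightarrow> carrier L" using \<phi>D(1) by auto
  show ?thesis
  proof (rule relation_coefficient_zero[where P = ?P and k = k, OF chart(1) \<phi>'])
    show "card ?P + k \<le> Suc r" "finite ?P" "?P \<subseteq> carrier L" "v n \<in> carrier R"
      using P chart(2) v[OF n] by simp_all
    fix \<psi> ys assume "alt k \<psi>" "set ys \<subseteq> carrier L" "length ys = k"
    then show "\<psi> (map \<phi> ys) = \<zero>\<^bsub>S\<^esub>" by (rule van)
  next
    fix w assume "w \<in> carrier L"
    then obtain w' where w': "w' \<in> carrier M" "w = g w'" using g(2) by blast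
    obtain c where c: "c \<in> carrier R" "i c \<in> Units S"
      "c \<odot>\<^bsub>M\<^esub> w' \<in> module_span R M (q ` {..<m} \<union> \<epsilon> ` carrier M)" using gen[OF w'(1)] by blast
    have "g (c \<odot>\<^bsub>M\<^esub> w') \<in> module_span R L (g ` (q ` {..<m} \<union> \<epsilon> ` carrier M))"
      by (rule semilinear_map_span[OF M.module_axioms L.module_axioms identity_hom g(1) _ c(3)])
        (use q \<epsilon>D(1) in auto)
    moreover have "g ` (q ` {..<m} \<union> \<epsilon> ` carrier M) \<subseteq> ?P \<union> \<phi> ` carrier L"
      using g\<epsilon> gD(1) by auto
    ultimately show "\<exists>u\<in>carrier R. i u \<in> Units S \<and> u \<odot>\<^bsub>L\<^esub> w \<in> module_span R L (?P \<union> \<phi> ` carrier L)"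
      using c w' gD(3) subsetD[OF module_span_mono[of "g ` (q ` {..<m} \<union> \<epsilon> ` carrier M)" "?P \<union> \<phi> ` carrier L" R L]]
      by (intro bexI[of _ c]) auto
  next
    show "card ?P + k \<le> r \<or> (\<exists>x\<in>?P. v n \<odot>\<^bsub>L\<^esub> x \<in> module_span R L (?P - {x} \<union> \<phi> ` carrier L))"
    \<comment> \<open>If two images coincide there are fewer than m of them, and the count of
      arguments is decisive without a relation.\<close>
    proof (cases "inj_on (\<lambda>n. g (q n)) {..<m}")
      case False
      then have "card ?P \<noteq> m" using eq_card_imp_inj_on[of "{..<m}" "\<lambda>n. g (q n)"] by auto
      then show ?thesis using P(3) chart(2) by simp
    next
      case True
      let ?x = "g (q n)"
      let ?Y = "?P - {?x} \<union> \<phi> ` carrier L"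
      have Y: "?Y \<subseteq> carrier L" using P \<phi>D(1) by auto
      note sp = module_span_submodule[OF L.module_axioms Y]
      note E = L.submoduleE[OF sp(1)]
      let ?rest = "(\<Oplus>\<^bsub>L\<^esub>a\<in>{..<m} - {n}. v a \<odot>\<^bsub>L\<^esub> g (q a)) \<oplus>\<^bsub>L\<^esub> \<phi> (g y)"
      have "v a \<odot>\<^bsub>L\<^esub> g (q a) \<in> module_span R L ?Y" if a: "a \<in> {..<m} - {n}" for a
      proof -
        have "g (q a) \<noteq> ?x" using inj_onD[OF True, of a n] a n by auto
        then have "g (q a) \<in> ?Y" using a by auto
        then show ?thesis using a E(4)[OF v subsetD[OF sp(2)]] by blast
      qed
      then have "(\<Oplus>\<^bsub>L\<^esub>a\<in>{..<m} - {n}. v a \<odot>\<^bsub>L\<^esub> g (q a)) \<in> module_span R L ?Y"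
        by (intro L.submodule_finsum[OF sp(1)]) auto
      moreover have "\<phi> (g y) \<in> module_span R L ?Y" using sp(2) gD(1)[OF y] by auto
      ultimately have rest: "?rest \<in> module_span R L ?Y" using E(5) by simp
      have vq: "v a \<odot>\<^bsub>M\<^esub> q a \<in> carrier M" if "a < m" for a using v q that by simp
      have vgq: "v a \<odot>\<^bsub>L\<^esub> g (q a) \<in> carrier L" if "a < m" for a using v q gD(1) that by simp
      have sc: "(\<Oplus>\<^bsub>M\<^esub>a\<in>{..<m}. v a \<odot>\<^bsub>M\<^esub> q a) \<in> carrier M" using vq by (intro M.finsum_closed) auto
      have "\<zero>\<^bsub>L\<^esub> = (\<Oplus>\<^bsub>L\<^esub>a\<in>{..<m}. g (v a \<odot>\<^bsub>M\<^esub> q a)) \<oplus>\<^bsub>L\<^esub> \<phi> (g y)"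
        using rel gD(2)[OF sc \<epsilon>D(1)[OF y]] g\<epsilon>[OF y] vq
          semilinear_map_finsum[OF M.module_axioms L.module_axioms g(1), of "{..<m}" "\<lambda>a. v a \<odot>\<^bsub>M\<^esub> q a"] by simp
      also have "(\<Oplus>\<^bsub>L\<^esub>a\<in>{..<m}. g (v a \<odot>\<^bsub>M\<^esub> q a)) = (\<Oplus>\<^bsub>L\<^esub>a\<in>{..<m}. v a \<odot>\<^bsub>L\<^esub> g (q a))"
        using v q gD(1,3) by (intro L.finsum_cong') auto
      also have "{..<m} = insert n ({..<m} - {n})" using n by auto
      also have "(\<Oplus>\<^bsub>L\<^esub>a\<in>insert n ({..<m} - {n}). v a \<odot>\<^bsub>L\<^esub> g (q a))
          = v n \<odot>\<^bsub>L\<^esub> ?x \<oplus>\<^bsub>L\<^esub> (\<Oplus>\<^bsub>L\<^esub>a\<in>{..<m} - {n}. v a \<odot>\<^bsub>L\<^esub> g (q a))"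
        using vgq n by (intro L.finsum_insert) auto
      finally have "v n \<odot>\<^bsub>L\<^esub> ?x \<oplus>\<^bsub>L\<^esub> ?rest = \<zero>\<^bsub>L\<^esub>"
        using vgq[OF n] rest sp(3) \<phi>D(1) gD(1)[OF y] L.finsum_closed[of "\<lambda>a. v a \<odot>\<^bsub>L\<^esub> g (q a)" "{..<m} - {n}"] vgq
        by (simp add: L.a_assoc Pi_iff)
      then have "v n \<odot>\<^bsub>L\<^esub> ?x = \<ominus>\<^bsub>L\<^esub> ?rest"
        using L.minus_equality[of "v n \<odot>\<^bsub>L\<^esub> ?x" ?rest] vgq[OF n] rest sp(3) by auto
      then have "v n \<odot>\<^bsub>L\<^esub> ?x \<in> module_span R L ?Y" using E(3)[OF rest] by simp
      then show ?thesis using n by blast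
    qed
  qed
qed

end

section \<open>Strict filtrations\<close>

context tensor_extension
begin

section \<open>Values of polynomials in the tensor product, and the elements e\<close>

lemma poly_value_hom:
  assumes "set q \<subseteq> carrier OK"
  shows "pt (F.eval (map i q) \<zeta>) \<one>\<^bsub>R\<^esub> = poly_value q"
  using assms
proof (induction q)
  interpret pt1: ring_hom_ring OF T "\<lambda>a. pt a \<one>\<^bsub>R\<^esub>"
    using pt_hom OF.ring_axioms TR.T.ring_axioms by (intro ring_hom_ringI2)
  case Nil
  then show ?case using pt1.hom_zero by simp
next
  interpret pt1: ring_hom_ring OF T "\<lambda>a. pt a \<one>\<^bsub>R\<^esub>"
    using pt_hom OF.ring_axioms TR.T.ring_axioms by (intro ring_hom_ringI2)
  case (Cons s q)
  have s: "s \<in> carrier OK" "i s \<in> carrier OF" "set q \<subseteq> carrier OK" using Cons.prems i_OK by auto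
  have m: "i s \<otimes>\<^bsub>F\<^esub> \<zeta> [^]\<^bsub>F\<^esub> length q \<in> carrier OF" using subringE(6)[OF OF_subring s(2) \<zeta>_pow_OF] .
  have "pt (F.eval (map i (s # q)) \<zeta>) \<one>\<^bsub>R\<^esub>
      = pt (i s \<otimes>\<^bsub>F\<^esub> \<zeta> [^]\<^bsub>F\<^esub> length q) \<one>\<^bsub>R\<^esub> \<oplus>\<^bsub>T\<^esub> pt (F.eval (map i q) \<zeta>) \<one>\<^bsub>R\<^esub>"
    using pt1.hom_add[OF m eval_OF[OF s(3)]] by simp
  also have "pt (i s \<otimes>\<^bsub>F\<^esub> \<zeta> [^]\<^bsub>F\<^esub> length q) \<one>\<^bsub>R\<^esub> = j (\<rho> s) \<otimes>\<^bsub>T\<^esub> x [^]\<^bsub>T\<^esub> length q"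
    using pt1.hom_mult[OF s(2) \<zeta>_pow_OF[of "length q"]]
    by (simp only: ring_simps pt_OK[OF s(1)] pt_pow)
  finally show ?case using Cons.IH[OF s(3)] by (simp only: poly_value_Cons)
qed

lemma poly_value_minpoly: "poly_value minpoly = \<zero>\<^bsub>T\<^esub>"
proof -
  interpret pt1: ring_hom_ring OF T "\<lambda>a. pt a \<one>\<^bsub>R\<^esub>"
    using pt_hom OF.ring_axioms TR.T.ring_axioms by (intro ring_hom_ringI2)
  have "F.eval (map i minpoly) \<zeta> = \<zero>\<^bsub>F\<^esub>" using minpoly_F(4) map_i_minpoly by simp
  then show ?thesis using poly_value_hom[OF minpoly_OK] pt1.hom_zero by simp
qed

lemma minpoly_OE: "set minpoly \<subseteq> carrier OE"
  using minpoly_OK OK_in_OE by blast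

text \<open>With this trivial factorization the chart modulo e can be used for
  \<open>minpoly\<close> itself, which measures the rank over \<open>R\<close> of a free module over
  \<open>T\<close>.\<close>

lemma minpoly_self_factor: "minpoly = C.poly_mult [\<one>\<^bsub>C\<^esub>] minpoly"
  using C.poly_mult_one(1)[OF subfieldE(1)[OF K_subfield] minpoly_props(4)] by (rule sym)

lemma N_pos: "0 < N"
proof (rule ccontr)
  assume "\<not> 0 < N"
  then have "minpoly = [\<one>\<^bsub>C\<^esub>]" using minpoly_props(2,3) by (cases minpoly) auto
  then show False using minpoly_F(4) map_i_minpoly by (simp add: i_one flip: map_i_minpoly)
qed

text \<open>For the divisibility: the values of the embeddings at \<zeta> are distinct roots of
  \<open>minpoly\<close>, and the quotient keeps coefficients in \<open>OE\<close> because the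
  divisor is monic.\<close>

lemma e_poly_props:
  assumes S: "S \<subseteq> field_embeddings K i F C" and "reflex_field C K F S \<subseteq> E"
  shows "set (e_poly C \<zeta> S) \<subseteq> carrier OE" "length (e_poly C \<zeta> S) = Suc (card S)"
    "hd (e_poly C \<zeta> S) = \<one>\<^bsub>C\<^esub>"
    "\<exists>b. set b \<subseteq> carrier OE \<and> minpoly = C.poly_mult b (e_poly C \<zeta> S)"
proof -
  let ?Y = "(\<lambda>\<phi>. \<phi> \<zeta>) ` S"
  have fin: "finite ?Y" using embeddings_finite S finite_subset by auto
  have Y: "?Y \<subseteq> carrier C" using S embedding_root by auto
  have card: "card ?Y = card S" using embedding_inj S by (intro card_image) (rule inj_on_subset)
  note P = C.root_product_props[OF C.carrier_is_subring fin Y]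
  show O: "set (e_poly C \<zeta> S) \<subseteq> carrier OE"
    using e_poly_integral[OF S E(1) assms(2)] by (simp add: OE_carrier)
  show l: "length (e_poly C \<zeta> S) = Suc (card S)" and hd: "hd (e_poly C \<zeta> S) = \<one>\<^bsub>C\<^esub>"
    using P(2,3) card unfolding e_poly_eq_root_product[OF S] by simp_all
  have ne: "e_poly C \<zeta> S \<noteq> []" using l by auto
  have e: "polynomial\<^bsub>C\<^esub> (carrier OE) (C.root_product ?Y)"
    using O hd ne unfolding polynomial_def e_poly_eq_root_product[OF S] by simp
  have mp: "polynomial\<^bsub>C\<^esub> (carrier OE) minpoly"
    using minpoly_OE minpoly_props(3) unfolding polynomial_def by auto
  obtain b where b: "polynomial\<^bsub>C\<^esub> (carrier OE) b" "minpoly = C.poly_mult (C.root_product ?Y) b"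
    using C.root_product_divides[OF C.field_axioms OE_subring fin Y e mp] embedding_root(2) S by blast
  interpret UP: cring "poly_ring C" using C.univ_poly_is_cring[OF C.carrier_is_subring] .
  have OC: "carrier OE \<subseteq> carrier C" using OE_closed by auto
  have "C.root_product ?Y \<in> carrier (poly_ring C)" "b \<in> carrier (poly_ring C)"
    using e b(1) OC by (auto simp: univ_poly_carrier[symmetric] polynomial_def)
  then have "minpoly = C.poly_mult b (C.root_product ?Y)"
    using UP.m_comm b(2) by (simp only: univ_poly_mult)
  then show "\<exists>b. set b \<subseteq> carrier OE \<and> minpoly = C.poly_mult b (e_poly C \<zeta> S)"
    using C.polynomial_incl[OF b(1)] unfolding e_poly_eq_root_product[OF S] by blast
qed

abbreviation "bc \<equiv> tensor_base_change OK i OF \<rho> R \<rho>"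

lemma base_change_hom: "bc \<in> ring_hom TE.T T"
  and base_change_pure: "a \<in> carrier OF \<Longrightarrow> w \<in> carrier OE \<Longrightarrow> bc (TE.pt a w) = pt a (\<rho> w)"
  using tensor_base_change_hom[OF TE.tensor_setting_axioms TR.tensor_setting_axioms \<rho>_hom] by simp_all

lemma e_element_closed:
  assumes "S \<subseteq> field_embeddings K i F C" "reflex_field C K F S \<subseteq> E"
  shows "e_element C OK i OF OE \<zeta> S \<in> carrier TE.T"
  unfolding e_element_def using e_poly_props(1)[OF assms] one_OF \<zeta> TE.pt_closed[OF \<zeta> OE.one_closed]
  by (intro TE.T.eval_in_carrier) auto

lemma base_change_e_element:
  assumes "S \<subseteq> field_embeddings K i F C" "reflex_field C K F S \<subseteq> E"
  shows "bc (e_element C OK i OF OE \<zeta> S) = poly_value (e_poly C \<zeta> S)"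
proof -
  interpret h: ring_hom_ring TE.T T bc
    using base_change_hom TE.T.ring_axioms TR.T.ring_axioms by (intro ring_hom_ringI2)
  note O = e_poly_props(1)[OF assms]
  have "bc (e_element C OK i OF OE \<zeta> S) =
      TR.T.eval (map bc (map (TE.pt \<one>\<^bsub>OF\<^esub>) (e_poly C \<zeta> S))) (bc (TE.pt \<zeta> \<one>\<^bsub>OE\<^esub>))"
    unfolding e_element_def using O one_OF TE.pt_closed[OF \<zeta> OE.one_closed] by (intro h.eval_hom') auto
  also have "map bc (map (TE.pt \<one>\<^bsub>OF\<^esub>) (e_poly C \<zeta> S)) = map (\<lambda>a. j (\<rho> a)) (e_poly C \<zeta> S)"
    using O one_OF base_change_pure by (auto simp: j_def)
  also have "bc (TE.pt \<zeta> \<one>\<^bsub>OE\<^esub>) = x"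
    using base_change_pure[OF \<zeta> OE.one_closed] \<rho>.hom_one by (simp add: x_def)
  finally show ?thesis by (simp add: poly_value_def)
qed

end

text \<open>For a principal ideal the multiples of the generator already form a submodule, so the
  span adds nothing.\<close>

lemma ideal_smult_principal:
  assumes P: "cring P" and M: "module T M" and h: "h \<in> ring_hom P T" and e: "e \<in> carrier P"
  shows "ideal_smult T h (Idl\<^bsub>P\<^esub> {e}) M = (\<lambda>y. h e \<odot>\<^bsub>M\<^esub> y) ` carrier M"
proof -
  interpret P: cring P by fact
  interpret M: module T M by fact
  interpret h: ring_hom_ring P T h using h P.ring_axioms M.R.ring_axioms by (intro ring_hom_ringI2)
  let ?G = "{h a \<odot>\<^bsub>M\<^esub> m | a m. a \<in> Idl\<^bsub>P\<^esub> {e} \<and> m \<in> carrier M}"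
  let ?H = "(\<lambda>y. h e \<odot>\<^bsub>M\<^esub> y) ` carrier M"
  have he: "h e \<in> carrier T" using e by simp
  have I: "Idl\<^bsub>P\<^esub> {e} = {c \<otimes>\<^bsub>P\<^esub> e | c. c \<in> carrier P}"
    using P.cgenideal_eq_genideal[OF e] by (simp add: cgenideal_def)
  have H: "submodule ?H T M"
  proof (rule M.submodule_of_closed)
    show "\<zero>\<^bsub>M\<^esub> \<in> ?H" using he by (intro image_eqI[of _ _ "\<zero>\<^bsub>M\<^esub>"]) auto
  next
    fix a b assume "a \<in> ?H" "b \<in> ?H"
    then obtain a' b' where "a' \<in> carrier M" "a = h e \<odot>\<^bsub>M\<^esub> a'" "b' \<in> carrier M" "b = h e \<odot>\<^bsub>M\<^esub> b'" by blast
    then show "a \<oplus>\<^bsub>M\<^esub> b \<in> ?H" using he by (intro image_eqI[of _ _ "a' \<oplus>\<^bsub>M\<^esub> b'"]) (auto simp: M.smult_r_distr)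
  next
    fix c a assume c: "c \<in> carrier T" and "a \<in> ?H"
    then obtain a' where "a' \<in> carrier M" "a = h e \<odot>\<^bsub>M\<^esub> a'" by blast
    then show "c \<odot>\<^bsub>M\<^esub> a \<in> ?H" using he c
      by (intro image_eqI[of _ _ "c \<odot>\<^bsub>M\<^esub> a'"]) (auto simp: M.smult_assoc1[symmetric] M.R.m_comm)
  qed (use he in auto)
  have "?G \<subseteq> ?H"
  proof
    fix w assume "w \<in> ?G"
    then obtain a m where "a \<in> Idl\<^bsub>P\<^esub> {e}" and m: "m \<in> carrier M" "w = h a \<odot>\<^bsub>M\<^esub> m" by blast
    then obtain c where c: "c \<in> carrier P" "a = c \<otimes>\<^bsub>P\<^esub> e" unfolding I by blast
    have "w = h e \<odot>\<^bsub>M\<^esub> (h c \<odot>\<^bsub>M\<^esub> m)"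
      using c m he e by (simp add: M.smult_assoc1[symmetric] M.R.m_comm)
    then show "w \<in> ?H" using c m by (intro image_eqI[of _ _ "h c \<odot>\<^bsub>M\<^esub> m"]) auto
  qed
  from module_span_minimal[OF H this] have "module_span T M ?G \<subseteq> ?H" .
  moreover have "?H \<subseteq> module_span T M ?G"
  proof -
    have "e \<in> Idl\<^bsub>P\<^esub> {e}" using P.genideal_self'[OF e] .
    then have "?H \<subseteq> ?G" by blast
    moreover have "?G \<subseteq> carrier M" using \<open>?G \<subseteq> ?H\<close> M.submoduleE(1)[OF H] by blast
    ultimately show ?thesis using module_span_submodule(2)[OF M] by blast
  qed
  ultimately show ?thesis by (auto simp: ideal_smult_def)
qed

lemma (in localization) trivial_localization:
  assumes "\<one>\<^bsub>Rs\<^esub> = \<zero>\<^bsub>Rs\<^esub>"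
  shows "\<exists>l::nat. s [^]\<^bsub>R\<^esub> l = \<zero>\<^bsub>R\<^esub>"
proof -
  have "rfrac \<one>\<^bsub>R\<^esub> 0 = \<zero>\<^bsub>localized_module R (regular_module R) s\<^esub>"
    using assms by (simp add: localized_ring_simps)
  then obtain l where "reg.pw l \<one>\<^bsub>R\<^esub> = \<zero>\<^bsub>regular_module R\<^esub>"
    using reg.frac_eq_zero_iff[of "\<one>\<^bsub>R\<^esub>" 0] by auto
  then show ?thesis by (auto simp: reg.pw_def)
qed

context tensor_extension
begin

text \<open>Over R[1/\<sigma>] all three freeness statements hold at once. The unknown rank k over
  \<open>T\<close> is identified by comparing two charts of the same module, of sizes k N and n N;
  this comparison fails only over the zero ring, where a power of \<sigma> is zero.\<close>

lemma local_charts: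
  fixes V :: "(('f \<times> 'r \<Rightarrow>\<^sub>0 int) set, 'm) module" and L :: "('r, 'l) module"
  assumes e: "set e \<subseteq> carrier OE" "length e = Suc D" "hd e = \<one>\<^bsub>C\<^esub>"
    and b: "set b \<subseteq> carrier OE" "minpoly = C.poly_mult b e"
    and V: "module T V" and L: "module R L" and s: "s \<in> carrier R" "s' \<in> carrier R" "s'' \<in> carrier R"
    and free: "free_of_rank (localized_ring T (j s)) (localized_module T V (j s)) k"
      "free_of_rank (localized_ring R s') (localized_module R (restrict_scalars j V) s') (n * N)"
      "free_of_rank (localized_ring R s'') (localized_module R L s'') r"
    and \<sigma>: "\<sigma> = s \<otimes>\<^bsub>R\<^esub> s' \<otimes>\<^bsub>R\<^esub> s''"
    and S: "S = localized_ring R \<sigma>" and \<theta>: "\<theta> = (\<lambda>c. fraction R (regular_module R) \<sigma> c 0)"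
  obtains (trivial) l :: nat where "\<sigma> [^]\<^bsub>R\<^esub> l = \<zero>\<^bsub>R\<^esub>"
    | (charts) q \<pi> \<beta> \<kappa> where
    "\<And>a. a < n * D \<Longrightarrow> q a \<in> carrier V"
    "\<And>a. a < n * D \<Longrightarrow> semilinear_map R (restrict_scalars j V) \<theta> (regular_module S) (\<pi> a)"
    "\<And>a. a < n * D \<Longrightarrow> \<pi> a (q a) \<in> Units S"
    "\<And>b a. a < n * D \<Longrightarrow> b < n * D \<Longrightarrow> a \<noteq> b \<Longrightarrow> \<pi> a (q b) = \<zero>\<^bsub>S\<^esub>"
    "\<And>a y. a < n * D \<Longrightarrow> y \<in> carrier V \<Longrightarrow> \<pi> a (poly_value e \<odot>\<^bsub>V\<^esub> y) = \<zero>\<^bsub>S\<^esub>"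
    "\<And>y. y \<in> carrier V \<Longrightarrow> \<exists>a::nat. s [^]\<^bsub>R\<^esub> a \<odot>\<^bsub>restrict_scalars j V\<^esub> y \<in>
       module_span R (restrict_scalars j V) (q ` {..<n * D} \<union> (\<lambda>y. poly_value e \<odot>\<^bsub>V\<^esub> y) ` carrier V)"
    "semilinear_setting.chart R L S \<theta> r \<beta> \<kappa>"
proof -
  let ?VR = "restrict_scalars j V"
  have sc: "\<sigma> \<in> carrier R" using s by (simp add: \<sigma>)
  interpret loc: localization R "regular_module R" \<sigma> by (rule R.localization_regular[OF sc])
  have Sc: "cring S" and \<theta>h: "\<theta> \<in> ring_hom R S"
    using loc.localized_ring_cring loc.rfrac_hom by (simp_all add: S \<theta>)
  interpret S: cring S by (rule Sc)
  interpret \<theta>: ring_hom_ring R S \<theta> using \<theta>h R.ring_axioms S.ring_axioms by (intro ring_hom_ringI2)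
  interpret VR: module R ?VR by (rule restrict_scalars_module[OF V])
  interpret L: module R L by (rule L)
  \<comment> \<open>The product of the three images is the image of \<sigma>, a unit, hence each
    factor is one.\<close>
  have "\<theta> s \<otimes>\<^bsub>S\<^esub> \<theta> s' \<otimes>\<^bsub>S\<^esub> \<theta> s'' \<in> Units S"
    using loc.rfrac_unit s by (simp add: S[symmetric] \<sigma> flip: \<theta>.hom_mult) (simp add: \<theta> \<sigma> S)
  then have u: "\<theta> s \<in> Units S" "\<theta> s' \<in> Units S" "\<theta> s'' \<in> Units S"
    using s S.unit_factor[of "\<theta> s \<otimes>\<^bsub>S\<^esub> \<theta> s'" "\<theta> s''"] S.unit_factor[of "\<theta> s" "\<theta> s'"]
      S.unit_factor[of "\<theta> s'" "\<theta> s"] S.unit_factor[of "\<theta> s''" "\<theta> s \<otimes>\<^bsub>S\<^esub> \<theta> s'"]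
    by (simp_all add: S.m_comm)
  interpret rvV: ring_valued_setting R ?VR S \<theta> by unfold_locales (rule \<theta>h)
  interpret locV: localization R ?VR s' using s by unfold_locales
  interpret locL: localization R L s'' using s by unfold_locales
  obtain q1 \<pi>1 where c1: "rvV.chart (n * N) q1 \<pi>1"
    by (rule locV.free_localization_chart[OF free(2) Sc \<theta>h u(2)]) (erule that)
  \<comment> \<open>The chart modulo e is taken for e = \<open>minpoly\<close>, whose value is zero;
    its generators therefore generate everything up to denominators.\<close>
  have c2: "\<exists>q2 \<pi>2. rvV.chart (k * N) q2 \<pi>2"
  proof -
    have one: "set [\<one>\<^bsub>C\<^esub>] \<subseteq> carrier OE" using subringE(3)[OF OE_subring] by simp
    obtain w \<pi> where w: "\<And>a. a < k * N \<Longrightarrow> w a \<in> carrier V"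
      "\<And>a. a < k * N \<Longrightarrow> semilinear_map R ?VR \<theta> (regular_module S) (\<pi> a)"
      "\<And>a. a < k * N \<Longrightarrow> \<pi> a (w a) \<in> Units S"
      "\<And>b a. a < k * N \<Longrightarrow> b < k * N \<Longrightarrow> a \<noteq> b \<Longrightarrow> \<pi> a (w b) = \<zero>\<^bsub>S\<^esub>"
      and sp: "\<And>y. y \<in> carrier V \<Longrightarrow> \<exists>a::nat. s [^]\<^bsub>R\<^esub> a \<odot>\<^bsub>?VR\<^esub> y \<in>
       module_span R ?VR (w ` {..<k * N} \<union> (\<lambda>y. poly_value minpoly \<odot>\<^bsub>V\<^esub> y) ` carrier V)"
      by (rule free_tensor_chart[OF minpoly_OE minpoly_props(2,3) one minpoly_self_factor V s(1) free(1) Sc \<theta>h u(1)])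
        blast
    interpret V: module T V by fact
    have wc: "w ` {..<k * N} \<subseteq> carrier ?VR" using w(1) by auto
    note m = module_span_submodule[OF VR.module_axioms wc]
    have "w ` {..<k * N} \<union> (\<lambda>y. poly_value minpoly \<odot>\<^bsub>V\<^esub> y) ` carrier V \<subseteq> module_span R ?VR (w ` {..<k * N})"
      using m(2) VR.submodule_zero[OF m(1)] by (auto simp: poly_value_minpoly)
    note spm = module_span_minimal[OF m(1) this]
    have "\<exists>c\<in>carrier R. \<theta> c \<in> Units S \<and> c \<odot>\<^bsub>?VR\<^esub> y \<in> module_span R ?VR (w ` {..<k * N})"
      if y: "y \<in> carrier ?VR" for y
    proof -
      obtain a where "s [^]\<^bsub>R\<^esub> (a::nat) \<odot>\<^bsub>?VR\<^esub> y \<in>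
          module_span R ?VR (w ` {..<k * N} \<union> (\<lambda>y. poly_value minpoly \<odot>\<^bsub>V\<^esub> y) ` carrier V)"
        using sp y by auto
      then show ?thesis
        using spm s u(1) S.Units_pow_closed[OF u(1), of a]
        by (intro bexI[of _ "s [^]\<^bsub>R\<^esub> a"]) (auto simp: \<theta>.hom_nat_pow)
    qed
    then have "rvV.chart (k * N) w \<pi>" using w unfolding rvV.chart_def by auto
    then show ?thesis by blast
  qed
  show thesis
  proof (cases "\<one>\<^bsub>S\<^esub> = \<zero>\<^bsub>S\<^esub>")
    case True
    then show thesis using loc.trivial_localization trivial by (auto simp: S)
  next
    case False
    then have "k * N = n * N" using c1 c2 rvV.chart_rank_unique by (metis nat_neq_iff)
    then have k: "k = n" using N_pos by simp
    obtain \<beta> \<kappa> where \<beta>: "semilinear_setting.chart R L S \<theta> r \<beta> \<kappa>"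
      by (rule locL.free_localization_chart[OF free(3) Sc \<theta>h u(3)]) (erule that)
    show thesis
      by (rule free_tensor_chart[OF e b V s(1) free(1) Sc \<theta>h u(1)], unfold k, rule charts[OF _ _ _ _ _ _ \<beta>]) blast+
  qed
qed

end

lemma exterior_power_generator_eq_zero:
  assumes L: "module R L" and xs: "xs \<in> tuples L k"
  shows "exterior_relations R L k +>\<^bsub>free_module R (tuples L k)\<^esub> free_generator R xs = \<zero>\<^bsub>exterior_power R L k\<^esub>
    \<longleftrightarrow> free_generator R xs \<in> exterior_relations R L k"
proof -
  interpret L: module R L by fact
  interpret T: module R "free_module R (tuples L k)" by (rule L.R.free_module_is_module)
  show ?thesis
    unfolding exterior_power_def
    by (rule quotient_module_eq_zero[OF T.module_axioms free_generator_exterior_relation(1)[OF L, where k = k]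
        L.R.free_generator_closed[OF xs]])
qed

section \<open>The kernel of g and the exterior power\<close>

context tensor_extension
begin

lemma surjection_intertwined:
  assumes V: "module T V" and L: "module T L" and g: "g \<in> module_homs T V L" "g ` carrier V = carrier L"
    and a: "a \<in> carrier T"
  shows "intertwined_surjection R (restrict_scalars j V) (restrict_scalars j L) g
    (\<lambda>y. a \<odot>\<^bsub>V\<^esub> y) (\<lambda>y. a \<odot>\<^bsub>L\<^esub> y)"
proof -
  interpret V: module T V by (rule V)
  interpret L: module T L by (rule L)
  interpret VR: module R "restrict_scalars j V" by (rule restrict_scalars_module[OF V])
  interpret LR: module R "restrict_scalars j L" by (rule restrict_scalars_module[OF L])
  have gD: "y \<in> carrier V \<Longrightarrow> g y \<in> carrier L" "y \<in> carrier V \<Longrightarrow> w \<in> carrier V \<Longrightarrow> g (y \<oplus>\<^bsub>V\<^esub> w) = g y \<oplus>\<^bsub>L\<^esub> g w"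
    "t \<in> carrier T \<Longrightarrow> y \<in> carrier V \<Longrightarrow> g (t \<odot>\<^bsub>V\<^esub> y) = t \<odot>\<^bsub>L\<^esub> g y" for y w t
    using g(1) by (auto simp: module_homs_def hom_def)
  show ?thesis
  proof unfold_locales
    show "semilinear_map R (restrict_scalars j V) (\<lambda>r. r) (restrict_scalars j L) g"
      by (rule semilinear_mapI) (use gD in auto)
    show "semilinear_map R (restrict_scalars j V) (\<lambda>r. r) (restrict_scalars j V) (\<lambda>y. a \<odot>\<^bsub>V\<^esub> y)"
      by (rule semilinear_mapI) (use a in \<open>auto simp: V.smult_r_distr V.smult_assoc1[symmetric] TR.T.m_comm\<close>)
    show "semilinear_map R (restrict_scalars j L) (\<lambda>r. r) (restrict_scalars j L) (\<lambda>y. a \<odot>\<^bsub>L\<^esub> y)"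
      by (rule semilinear_mapI) (use a in \<open>auto simp: L.smult_r_distr L.smult_assoc1[symmetric] TR.T.m_comm\<close>)
  qed (use g gD a in auto)
qed

text \<open>Both directions fix an element and show that a power of \<sigma> moves it into a
  submodule: into the zero submodule of the exterior power, or into the multiples of e in the
  module.\<close>

lemma kernel_in_image_iff:
  fixes V :: "(('f \<times> 'r \<Rightarrow>\<^sub>0 int) set, 'm) module" and L :: "(('f \<times> 'r \<Rightarrow>\<^sub>0 int) set, 'l) module"
  assumes e: "set e \<subseteq> carrier OE" "length e = Suc D" "hd e = \<one>\<^bsub>C\<^esub>"
    and b: "set b \<subseteq> carrier OE" "minpoly = C.poly_mult b e"
    and V: "module T V" and L: "module T L" and g: "g \<in> module_homs T V L" "g ` carrier V = carrier L"
    and free: "locally_free_over R T j V" "locally_free_of_rank R (restrict_scalars j V) (n * N)"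
      "locally_free_of_rank R (restrict_scalars j L) (n * D + d)"
    and k1: "k1 = d + 1"
  shows "{y \<in> carrier V. g y = \<zero>\<^bsub>L\<^esub>} \<subseteq> (\<lambda>y. poly_value e \<odot>\<^bsub>V\<^esub> y) ` carrier V \<longleftrightarrow>
    (\<forall>xs\<in>tuples (restrict_scalars j L) k1.
      free_generator R (map (\<lambda>y. poly_value e \<odot>\<^bsub>L\<^esub> y) xs) \<in> exterior_relations R (restrict_scalars j L) k1)"
    (is "?ker \<subseteq> ?im \<longleftrightarrow> (\<forall>xs\<in>?tuples. ?G (map ?\<phi> xs) \<in> ?rel)")
proof -
  let ?VR = "restrict_scalars j V" and ?LR = "restrict_scalars j L" and ?k = k1
  have pe: "poly_value e \<in> carrier T" using e(1) by simp
  interpret X: intertwined_surjection R ?VR ?LR g "\<lambda>y. poly_value e \<odot>\<^bsub>V\<^esub> y" ?\<phi>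
    by (rule surjection_intertwined[OF V L g pe])
  interpret V: module T V by (rule V)
  interpret L: module T L by (rule L)
  have LR: "module R ?LR" by (rule X.L.module_axioms)
  obtain Y where Y: "Y \<subseteq> carrier R" "Idl\<^bsub>R\<^esub> Y = carrier R"
    and Yf: "\<And>s. s \<in> Y \<Longrightarrow> \<exists>k. free_of_rank (localized_ring T (j s)) (localized_module T V (j s)) k"
    using free(1) unfolding locally_free_over_def by blast
  obtain Y' where Y': "Y' \<subseteq> carrier R" "Idl\<^bsub>R\<^esub> Y' = carrier R"
    and Yf': "\<And>s. s \<in> Y' \<Longrightarrow> free_of_rank (localized_ring R s) (localized_module R ?VR s) (n * N)"
    using free(2) unfolding locally_free_of_rank_def by blast
  obtain Y'' where Y'': "Y'' \<subseteq> carrier R" "Idl\<^bsub>R\<^esub> Y'' = carrier R"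
    and Yf'': "\<And>s. s \<in> Y'' \<Longrightarrow> free_of_rank (localized_ring R s) (localized_module R ?LR s) (n * D + d)"
    using free(3) unfolding locally_free_of_rank_def by blast
  note Ys = Y Y' Y''
  show ?thesis
  proof
    assume ker: "?ker \<subseteq> ?im"
    let ?W = "exterior_power R ?LR ?k"
    let ?\<tau> = "\<lambda>xs. exterior_relations R ?LR ?k +>\<^bsub>free_module R (tuples ?LR ?k)\<^esub> free_generator R xs"
    note W = exterior_power_alternating[OF LR, of ?k]
    interpret W: module R ?W by (rule W(1))
    have "\<And>xs. xs \<in> ?tuples \<Longrightarrow> ?\<tau> (map ?\<phi> xs) = \<zero>\<^bsub>?W\<^esub>"
    proof -
      fix xs assume xs: "xs \<in> ?tuples"
      let ?w = "?\<tau> (map ?\<phi> xs)"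
      have xs': "set xs \<subseteq> carrier ?LR" "length xs = ?k" using xs by (auto simp: tuples_def)
      have m: "set (map ?\<phi> xs) \<subseteq> carrier ?LR" "length (map ?\<phi> xs) = ?k" using xs' pe by auto
      have w: "?w \<in> carrier ?W" using alternating_mapD(1)[OF W(2) m] .
      \<comment> \<open>Vanishing is read as membership in the zero submodule, so that the gluing
        lemma applies.\<close>
      have "submodule {\<zero>\<^bsub>?W\<^esub>} R ?W" by (rule W.submodule_of_closed) auto
      then have "?w \<in> {\<zero>\<^bsub>?W\<^esub>}"
      proof (rule W.submodule_local_membership_three[OF _ w Ys])
        fix s s' s'' assume s: "s \<in> Y" "s' \<in> Y'" "s'' \<in> Y''"
        then have sc: "s \<in> carrier R" "s' \<in> carrier R" "s'' \<in> carrier R" using Ys by auto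
        define \<sigma> where "\<sigma> = s \<otimes>\<^bsub>R\<^esub> s' \<otimes>\<^bsub>R\<^esub> s''"
        have \<sigma>: "\<sigma> \<in> carrier R" using sc by (simp add: \<sigma>_def)
        define S where "S = localized_ring R \<sigma>"
        define \<theta> where "\<theta> = (\<lambda>c. fraction R (regular_module R) \<sigma> c 0)"
        interpret loc: localization R ?W \<sigma> using \<sigma> by unfold_locales
        obtain k where k: "free_of_rank (localized_ring T (j s)) (localized_module T V (j s)) k" using Yf s by blast
        have "\<exists>l::nat. (\<sigma> [^]\<^bsub>R\<^esub> l) \<odot>\<^bsub>?W\<^esub> ?w = \<zero>\<^bsub>?W\<^esub>"
        proof (rule local_charts[OF e b V LR sc k Yf'[OF s(2)] Yf''[OF s(3)] \<sigma>_def S_def \<theta>_def], goal_cases)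
          case (1 l)
          then show ?thesis using w by (intro exI[of _ l]) simp
        next
          case (2 q \<pi> \<beta> \<kappa>)
          \<comment> \<open>The universal form followed by localization of the exterior power; where
            it is zero, some power of \<sigma> annihilates the class.\<close>
          let ?\<psi> = "\<lambda>ys. loc.mfrac (?\<tau> ys) 0"
          have Ws: "module S loc.Ms" using loc.localized_module_is_module by (simp add: S_def)
          have sl: "semilinear_setting R ?LR S loc.Ms \<theta>"
            using LR Ws loc.rfrac_hom by (simp add: semilinear_setting_def semilinear_setting_axioms_def S_def \<theta>_def)
          have alt: "alternating_map R ?LR \<theta> loc.Ms ?k ?\<psi>"
          proof -
            note D = alternating_mapD[OF W(2)] and Fr = semilinear_mapD[OF loc.frac_semilinear]
            show ?thesis
            proof (rule alternating_mapI, goal_cases)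
              case (1 xs) then show ?case using D(1) Fr(1) by blast
            next
              case (2 us vs a b)
              then show ?case using D(2)[OF 2] Fr(2)[OF D(1) D(1), of "us @ a # vs" "us @ b # vs"] by simp
            next
              case (3 us vs r a)
              then show ?case using D(3)[OF 3] Fr(3)[OF _ D(1), of r "us @ a # vs"] by (simp add: \<theta>_def)
            next
              case (4 us vs a)
              then show ?case using D(4)[OF 4] loc.frac_zero by simp
            qed
          qed
          have ker': "\<And>y. y \<in> carrier ?VR \<Longrightarrow> g y = \<zero>\<^bsub>?LR\<^esub> \<Longrightarrow> y \<in> (\<lambda>y. poly_value e \<odot>\<^bsub>V\<^esub> y) ` carrier ?VR"
            using ker by auto
          \<comment> \<open>The chart of \<open>L\<close> has n D + d generators and n D of them are
            matched by the functionals, which leaves d, one less than the degree.\<close>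
          have "?\<psi> (map ?\<phi> xs) = \<zero>\<^bsub>loc.Ms\<^esub>"
            using X.alternating_vanishes_on_image[OF sl ker' _ _ _ _ _ 2(7) _ alt xs', of "n * D" q \<pi>] 2(1-5) k1 by simp
          then show ?thesis using loc.frac_eq_zero_iff[OF w] by (simp add: loc.pw_def)
        qed
        then show "\<exists>l::nat. ((s \<otimes>\<^bsub>R\<^esub> s' \<otimes>\<^bsub>R\<^esub> s'') [^]\<^bsub>R\<^esub> l) \<odot>\<^bsub>?W\<^esub> ?w \<in> {\<zero>\<^bsub>?W\<^esub>}" by (simp add: \<sigma>_def)
      qed
      then show "?\<tau> (map ?\<phi> xs) = \<zero>\<^bsub>?W\<^esub>" by simp
    qed
    moreover have "map ?\<phi> xs \<in> ?tuples" if "xs \<in> ?tuples" for xs using that pe by (auto simp: tuples_def)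
    ultimately show "\<forall>xs\<in>?tuples. ?G (map ?\<phi> xs) \<in> ?rel"
      using exterior_power_generator_eq_zero[OF LR] by blast
  next
    assume ext: "\<forall>xs\<in>?tuples. ?G (map ?\<phi> xs) \<in> ?rel"
    show "?ker \<subseteq> ?im"
    proof
      fix y assume "y \<in> ?ker"
      then have y: "y \<in> carrier ?VR" and gy: "g y = \<zero>\<^bsub>?LR\<^esub>" by auto
      have im: "submodule ?im R ?VR" using X.image_submodule by simp
      note E = X.M.submoduleE[OF im]
      show "y \<in> ?im"
      proof (rule X.M.submodule_local_membership_three[OF im y Ys])
        fix s s' s'' assume s: "s \<in> Y" "s' \<in> Y'" "s'' \<in> Y''"
        then have sc: "s \<in> carrier R" "s' \<in> carrier R" "s'' \<in> carrier R" using Ys by auto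
        define \<sigma> where "\<sigma> = s \<otimes>\<^bsub>R\<^esub> s' \<otimes>\<^bsub>R\<^esub> s''"
        have \<sigma>: "\<sigma> \<in> carrier R" using sc by (simp add: \<sigma>_def)
        define S where "S = localized_ring R \<sigma>"
        define \<theta> where "\<theta> = (\<lambda>c. fraction R (regular_module R) \<sigma> c 0)"
        interpret loc: localization R "regular_module R" \<sigma> by (rule R.localization_regular[OF \<sigma>])
        obtain k where k: "free_of_rank (localized_ring T (j s)) (localized_module T V (j s)) k" using Yf s by blast
        have "\<exists>l::nat. (\<sigma> [^]\<^bsub>R\<^esub> l) \<odot>\<^bsub>?VR\<^esub> y \<in> ?im"
        proof (rule local_charts[OF e b V LR sc k Yf'[OF s(2)] Yf''[OF s(3)] \<sigma>_def S_def \<theta>_def], goal_cases)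
          case (1 l)
          then have "(\<sigma> [^]\<^bsub>R\<^esub> l) \<odot>\<^bsub>?VR\<^esub> y = \<zero>\<^bsub>?VR\<^esub>" using X.M.smult_l_null[OF y] by (simp only:)
          then show ?thesis using X.M.submodule_zero[OF im] by (metis (lifting))
        next
          case (2 q \<pi> \<beta> \<kappa>)
          let ?m = "n * D"
          have Sc: "cring S" and \<theta>h: "\<theta> \<in> ring_hom R S"
            using loc.localized_ring_cring loc.rfrac_hom by (simp_all add: S_def \<theta>_def)
          interpret S: cring S by (rule Sc)
          interpret \<theta>: ring_hom_ring R S \<theta> using \<theta>h R.ring_axioms S.ring_axioms by (intro ring_hom_ringI2)
          have rv: "ring_valued_setting R ?LR S \<theta>"
            using LR Sc \<theta>h by (simp add: ring_valued_setting_def ring_valued_setting_axioms_def)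
          have us: "\<theta> s \<in> Units S"
          proof (rule S.unit_factor[of _ "\<theta> (s' \<otimes>\<^bsub>R\<^esub> s'')"])
            have "\<theta> s \<otimes>\<^bsub>S\<^esub> \<theta> (s' \<otimes>\<^bsub>R\<^esub> s'') = \<theta> \<sigma>" using sc by (simp add: \<sigma>_def R.m_assoc)
            then show "\<theta> s \<otimes>\<^bsub>S\<^esub> \<theta> (s' \<otimes>\<^bsub>R\<^esub> s'') \<in> Units S" using loc.rfrac_unit by (simp add: S_def \<theta>_def)
          qed (use sc in auto)
          \<comment> \<open>The hypothesis on the exterior power enters here: generators of tuples
            of images are relations, and every form kills relations.\<close>
          have van: "\<psi> (map ?\<phi> ys) = \<zero>\<^bsub>S\<^esub>"
            if alt: "alternating_map R ?LR \<theta> (regular_module S) ?k \<psi>" and ys: "set ys \<subseteq> carrier ?LR" "length ys = ?k" for \<psi> ys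
          proof -
            have t: "map ?\<phi> ys \<in> ?tuples" "ys \<in> ?tuples" using ys pe by (auto simp: tuples_def)
            show ?thesis
              using alternating_map_kills_relations[OF LR S.regular_module_is_module \<theta>h alt t(1)] ext t(2) by simp
          qed
          obtain a where "s [^]\<^bsub>R\<^esub> (a::nat) \<odot>\<^bsub>?VR\<^esub> y \<in> module_span R ?VR (q ` {..<?m} \<union> ?im)" using 2(6) y by auto
          \<comment> \<open>Modulo multiples of e, some s^a y is a combination of the
            \<open>q t\<close>. Since g y = 0, its image under g is zero, which is the relation that
            forces the coefficients to vanish over R[1/\<sigma>].\<close>
          then obtain v w where v: "\<And>t. t < ?m \<Longrightarrow> v t \<in> carrier R" and "w \<in> ?im"
            and eq: "s [^]\<^bsub>R\<^esub> a \<odot>\<^bsub>?VR\<^esub> y = (\<Oplus>\<^bsub>?VR\<^esub>t\<in>{..<?m}. v t \<odot>\<^bsub>?VR\<^esub> q t) \<oplus>\<^bsub>?VR\<^esub> w"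
            by (rule span_union_submodule[OF X.M.module_axioms im, rotated]) (use 2(1) in auto)
          then obtain w' where w: "w' \<in> carrier ?VR" "w = poly_value e \<odot>\<^bsub>V\<^esub> w'" by auto
          have q: "q t \<in> carrier ?VR" if "t < ?m" for t using 2(1) that by simp
          have gen: "\<exists>c\<in>carrier R. \<theta> c \<in> Units S \<and> c \<odot>\<^bsub>?VR\<^esub> y \<in>
              module_span R ?VR (q ` {..<?m} \<union> (\<lambda>y. poly_value e \<odot>\<^bsub>V\<^esub> y) ` carrier ?VR)"
            if y: "y \<in> carrier ?VR" for y
          proof -
            obtain a where "s [^]\<^bsub>R\<^esub> (a::nat) \<odot>\<^bsub>?VR\<^esub> y \<in> module_span R ?VR (q ` {..<?m} \<union> ?im)" using 2(6) y by auto
            then show ?thesis using sc us S.Units_pow_closed[OF us, of a]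
              by (intro bexI[of _ "s [^]\<^bsub>R\<^esub> a"]) (auto simp: \<theta>.hom_nat_pow)
          qed
          have g0: "g ((\<Oplus>\<^bsub>?VR\<^esub>t\<in>{..<?m}. v t \<odot>\<^bsub>?VR\<^esub> q t) \<oplus>\<^bsub>?VR\<^esub> poly_value e \<odot>\<^bsub>V\<^esub> w') = \<zero>\<^bsub>?LR\<^esub>"
            using X.gD(3)[OF _ y, of "s [^]\<^bsub>R\<^esub> a"] sc gy X.L.smult_r_null[of "s [^]\<^bsub>R\<^esub> a"]
            unfolding w(2)[symmetric] eq[symmetric] by simp
          have "\<theta> (v t) = \<zero>\<^bsub>S\<^esub>" if t: "t < ?m" for t
            by (rule X.relation_coefficients_vanish[where q = q and m = ?m and k = k1 and v = v and y = w', OF rv _ _ 2(7)])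
              (rule q gen van v w(1) g0 t | assumption | simp add: k1)+
          then have "\<exists>l::nat. \<sigma> [^]\<^bsub>R\<^esub> l \<otimes>\<^bsub>R\<^esub> v t = \<zero>\<^bsub>R\<^esub>" if "t < ?m" for t
            using loc.frac_eq_zero_iff[of "v t" 0] v that
            by (simp add: \<theta>_def S_def loc.localized_ring_simps loc.pw_def)
          then obtain l where l: "\<And>t. t < ?m \<Longrightarrow> \<sigma> [^]\<^bsub>R\<^esub> (l t :: nat) \<otimes>\<^bsub>R\<^esub> v t = \<zero>\<^bsub>R\<^esub>" by metis
          \<comment> \<open>A single exponent for all t: the sum dominates each
            \<open>l t\<close>.\<close>
          define b where "b = (\<Sum>t<?m. l t)"
          have bz: "\<sigma> [^]\<^bsub>R\<^esub> b \<otimes>\<^bsub>R\<^esub> v t = \<zero>\<^bsub>R\<^esub>" if t: "t < ?m" for t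
          proof -
            have "l t \<le> b" unfolding b_def using t by (intro member_le_sum) auto
            then have "\<sigma> [^]\<^bsub>R\<^esub> b = \<sigma> [^]\<^bsub>R\<^esub> (b - l t) \<otimes>\<^bsub>R\<^esub> \<sigma> [^]\<^bsub>R\<^esub> l t"
              using \<sigma> by (simp add: R.nat_pow_mult)
            then show ?thesis using l[OF t] v[OF t] \<sigma> by (simp add: R.m_assoc)
          qed
          have vq: "v t \<odot>\<^bsub>?VR\<^esub> q t \<in> carrier ?VR" if "t < ?m" for t using v q that by (intro X.M.smult_closed)
          have "\<sigma> [^]\<^bsub>R\<^esub> b \<odot>\<^bsub>?VR\<^esub> (\<Oplus>\<^bsub>?VR\<^esub>t\<in>{..<?m}. v t \<odot>\<^bsub>?VR\<^esub> q t)
              = (\<Oplus>\<^bsub>?VR\<^esub>t\<in>{..<?m}. \<sigma> [^]\<^bsub>R\<^esub> b \<odot>\<^bsub>?VR\<^esub> (v t \<odot>\<^bsub>?VR\<^esub> q t))"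
            using vq \<sigma> by (intro X.M.finsum_smult_ldistr) auto
          also have "\<dots> = (\<Oplus>\<^bsub>?VR\<^esub>t\<in>{..<?m}. \<zero>\<^bsub>?VR\<^esub>)"
          proof (rule X.M.finsum_cong')
            fix t assume t: "t \<in> {..<?m}"
            have "\<sigma> [^]\<^bsub>R\<^esub> b \<odot>\<^bsub>?VR\<^esub> (v t \<odot>\<^bsub>?VR\<^esub> q t) = (\<sigma> [^]\<^bsub>R\<^esub> b \<otimes>\<^bsub>R\<^esub> v t) \<odot>\<^bsub>?VR\<^esub> q t"
              using v q t \<sigma> by (intro X.M.smult_assoc1[symmetric]) auto
            also have "\<dots> = \<zero>\<^bsub>?VR\<^esub>" using bz q t X.M.smult_l_null by (simp only: lessThan_iff)
            finally show "\<sigma> [^]\<^bsub>R\<^esub> b \<odot>\<^bsub>?VR\<^esub> (v t \<odot>\<^bsub>?VR\<^esub> q t) = \<zero>\<^bsub>?VR\<^esub>" .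
          qed auto
          also have "\<dots> = \<zero>\<^bsub>?VR\<^esub>" by (rule X.M.finsum_zero)
          finally have s0: "\<sigma> [^]\<^bsub>R\<^esub> b \<odot>\<^bsub>?VR\<^esub> (\<Oplus>\<^bsub>?VR\<^esub>t\<in>{..<?m}. v t \<odot>\<^bsub>?VR\<^esub> q t) = \<zero>\<^bsub>?VR\<^esub>" .
          have sc': "(\<Oplus>\<^bsub>?VR\<^esub>t\<in>{..<?m}. v t \<odot>\<^bsub>?VR\<^esub> q t) \<in> carrier ?VR" using vq by (intro X.M.finsum_closed) auto
          have wc: "w \<in> carrier ?VR" using \<open>w \<in> ?im\<close> E(1) by auto
          have "\<sigma> [^]\<^bsub>R\<^esub> b \<odot>\<^bsub>?VR\<^esub> (s [^]\<^bsub>R\<^esub> a \<odot>\<^bsub>?VR\<^esub> y) = \<zero>\<^bsub>?VR\<^esub> \<oplus>\<^bsub>?VR\<^esub> \<sigma> [^]\<^bsub>R\<^esub> b \<odot>\<^bsub>?VR\<^esub> w"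
            unfolding eq s0[symmetric] using X.M.smult_r_distr[OF _ sc' wc] \<sigma> by simp
          also have "\<dots> = \<sigma> [^]\<^bsub>R\<^esub> b \<odot>\<^bsub>?VR\<^esub> w" using X.M.l_zero X.M.smult_closed \<sigma> wc by (metis R.nat_pow_closed)
          also have "\<dots> \<in> ?im" using E(4)[OF _ \<open>w \<in> ?im\<close>] \<sigma> by simp
          finally have in_im: "\<sigma> [^]\<^bsub>R\<^esub> b \<odot>\<^bsub>?VR\<^esub> (s [^]\<^bsub>R\<^esub> a \<odot>\<^bsub>?VR\<^esub> y) \<in> ?im" .
          let ?c = "(s' \<otimes>\<^bsub>R\<^esub> s'') [^]\<^bsub>R\<^esub> a"
          \<comment> \<open>So far a product of a power of \<sigma> and a power of s moves y into
            the multiples of e, while gluing asks for a power of \<sigma> alone; the powers of s'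
            and s'' supply the missing factor.\<close>
          have "\<sigma> [^]\<^bsub>R\<^esub> (a + b) = ?c \<otimes>\<^bsub>R\<^esub> (\<sigma> [^]\<^bsub>R\<^esub> b \<otimes>\<^bsub>R\<^esub> s [^]\<^bsub>R\<^esub> a)"
          proof -
            have "\<sigma> [^]\<^bsub>R\<^esub> a = s [^]\<^bsub>R\<^esub> a \<otimes>\<^bsub>R\<^esub> ?c"
              using sc by (simp add: \<sigma>_def R.m_assoc flip: R.nat_pow_distrib)
            then have "\<sigma> [^]\<^bsub>R\<^esub> (a + b) = (s [^]\<^bsub>R\<^esub> a \<otimes>\<^bsub>R\<^esub> ?c) \<otimes>\<^bsub>R\<^esub> \<sigma> [^]\<^bsub>R\<^esub> b"
              using \<sigma> by (simp flip: R.nat_pow_mult)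
            then show ?thesis using sc \<sigma> by (simp add: R.m_ac)
          qed
          then have "\<sigma> [^]\<^bsub>R\<^esub> (a + b) \<odot>\<^bsub>?VR\<^esub> y = ?c \<odot>\<^bsub>?VR\<^esub> (\<sigma> [^]\<^bsub>R\<^esub> b \<odot>\<^bsub>?VR\<^esub> (s [^]\<^bsub>R\<^esub> a \<odot>\<^bsub>?VR\<^esub> y))"
            using X.M.smult_assoc1[OF _ _ y] X.M.smult_assoc1[OF _ _ X.M.smult_closed[OF _ y]] sc \<sigma>
            by (simp only: R.m_closed R.nat_pow_closed simp_thms)
          then show ?thesis using E(4)[OF _ in_im, of ?c] sc by (intro exI[of _ "a + b"]) simp
        qed
        then show "\<exists>l::nat. ((s \<otimes>\<^bsub>R\<^esub> s' \<otimes>\<^bsub>R\<^esub> s'') [^]\<^bsub>R\<^esub> l) \<odot>\<^bsub>?VR\<^esub> y \<in> ?im" by (simp add: \<sigma>_def)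
      qed
    qed
  qed
qed

text \<open>Both ideals are principal, so strictness speaks of multiples of two elements of
  \<open>T\<close> in \<open>M\<close>. The conditions for B and for A then match separately, the
  latter by \<open>kernel_in_image_iff\<close>.\<close>

lemma strict_iff:
  fixes M :: "(('f \<times> 'r \<Rightarrow>\<^sub>0 int) set, 'm) module" and L :: "(('f \<times> 'r \<Rightarrow>\<^sub>0 int) set, 'l) module"
  assumes sub: "A \<subseteq> field_embeddings K i F C" "B \<subseteq> field_embeddings K i F C"
    and reflex: "reflex_field C K F A \<subseteq> E" "reflex_field C K F B \<subseteq> E"
    and exact: "short_exact T V f M g L"
    and free: "locally_free_over R T j M" "locally_free_of_rank R (restrict_scalars j M) (n * N)"
      "locally_free_of_rank R (restrict_scalars j L) (n * card A + d)"
  shows "(ideal_smult T bc (J_ideal C OK i OF OE \<zeta> B) M \<subseteq> f ` carrier V \<and>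
      f ` carrier V \<subseteq> ideal_smult T bc (J_ideal C OK i OF OE \<zeta> A) M)
     \<longleftrightarrow>
     ((\<forall>y\<in>carrier L. bc (e_element C OK i OF OE \<zeta> B) \<odot>\<^bsub>L\<^esub> y = \<zero>\<^bsub>L\<^esub>) \<and>
      (\<forall>w\<in>carrier (exterior_power R (restrict_scalars j L) (d + 1)).
         exterior_map R (restrict_scalars j L) (d + 1)
           (\<lambda>y. bc (e_element C OK i OF OE \<zeta> A) \<odot>\<^bsub>L\<^esub> y) w
         = \<zero>\<^bsub>exterior_power R (restrict_scalars j L) (d + 1)\<^esub>))"
proof -
  let ?a = "poly_value (e_poly C \<zeta> A)" and ?b = "poly_value (e_poly C \<zeta> B)"
  have M: "module T M" and L: "module T L" and g: "g \<in> module_homs T M L" "g ` carrier M = carrier L"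
    and f: "f ` carrier V = {m \<in> carrier M. g m = \<zero>\<^bsub>L\<^esub>}"
    using exact by (auto simp: short_exact_def)
  interpret L: module T L by (rule L)
  note eA = e_poly_props[OF sub(1) reflex(1)] and eB = e_poly_props[OF sub(2) reflex(2)]
  have ac: "?a \<in> carrier T" "?b \<in> carrier T" using eA(1) eB(1) by simp_all
  have ideal: "ideal_smult T bc (J_ideal C OK i OF OE \<zeta> S) M
      = (\<lambda>y. poly_value (e_poly C \<zeta> S) \<odot>\<^bsub>M\<^esub> y) ` carrier M"
    if "S \<subseteq> field_embeddings K i F C" "reflex_field C K F S \<subseteq> E" for S
    unfolding J_ideal_def
    using ideal_smult_principal[OF TE.tensor_ring_cring M base_change_hom e_element_closed[OF that]]
    by (simp only: base_change_e_element[OF that])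
  obtain b where b: "set b \<subseteq> carrier OE" "minpoly = C.poly_mult b (e_poly C \<zeta> A)" using eA(4) by blast
  interpret X: intertwined_surjection R "restrict_scalars j M" "restrict_scalars j L" g
    "\<lambda>y. ?b \<odot>\<^bsub>M\<^esub> y" "\<lambda>y. ?b \<odot>\<^bsub>L\<^esub> y"
    by (rule surjection_intertwined[OF M L g ac(2)])
  have "(\<lambda>y. ?b \<odot>\<^bsub>M\<^esub> y) ` carrier M \<subseteq> {m \<in> carrier M. g m = \<zero>\<^bsub>L\<^esub>} \<longleftrightarrow> (\<forall>y\<in>carrier M. ?b \<odot>\<^bsub>L\<^esub> g y = \<zero>\<^bsub>L\<^esub>)"
    using X.g\<epsilon> X.\<epsilon>D(1) by auto
  also have "\<dots> \<longleftrightarrow> (\<forall>y\<in>carrier L. ?b \<odot>\<^bsub>L\<^esub> y = \<zero>\<^bsub>L\<^esub>)" unfolding g(2)[symmetric] by simp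
  finally have 1: "(\<lambda>y. ?b \<odot>\<^bsub>M\<^esub> y) ` carrier M \<subseteq> {m \<in> carrier M. g m = \<zero>\<^bsub>L\<^esub>} \<longleftrightarrow>
      (\<forall>y\<in>carrier L. ?b \<odot>\<^bsub>L\<^esub> y = \<zero>\<^bsub>L\<^esub>)" .
  have \<phi>: "(\<lambda>y. ?a \<odot>\<^bsub>L\<^esub> y) \<in> carrier (restrict_scalars j L) \<rightarrow> carrier (restrict_scalars j L)"
    using ac by auto
  show ?thesis
    unfolding ideal[OF sub(1) reflex(1)] ideal[OF sub(2) reflex(2)] f 1
      base_change_e_element[OF sub(1) reflex(1)] base_change_e_element[OF sub(2) reflex(2)]
      kernel_in_image_iff[OF eA(1-3) b M L g free refl] exterior_map_zero_iff[OF X.L.module_axioms \<phi>] ..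
qed

end

theorem proposition2p11:
  fixes p n d :: nat
    and z :: "(nat \<Rightarrow> int) \<Rightarrow> 'c"
    and C :: "'c ring" and K E :: "'c set"
    and F :: "'f ring" and \<iota> :: "'c \<Rightarrow> 'f" and \<zeta> :: 'f
    and A B :: "('f \<Rightarrow> 'c) set"
    and OK OE :: "'c ring" and OF :: "'f ring"
    and R :: "'r ring" and \<rho> :: "'c \<Rightarrow> 'r"
    and TR :: "('f \<times> 'r \<Rightarrow>\<^sub>0 int) set ring"
    and j :: "'r \<Rightarrow> ('f \<times> 'r \<Rightarrow>\<^sub>0 int) set"
    and h :: "('f \<times> 'c \<Rightarrow>\<^sub>0 int) set \<Rightarrow> ('f \<times> 'r \<Rightarrow>\<^sub>0 int) set"
    and N :: "(('f \<times> 'r \<Rightarrow>\<^sub>0 int) set, 'n) module"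
    and M :: "(('f \<times> 'r \<Rightarrow>\<^sub>0 int) set, 'm) module"
    and L :: "(('f \<times> 'r \<Rightarrow>\<^sub>0 int) set, 'l) module"
    and f :: "'n \<Rightarrow> 'm" and g :: "'m \<Rightarrow> 'l"
  assumes
    \<comment> \<open>the extension \<open>F\<close> of \<open>K\<close> and the algebraic closure \<open>C\<close> of \<open>K\<close>\<close>
    "Factorial_Ring.prime p"
    and "algebraic_closure C K"
    and "padic_local_field p z (C\<lparr>carrier := K\<rparr>)"
    and "field F"
    and "\<iota> \<in> ring_hom (C\<lparr>carrier := K\<rparr>) F"
    and "ring.finite_dimension F (\<iota> ` K) (carrier F)"
    \<comment> \<open>the subsets \<open>A\<close> and \<open>B\<close>, the field \<open>E\<close>, the rings of integers, and \<open>\<zeta>\<close>\<close>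
    and "A \<subseteq> B" and "B \<subseteq> field_embeddings K \<iota> F C"
    and "E = generate_field C (reflex_field C K F A \<union> reflex_field C K F B)"
    and "OK = ring_of_integers C (z ` carrier (padic_integers p)) K"
    and "OE = ring_of_integers C (z ` carrier (padic_integers p)) E"
    and "OF = ring_of_integers F (\<iota> ` z ` carrier (padic_integers p)) (carrier F)"
    and "\<zeta> \<in> carrier OF"
    and "carrier OF = ring.simple_extension F (\<iota> ` carrier OK) \<zeta>"
    \<comment> \<open>the \<open>OE\<close>-algebra \<open>R\<close>; \<open>TR\<close> is the tensor product of \<open>OF\<close> and \<open>R\<close> over \<open>OK\<close>, viewed as an
      \<open>R\<close>-algebra via \<open>j\<close>, and \<open>h\<close> is the map to it from the tensor product of \<open>OF\<close> and \<open>OE\<close>\<close>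
    and "cring R" and "\<rho> \<in> ring_hom OE R"
    and "TR = tensor_ring OK \<iota> OF \<rho> R"
    and "j = pure_tensor OK \<iota> OF \<rho> R \<one>\<^bsub>OF\<^esub>"
    and "h = tensor_base_change OK \<iota> OF \<rho> R \<rho>"
    \<comment> \<open>the modules\<close>
    and "module TR M"
    and "locally_free_over R TR j M"
    and "locally_free_of_rank R (restrict_scalars j M) (n * ring.dim F (\<iota> ` K) (carrier F))"
    and "short_exact TR N f M g L"
    and "locally_free_of_rank R (restrict_scalars j L) (n * card A + d)"
  shows
    "(ideal_smult TR h (J_ideal C OK \<iota> OF OE \<zeta> B) M \<subseteq> f ` carrier N \<and>
      f ` carrier N \<subseteq> ideal_smult TR h (J_ideal C OK \<iota> OF OE \<zeta> A) M)
     \<longleftrightarrow>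
     ((\<forall>x\<in>carrier L. h (e_element C OK \<iota> OF OE \<zeta> B) \<odot>\<^bsub>L\<^esub> x = \<zero>\<^bsub>L\<^esub>) \<and>
      (\<forall>w\<in>carrier (exterior_power R (restrict_scalars j L) (d + 1)).
         exterior_map R (restrict_scalars j L) (d + 1)
           (\<lambda>x. h (e_element C OK \<iota> OF OE \<zeta> A) \<odot>\<^bsub>L\<^esub> x) w
         = \<zero>\<^bsub>exterior_power R (restrict_scalars j L) (d + 1)\<^esub>))"
proof -
  note hyps = assms
  interpret X: local_extension p z C K F \<iota> \<zeta> OK OF
    by (intro local_extension.intro) (fact hyps)+
  let ?G = "reflex_field C K F A \<union> reflex_field C K F B"
  have G: "?G \<subseteq> carrier C" by (auto simp: reflex_field_def)
  have E: "E = generate_field C ?G" by (fact hyps)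
  have sub: "subfield E C" unfolding E by (rule X.C.generate_field_is_subfield[OF G])
  have GE: "?G \<subseteq> E" unfolding E using generate_field.incl[of _ ?G C] by blast
  interpret Y: tensor_extension p z C K F \<iota> \<zeta> OK OF E OE R \<rho>
  proof (intro tensor_extension.intro tensor_extension_axioms.intro)
    show "local_extension p z C K F \<iota> \<zeta> OK OF" by (rule X.local_extension_axioms)
    show "subring E C" by (rule subfieldE(1)[OF sub])
    show "K \<subseteq> E" using X.K_in_reflex_field[of A] GE by blast
  qed (fact hyps)+
  have AB: "A \<subseteq> field_embeddings K \<iota> F C" "B \<subseteq> field_embeddings K \<iota> F C"
    using \<open>A \<subseteq> B\<close> \<open>B \<subseteq> field_embeddings K \<iota> F C\<close> by blast+
  have ref: "reflex_field C K F A \<subseteq> E" "reflex_field C K F B \<subseteq> E" using GE by blast+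
  have eq: "TR = tensor_ring OK \<iota> OF \<rho> R" "j = Y.j" "h = tensor_base_change OK \<iota> OF \<rho> R \<rho>"
    "ring.dim F (\<iota> ` K) (carrier F) = X.N"
    unfolding Y.j_def by (fact hyps X.dim_F)+
  note mods = \<open>short_exact TR N f M g L\<close> \<open>locally_free_over R TR j M\<close>
    \<open>locally_free_of_rank R (restrict_scalars j M) (n * ring.dim F (\<iota> ` K) (carrier F))\<close>
    \<open>locally_free_of_rank R (restrict_scalars j L) (n * card A + d)\<close>
  show ?thesis
    unfolding eq(1-3) by (rule Y.strict_iff[OF AB ref mods[unfolded eq]])
qed

end
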